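(* Suppose that $m>n\geq0$ and that $w\in W_m$ is an $n$-Grassmannian element. Set $\widehat{w}:=ww_0^{(n)}$, where $w_0^{(n)}=(-1,\ldots,-n)$ is the longest element of $W_n$. Then \[\mathfrak{C}_{\widehat{w}}(X,Y)={}^{\nu(\widehat{w})}Q_{\lambda(\widehat{w})}^{\beta(\widehat{w})}\] in the ring $\Gamma[X_n,Y_{m-1}]$. In particular, if $w\in S_m$, then \[\mathfrak{C}_{\widehat{w}}(X,Y)={}^{\delta_{n-1}}Q_{\delta_n+\delta_{n-1}+\lambda(w)'}^{(1-w_n,\ldots,1-w_1)},\] where $\lambda(w)'$ is the conjugate partition of $\lambda(w)$.
   Context: The ring $\Gamma$. $c_1,c_2,\ldots$ are commuting variables, $c_0:=1$, $c_p:=0$ for $p<0$; $\Gamma$ is the quotient of $\mathbb{Z}[c_1,c_2,\ldots]$ by the relations $c_p^2+2\sum_{i=1}^p(-1)^ic_{p+i}c_{p-i}=0$, $p\geq1$. $X=(x_1,x_2,\ldots)$, $Y=(y_1,y_2,\ldots)$ are independent variables, $X_n=(x_1,\ldots,x_n)$, $Y_r=(y_1,\ldots,y_r)$. Weyl group. $W_k$ is the group of signed permutations $w=(w_1,\ldots,w_k)$ of $\{1,\ldots,k\}$, $W_\infty=\bigcup_kW_k$ (adjoining fixed points), generated by $s_i=(i,i+1)$, $i\geq1$, and the sign change $s_0$ of $1$; $\ell$ is the length; $S_m\subset W_m$ is the group of unsigned permutations. $W_\infty$ acts on $\Gamma[X,Y]$ by ring automorphisms: $s_i$ ($i\geq1$)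 interchanges $x_i,x_{i+1}$ and fixes all other variables and all $c_p$; $s_0$ sends $x_1\mapsto-x_1$, fixes $x_j$ ($j\geq2$) and all $y_j$, and $s_0(c_p)=c_p+2\sum_{j=1}^px_1^jc_{p-j}$. Schubert polynomials. $\partial_0^xf=\frac{f-s_0f}{-2x_1}$, $\partial_i^xf=\frac{f-s_if}{x_i-x_{i+1}}$ ($i\geq1$); $\omega$ is the ring involution of $\Gamma[X,Y]$ with $\omega(x_j)=-y_j$, $\omega(y_j)=-x_j$, $\omega(c_p)=c_p$, and $\partial_i^y=\omega\partial_i^x\omega$. $\mathfrak{C}_w(X,Y)$, $w\in W_\infty$, is the unique family in $\Gamma[X,Y]$ such that for all $i\geq0$: $\partial_i^x\mathfrak{C}_w=\mathfrak{C}_{ws_i}$ if $\ell(ws_i)<\ell(w)$ and $0$ otherwise; $\partial_i^y\mathfrak{C}_w=\mathfrak{C}_{s_iw}$ if $\ell(s_iw)<\ell(w)$ and $0$ otherwise; and the constant term of $\mathfrak{C}_w$ is $1$ if $w=1$ and $0$ otherwise. Statistics. $w\in W_\infty$ is $n$-Grassmannian if $\ell(ws_i)>\ell(w)$ for all $i\neq n$. For $w\in W_\infty$: $\mu(w)$ is the strict partition whose parts are the absolute values of the negative entries of $w$; $\gamma_i(w)=\#\{j>i:w_j<w_i\}$; $\delta(w)$ is the partition whose parts are the non-zero $\gamma_i(w)$; $\nu(w)$ is the conjugate of $\delta(w)$; $\lambda(w):=\mu(w)+\nu(w)$ (componentwise); $\beta(w)_i:=\min(1-\mu(w)_i,0)$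 for $i\geq1$ (with $\mu(w)_i=0$ beyond the length). $\delta_k:=(k,k-1,\ldots,1,0)$ (empty for $k<0$). Multi-Schur Pfaffians. For $r\geq1$ let $e^r_j(Z),h^r_j(Z)$ be the elementary and complete symmetric polynomials of degree $j$ in $z_1,\ldots,z_r$; $e^0_j=h^0_j=\delta_{0j}$; for $r<0$, $h^r_j:=e^{-r}_j$ and $e^r_j:=h^{-r}_j$. For $k,r,p\in\mathbb{Z}$, ${}^kc^r_p:=\sum_{i,j\geq0}c_{p-i-j}\,h^{-k}_i(X)\,h^r_j(-Y)$. For integer sequences $\rho,\beta,\alpha$ (padded with zeros), ${}^\rho c^\beta_\alpha:=\prod_i{}^{\rho_i}c^{\beta_i}_{\alpha_i}$. For $i<j$, $R_{ij}\alpha=(\ldots,\alpha_i+1,\ldots,\alpha_j-1,\ldots)$, and a monomial $R$ in the $R_{ij}$ acts by $R\,{}^\rho c^\beta_\alpha:={}^\rho c^\beta_{R\alpha}$. For $\alpha$ of length $\ell$, ${}^\rho Q^\beta_\alpha:=\prod_{1\leq i<j\leq\ell}\frac{1-R_{ij}}{1+R_{ij}}\,{}^\rho c^\beta_\alpha$, expanded as a power series in the $R_{ij}$. *)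

theory Defs
  imports
    "HOL-Library.Poly_Mapping"
    "HOL-Library.More_List"
    "HOL-Library.Multiset"
    "HOL-Combinatorics.Permutations"
    "HOL-Computational_Algebra.Formal_Power_Series"
begin

section \<open>Evaluation of multivariate polynomials\<close>

text \<open>
  A polynomial ring in variables of type \<open>'v\<close> over \<open>'a\<close> is
  \<open>('v \<Rightarrow>\<^sub>0 nat) \<Rightarrow>\<^sub>0 'a\<close>: finitely supported functions
  from monomials to coefficients.
\<close>

definition pvar :: "'v \<Rightarrow> ('v \<Rightarrow>\<^sub>0 nat) \<Rightarrow>\<^sub>0 'a::comm_ring_1" where
  "pvar v = Poly_Mapping.single (Poly_Mapping.single v 1) 1"

definition pconst :: "'a \<Rightarrow> ('v \<Rightarrow>\<^sub>0 nat) \<Rightarrow>\<^sub>0 'a::comm_ring_1" where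
  "pconst a = Poly_Mapping.single 0 a"

definition meval :: "('v \<Rightarrow> 'b::comm_ring_1) \<Rightarrow> ('v \<Rightarrow>\<^sub>0 nat) \<Rightarrow> 'b" where
  "meval f t = (\<Prod>v\<in>Poly_Mapping.keys t. f v ^ Poly_Mapping.lookup t v)"

definition peval ::
  "('a::comm_ring_1 \<Rightarrow> 'b::comm_ring_1) \<Rightarrow> ('v \<Rightarrow> 'b) \<Rightarrow> (('v \<Rightarrow>\<^sub>0 nat) \<Rightarrow>\<^sub>0 'a) \<Rightarrow> 'b" where
  "peval \<phi> f p = (\<Sum>t\<in>Poly_Mapping.keys p. \<phi> (Poly_Mapping.lookup p t) * meval f t)"

definition is_ring_hom :: "('a::comm_ring_1 \<Rightarrow> 'b::comm_ring_1) \<Rightarrow> bool" where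
  "is_ring_hom \<phi> \<longleftrightarrow> \<phi> 1 = 1 \<and> (\<forall>a b. \<phi> (a + b) = \<phi> a + \<phi> b) \<and> (\<forall>a b. \<phi> (a * b) = \<phi> a * \<phi> b)"

lemma is_ring_hom_0: "is_ring_hom \<phi> \<Longrightarrow> \<phi> 0 = 0"
proof -
  assume "is_ring_hom \<phi>"
  then have "\<phi> (0 + 0) = \<phi> 0 + \<phi> 0" unfolding is_ring_hom_def by blast
  then show "\<phi> 0 = 0" by simp
qed

lemma is_ring_hom_uminus: "is_ring_hom \<phi> \<Longrightarrow> \<phi> (- a) = - \<phi> a"
proof -
  assume h: "is_ring_hom \<phi>"
  then have "\<phi> (a + - a) = \<phi> a + \<phi> (- a)" unfolding is_ring_hom_def by blast
  then show "\<phi> (- a) = - \<phi> a" using is_ring_hom_0[OF h] by (simp add: eq_neg_iff_add_eq_0 add.commute)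
qed

lemma is_ring_hom_diff: "is_ring_hom \<phi> \<Longrightarrow> \<phi> (a - b) = \<phi> a - \<phi> b"
proof -
  assume h: "is_ring_hom \<phi>"
  then have "\<phi> (a + - b) = \<phi> a + \<phi> (- b)" unfolding is_ring_hom_def by blast
  then show "\<phi> (a - b) = \<phi> a - \<phi> b" using is_ring_hom_uminus[OF h] by simp
qed

lemma is_ring_hom_sum: "is_ring_hom \<phi> \<Longrightarrow> \<phi> (sum f A) = (\<Sum>a\<in>A. \<phi> (f a))"
proof -
  assume h: "is_ring_hom \<phi>"
  have "\<phi> (a + b) = \<phi> a + \<phi> b" for a b using h by (simp add: is_ring_hom_def)
  then show ?thesis
    by (induction A rule: infinite_finite_induct) (simp_all add: is_ring_hom_0[OF h])
qed

lemma is_ring_hom_power: "is_ring_hom \<phi> \<Longrightarrow> \<phi> (a ^ k) = \<phi> a ^ k"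
proof -
  assume "is_ring_hom \<phi>"
  then have "\<phi> 1 = 1" "\<phi> (a * b) = \<phi> a * \<phi> b" for a b by (auto simp: is_ring_hom_def)
  then show ?thesis by (induction k) simp_all
qed

lemma is_ring_hom_numeral: "is_ring_hom \<phi> \<Longrightarrow> \<phi> (numeral k) = numeral k"
proof -
  assume h: "is_ring_hom \<phi>"
  then have a: "\<phi> (a + b) = \<phi> a + \<phi> b" and o: "\<phi> 1 = 1" for a b
    by (auto simp: is_ring_hom_def)
  have "\<phi> (of_nat n) = of_nat n" for n
    by (induction n) (simp_all only: of_nat_0 of_nat_Suc is_ring_hom_0[OF h] a o)
  from this[of "numeral k"] show ?thesis by simp
qed

lemma is_ring_hom_of_int: "is_ring_hom (of_int :: int \<Rightarrow> 'a::comm_ring_1)"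
  by (simp add: is_ring_hom_def)

lemma meval_superset:
  assumes "finite A" "Poly_Mapping.keys t \<subseteq> A"
  shows "meval f t = (\<Prod>v\<in>A. f v ^ Poly_Mapping.lookup t v)"
  unfolding meval_def using assms
  by (intro prod.mono_neutral_left) (auto simp: in_keys_iff)

lemma meval_0 [simp]: "meval f 0 = 1"
  by (simp add: meval_def)

lemma meval_single [simp]: "meval f (Poly_Mapping.single v k) = f v ^ k"
  by (cases "k = 0") (simp_all add: meval_def)

lemma meval_add: "meval f (s + t) = meval f s * meval f t"
proof -
  let ?A = "Poly_Mapping.keys s \<union> Poly_Mapping.keys t"
  have "Poly_Mapping.keys (s + t) \<subseteq> ?A" by (rule keys_add)
  then have "meval f (s + t) = (\<Prod>v\<in>?A. f v ^ Poly_Mapping.lookup (s + t) v)"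
    by (intro meval_superset) auto
  also have "\<dots> = (\<Prod>v\<in>?A. f v ^ Poly_Mapping.lookup s v) * (\<Prod>v\<in>?A. f v ^ Poly_Mapping.lookup t v)"
    by (simp add: lookup_add power_add prod.distrib)
  also have "\<dots> = meval f s * meval f t"
    by (subst (1 2) meval_superset[of ?A]) auto
  finally show ?thesis .
qed

lemma poly_mapping_sum_single:
  "(\<Sum>t\<in>Poly_Mapping.keys p. Poly_Mapping.single t (Poly_Mapping.lookup p t)) = p"
proof (rule poly_mapping_eqI)
  fix u
  show "Poly_Mapping.lookup (\<Sum>t\<in>Poly_Mapping.keys p. Poly_Mapping.single t (Poly_Mapping.lookup p t)) u
      = Poly_Mapping.lookup p u"
    by (simp add: lookup_sum lookup_single when_def in_keys_iff)
qed

context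
  fixes \<phi> :: "'a::comm_ring_1 \<Rightarrow> 'b::comm_ring_1" and f :: "'v \<Rightarrow> 'b"
  assumes hom: "is_ring_hom \<phi>"
begin

lemma peval_superset:
  assumes "finite A" "Poly_Mapping.keys p \<subseteq> A"
  shows "peval \<phi> f p = (\<Sum>t\<in>A. \<phi> (Poly_Mapping.lookup p t) * meval f t)"
  unfolding peval_def using assms
  by (intro sum.mono_neutral_left) (auto simp: in_keys_iff is_ring_hom_0[OF hom])

lemma peval_0: "peval \<phi> f 0 = 0"
  by (simp add: peval_def)

lemma peval_single: "peval \<phi> f (Poly_Mapping.single t a) = \<phi> a * meval f t"
  by (cases "a = 0") (simp_all add: peval_def is_ring_hom_0[OF hom])

lemma peval_add: "peval \<phi> f (p + q) = peval \<phi> f p + peval \<phi> f q"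
proof -
  let ?A = "Poly_Mapping.keys p \<union> Poly_Mapping.keys q"
  have "Poly_Mapping.keys (p + q) \<subseteq> ?A" by (rule keys_add)
  then have "peval \<phi> f (p + q) = (\<Sum>t\<in>?A. \<phi> (Poly_Mapping.lookup (p + q) t) * meval f t)"
    by (intro peval_superset) auto
  also have "\<dots> = (\<Sum>t\<in>?A. \<phi> (Poly_Mapping.lookup p t) * meval f t) +
                  (\<Sum>t\<in>?A. \<phi> (Poly_Mapping.lookup q t) * meval f t)"
    using hom by (simp add: lookup_add is_ring_hom_def distrib_right sum.distrib)
  also have "\<dots> = peval \<phi> f p + peval \<phi> f q"
    by (subst (1 2) peval_superset[of ?A]) auto
  finally show ?thesis .
qed

lemma peval_sum: "peval \<phi> f (sum g A) = (\<Sum>a\<in>A. peval \<phi> f (g a))"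
  by (induction A rule: infinite_finite_induct) (simp_all add: peval_0 peval_add)

lemma peval_mult: "peval \<phi> f (p * q) = peval \<phi> f p * peval \<phi> f q"
proof -
  have hm: "\<phi> (a * b) = \<phi> a * \<phi> b" for a b
    using hom by (simp add: is_ring_hom_def)
  have "p * q = (\<Sum>s\<in>Poly_Mapping.keys p. \<Sum>t\<in>Poly_Mapping.keys q.
      Poly_Mapping.single (s + t) (Poly_Mapping.lookup p s * Poly_Mapping.lookup q t))"
    using arg_cong2[OF poly_mapping_sum_single[of p] poly_mapping_sum_single[of q], of "(*)"]
    by (simp add: sum_product mult_single)
  then have "peval \<phi> f (p * q) = (\<Sum>s\<in>Poly_Mapping.keys p. \<Sum>t\<in>Poly_Mapping.keys q.
      \<phi> (Poly_Mapping.lookup p s) * meval f s * (\<phi> (Poly_Mapping.lookup q t) * meval f t))"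
    by (simp add: peval_sum peval_single hm meval_add mult_ac)
  also have "\<dots> = peval \<phi> f p * peval \<phi> f q"
    by (simp add: peval_def sum_product)
  finally show ?thesis .
qed

lemma peval_pvar: "peval \<phi> f (pvar v) = f v"
  using hom by (simp add: pvar_def peval_single is_ring_hom_def)

lemma peval_pconst: "peval \<phi> f (pconst a) = \<phi> a"
  by (simp add: pconst_def peval_single)

lemma is_ring_hom_peval: "is_ring_hom (peval \<phi> f)"
proof -
  have "peval \<phi> f 1 = 1"
    using peval_single[of 0 1] hom by (simp add: is_ring_hom_def)
  then show ?thesis
    by (simp add: is_ring_hom_def peval_add peval_mult)
qed

end

lemma is_ring_hom_pconst: "is_ring_hom (pconst :: 'a::comm_ring_1 \<Rightarrow> _)"
  by (simp add: is_ring_hom_def pconst_def single_add mult_single)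


section \<open>The ring \<open>\<Gamma>\<close>\<close>

text \<open>
  The variable with index \<open>i\<close> stands for \<open>c\<^bsub>i+1\<^esub>\<close>.
\<close>

definition cpoly :: "int \<Rightarrow> (nat \<Rightarrow>\<^sub>0 nat) \<Rightarrow>\<^sub>0 int" where
  "cpoly p = (if p < 0 then 0 else if p = 0 then 1 else pvar (nat p - 1))"

definition gamma_rel :: "nat \<Rightarrow> (nat \<Rightarrow>\<^sub>0 nat) \<Rightarrow>\<^sub>0 int" where
  "gamma_rel p = cpoly (int p) ^ 2
     + 2 * (\<Sum>i = 1..p. (-1) ^ i * cpoly (int p + int i) * cpoly (int p - int i))"

text \<open>
  The ideal generated by a set is its span in the ring regarded as a module over itself.
\<close>

definition gamma_ideal :: "((nat \<Rightarrow>\<^sub>0 nat) \<Rightarrow>\<^sub>0 int) set" where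
  "gamma_ideal = module.span (*) (gamma_rel ` {1..})"

lemma module_mult: "module ((*) :: 'a::comm_ring_1 \<Rightarrow> 'a \<Rightarrow> 'a)"
  by unfold_locales (simp_all add: algebra_simps)

lemma gamma_ideal_0: "0 \<in> gamma_ideal"
  unfolding gamma_ideal_def by (rule module.span_zero[OF module_mult])

lemma gamma_ideal_add: "a \<in> gamma_ideal \<Longrightarrow> b \<in> gamma_ideal \<Longrightarrow> a + b \<in> gamma_ideal"
  unfolding gamma_ideal_def by (rule module.span_add[OF module_mult])

lemma gamma_ideal_diff: "a \<in> gamma_ideal \<Longrightarrow> b \<in> gamma_ideal \<Longrightarrow> a - b \<in> gamma_ideal"
  unfolding gamma_ideal_def by (rule module.span_diff[OF module_mult])

lemma gamma_ideal_uminus: "a \<in> gamma_ideal \<Longrightarrow> - a \<in> gamma_ideal"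
  unfolding gamma_ideal_def by (rule module.span_neg[OF module_mult])

lemma gamma_ideal_mult: "a \<in> gamma_ideal \<Longrightarrow> b * a \<in> gamma_ideal"
  unfolding gamma_ideal_def by (rule module.span_scale[OF module_mult])

lemma gamma_ideal_hom_0:
  assumes "is_ring_hom h" "\<And>p. p \<ge> 1 \<Longrightarrow> h (gamma_rel p) = 0" "a \<in> gamma_ideal"
  shows "h a = 0"
  using assms(3) unfolding gamma_ideal_def
proof (induction a rule: module.span_induct_alt[OF module_mult, consumes 1, case_names base step])
  case base
  show ?case using assms(1) by (rule is_ring_hom_0)
next
  case (step c x y)
  then show ?case using assms(1,2) by (auto simp: is_ring_hom_def)
qed

lemma gamma_ideal_eq: "p = q \<Longrightarrow> p - q \<in> gamma_ideal"
  using gamma_ideal_0 by simp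

lemma one_notin_gamma_ideal: "1 \<notin> gamma_ideal"
proof
  define h where "h = peval (of_int :: int \<Rightarrow> int) (\<lambda>_::nat. 0)"
  have h: "is_ring_hom h"
    unfolding h_def by (rule is_ring_hom_peval[OF is_ring_hom_of_int])
  then have m: "h (a * b) = h a * h b" and a: "h (a + b) = h a + h b" and o: "h 1 = 1" for a b
    by (auto simp: is_ring_hom_def)
  have c: "h (cpoly p) = 0" if "p > 0" for p
  proof -
    have "h (pvar v) = 0" for v
      unfolding h_def by (rule peval_pvar[OF is_ring_hom_of_int])
    then show ?thesis using that by (simp add: cpoly_def)
  qed
  have "h (gamma_rel p) = 0" if "p \<ge> 1" for p
    using that unfolding gamma_rel_def
    by (simp add: a m is_ring_hom_sum[OF h] is_ring_hom_power[OF h] c)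
  moreover assume "1 \<in> gamma_ideal"
  ultimately have "h 1 = 0"
    using gamma_ideal_hom_0[OF h] by blast
  with o show False by simp
qed

quotient_type gam = "(nat \<Rightarrow>\<^sub>0 nat) \<Rightarrow>\<^sub>0 int" / "\<lambda>p q. p - q \<in> gamma_ideal"
proof (rule equivpI)
  show "reflp (\<lambda>p q. p - q \<in> gamma_ideal)"
    by (simp add: reflp_def gamma_ideal_0)
  show "symp (\<lambda>p q. p - q \<in> gamma_ideal)"
    unfolding symp_def using gamma_ideal_uminus by fastforce
  show "transp (\<lambda>p q. p - q \<in> gamma_ideal)"
    unfolding transp_def using gamma_ideal_add by fastforce
qed

instantiation gam :: comm_ring_1
begin

lift_definition zero_gam :: gam is 0 .
lift_definition one_gam :: gam is 1 .

lift_definition plus_gam :: "gam \<Rightarrow> gam \<Rightarrow> gam" is "(+)"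
  using gamma_ideal_add by (simp add: add_diff_add)

lift_definition minus_gam :: "gam \<Rightarrow> gam \<Rightarrow> gam" is "(-)"
proof -
  fix a a' b b' :: "(nat \<Rightarrow>\<^sub>0 nat) \<Rightarrow>\<^sub>0 int"
  assume "a - a' \<in> gamma_ideal" "b - b' \<in> gamma_ideal"
  then have "(a - a') - (b - b') \<in> gamma_ideal" by (rule gamma_ideal_diff)
  then show "a - b - (a' - b') \<in> gamma_ideal" by (simp add: algebra_simps)
qed

lift_definition uminus_gam :: "gam \<Rightarrow> gam" is uminus
  using gamma_ideal_uminus by fastforce

lift_definition times_gam :: "gam \<Rightarrow> gam \<Rightarrow> gam" is "(*)"
proof -
  fix a a' b b' :: "(nat \<Rightarrow>\<^sub>0 nat) \<Rightarrow>\<^sub>0 int"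
  assume "a - a' \<in> gamma_ideal" "b - b' \<in> gamma_ideal"
  then have "b * (a - a') + a' * (b - b') \<in> gamma_ideal"
    by (intro gamma_ideal_add gamma_ideal_mult)
  then show "a * b - a' * b' \<in> gamma_ideal" by (simp add: algebra_simps)
qed

instance
proof
  fix a b c :: gam
  show "a + b + c = a + (b + c)" by transfer (rule gamma_ideal_eq, rule add.assoc)
  show "a + b = b + a" by transfer (rule gamma_ideal_eq, rule add.commute)
  show "0 + a = a" by transfer (rule gamma_ideal_eq, simp)
  show "- a + a = 0" by transfer (rule gamma_ideal_eq, simp)
  show "a - b = a + - b" by transfer (rule gamma_ideal_eq, simp)
  show "a * b * c = a * (b * c)" by transfer (rule gamma_ideal_eq, rule mult.assoc)
  show "a * b = b * a" by transfer (rule gamma_ideal_eq, rule mult.commute)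
  show "1 * a = a" by transfer (rule gamma_ideal_eq, simp)
  show "(a + b) * c = a * c + b * c" by transfer (rule gamma_ideal_eq, rule distrib_right)
  show "(0::gam) \<noteq> 1"
  proof transfer
    show "(0 :: (nat \<Rightarrow>\<^sub>0 nat) \<Rightarrow>\<^sub>0 int) - 1 \<notin> gamma_ideal"
      using one_notin_gamma_ideal gamma_ideal_uminus[of "0 - 1"] by auto
  qed
qed

end

text \<open>
  The ring homomorphism from \<open>\<Gamma>\<close> with \<open>c\<^bsub>p\<^esub> \<mapsto> f p\<close>
  for \<open>p \<ge> 1\<close>; it does not depend on the representative when the values \<open>f p\<close>
  (with \<open>f 0 = 1\<close>) satisfy the defining relations, see below.
\<close>

definition gam_lift :: "(nat \<Rightarrow> 'b::comm_ring_1) \<Rightarrow> gam \<Rightarrow> 'b" where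
  "gam_lift f g = peval of_int (\<lambda>i. f (Suc i)) (rep_gam g)"

definition gamma_relations :: "(nat \<Rightarrow> 'b::comm_ring_1) \<Rightarrow> bool" where
  "gamma_relations f \<longleftrightarrow> f 0 = 1 \<and>
     (\<forall>p\<ge>1. f p ^ 2 + 2 * (\<Sum>i = 1..p. (-1) ^ i * f (p + i) * f (p - i)) = 0)"

definition gam_c :: "int \<Rightarrow> gam" where
  "gam_c p = abs_gam (cpoly p)"

lemma gam_lift_abs:
  fixes f :: "nat \<Rightarrow> 'b::comm_ring_1"
  assumes "gamma_relations f"
  shows "gam_lift f (abs_gam q) = peval of_int (\<lambda>i. f (Suc i)) q"
proof -
  let ?h = "peval (of_int :: int \<Rightarrow> 'b) (\<lambda>i. f (Suc i))"
  note h = is_ring_hom_peval[OF is_ring_hom_of_int, of "\<lambda>i. f (Suc i)"]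
  have m: "?h (a * b) = ?h a * ?h b" and a: "?h (a + b) = ?h a + ?h b" and o: "?h 1 = 1" for a b
    using h by (auto simp: is_ring_hom_def)
  have c: "?h (cpoly (int p)) = f p" for p
  proof (cases p)
    case 0
    then show ?thesis using assms by (simp add: cpoly_def o gamma_relations_def)
  next
    case (Suc k)
    then have "cpoly (int p) = pvar k" by (simp add: cpoly_def nat_add_distrib)
    then show ?thesis using Suc by (simp add: peval_pvar[OF is_ring_hom_of_int])
  qed
  have c2: "?h (cpoly (int p - int i)) = f (p - i)" if "i \<le> p" for p i
    using c[of "p - i"] that by (simp add: of_nat_diff)
  have "?h (gamma_rel p) = 0" if "p \<ge> 1" for p
  proof -
    have "?h (gamma_rel p) = f p ^ 2 + 2 * (\<Sum>i = 1..p. (-1) ^ i * f (p + i) * f (p - i))"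
      unfolding gamma_rel_def
      using c[of "p + i" for i]
      by (simp add: a m is_ring_hom_sum[OF h] is_ring_hom_power[OF h] is_ring_hom_uminus[OF h]
          is_ring_hom_numeral[OF h] o c c2)
    then show ?thesis using assms that by (simp add: gamma_relations_def)
  qed
  moreover have "rep_gam (abs_gam q) - q \<in> gamma_ideal"
    using Quotient3_rep_abs[OF Quotient3_gam] gamma_ideal_0 by simp
  ultimately have "?h (rep_gam (abs_gam q) - q) = 0"
    using gamma_ideal_hom_0[OF h] by blast
  then show ?thesis by (simp add: gam_lift_def is_ring_hom_diff[OF h])
qed

lemma is_ring_hom_gam_lift:
  assumes "gamma_relations f"
  shows "is_ring_hom (gam_lift f)"
proof -
  have h: "is_ring_hom (peval (of_int :: int \<Rightarrow> 'a) (\<lambda>i. f (Suc i)))"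
    by (rule is_ring_hom_peval[OF is_ring_hom_of_int])
  show ?thesis
    unfolding is_ring_hom_def
  proof (intro conjI allI)
    show "gam_lift f 1 = 1"
      using gam_lift_abs[OF assms, of 1] h by (simp add: is_ring_hom_def one_gam_def)
    fix a b :: gam
    obtain p q where ab: "a = abs_gam p" "b = abs_gam q"
      by (metis Quotient3_abs_rep[OF Quotient3_gam])
    show "gam_lift f (a + b) = gam_lift f a + gam_lift f b"
      using h unfolding ab plus_gam.abs_eq gam_lift_abs[OF assms] by (simp add: is_ring_hom_def)
    show "gam_lift f (a * b) = gam_lift f a * gam_lift f b"
      using h unfolding ab times_gam.abs_eq gam_lift_abs[OF assms] by (simp add: is_ring_hom_def)
  qed
qed

lemma gam_lift_c:
  assumes "gamma_relations f"
  shows "gam_lift f (gam_c (int p)) = f p"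
proof (cases p)
  case 0
  then have "gam_c (int p) = 1" by (simp add: gam_c_def cpoly_def one_gam_def)
  then show ?thesis
    using 0 assms is_ring_hom_gam_lift[OF assms] by (simp add: is_ring_hom_def gamma_relations_def)
next
  case (Suc k)
  then have "cpoly (int p) = pvar k" by (simp add: cpoly_def nat_add_distrib)
  then show ?thesis
    using Suc by (simp add: gam_c_def gam_lift_abs[OF assms] peval_pvar[OF is_ring_hom_of_int])
qed

lemma abs_gam_hom: "is_ring_hom abs_gam"
  by (simp add: is_ring_hom_def one_gam_def plus_gam.abs_eq times_gam.abs_eq)

lemma gam_c_nonpos: "p < 0 \<Longrightarrow> gam_c p = 0" "gam_c 0 = 1"
  by (simp_all add: gam_c_def cpoly_def zero_gam_def one_gam_def)

lemma gam_c_relations: "gamma_relations (\<lambda>p. gam_c (int p))"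
  unfolding gamma_relations_def
proof (intro conjI allI impI)
  show "gam_c (int 0) = 1" by (simp add: gam_c_nonpos)
  fix p :: nat assume p: "1 \<le> p"
  then have "gamma_rel p \<in> gamma_ideal"
    unfolding gamma_ideal_def by (intro module.span_base[OF module_mult]) auto
  then have "gamma_rel p - 0 \<in> gamma_ideal" by simp
  then have *: "abs_gam (gamma_rel p) = 0"
    unfolding zero_gam_def using Quotient3_rel[OF Quotient3_gam] gamma_ideal_eq by blast
  note h = abs_gam_hom
  have m: "abs_gam (a * b) = abs_gam a * abs_gam b" and a: "abs_gam (a + b) = abs_gam a + abs_gam b"
    and o: "abs_gam 1 = 1" for a b
    using h by (auto simp: is_ring_hom_def)
  have "abs_gam (gamma_rel p) = gam_c (int p) ^ 2
    + 2 * (\<Sum>i = 1..p. (-1) ^ i * gam_c (int p + int i) * gam_c (int p - int i))"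
    unfolding gamma_rel_def gam_c_def
    by (simp only: a m o is_ring_hom_sum[OF h] is_ring_hom_power[OF h] is_ring_hom_uminus[OF h]
        is_ring_hom_numeral[OF h])
  also have "(\<Sum>i = 1..p. (-1) ^ i * gam_c (int p + int i) * gam_c (int p - int i)) =
      (\<Sum>i = 1..p. (-1) ^ i * gam_c (int (p + i)) * gam_c (int (p - i)))"
    by (intro sum.cong) (auto simp: of_nat_diff)
  finally show "gam_c (int p) ^ 2 + 2 * (\<Sum>i = 1..p. (-1) ^ i * gam_c (int (p + i)) * gam_c (int (p - i))) = 0"
    using * by simp
qed


section \<open>The ring \<open>\<Gamma>[X,Y]\<close>\<close>

text \<open>
  \<open>VX i\<close> and \<open>VY i\<close> stand for \<open>x\<^bsub>i+1\<^esub>\<close> and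
  \<open>y\<^bsub>i+1\<^esub>\<close>; the functions \<open>xg\<close> and \<open>yg\<close> below use the
  indices \<open>1, 2, \<dots>\<close> and are not meant to be applied to \<open>0\<close>.
\<close>

datatype var = VX nat | VY nat

type_synonym gxy = "(var \<Rightarrow>\<^sub>0 nat) \<Rightarrow>\<^sub>0 gam"

definition xg :: "nat \<Rightarrow> gxy" where "xg i = pvar (VX (i - 1))"

definition yg :: "nat \<Rightarrow> gxy" where "yg i = pvar (VY (i - 1))"

definition cg :: "int \<Rightarrow> gxy" where "cg p = pconst (gam_c p)"

definition subring_XY :: "nat \<Rightarrow> nat \<Rightarrow> gxy set" where
  "subring_XY n r = {f. \<forall>t\<in>Poly_Mapping.keys f. Poly_Mapping.keys t \<subseteq> VX ` {..<n} \<union> VY ` {..<r}}"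

definition const_term :: "gxy \<Rightarrow> int" where
  "const_term f = gam_lift (\<lambda>p. if p = 0 then 1 else 0) (Poly_Mapping.lookup f 0)"

text \<open>
  The ring homomorphism with \<open>c\<^bsub>p\<^esub> \<mapsto> fc p\<close>,
  \<open>x\<^bsub>j\<^esub> \<mapsto> fx j\<close> and \<open>y\<^bsub>j\<^esub> \<mapsto> fy j\<close>.
\<close>

definition gxy_lift :: "(nat \<Rightarrow> gxy) \<Rightarrow> (nat \<Rightarrow> gxy) \<Rightarrow> (nat \<Rightarrow> gxy) \<Rightarrow> gxy \<Rightarrow> gxy" where
  "gxy_lift fc fx fy =
     peval (gam_lift fc) (\<lambda>v. case v of VX j \<Rightarrow> fx (Suc j) | VY j \<Rightarrow> fy (Suc j))"

lemma gxy_lift: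
  assumes "gamma_relations fc"
  shows "is_ring_hom (gxy_lift fc fx fy)"
    and "gxy_lift fc fx fy (cg (int p)) = fc p"
    and "j \<ge> 1 \<Longrightarrow> gxy_lift fc fx fy (xg j) = fx j"
    and "j \<ge> 1 \<Longrightarrow> gxy_lift fc fx fy (yg j) = fy j"
  unfolding gxy_lift_def cg_def xg_def yg_def
  using is_ring_hom_peval[OF is_ring_hom_gam_lift[OF assms]]
  by (simp_all add: peval_pvar[OF is_ring_hom_gam_lift[OF assms]]
      peval_pconst[OF is_ring_hom_gam_lift[OF assms]] gam_lift_c[OF assms])

lemma cg_nonpos: "p < 0 \<Longrightarrow> cg p = 0" "cg 0 = 1"
  by (simp_all add: cg_def gam_c_nonpos pconst_def)

lemma cg_relations: "gamma_relations (\<lambda>p. cg (int p))"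
proof -
  note h = is_ring_hom_pconst[where ?'a = gam and ?'b = var]
  have m: "pconst (a * b) = pconst a * (pconst b :: gxy)" and a: "pconst (a + b) = pconst a + (pconst b :: gxy)"
    and o: "pconst 1 = (1 :: gxy)" and z: "pconst 0 = (0 :: gxy)" for a b
    using h is_ring_hom_0[OF h] by (auto simp: is_ring_hom_def)
  show ?thesis
    unfolding gamma_relations_def
  proof (intro conjI allI impI)
    show "cg (int 0) = 1" by (simp add: cg_nonpos)
    fix p :: nat assume "1 \<le> p"
    then have "(pconst (gam_c (int p) ^ 2
        + 2 * (\<Sum>i = 1..p. (-1) ^ i * gam_c (int (p + i)) * gam_c (int (p - i)))) :: gxy) = 0"
      using gam_c_relations z unfolding gamma_relations_def by metis
    then show "cg (int p) ^ 2 + 2 * (\<Sum>i = 1..p. (-1) ^ i * cg (int (p + i)) * cg (int (p - i))) = 0"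
      unfolding cg_def
      by (simp only: a m o is_ring_hom_sum[OF h] is_ring_hom_power[OF h] is_ring_hom_uminus[OF h]
          is_ring_hom_numeral[OF h])
  qed
qed

definition weyl_act :: "nat \<Rightarrow> gxy \<Rightarrow> gxy" where
  "weyl_act i =
     (if i = 0
      then gxy_lift (\<lambda>p. cg (int p) + 2 * (\<Sum>j = 1..p. xg 1 ^ j * cg (int p - int j)))
                    (\<lambda>j. if j = 1 then - xg 1 else xg j) yg
      else gxy_lift (\<lambda>p. cg (int p)) (\<lambda>j. xg (transpose i (i + 1) j)) yg)"

definition omega :: "gxy \<Rightarrow> gxy" where
  "omega = gxy_lift (\<lambda>p. cg (int p)) (\<lambda>j. - yg j) (\<lambda>j. - xg j)"

lemma omega:
  "is_ring_hom omega" "omega (cg (int p)) = cg (int p)"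
  "j \<ge> 1 \<Longrightarrow> omega (xg j) = - yg j" "j \<ge> 1 \<Longrightarrow> omega (yg j) = - xg j"
  unfolding omega_def using gxy_lift[OF cg_relations] by auto

lemma weyl_act_pos:
  assumes "i \<ge> 1"
  shows "is_ring_hom (weyl_act i)" "weyl_act i (cg (int p)) = cg (int p)"
    "j \<ge> 1 \<Longrightarrow> weyl_act i (xg j) = xg (transpose i (i + 1) j)"
    "j \<ge> 1 \<Longrightarrow> weyl_act i (yg j) = yg j"
  unfolding weyl_act_def using gxy_lift[OF cg_relations] assms by auto

text \<open>
  The images of the \<open>c\<^bsub>p\<^esub>\<close> under \<open>s\<^bsub>0\<^esub>\<close>
  satisfy the relations of \<open>\<Gamma>\<close>, which say \<open>F(t) F(-t) = 1\<close> for the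
  generating function \<open>F\<close>.
\<close>

definition fps_flip :: "'a::comm_ring_1 fps \<Rightarrow> 'a fps" where
  "fps_flip F = Abs_fps (\<lambda>n. (-1) ^ n * fps_nth F n)"

lemma fps_flip_mult: "fps_flip (F * G) = fps_flip F * fps_flip G"
proof (rule fps_ext)
  fix n
  have "fps_nth (fps_flip F * fps_flip G) n =
      (\<Sum>i=0..n. ((-1) ^ i * (-1) ^ (n - i)) * (fps_nth F i * fps_nth G (n - i)))"
    by (simp add: fps_mult_nth fps_flip_def mult_ac)
  also have "\<dots> = (\<Sum>i=0..n. (-1) ^ n * (fps_nth F i * fps_nth G (n - i)))"
    by (intro sum.cong) (auto simp: power_add[symmetric])
  finally show "fps_nth (fps_flip (F * G)) n = fps_nth (fps_flip F * fps_flip G) n"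
    by (simp add: fps_flip_def fps_mult_nth sum_distrib_left)
qed

lemma fps_mult_flip_odd: "fps_nth (F * fps_flip F) (2 * p + 1) = 0"
proof -
  let ?n = "2 * p + 1"
  let ?g = "\<lambda>i. (-1) ^ (?n - i) * (fps_nth F i * fps_nth F (?n - i))"
  have "fps_nth (F * fps_flip F) ?n = sum ?g {0..?n}"
    unfolding fps_mult_nth by (intro sum.cong) (simp_all add: fps_flip_def mult_ac)
  also have "{0..?n} = {0..p} \<union> {p+1..?n}" by auto
  also have "sum ?g ({0..p} \<union> {p+1..?n}) = sum ?g {0..p} + sum ?g {p+1..?n}"
    by (intro sum.union_disjoint) auto
  also have "sum ?g {p+1..?n} = (\<Sum>i=0..p. - ?g i)"
  proof (rule sum.reindex_bij_witness[where i = "\<lambda>i. ?n - i" and j = "\<lambda>i. ?n - i"])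
    fix i assume i: "i \<in> {p+1..?n}"
    then have "(-1 :: 'a) ^ i = - ((-1) ^ (?n - i))"
      by (auto simp: minus_one_power_iff)
    with i show "- ?g (?n - i) = ?g i" by (simp add: mult_ac)
  qed auto
  finally show ?thesis by (simp add: sum_negf)
qed

lemma fps_mult_flip_even:
  "fps_nth (F * fps_flip F) (2 * p) =
     (-1) ^ p * (fps_nth F p ^ 2 + 2 * (\<Sum>i = 1..p. (-1) ^ i * fps_nth F (p + i) * fps_nth F (p - i)))"
proof -
  let ?n = "2 * p"
  let ?g = "\<lambda>i. (-1) ^ (?n - i) * (fps_nth F i * fps_nth F (?n - i))"
  let ?h = "\<lambda>i. (-1) ^ p * ((-1) ^ i * fps_nth F (p + i) * fps_nth F (p - i))"
  have "fps_nth (F * fps_flip F) ?n = sum ?g {0..?n}"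
    unfolding fps_mult_nth by (intro sum.cong) (simp_all add: fps_flip_def mult_ac)
  also have "{0..?n} = {0..<p} \<union> ({p} \<union> {p+1..?n})" by auto
  also have "sum ?g \<dots> = sum ?g {0..<p} + (?g p + sum ?g {p+1..?n})"
    by (subst sum.union_disjoint; (simp; fail)?) auto
  also have "sum ?g {0..<p} = sum ?h {1..p}"
  proof (rule sum.reindex_bij_witness[where i = "\<lambda>i. p - i" and j = "\<lambda>i. p - i"])
    fix i assume i: "i \<in> {0..<p}"
    then have "?n - i = p + (p - i)" "p - (p - i) = i" by auto
    moreover from i have "(-1 :: 'a) ^ p * (-1) ^ (p - i) = (-1) ^ (p + (p - i))"
      by (simp only: power_add)
    ultimately show "?h (p - i) = ?g i" by (simp only: mult.assoc[symmetric]) (simp only: mult_ac)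
  qed auto
  also have "sum ?g {p+1..?n} = sum ?h {1..p}"
  proof (rule sum.reindex_bij_witness[where i = "\<lambda>i. p + i" and j = "\<lambda>i. i - p"])
    fix i assume i: "i \<in> {p+1..?n}"
    then have "(-1 :: 'a) ^ p * (-1) ^ (i - p) = (-1) ^ (?n - i)"
      by (auto simp: minus_one_power_iff)
    moreover from i have "p + (i - p) = i" "p - (i - p) = ?n - i" by auto
    ultimately show "?h (i - p) = ?g i" by (simp only: mult.assoc[symmetric])
  qed auto
  also have "sum ?h {1..p} = (-1) ^ p * (\<Sum>i = 1..p. (-1) ^ i * fps_nth F (p + i) * fps_nth F (p - i))"
    by (rule sum_distrib_left[symmetric])
  finally show ?thesis
    by (simp add: algebra_simps power2_eq_square)
qed

lemma gamma_relations_iff: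
  "gamma_relations f \<longleftrightarrow> f 0 = 1 \<and> Abs_fps f * fps_flip (Abs_fps f) = 1"
proof (cases "f 0 = 1")
  case True
  let ?r = "\<lambda>p. f p ^ 2 + 2 * (\<Sum>i = 1..p. (-1) ^ i * f (p + i) * f (p - i))"
  have "Abs_fps f * fps_flip (Abs_fps f) = 1 \<longleftrightarrow>
      (\<forall>n. fps_nth (Abs_fps f * fps_flip (Abs_fps f)) n = (if n = 0 then 1 else 0))"
    by (simp add: fps_eq_iff)
  also have "\<dots> \<longleftrightarrow> (\<forall>p. fps_nth (Abs_fps f * fps_flip (Abs_fps f)) (2 * p) = (if p = 0 then 1 else 0))"
  proof (intro iffI allI)
    fix n
    assume *: "\<forall>p. fps_nth (Abs_fps f * fps_flip (Abs_fps f)) (2 * p) = (if p = 0 then 1 else 0)"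
    show "fps_nth (Abs_fps f * fps_flip (Abs_fps f)) n = (if n = 0 then 1 else 0)"
    proof (cases "even n")
      case True
      then obtain p where "n = 2 * p" by auto
      with * show ?thesis by simp
    next
      case False
      then obtain p where "n = 2 * p + 1" by (auto elim: oddE)
      then show ?thesis using fps_mult_flip_odd[of "Abs_fps f" p] by simp
    qed
  qed simp
  also have "\<dots> \<longleftrightarrow> (\<forall>p. (-1) ^ p * ?r p = (if p = 0 then 1 else 0))"
    by (simp only: fps_mult_flip_even fps_nth_Abs_fps)
  also have "\<dots> \<longleftrightarrow> (\<forall>p\<ge>1. ?r p = 0)"
  proof -
    have "(-1) ^ p * z = 0 \<longleftrightarrow> z = 0" for p and z :: 'a
      by (auto simp: minus_one_power_iff)
    then show ?thesis using True
      by (auto simp: Suc_le_eq)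
  qed
  finally show ?thesis using True by (simp add: gamma_relations_def)
qed (simp add: gamma_relations_def)

lemma gamma_relations_s0:
  assumes "gamma_relations f"
  shows "gamma_relations (\<lambda>p. f p + 2 * (\<Sum>j = 1..p. a ^ j * f (p - j)))"
proof -
  define g where "g = (\<lambda>p. f p + 2 * (\<Sum>j = 1..p. a ^ j * f (p - j)))"
  define E where "E = Abs_fps (\<lambda>n. a ^ n)"
  define P where "P = 1 + fps_const a * fps_X"
  define M where "M = 1 - fps_const a * fps_X"
  have E: "M * E = 1"
    unfolding M_def E_def
    by (rule fps_ext) (auto simp: algebra_simps fps_X_mult_nth mult.assoc simp flip: power_Suc)
  have flipP: "fps_flip P = M"
    unfolding P_def M_def fps_flip_def
    by (rule fps_ext) (auto simp: fps_X_def)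
  have flipM: "fps_flip M = P"
    unfolding P_def M_def fps_flip_def
    by (rule fps_ext) (auto simp: fps_X_def)
  have flip1: "fps_flip 1 = (1 :: 'a fps)"
    unfolding fps_flip_def by (rule fps_ext) auto
  have E': "P * fps_flip E = 1"
    using arg_cong[OF E, of fps_flip] by (simp add: fps_flip_mult flipM flip1)
  have K: "P * E = Abs_fps (\<lambda>n. if n = 0 then 1 else 2 * a ^ n)"
    unfolding P_def E_def
    by (rule fps_ext) (auto simp: algebra_simps fps_X_mult_nth mult.assoc simp flip: power_Suc)
  have "Abs_fps g = P * E * Abs_fps f"
  proof (rule fps_ext)
    fix n
    have "fps_nth (P * E * Abs_fps f) n = (\<Sum>j=0..n. (if j = 0 then 1 else 2 * a ^ j) * f (n - j))"
      by (simp add: K fps_mult_nth)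
    also have "\<dots> = f n + (\<Sum>j=1..n. (if j = 0 then 1 else 2 * a ^ j) * f (n - j))"
      by (simp add: sum.atLeast_Suc_atMost)
    also have "\<dots> = g n"
      unfolding g_def by (simp add: sum_distrib_left mult.assoc)
    finally show "fps_nth (Abs_fps g) n = fps_nth (P * E * Abs_fps f) n" by simp
  qed
  then have "Abs_fps g * fps_flip (Abs_fps g) =
      (M * E) * (P * fps_flip E) * (Abs_fps f * fps_flip (Abs_fps f))"
    by (simp add: fps_flip_mult flipP mult_ac)
  also have "\<dots> = 1"
    using assms E E' by (simp add: gamma_relations_iff)
  finally show ?thesis
    using assms unfolding g_def[symmetric] gamma_relations_iff by (simp add: g_def gamma_relations_def)
qed

lemma weyl_act_0:
  "is_ring_hom (weyl_act 0)"
  "weyl_act 0 (cg (int p)) = cg (int p) + 2 * (\<Sum>j = 1..p. xg 1 ^ j * cg (int p - int j))"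
  "weyl_act 0 (xg 1) = - xg 1"
  "j \<ge> 2 \<Longrightarrow> weyl_act 0 (xg j) = xg j"
  "j \<ge> 1 \<Longrightarrow> weyl_act 0 (yg j) = yg j"
proof -
  have "(\<lambda>p. cg (int p) + 2 * (\<Sum>j = 1..p. xg 1 ^ j * cg (int p - int j))) =
      (\<lambda>p. cg (int p) + 2 * (\<Sum>j = 1..p. xg 1 ^ j * cg (int (p - j))))"
    by (intro ext arg_cong2[of _ _ _ _ "(+)"] arg_cong2[of _ _ _ _ "(*)"] sum.cong)
       (auto simp: of_nat_diff)
  then have *: "gamma_relations (\<lambda>p. cg (int p) + 2 * (\<Sum>j = 1..p. xg 1 ^ j * cg (int p - int j)))"
    using gamma_relations_s0[OF cg_relations, of "xg 1"] by simp
  show "is_ring_hom (weyl_act 0)"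
    "weyl_act 0 (cg (int p)) = cg (int p) + 2 * (\<Sum>j = 1..p. xg 1 ^ j * cg (int p - int j))"
    "weyl_act 0 (xg 1) = - xg 1"
    "j \<ge> 2 \<Longrightarrow> weyl_act 0 (xg j) = xg j"
    "j \<ge> 1 \<Longrightarrow> weyl_act 0 (yg j) = yg j"
    unfolding weyl_act_def using gxy_lift[OF *] by auto
qed


section \<open>The Weyl group\<close>

text \<open>
  A signed permutation \<open>w\<close> of \<open>{1..k}\<close> is extended to an odd
  permutation of \<open>{-k..k}\<close>, so that \<open>w\<^bsub>i\<^esub>\<close> is
  \<open>w i\<close> and products are compositions. Being the identity outside \<open>{-k..k}\<close>,
  the elements of \<open>Weyl k\<close> are also elements of \<open>Weyl (k + 1)\<close>.
\<close>

definition Weyl :: "nat \<Rightarrow> (int \<Rightarrow> int) set" where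
  "Weyl k = {w. w permutes {- int k..int k} \<and> (\<forall>i. w (- i) = - w i)}"

definition W_inf :: "(int \<Rightarrow> int) set" where
  "W_inf = (\<Union>k. Weyl k)"

definition Sym :: "nat \<Rightarrow> (int \<Rightarrow> int) set" where
  "Sym m = {w \<in> Weyl m. \<forall>i>0. w i > 0}"

definition sref :: "nat \<Rightarrow> int \<Rightarrow> int" where
  "sref i = (if i = 0 then transpose (-1) 1
          else transpose (int i) (int i + 1) \<circ> transpose (- int i) (- int i - 1))"

definition wlen :: "(int \<Rightarrow> int) \<Rightarrow> nat" where
  "wlen w = (LEAST l. \<exists>is. length is = l \<and> w = foldr (\<lambda>i u. sref i \<circ> u) is id)"

definition w_long :: "nat \<Rightarrow> int \<Rightarrow> int" where
  "w_long n i = (if \<bar>i\<bar> \<le> int n then - i else i)"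

definition grassmannian :: "nat \<Rightarrow> (int \<Rightarrow> int) \<Rightarrow> bool" where
  "grassmannian n w \<longleftrightarrow> w \<in> W_inf \<and> (\<forall>i. i \<noteq> n \<longrightarrow> wlen (w \<circ> sref i) > wlen w)"


section \<open>Schubert polynomials\<close>

text \<open>
  The divisions below are exact, and the quotients are unique because \<open>\<Gamma>\<close> is
  torsion-free.
\<close>

definition exact_div :: "gxy \<Rightarrow> gxy \<Rightarrow> gxy" where
  "exact_div f d = (THE q. f = q * d)"

definition ddx :: "nat \<Rightarrow> gxy \<Rightarrow> gxy" where
  "ddx i f = exact_div (f - weyl_act i f) (if i = 0 then - 2 * xg 1 else xg i - xg (i + 1))"

definition ddy :: "nat \<Rightarrow> gxy \<Rightarrow> gxy" where
  "ddy i f = omega (ddx i (omega f))"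

text \<open>
  The polynomials \<open>C\<^bsub>w\<^esub>\<close> form the unique family with the following
  property. Values of \<open>C\<close> outside \<open>W_inf\<close> are irrelevant.
\<close>

definition is_schubert_family :: "((int \<Rightarrow> int) \<Rightarrow> gxy) \<Rightarrow> bool" where
  "is_schubert_family C \<longleftrightarrow> (\<forall>w\<in>W_inf.
     (\<forall>i. ddx i (C w) = (if wlen (w \<circ> sref i) < wlen w then C (w \<circ> sref i) else 0)) \<and>
     (\<forall>i. ddy i (C w) = (if wlen (sref i \<circ> w) < wlen w then C (sref i \<circ> w) else 0)) \<and>
     const_term (C w) = (if w = id then 1 else 0))"


section \<open>Partitions attached to a signed permutation\<close>

text \<open>
  Partitions are weakly decreasing lists of positive integers; \<open>nth_default 0\<close> pads
  with zeros. List positions start at \<open>0\<close>.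
\<close>

definition conj_part :: "nat list \<Rightarrow> nat list" where
  "conj_part p = map (\<lambda>j. length (filter (\<lambda>a. a > j) p)) [0..<Max (insert 0 (set p))]"

definition add_part :: "'a::comm_monoid_add list \<Rightarrow> 'a list \<Rightarrow> 'a list" where
  "add_part p q = map (\<lambda>i. nth_default 0 p i + nth_default 0 q i) [0..<max (length p) (length q)]"

definition mu_part :: "(int \<Rightarrow> int) \<Rightarrow> nat list" where
  "mu_part w = rev (sorted_list_of_set {nat \<bar>w i\<bar> |i. i > 0 \<and> w i < 0})"

definition gamma_code :: "(int \<Rightarrow> int) \<Rightarrow> int \<Rightarrow> nat" where
  "gamma_code w i = card {j. j > i \<and> w j < w i}"

definition delta_part :: "(int \<Rightarrow> int) \<Rightarrow> nat list" where
  "delta_part w = rev (sorted_list_of_multiset (image_mset (gamma_code w) (mset_set {i. i > 0 \<and> gamma_code w i \<noteq> 0})))"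

definition nu_part :: "(int \<Rightarrow> int) \<Rightarrow> nat list" where
  "nu_part w = conj_part (delta_part w)"

definition lam_part :: "(int \<Rightarrow> int) \<Rightarrow> nat list" where
  "lam_part w = add_part (mu_part w) (nu_part w)"

text \<open>Beyond the length of \<open>mu_part w\<close> the entries \<open>min (1 - 0) 0\<close> vanish.\<close>

definition beta_seq :: "(int \<Rightarrow> int) \<Rightarrow> int list" where
  "beta_seq w = map (\<lambda>a. min (1 - int a) 0) (mu_part w)"

definition stair :: "int \<Rightarrow> int list" where
  "stair k = rev [0..k]"


section \<open>Multi-Schur Pfaffians\<close>

definition esym :: "nat \<Rightarrow> nat \<Rightarrow> (nat \<Rightarrow> gxy) \<Rightarrow> gxy" where
  "esym r j z = (\<Sum>A | A \<subseteq> {1..r} \<and> card A = j. \<Prod>i\<in>A. z i)"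

definition hsym :: "nat \<Rightarrow> nat \<Rightarrow> (nat \<Rightarrow> gxy) \<Rightarrow> gxy" where
  "hsym r j z = (\<Sum>M | set_mset M \<subseteq> {1..r} \<and> size M = j. \<Prod>i\<in>#M. z i)"

definition hgen :: "int \<Rightarrow> nat \<Rightarrow> (nat \<Rightarrow> gxy) \<Rightarrow> gxy" where
  "hgen r j z = (if r \<ge> 0 then hsym (nat r) j z else esym (nat (- r)) j z)"

text \<open>The terms with \<open>i + j > p\<close> vanish.\<close>

definition multi_c :: "int \<Rightarrow> int \<Rightarrow> int \<Rightarrow> gxy" where
  "multi_c k r p = (\<Sum>i\<le>nat p. \<Sum>j\<le>nat p. cg (p - int i - int j) * hgen (- k) i xg * hgen r j (\<lambda>l. - yg l))"

text \<open>
  Factors beyond the length of \<open>\<alpha>\<close> are \<open>multi_c k r 0 = 1\<close>.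
\<close>

definition multi_c_prod :: "int list \<Rightarrow> int list \<Rightarrow> int list \<Rightarrow> gxy" where
  "multi_c_prod \<rho> \<beta> \<alpha> = (\<Prod>i<length \<alpha>. multi_c (nth_default 0 \<rho> i) (nth_default 0 \<beta> i) (\<alpha> ! i))"

text \<open>
  A monomial in the raising operators \<open>R\<^bsub>ij\<^esub>\<close>, \<open>i < j < l\<close>, is given
  by its exponents.
\<close>

definition raise :: "((nat \<times> nat) \<Rightarrow>\<^sub>0 nat) \<Rightarrow> int list \<Rightarrow> int list" where
  "raise N \<alpha> = map (\<lambda>i. \<alpha> ! i + (\<Sum>j<length \<alpha>. int (Poly_Mapping.lookup N (i, j)))
                              - (\<Sum>j<length \<alpha>. int (Poly_Mapping.lookup N (j, i)))) [0..<length \<alpha>]"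

definition raising_pairs :: "nat \<Rightarrow> (nat \<times> nat) set" where
  "raising_pairs l = {(i, j). i < j \<and> j < l}"

text \<open>The coefficients of the power series \<open>(1 - R) / (1 + R)\<close>.\<close>

definition raising_coeff :: "nat \<Rightarrow> int" where
  "raising_coeff k = (if k = 0 then 1 else 2 * (-1) ^ k)"

lemma raising_coeff: "(1 + fps_X) * Abs_fps raising_coeff = 1 - fps_X"
proof (rule fps_ext)
  fix n
  show "fps_nth ((1 + fps_X) * Abs_fps raising_coeff) n = fps_nth (1 - fps_X) n"
    by (cases n; cases "n - 1") (simp_all add: distrib_right raising_coeff_def fps_X_nth)
qed

lemma multi_c_neg: "p < 0 \<Longrightarrow> multi_c k r p = 0"
  by (simp add: multi_c_def cg_nonpos)

lemma multi_c_zero: "multi_c k r 0 = 1"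
proof -
  have "{A. A \<subseteq> {1..m} \<and> card A = 0} = {{}}" for m :: nat
    using finite_subset[of _ "{1..m}"] by auto
  moreover have "{M. set_mset M \<subseteq> {1..m} \<and> size M = 0} = {{#}}" for m :: nat
    by auto
  ultimately have "hgen r 0 z = 1" for r z
    by (simp add: hgen_def hsym_def esym_def)
  then show ?thesis by (simp add: multi_c_def cg_nonpos)
qed

lemma finite_raising:
  "finite {N. Poly_Mapping.keys N \<subseteq> raising_pairs (length \<alpha>) \<and> multi_c_prod \<rho> \<beta> (raise N \<alpha>) \<noteq> 0}"
  (is "finite ?A")
proof -
  let ?l = "length \<alpha>" and ?I = "raising_pairs (length \<alpha>)"
  define B where "B = (\<Sum>i<?l. int i * \<alpha> ! i)"
  have bound: "Poly_Mapping.lookup N e \<le> nat B" if N: "N \<in> ?A" for N e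
  proof -
    define n where "n = (\<lambda>i j. int (Poly_Mapping.lookup N (i, j)))"
    have n0: "n i j = 0" if "\<not> (i < j \<and> j < ?l)" for i j
    proof -
      have "(i, j) \<notin> Poly_Mapping.keys N" using N that by (auto simp: raising_pairs_def)
      then show ?thesis by (simp add: n_def in_keys_iff)
    qed
    have "0 \<le> \<alpha> ! i + (\<Sum>j<?l. n i j) - (\<Sum>j<?l. n j i)" if "i < ?l" for i
    proof (rule ccontr)
      assume "\<not> ?thesis"
      then have "raise N \<alpha> ! i < 0" using that by (simp add: raise_def n_def)
      then have "multi_c_prod \<rho> \<beta> (raise N \<alpha>) = 0"
        unfolding multi_c_prod_def using that
        by (intro prod_zero) (auto simp: raise_def intro!: multi_c_neg)
      then show False using N by simp
    qed
    then have "0 \<le> (\<Sum>i<?l. int i * (\<alpha> ! i + (\<Sum>j<?l. n i j) - (\<Sum>j<?l. n j i)))"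
      by (intro sum_nonneg) simp
    also have "\<dots> = B + (\<Sum>i<?l. \<Sum>j<?l. int i * n i j) - (\<Sum>i<?l. \<Sum>j<?l. int i * n j i)"
      by (simp add: B_def algebra_simps sum.distrib sum_subtractf sum_distrib_left)
    also have "(\<Sum>i<?l. \<Sum>j<?l. int i * n j i) = (\<Sum>i<?l. \<Sum>j<?l. int j * n i j)"
      by (rule sum.swap)
    finally have le: "(\<Sum>i<?l. \<Sum>j<?l. int j * n i j) - (\<Sum>i<?l. \<Sum>j<?l. int i * n i j) \<le> B"
      by simp
    have "(\<Sum>i<?l. \<Sum>j<?l. n i j) \<le> (\<Sum>i<?l. \<Sum>j<?l. (int j - int i) * n i j)"
    proof (intro sum_mono)
      fix i j
      show "n i j \<le> (int j - int i) * n i j"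
      proof (cases "i < j")
        case True
        then show ?thesis
          using mult_right_mono[of 1 "int j - int i" "n i j"] by (simp add: n_def)
      next
        case False
        then show ?thesis by (simp add: n0)
      qed
    qed
    with le have tot: "(\<Sum>i<?l. \<Sum>j<?l. n i j) \<le> B"
      by (simp add: left_diff_distrib sum_subtractf)
    obtain a b where e: "e = (a, b)" by (cases e)
    have nn: "0 \<le> n i j" for i j by (simp add: n_def)
    have "n a b \<le> (\<Sum>i<?l. \<Sum>j<?l. n i j)"
    proof (cases "a < b \<and> b < ?l")
      case True
      have "n a b \<le> (\<Sum>j<?l. n a j)"
        using True nn by (intro member_le_sum) auto
      also have "\<dots> \<le> (\<Sum>i<?l. \<Sum>j<?l. n i j)"
        using True nn by (intro member_le_sum[where f = "\<lambda>i. \<Sum>j<?l. n i j"] sum_nonneg) auto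
      finally show ?thesis .
    next
      case False
      then have "n a b = 0" by (rule n0)
      then show ?thesis using nn by (simp add: sum_nonneg)
    qed
    with tot show ?thesis by (simp add: e n_def)
  qed
  have fI: "finite ?I"
    by (rule finite_subset[of _ "{..<?l} \<times> {..<?l}"]) (auto simp: raising_pairs_def)
  have "Poly_Mapping.lookup ` ?A \<subseteq>
      {f. \<forall>e. (e \<in> ?I \<longrightarrow> f e \<in> {..nat B}) \<and> (e \<notin> ?I \<longrightarrow> f e = 0)}"
    using bound by (auto simp: in_keys_iff subset_iff)
  then have "finite (Poly_Mapping.lookup ` ?A)"
    by (rule finite_subset) (rule finite_set_of_finite_funs[OF fI], simp)
  then show ?thesis
    by (rule finite_imageD) (auto simp: inj_on_def poly_mapping_eqI)
qed

text \<open>Only finitely many terms of the following sum are non-zero, by the previous lemma.\<close>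

definition multi_Q :: "int list \<Rightarrow> int list \<Rightarrow> int list \<Rightarrow> gxy" where
  "multi_Q \<rho> \<beta> \<alpha> =
     (let I = raising_pairs (length \<alpha>);
          T = (\<lambda>N. of_int (\<Prod>e\<in>I. raising_coeff (Poly_Mapping.lookup N e)) * multi_c_prod \<rho> \<beta> (raise N \<alpha>))
      in \<Sum>N | Poly_Mapping.keys N \<subseteq> I \<and> T N \<noteq> 0. T N)"

end

theory Submission imports Defs "HOL-Computational_Algebra.Polynomial" begin

text \<open>
  The Pfaffian \<open>P\<close> proposed for the longest element \<open>w\<^sub>0\<close> of \<open>W\<^sub>m\<close> satisfies
  \<open>\<partial>\<^sub>i\<^sup>x P = \<partial>\<^sub>i\<^sup>y P\<close>. The common kernel of all divided differences consists of the constants, so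
  \<open>P\<close>, being homogeneous of degree \<open>m\<^sup>2 = \<ell>(w\<^sub>0)\<close>, is a multiple of \<open>C\<^bsub>w\<^sub>0\<^esub>\<close>. Every \<open>w w\<^sub>0\<^sup>(\<^sup>n\<^sup>)\<close> with \<open>w\<close> \<open>n\<close>-Grassmannian is reached from
  \<open>w\<^sub>0\<close> by divided differences in \<open>x\<close> and \<open>y\<close>. Each of them acts on a single row of the Pfaffian,
  up to Pfaffians with two equal adjacent rows, which vanish by the relations of \<open>\<Gamma>\<close>. The remaining
  multiple is \<open>1\<close>, as one sees at \<open>n = 0\<close>, \<open>w = 1\<close>, where the Pfaffian is empty.
\<close>

section \<open>The ring \<open>\<Gamma>\<close> is a torsion-free domain\<close>

text \<open>The quotients in \<open>exact_div\<close> have to be unique, and identities between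
  divided differences are proved by clearing denominators; hence \<Gamma>\<open>[X,Y]\<close> has to
  be an integral domain. The Pfaffian \<open>P\<close> is not known beforehand to be a combination
  of the \<open>C w\<close>. That its iterated divided differences depend only on the group element
  is therefore proved for arbitrary polynomials, from the braid relations and the linking of reduced
  words. Invariance under the \<open>s_i\<close> with \<open>i \<ge> 1\<close> removes the finitely
  many variables of a polynomial; the difficulty of the common kernel lies in the elements of
  \<Gamma> fixed by \<open>s_0\<close>. A row with \<open>k\<close> factors in \<open>x\<close> and
  \<open>v - 1\<close> factors in \<open>y\<close> has a generating function \<open>f(t)\<close>. As
  \<open>c(t) c(-t) = 1\<close>, the product \<open>f(t) f(-t)\<close> is a polynomial of degree at
  most \<open>2 (k + v - 1)\<close>. The part belonging to that row is \<open>v + k\<close>, just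
  large enough for two equal rows to cancel. A priori the multiple may be zero; every identity
  carries it along as \<open>of_int k * C w = Pf ...\<close>, and nothing is ever divided by
  it.\<close>

lemma is_ring_homD:
  assumes "is_ring_hom h"
  shows "h 1 = 1" "h (a + b) = h a + h b" "h (a * b) = h a * h b" "h 0 = 0" "h (- a) = - h a"
    "h (a - b) = h a - h b" "h (sum f A) = (\<Sum>a\<in>A. h (f a))" "h (a ^ k) = h a ^ k"
    "h (numeral m) = numeral m"
  using assms is_ring_hom_0[OF assms] is_ring_hom_uminus[OF assms] is_ring_hom_diff[OF assms]
    is_ring_hom_sum[OF assms] is_ring_hom_power[OF assms] is_ring_hom_numeral[OF assms]
  by (auto simp: is_ring_hom_def)

lemma is_ring_hom_prod: "is_ring_hom h \<Longrightarrow> h (prod f A) = (\<Prod>a\<in>A. h (f a))"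
  by (induction A rule: infinite_finite_induct) (auto simp: is_ring_homD)

lemma is_ring_hom_of_nat_eq: "is_ring_hom h \<Longrightarrow> h (of_nat n) = of_nat n"
  by (induction n) (simp_all add: is_ring_homD)

lemma is_ring_hom_of_int_eq: "is_ring_hom h \<Longrightarrow> h (of_int n) = of_int n"
  by (cases n rule: int_cases2) (simp_all add: is_ring_homD is_ring_hom_of_nat_eq)

lemma is_ring_hom_comp: "is_ring_hom g \<Longrightarrow> is_ring_hom h \<Longrightarrow> is_ring_hom (\<lambda>a. g (h a))"
  by (simp add: is_ring_hom_def)

lemma is_ring_hom_id: "is_ring_hom (\<lambda>a. a)"
  by (simp add: is_ring_hom_def)

lemma pvar_power: "pvar v ^ k = Poly_Mapping.single (Poly_Mapping.single v k) (1 :: 'a::comm_ring_1)"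
  by (induction k) (simp_all add: pvar_def mult_single flip: single_add)

lemma meval_pvar: "meval pvar t = Poly_Mapping.single t (1 :: 'a::comm_ring_1)"
proof -
  have "(\<Prod>v\<in>A. Poly_Mapping.single (Poly_Mapping.single v (Poly_Mapping.lookup t v)) (1 :: 'a)) =
      Poly_Mapping.single (\<Sum>v\<in>A. Poly_Mapping.single v (Poly_Mapping.lookup t v)) 1" if "finite A" for A
    using that by (induction A) (simp_all add: mult_single)
  then show ?thesis by (simp add: meval_def pvar_power poly_mapping_sum_single)
qed

lemma peval_pconst_pvar: "peval pconst pvar p = p"
  by (simp add: peval_def meval_pvar pconst_def mult_single poly_mapping_sum_single)

lemma mpoly_induct [case_names const var add mult]:
  assumes c: "\<And>a. P (pconst a)" and v: "\<And>v. P (pvar v)"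
    and a: "\<And>p q. P p \<Longrightarrow> P q \<Longrightarrow> P (p + q)" and m: "\<And>p q. P p \<Longrightarrow> P q \<Longrightarrow> P (p * q)"
  shows "P p"
proof -
  have 0: "P 0" "P 1" using c[of 0] c[of 1] by (simp_all add: pconst_def)
  have pw: "P (pvar v ^ k)" for v k by (induction k) (auto intro: 0 m v)
  have "P (\<Prod>v\<in>A. pvar v ^ f v)" for A f
    by (induction A rule: infinite_finite_induct) (auto intro: 0 m pw)
  then have "P (\<Sum>t\<in>A. pconst (g t) * meval pvar t)" for A g
    by (induction A rule: infinite_finite_induct) (auto intro!: 0 a m c simp: meval_def)
  then have "P (peval pconst pvar p)" by (simp add: peval_def)
  then show ?thesis by (simp add: peval_pconst_pvar)
qed

section \<open>Absence of torsion at the prime 2 in \<Gamma>\<close>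

definition gamma_span :: "nat set \<Rightarrow> ((nat \<Rightarrow>\<^sub>0 nat) \<Rightarrow>\<^sub>0 int) set" where
  "gamma_span B = {x. \<exists>k. x = (\<Sum>p\<in>B. k p * gamma_rel p)}"

lemma gamma_spanI: "x = (\<Sum>p\<in>B. k p * gamma_rel p) \<Longrightarrow> x \<in> gamma_span B"
  unfolding gamma_span_def by (intro CollectI exI[of _ k])

lemma gamma_span_add:
  assumes "x \<in> gamma_span B" "y \<in> gamma_span B" shows "x + y \<in> gamma_span B"
proof -
  obtain k l where "x = (\<Sum>p\<in>B. k p * gamma_rel p)" "y = (\<Sum>p\<in>B. l p * gamma_rel p)"
    using assms by (auto simp: gamma_span_def)
  then have "x + y = (\<Sum>p\<in>B. (k p + l p) * gamma_rel p)" by (simp add: algebra_simps sum.distrib)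
  then show ?thesis by (rule gamma_spanI)
qed

lemma gamma_span_mono:
  assumes "x \<in> gamma_span B" "B \<subseteq> B'" "finite B'" shows "x \<in> gamma_span B'"
proof -
  obtain k where k: "x = (\<Sum>p\<in>B. k p * gamma_rel p)" using assms by (auto simp: gamma_span_def)
  have "x = (\<Sum>p\<in>B'. (if p \<in> B then k p else 0) * gamma_rel p)"
    unfolding k using assms by (intro sum.mono_neutral_cong_left) auto
  then show ?thesis by (rule gamma_spanI)
qed

lemma gamma_span_single: "p \<in> B \<Longrightarrow> finite B \<Longrightarrow> c * gamma_rel p \<in> gamma_span B"
proof -
  assume *: "p \<in> B" "finite B"
  have "c * gamma_rel p \<in> gamma_span {p}" unfolding gamma_span_def by (auto intro: exI[of _ "\<lambda>_. c"])
  then show ?thesis using * by (auto intro: gamma_span_mono)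
qed

text \<open>An element of the ideal involves finitely many relations; the induction in
  \<open>gamma_span_2_cancel\<close> runs over finite index sets.\<close>

lemma gamma_ideal_span:
  assumes "a \<in> gamma_ideal"
  shows "\<exists>B. finite B \<and> B \<subseteq> {1..} \<and> a \<in> gamma_span B"
  using assms unfolding gamma_ideal_def
proof (induction a rule: module.span_induct_alt[OF module_mult, consumes 1, case_names base step])
  case base
  show ?case by (intro exI[of _ "{}"]) (simp add: gamma_span_def)
next
  case (step c x y)
  then obtain B p where B: "finite B" "B \<subseteq> {1..}" "y \<in> gamma_span B" "p \<ge> 1" "x = gamma_rel p" by auto
  then have "c * x + y \<in> gamma_span (insert p B)"
    by (auto intro!: gamma_span_add gamma_span_single intro: gamma_span_mono)
  with B show ?case by (intro exI[of _ "insert p B"]) auto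
qed

lemma gamma_span_ideal: "a \<in> gamma_span B \<Longrightarrow> B \<subseteq> {1..} \<Longrightarrow> a \<in> gamma_ideal"
proof -
  assume "a \<in> gamma_span B" and B: "B \<subseteq> {1..}"
  then obtain k where "a = (\<Sum>p\<in>B. k p * gamma_rel p)" by (auto simp: gamma_span_def)
  moreover have "gamma_rel p \<in> gamma_ideal" if "p \<in> B" for p
    using that B unfolding gamma_ideal_def by (intro module.span_base[OF module_mult]) auto
  then have "(\<Sum>p\<in>B. k p * gamma_rel p) \<in> gamma_ideal"
    unfolding gamma_ideal_def
    by (intro module.span_sum[OF module_mult] module.span_scale[OF module_mult]) auto
  ultimately show ?thesis by simp
qed

abbreviation csq :: "nat \<Rightarrow> (nat \<Rightarrow>\<^sub>0 nat) \<Rightarrow>\<^sub>0 int" where "csq p \<equiv> pvar (p - 1) ^ 2"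

text \<open>For finite \<open>B\<close>, the ideal of the relations from \<open>B\<close> modulo
  \<open>2\<close>, since \<open>gamma_rel p\<close> is \<open>c_p^2\<close> plus an even
  polynomial.\<close>

definition sq_span :: "nat set \<Rightarrow> ((nat \<Rightarrow>\<^sub>0 nat) \<Rightarrow>\<^sub>0 int) set" where
  "sq_span B = {x. \<exists>e k. x = 2 * e + (\<Sum>p\<in>B. k p * csq p)}"

lemma sq_spanI: "x = 2 * e + (\<Sum>p\<in>B. k p * csq p) \<Longrightarrow> x \<in> sq_span B"
  unfolding sq_span_def by (intro CollectI exI[of _ k] exI[of _ e])

lemma sq_span_add:
  assumes "x \<in> sq_span B" "y \<in> sq_span B" shows "x + y \<in> sq_span B"
proof -
  obtain d e k l where "x = 2 * d + (\<Sum>p\<in>B. k p * csq p)" "y = 2 * e + (\<Sum>p\<in>B. l p * csq p)"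
    using assms by (auto simp: sq_span_def)
  then have "x + y = 2 * (d + e) + (\<Sum>p\<in>B. (k p + l p) * csq p)" by (simp add: algebra_simps sum.distrib)
  then show ?thesis by (rule sq_spanI)
qed

lemma sq_span_sum: "(\<And>t. t \<in> A \<Longrightarrow> f t \<in> sq_span B) \<Longrightarrow> sum f A \<in> sq_span B"
proof (induction A rule: infinite_finite_induct)
  case (insert x F)
  then show ?case by (simp add: sq_span_add)
qed (auto simp: sq_span_def intro!: exI[of _ 0] exI[of _ "\<lambda>_. 0"])

lemma lookup_mult_monom:
  fixes x :: "(nat \<Rightarrow>\<^sub>0 nat) \<Rightarrow>\<^sub>0 int"
  shows "Poly_Mapping.lookup (x * Poly_Mapping.single s 1) (t + s) = Poly_Mapping.lookup x t"
proof -
  have "x * Poly_Mapping.single s 1 = (\<Sum>u\<in>Poly_Mapping.keys x. Poly_Mapping.single (u + s) (Poly_Mapping.lookup x u))"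
    using arg_cong2[OF poly_mapping_sum_single[of x] refl, of "(*)" "Poly_Mapping.single s 1"]
    by (simp add: sum_distrib_right mult_single)
  then show ?thesis by (simp add: lookup_sum lookup_single when_def in_keys_iff)
qed

lemma lookup_mult_monom_0:
  fixes x :: "(nat \<Rightarrow>\<^sub>0 nat) \<Rightarrow>\<^sub>0 int"
  assumes "Poly_Mapping.lookup t v < k"
  shows "Poly_Mapping.lookup (x * Poly_Mapping.single (Poly_Mapping.single v k) 1) t = 0"
proof -
  let ?s = "Poly_Mapping.single v k"
  have "x * Poly_Mapping.single ?s 1 = (\<Sum>u\<in>Poly_Mapping.keys x. Poly_Mapping.single (u + ?s) (Poly_Mapping.lookup x u))"
    using arg_cong2[OF poly_mapping_sum_single[of x] refl, of "(*)" "Poly_Mapping.single ?s 1"]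
    by (simp add: sum_distrib_right mult_single)
  moreover have "u + ?s \<noteq> t" for u
    using assms by (auto simp: lookup_add)
  ultimately show ?thesis by (simp add: lookup_sum lookup_single when_def)
qed

text \<open>Modulo \<open>2\<close> this is a monomial ideal: a term of \<open>b\<close> is
  divisible by some \<open>c_p^2\<close> with \<open>p\<close> in \<open>B\<close>, or its product
  with \<open>c_q^2\<close> is divisible by none of them either and must have an even
  coefficient.\<close>

lemma sq_span_cancel:
  assumes B: "finite B" "B \<subseteq> {1..}" "q \<ge> 1" "q \<notin> B" and m: "b * csq q \<in> sq_span B"
  shows "b \<in> sq_span B"
proof -
  obtain e k where e: "b * csq q = 2 * e + (\<Sum>p\<in>B. k p * csq p)" using m by (auto simp: sq_span_def)
  have "Poly_Mapping.single t (Poly_Mapping.lookup b t) \<in> sq_span B" for t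
  proof (cases "\<exists>p\<in>B. Poly_Mapping.lookup t (p - 1) \<ge> 2")
    case True
    then obtain p where p: "p \<in> B" "Poly_Mapping.lookup t (p - 1) \<ge> 2" by blast
    define s where "s = t - Poly_Mapping.single (p - 1) 2"
    have "t = s + Poly_Mapping.single (p - 1) 2"
      by (rule poly_mapping_eqI) (use p in \<open>auto simp: s_def lookup_add lookup_minus lookup_single when_def\<close>)
    then have "Poly_Mapping.single t (Poly_Mapping.lookup b t) =
        Poly_Mapping.single s (Poly_Mapping.lookup b t) * csq p"
      by (simp add: pvar_power mult_single)
    also have "\<dots> = 2 * 0 + (\<Sum>r\<in>B. (if r = p then Poly_Mapping.single s (Poly_Mapping.lookup b t) else 0) * csq r)"
      using p B by (simp add: if_distrib[of "\<lambda>x. x * _"] cong: if_cong)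
    finally show ?thesis by (rule sq_spanI)
  next
    case False
    let ?s = "Poly_Mapping.single (q - 1) 2"
    have "Poly_Mapping.lookup b t = Poly_Mapping.lookup (b * csq q) (t + ?s)"
      by (simp only: pvar_power lookup_mult_monom)
    also have "\<dots> = Poly_Mapping.lookup (2 * e) (t + ?s) + (\<Sum>p\<in>B. Poly_Mapping.lookup (k p * csq p) (t + ?s))"
      by (simp only: e lookup_add lookup_sum)
    also have "(\<Sum>p\<in>B. Poly_Mapping.lookup (k p * csq p) (t + ?s)) = 0"
    proof (intro sum.neutral ballI)
      fix p assume p: "p \<in> B"
      then have "p \<noteq> q" "p \<ge> 1" using B by auto
      then have "p - 1 \<noteq> q - 1" using B by linarith
      then have "Poly_Mapping.lookup (t + ?s) (p - 1) < 2"
        using False p by (auto simp: lookup_add lookup_single when_def not_le)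
      then show "Poly_Mapping.lookup (k p * csq p) (t + ?s) = 0"
        by (simp only: pvar_power lookup_mult_monom_0)
    qed
    also have "Poly_Mapping.lookup (2 * e) (t + ?s) = 2 * Poly_Mapping.lookup e (t + ?s)"
      by (simp only: mult_2 lookup_add)
    finally have "Poly_Mapping.lookup b t = 2 * Poly_Mapping.lookup e (t + ?s)" by simp
    then have "Poly_Mapping.single t (Poly_Mapping.lookup b t) =
        2 * Poly_Mapping.single t (Poly_Mapping.lookup e (t + ?s)) + (\<Sum>p\<in>B. 0 * csq p)"
      by (simp only: mult_2 single_add mult_zero_left sum.neutral_const add_0_right)
    then show ?thesis by (rule sq_spanI)
  qed
  then have "(\<Sum>t\<in>Poly_Mapping.keys b. Poly_Mapping.single t (Poly_Mapping.lookup b t)) \<in> sq_span B"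
    by (intro sq_span_sum)
  then show ?thesis by (simp add: poly_mapping_sum_single)
qed

text \<open>Modulo \<open>2\<close> the relations are the squares of the variables, whose syzygies are generated by
  the trivial ones.\<close>

lemma gamma_span_2_cancel:
  assumes "finite B" "B \<subseteq> {1..}" "2 * a \<in> gamma_span B"
  shows "a \<in> gamma_span B"
  using assms
proof (induction B arbitrary: a)
  case empty
  then show ?case by (simp add: gamma_span_def)
next
  case (insert q B)
  define g where "g = (\<lambda>p. \<Sum>i = 1..p. (-1) ^ i * cpoly (int p + int i) * cpoly (int p - int i))"
  have g: "gamma_rel p = csq p + 2 * g p" if "p \<ge> 1" for p
    using that by (simp add: gamma_rel_def g_def cpoly_def nat_diff_distrib)
  obtain k where k: "2 * a = (\<Sum>p\<in>insert q B. k p * gamma_rel p)" using insert by (auto simp: gamma_span_def)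
  then have k: "2 * a = k q * gamma_rel q + (\<Sum>p\<in>B. k p * gamma_rel p)" using insert by simp
  have sB: "(\<Sum>p\<in>B. l p * gamma_rel p) = (\<Sum>p\<in>B. l p * csq p) + 2 * (\<Sum>p\<in>B. l p * g p)" for l
  proof -
    have "(\<Sum>p\<in>B. l p * gamma_rel p) = (\<Sum>p\<in>B. l p * csq p + 2 * (l p * g p))"
    proof (intro sum.cong refl)
      fix p assume "p \<in> B"
      then have "p \<ge> 1" using insert.prems by auto
      then show "l p * gamma_rel p = l p * csq p + 2 * (l p * g p)" by (simp only: g) (simp add: algebra_simps)
    qed
    then show ?thesis by (simp only: sum.distrib sum_distrib_left)
  qed
  \<comment> \<open>Modulo \<open>2\<close> and the squares from \<open>B\<close> the given relation
    reads \<open>k q * csq q = 0\<close>.\<close>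
  have "k q * csq q = 2 * a - 2 * (k q * g q) - (\<Sum>p\<in>B. k p * gamma_rel p)"
    using k insert.prems by (simp add: g algebra_simps)
  also have "\<dots> = 2 * (a - k q * g q - (\<Sum>p\<in>B. k p * g p)) + (\<Sum>p\<in>B. - k p * csq p)"
    by (simp only: sB) (simp add: algebra_simps sum_negf)
  finally have kqm: "k q * csq q \<in> sq_span B" by (rule sq_spanI)
  have "k q \<in> sq_span B"
    by (rule sq_span_cancel[OF _ _ _ _ kqm]) (use insert.hyps insert.prems in auto)
  then obtain e l where "k q = 2 * e + (\<Sum>p\<in>B. l p * csq p)" unfolding sq_span_def by blast
  then have kq: "k q = 2 * (e - (\<Sum>p\<in>B. l p * g p)) + (\<Sum>p\<in>B. l p * gamma_rel p)"
    by (simp only: sB) (simp add: right_diff_distrib)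
  let ?e = "e - (\<Sum>p\<in>B. l p * g p)"
  have eq: "(2 * e' + L) * r + K - 2 * (e' * r) = L * r + K" for e' L r K :: "(nat \<Rightarrow>\<^sub>0 nat) \<Rightarrow>\<^sub>0 int"
    by (simp add: distrib_right mult.assoc)
  \<comment> \<open>Subtracting \<open>2 * ?e * gamma_rel q\<close> leaves a combination of the
    relations from \<open>B\<close> alone, to which the induction hypothesis applies.\<close>
  have "2 * (a - ?e * gamma_rel q) = (\<Sum>p\<in>B. l p * gamma_rel p) * gamma_rel q + (\<Sum>p\<in>B. k p * gamma_rel p)"
    unfolding right_diff_distrib[of 2] k by (subst kq) (rule eq)
  also have "\<dots> = (\<Sum>p\<in>B. (l p * gamma_rel q + k p) * gamma_rel p)"
    by (simp add: algebra_simps sum.distrib sum_distrib_left)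
  finally have "2 * (a - ?e * gamma_rel q) \<in> gamma_span B" by (rule gamma_spanI)
  then have "a - ?e * gamma_rel q \<in> gamma_span B" using insert.IH insert.prems by blast
  then have "(a - ?e * gamma_rel q) + ?e * gamma_rel q \<in> gamma_span (insert q B)"
    using insert.hyps by (intro gamma_span_add gamma_span_single) (auto intro: gamma_span_mono)
  then show ?case by simp
qed

lemma abs_gam_eq_0_iff: "abs_gam q = 0 \<longleftrightarrow> q \<in> gamma_ideal"
  unfolding zero_gam_def gam.abs_eq_iff by simp

lemma gam_2_cancel:
  assumes "2 * (a :: gam) = 0" shows "a = 0"
proof -
  obtain q where q: "a = abs_gam q" by (metis Quotient3_abs_rep[OF Quotient3_gam])
  have "abs_gam (2 * q) = 0" using assms by (simp add: q is_ring_homD[OF abs_gam_hom])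
  then have "2 * q \<in> gamma_ideal" by (simp add: abs_gam_eq_0_iff)
  then obtain B where "finite B" "B \<subseteq> {1..}" "2 * q \<in> gamma_span B" using gamma_ideal_span by blast
  then have "q \<in> gamma_ideal" using gamma_span_2_cancel gamma_span_ideal by blast
  then show ?thesis by (simp add: q abs_gam_eq_0_iff)
qed

lemma gam_2_power_cancel: "2 ^ k * (a :: gam) = 0 \<Longrightarrow> a = 0"
  by (induction k) (auto simp: mult.assoc dest!: gam_2_cancel)

lemma gam_induct [case_names c add mult one uminus]:
  assumes c: "\<And>p. p \<ge> 1 \<Longrightarrow> P (gam_c (int p))"
    and a: "\<And>p q. P p \<Longrightarrow> P q \<Longrightarrow> P (p + q)" and m: "\<And>p q. P p \<Longrightarrow> P q \<Longrightarrow> P (p * q)"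
    and o: "P 1" and u: "\<And>p. P p \<Longrightarrow> P (- p)"
  shows "P (g :: gam)"
proof -
  note h = is_ring_homD[OF abs_gam_hom]
  obtain q where q: "g = abs_gam q" by (metis Quotient3_abs_rep[OF Quotient3_gam])
  have "P (abs_gam q)"
  proof (induction q rule: mpoly_induct)
    case (const n)
    have n: "P (of_nat k)" for k
      using a[OF o u[OF o]] by (induction k) (auto intro: a o)
    have "(pconst n :: (nat \<Rightarrow>\<^sub>0 nat) \<Rightarrow>\<^sub>0 int) = of_int n"
      using is_ring_hom_of_int_eq[OF is_ring_hom_pconst[where ?'a = int and ?'b = nat], of n] by simp
    then have "abs_gam (pconst n) = of_int n"
      using is_ring_hom_of_int_eq[OF abs_gam_hom, of n] by simp
    moreover have "P (of_int n)" by (cases n rule: int_cases2) (auto intro: n u)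
    ultimately show ?case by simp
  next
    case (var v)
    have "pvar v = cpoly (int (Suc v))" by (simp add: cpoly_def nat_add_distrib)
    then show ?case using c[of "Suc v"] by (simp add: gam_c_def)
  qed (auto simp: h intro: a m)
  then show ?thesis by (simp add: q)
qed

section \<open>Embedding of \<Gamma> into a rational polynomial ring\<close>

type_synonym qpoly = "(nat \<Rightarrow>\<^sub>0 nat) \<Rightarrow>\<^sub>0 rat"

text \<open>Over the rationals the relations solve for the \<open>c\<close> with even index.\<close>

function codd :: "nat \<Rightarrow> qpoly" where
  "codd n = (if n = 0 then 1 else if odd n then pvar (n - 1) else
     (let p = n div 2 in pconst (-(1/2)) * (-1) ^ p *
       (codd p ^ 2 + 2 * (\<Sum>i\<in>{1..<p}. (-1) ^ i * codd (p + i) * codd (p - i)))))"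
  by auto
termination
  by (relation "measure id") (auto elim!: oddE evenE)

declare codd.simps [simp del]

text \<open>The summand \<open>i = p\<close> of relation \<open>p\<close> is
  \<open>(-1)^p c_(2p) c_0\<close>, so the relation is the equation that was solved for
  \<open>codd (2 * p)\<close>.\<close>

lemma codd_relations: "gamma_relations codd"
  unfolding gamma_relations_def
proof (intro conjI allI impI)
  show "codd 0 = 1" by (simp add: codd.simps)
  fix p :: nat assume p: "p \<ge> 1"
  let ?s = "codd p ^ 2 + 2 * (\<Sum>i\<in>{1..<p}. (-1) ^ i * codd (p + i) * codd (p - i))"
  have "(2 :: qpoly) = pconst 2"
    using is_ring_hom_numeral[OF is_ring_hom_pconst, of "num.Bit0 num.One"] by metis
  then have 2: "2 * (pconst (-(1/2)) :: qpoly) = -1"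
    using is_ring_homD(1,3,5)[OF is_ring_hom_pconst[where ?'a = rat and ?'b = nat]]
    by (metis mult_minus_right nonzero_mult_div_cancel_left times_divide_eq_right zero_neq_numeral mult.right_neutral)
  have "codd (2 * p) = pconst (-(1/2)) * (-1) ^ p * ?s"
    using p by (subst codd.simps) (simp add: Let_def)
  then have "2 * ((-1) ^ p * codd (2 * p)) = (2 * pconst (-(1/2))) * ((-1) ^ p * (-1) ^ p) * ?s"
    by (simp only: mult_ac)
  also have "\<dots> = - ?s" unfolding 2 by (simp flip: power_add)
  finally have *: "2 * ((-1) ^ p * codd (2 * p)) + ?s = 0" by simp
  have "{1..p} = insert p {1..<p}" using p by auto
  moreover have "codd 0 = 1" by (simp add: codd.simps)
  ultimately have "(\<Sum>i = 1..p. (-1) ^ i * codd (p + i) * codd (p - i)) =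
      (-1) ^ p * codd (2 * p) + (\<Sum>i\<in>{1..<p}. (-1) ^ i * codd (p + i) * codd (p - i))"
    by (simp add: mult_2)
  then show "codd p ^ 2 + 2 * (\<Sum>i = 1..p. (-1) ^ i * codd (p + i) * codd (p - i)) = 0"
    using * by (simp only: distrib_left add_ac)
qed

text \<open>Variable \<open>v\<close> stands for \<open>c_(v+1)\<close>, so even \<open>v\<close>
  means the generators with odd index.\<close>

definition even_vars :: "((nat \<Rightarrow>\<^sub>0 nat) \<Rightarrow>\<^sub>0 int) set" where
  "even_vars = {b. \<forall>t\<in>Poly_Mapping.keys b. \<forall>v\<in>Poly_Mapping.keys t. even v}"

lemma even_vars_add: "a \<in> even_vars \<Longrightarrow> b \<in> even_vars \<Longrightarrow> a + b \<in> even_vars"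
  unfolding even_vars_def using keys_add[of a b] by blast

lemma even_vars_mult: "a \<in> even_vars \<Longrightarrow> b \<in> even_vars \<Longrightarrow> a * b \<in> even_vars"
  unfolding even_vars_def
proof (intro CollectI ballI)
  fix t v assume *: "a \<in> {b. \<forall>t\<in>Poly_Mapping.keys b. \<forall>v\<in>Poly_Mapping.keys t. even v}"
    "b \<in> {b. \<forall>t\<in>Poly_Mapping.keys b. \<forall>v\<in>Poly_Mapping.keys t. even v}"
    "t \<in> Poly_Mapping.keys (a * b)" "v \<in> Poly_Mapping.keys t"
  then obtain s u where "t = s + u" "s \<in> Poly_Mapping.keys a" "u \<in> Poly_Mapping.keys b"
    using keys_mult[of a b] by blast
  with * show "even v" using keys_add[of s u] by blast
qed

lemma even_vars_uminus: "a \<in> even_vars \<Longrightarrow> - a \<in> even_vars"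
  unfolding even_vars_def by simp

lemma even_vars_one: "1 \<in> even_vars"
  unfolding even_vars_def by (auto simp: one_poly_mapping.rep_eq in_keys_iff when_def)

lemma even_vars_2_power: "2 ^ k \<in> even_vars"
proof (induction k)
  case (Suc k)
  have "2 ^ Suc k = (2 ^ k + 2 ^ k :: (nat \<Rightarrow>\<^sub>0 nat) \<Rightarrow>\<^sub>0 int)" by simp
  then show ?case using Suc even_vars_add by metis
qed (simp add: even_vars_one)

definition almost_odd :: "gam \<Rightarrow> bool" where
  "almost_odd a \<longleftrightarrow> (\<exists>k b. b \<in> even_vars \<and> 2 ^ k * a = abs_gam b)"

lemma almost_odd_2: "almost_odd (2 * a) \<Longrightarrow> almost_odd a"
  unfolding almost_odd_def by (metis mult.assoc mult.commute power_Suc)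

lemma almost_odd_mult: "almost_odd a \<Longrightarrow> almost_odd b \<Longrightarrow> almost_odd (a * b)"
  unfolding almost_odd_def
proof (elim exE conjE)
  fix k c l d assume "c \<in> even_vars" "2 ^ k * a = abs_gam c" "d \<in> even_vars" "2 ^ l * b = abs_gam d"
  moreover then have "2 ^ (k + l) * (a * b) = abs_gam (c * d)"
    by (simp only: is_ring_homD[OF abs_gam_hom] power_add) (metis mult.assoc mult.left_commute)
  ultimately show "\<exists>k e. e \<in> even_vars \<and> 2 ^ k * (a * b) = abs_gam e" using even_vars_mult by blast
qed

lemma almost_odd_add: "almost_odd a \<Longrightarrow> almost_odd b \<Longrightarrow> almost_odd (a + b)"
  unfolding almost_odd_def
proof (elim exE conjE)
  fix k c l d assume *: "c \<in> even_vars" "2 ^ k * a = abs_gam c" "d \<in> even_vars" "2 ^ l * b = abs_gam d"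
  have "2 ^ (k + l) * (a + b) = 2 ^ l * (2 ^ k * a) + 2 ^ k * (2 ^ l * b)"
    by (simp add: power_add algebra_simps)
  also have "\<dots> = abs_gam (2 ^ l * c + 2 ^ k * d)"
    by (simp add: is_ring_homD[OF abs_gam_hom] *)
  finally show "\<exists>k e. e \<in> even_vars \<and> 2 ^ k * (a + b) = abs_gam e"
    using * even_vars_mult even_vars_add even_vars_2_power by meson
qed

lemma almost_odd_uminus: "almost_odd a \<Longrightarrow> almost_odd (- a)"
  unfolding almost_odd_def using even_vars_uminus is_ring_homD(5)[OF abs_gam_hom] by fastforce

lemma almost_odd_one: "almost_odd 1"
  unfolding almost_odd_def using even_vars_one
  by (intro exI[of _ 0] exI[of _ 1]) (simp add: is_ring_homD[OF abs_gam_hom])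

lemma almost_odd_sum: "(\<And>i. i \<in> A \<Longrightarrow> almost_odd (f i)) \<Longrightarrow> almost_odd (sum f A)"
  using almost_odd_add[OF almost_odd_one almost_odd_uminus[OF almost_odd_one]]
  by (induction A rule: infinite_finite_induct) (auto intro: almost_odd_add)

text \<open>Relation \<open>p\<close> expresses \<open>2 c_(2p)\<close> through generators of
  smaller index; induction eliminates those with even index at the cost of a power of
  \<open>2\<close>.\<close>

lemma almost_odd_c: "almost_odd (gam_c (int n))"
proof (induction n rule: less_induct)
  case (less n)
  show ?case
  proof (cases "n = 0 \<or> odd n")
    case True
    then show ?thesis
    proof
      assume "n = 0"
      then show ?thesis using almost_odd_one by (simp add: gam_c_nonpos)
    next
      assume "odd n"
      then have "cpoly (int n) \<in> even_vars"
        by (auto simp: cpoly_def pvar_def even_vars_def elim!: oddE)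
      then show ?thesis unfolding almost_odd_def gam_c_def by (intro exI[of _ 0] exI[of _ "cpoly (int n)"]) auto
    qed
  next
    case False
    then obtain p where p: "n = 2 * p" "p \<ge> 1" by (auto elim!: evenE)
    let ?t = "\<lambda>i. (-1) ^ i * gam_c (int (p + i)) * gam_c (int (p - i))"
    have rel: "gam_c (int p) ^ 2 + 2 * (\<Sum>i = 1..p. ?t i) = 0"
      using gam_c_relations p unfolding gamma_relations_def by blast
    have "{1..p} = insert p {1..<p}" using p by auto
    then have "(\<Sum>i = 1..p. ?t i) = ?t p + (\<Sum>i = 1..<p. ?t i)" by simp
    moreover have "p + p = n" using p by simp
    ultimately have split: "(\<Sum>i = 1..p. ?t i) = (\<Sum>i = 1..<p. ?t i) + (-1) ^ p * gam_c (int n)"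
      by (simp only: gam_c_nonpos diff_self_eq_0 of_nat_0 mult_1_right add.commute)
    have *: "2 * c = - (a + 2 * b)" if "a + 2 * (b + c) = 0" for a b c :: gam
      using that by (metis add.assoc add.commute distrib_left eq_neg_iff_add_eq_0)
    have "2 * ((-1) ^ p * gam_c (int n)) = - (gam_c (int p) ^ 2 + 2 * (\<Sum>i = 1..<p. ?t i))"
      by (rule *[OF rel[unfolded split]])
    moreover have s: "almost_odd ((-1) ^ i)" for i
      by (induction i) (auto intro: almost_odd_one almost_odd_uminus)
    then have "almost_odd (- (gam_c (int p) ^ 2 + 2 * (\<Sum>i = 1..<p. ?t i)))"
      unfolding power2_eq_square mult_2 using p
      by (intro almost_odd_uminus almost_odd_add almost_odd_mult almost_odd_sum less) auto
    ultimately have "almost_odd ((-1) ^ p * gam_c (int n))" using almost_odd_2 by metis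
    then have "almost_odd ((-1) ^ p * ((-1) ^ p * gam_c (int n)))" using s almost_odd_mult by blast
    then show ?thesis by (simp flip: mult.assoc power_add)
  qed
qed

lemma almost_odd: "almost_odd a"
  by (induction a rule: gam_induct)
     (auto intro: almost_odd_c almost_odd_add almost_odd_mult almost_odd_one almost_odd_uminus)

definition gam_embed :: "gam \<Rightarrow> qpoly" where "gam_embed = gam_lift codd"

lemma gam_embed_hom: "is_ring_hom gam_embed"
  unfolding gam_embed_def by (rule is_ring_hom_gam_lift[OF codd_relations])

text \<open>A multiple of \<open>a\<close> by a power of \<open>2\<close> is represented by a
  polynomial in the generators with odd index, which \<open>codd\<close> sends to themselves. That
  polynomial vanishes, and the power of \<open>2\<close> can be cancelled.\<close>

lemma gam_embed_eq_0: assumes "gam_embed a = 0" shows "a = 0"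
proof -
  obtain k b where b: "b \<in> even_vars" "2 ^ k * a = abs_gam b"
    using almost_odd[of a] unfolding almost_odd_def by blast
  have v: "meval (\<lambda>i. codd (Suc i)) t = Poly_Mapping.single t 1" if "t \<in> Poly_Mapping.keys b" for t
  proof -
    have "meval (\<lambda>i. codd (Suc i)) t = meval pvar t"
      unfolding meval_def using that b(1)
      by (intro prod.cong) (auto simp: even_vars_def codd.simps)
    then show ?thesis by (simp add: meval_pvar)
  qed
  have of: "(of_int n :: qpoly) = Poly_Mapping.single 0 (of_int n)" for n
    using is_ring_hom_of_int_eq[OF is_ring_hom_pconst[where ?'a = rat and ?'b = nat], of n] by (simp add: pconst_def)
  have "gam_embed (2 ^ k * a) = 0" using assms by (simp only: is_ring_homD[OF gam_embed_hom] mult_zero_right)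
  then have "peval of_int (\<lambda>i. codd (Suc i)) b = 0"
    by (simp only: b(2) gam_embed_def gam_lift_abs[OF codd_relations])
  moreover have "peval of_int (\<lambda>i. codd (Suc i)) b =
      (\<Sum>t\<in>Poly_Mapping.keys b. Poly_Mapping.single t (of_int (Poly_Mapping.lookup b t)))"
    unfolding peval_def
    by (intro sum.cong refl) (simp only: v of mult_single mult_1_right add_0_left)
  ultimately have s: "(\<Sum>t\<in>Poly_Mapping.keys b. Poly_Mapping.single t (of_int (Poly_Mapping.lookup b t) :: rat)) = 0"
    by simp
  have "Poly_Mapping.lookup b t = 0" for t
    using arg_cong[OF s, of "\<lambda>p. Poly_Mapping.lookup p t"]
    by (auto simp: lookup_sum lookup_single when_def in_keys_iff split: if_splits)
  then have "b = 0" by (intro poly_mapping_eqI) simp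
  then have "2 ^ k * a = 0" using b(2) by (simp add: is_ring_homD[OF abs_gam_hom])
  then show ?thesis by (rule gam_2_power_cancel)
qed

instance gam :: idom
proof
  fix a b :: gam assume "a \<noteq> 0" "b \<noteq> 0"
  then have "gam_embed a \<noteq> 0" "gam_embed b \<noteq> 0" using gam_embed_eq_0 by auto
  then have "gam_embed (a * b) \<noteq> 0" by (simp add: is_ring_homD[OF gam_embed_hom])
  then show "a * b \<noteq> 0" using is_ring_homD(4)[OF gam_embed_hom] by metis
qed

instance gam :: ring_char_0
proof
  have "(of_nat m :: gam) \<noteq> of_nat n" if "m \<noteq> n" for m n
    using that is_ring_hom_of_nat_eq[OF gam_embed_hom] by (metis of_nat_eq_iff)
  then show "inj (of_nat :: nat \<Rightarrow> gam)" by (auto simp: inj_on_def)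
qed

text \<open>Any linear order on the variables would do: it makes the monomials linearly ordered,
  from which \<Gamma>\<open>[X,Y]\<close> inherits that it has no zero divisors.\<close>

instantiation var :: linorder
begin

definition var_code :: "var \<Rightarrow> nat \<times> nat" where
  "var_code v = (case v of VX i \<Rightarrow> (0, i) | VY i \<Rightarrow> (1, i))"

definition less_eq_var :: "var \<Rightarrow> var \<Rightarrow> bool" where
  "less_eq_var u v \<longleftrightarrow> fst (var_code u) < fst (var_code v) \<or>
     fst (var_code u) = fst (var_code v) \<and> snd (var_code u) \<le> snd (var_code v)"

definition less_var :: "var \<Rightarrow> var \<Rightarrow> bool" where
  "less_var u v \<longleftrightarrow> u \<le> v \<and> \<not> v \<le> u"

instance
  by standard (auto simp: less_eq_var_def less_var_def var_code_def split: var.splits)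

end

section \<open>The action of the simple reflections\<close>

lemma gxy_induct [case_names c x y add mult one uminus]:
  assumes c: "\<And>p. p \<ge> 1 \<Longrightarrow> P (cg (int p))" and x: "\<And>j. j \<ge> 1 \<Longrightarrow> P (xg j)" and y: "\<And>j. j \<ge> 1 \<Longrightarrow> P (yg j)"
    and a: "\<And>p q. P p \<Longrightarrow> P q \<Longrightarrow> P (p + q)" and m: "\<And>p q. P p \<Longrightarrow> P q \<Longrightarrow> P (p * q)"
    and o: "P 1" and u: "\<And>p. P p \<Longrightarrow> P (- p)"
  shows "P (g :: gxy)"
proof (induction g rule: mpoly_induct)
  case (const g)
  note h = is_ring_homD[OF is_ring_hom_pconst[where ?'a = gam and ?'b = var]]
  show ?case
    by (induction g rule: gam_induct) (auto simp: h intro: a m o u c[unfolded cg_def])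
next
  case (var v)
  show ?case
  proof (cases v)
    case (VX j)
    then show ?thesis using x[of "Suc j"] by (simp add: xg_def)
  next
    case (VY j)
    then show ?thesis using y[of "Suc j"] by (simp add: yg_def)
  qed
qed (auto intro: a m)

definition fmap :: "('a \<Rightarrow> 'b) \<Rightarrow> 'a fps \<Rightarrow> 'b fps" where
  "fmap h F = Abs_fps (\<lambda>n. h (fps_nth F n))"

lemma fmap_nth [simp]: "fps_nth (fmap h F) n = h (fps_nth F n)"
  by (simp add: fmap_def)

lemma is_ring_hom_fmap: "is_ring_hom h \<Longrightarrow> is_ring_hom (fmap h)"
  unfolding is_ring_hom_def[of "fmap h"]
  by (auto simp: fps_eq_iff fps_mult_nth is_ring_homD)

lemma fmap_X: "is_ring_hom h \<Longrightarrow> fmap h fps_X = fps_X"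
  by (auto simp: fps_eq_iff fps_X_def is_ring_homD)

lemma fmap_const: "is_ring_hom h \<Longrightarrow> fmap h (fps_const a) = fps_const (h a)"
  by (auto simp: fps_eq_iff is_ring_homD)

definition cfps :: "gxy fps" where "cfps = Abs_fps (\<lambda>p. cg (int p))"

text \<open>The images of all \<open>c_p\<close> are compared at once through \<open>c(t)\<close>,
  on which \<open>s_0\<close> acts by a single factor; the relations of the Weyl group become
  identities between factors \<open>kfps\<close>.\<close>

lemma gxy_hom_eqI:
  assumes h: "is_ring_hom h" and k: "is_ring_hom k"
    and c: "fmap h cfps = fmap k cfps"
    and x: "\<And>j. j \<ge> 1 \<Longrightarrow> h (xg j) = k (xg j)" and y: "\<And>j. j \<ge> 1 \<Longrightarrow> h (yg j) = k (yg j)"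
  shows "h (f :: gxy) = k f"
proof (induction f rule: gxy_induct)
  case (c p)
  then show ?case using arg_cong[OF assms(3), of "\<lambda>F. fps_nth F p"] by (simp add: cfps_def)
qed (use x y in \<open>auto simp: is_ring_homD[OF h] is_ring_homD[OF k]\<close>)

text \<open>The power series \<open>(1 + a t) / (1 - a t)\<close>.\<close>

definition kfps :: "'a::comm_ring_1 \<Rightarrow> 'a fps" where
  "kfps a = Abs_fps (\<lambda>n. if n = 0 then 1 else 2 * a ^ n)"

lemma kfps_mult: "(1 - fps_const a * fps_X) * kfps a = 1 + fps_const a * fps_X"
proof (rule fps_ext)
  fix n
  show "fps_nth ((1 - fps_const a * fps_X) * kfps a) n = fps_nth (1 + fps_const a * fps_X) n"
    by (cases n; cases "n - 1") (simp_all add: kfps_def algebra_simps fps_X_mult_nth mult.assoc)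
qed

lemma fps_linear_nonzero: "1 - fps_const a * fps_X \<noteq> (0 :: gxy fps)" "1 + fps_const a * fps_X \<noteq> (0 :: gxy fps)"
  by (auto simp: fps_eq_iff intro!: exI[of _ 0])

lemma kfps_uminus: "kfps a * kfps (- a) = (1 :: gxy fps)"
proof -
  define A where "A = fps_const a * fps_X"
  have k: "(1 - A) * kfps a = 1 + A" unfolding A_def by (rule kfps_mult)
  have m: "(1 + A) * kfps (- a) = 1 - A"
    using kfps_mult[of "- a"] by (simp add: A_def flip: fps_const_neg)
  have "((1 - A) * (1 + A)) * (kfps a * kfps (- a)) = ((1 - A) * kfps a) * ((1 + A) * kfps (- a))"
    by (simp only: mult_ac)
  also have "\<dots> = ((1 - A) * (1 + A)) * 1" unfolding k m by (simp only: mult_ac mult_1_left)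
  finally show ?thesis
    using fps_linear_nonzero[of a] by (subst (asm) mult_left_cancel) (auto simp: A_def)
qed

lemma kfps_cancel:
  "kfps a * (kfps (- a) * F) = (F :: gxy fps)" "kfps (- a) * (kfps a * F) = (F :: gxy fps)"
  using kfps_uminus[of a] by (metis mult.assoc mult.commute mult_1_left)+

lemma fmap_kfps: "is_ring_hom h \<Longrightarrow> fmap h (kfps a) = kfps (h a)"
  by (auto simp: fps_eq_iff kfps_def is_ring_homD)

lemma weyl_hom: "is_ring_hom (weyl_act i)"
  using weyl_act_0(1) weyl_act_pos(1)[of i] by (cases "i = 0") auto

lemmas weyl_simps = is_ring_homD[OF weyl_hom]

lemma weyl_c_pos: "i \<ge> 1 \<Longrightarrow> weyl_act i (cg p) = cg p"
  using weyl_act_pos(2)[of i "nat p"] by (cases "p < 0") (simp_all add: cg_nonpos weyl_simps)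

text \<open>The given formula for \<open>s_0(c_p)\<close> is the coefficient of \<open>t^p\<close>
  in \<open>c(t) (1 + x_1 t) / (1 - x_1 t)\<close>.\<close>

lemma weyl_cfps: "fmap (weyl_act i) cfps = (if i = 0 then kfps (xg 1) * cfps else cfps)"
proof (cases "i = 0")
  case True
  have "weyl_act 0 (cg (int n)) = fps_nth (kfps (xg 1) * cfps) n" for n
  proof -
    have "fps_nth (kfps (xg 1) * cfps) n = (\<Sum>j=0..n. (if j = 0 then 1 else 2 * xg 1 ^ j) * cg (int (n - j)))"
      by (simp add: kfps_def cfps_def fps_mult_nth del: One_nat_def)
    also have "\<dots> = cg (int n) + (\<Sum>j=1..n. 2 * xg 1 ^ j * cg (int n - int j))"
      by (subst sum.atLeast_Suc_atMost) (auto simp: of_nat_diff intro!: sum.cong)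
    finally show ?thesis unfolding weyl_act_0(2) by (simp add: sum_distrib_left mult.assoc)
  qed
  then show ?thesis using True by (auto simp: fps_eq_iff) (simp add: cfps_def)
qed (auto simp: fps_eq_iff cfps_def weyl_c_pos)

lemma weyl_x: "j \<ge> 1 \<Longrightarrow> weyl_act i (xg j) =
    (if i = 0 then if j = 1 then - xg 1 else xg j else xg (transpose i (i + 1) j))"
  using weyl_act_0(3) weyl_act_0(4)[of j] weyl_act_pos(3)[of i j] by auto

lemma weyl_y: "j \<ge> 1 \<Longrightarrow> weyl_act i (yg j) = yg j"
  using weyl_act_0(5) weyl_act_pos(4)[of i] by (cases "i = 0") auto

lemma fmap_comp: "fmap (\<lambda>a. g (h a)) F = fmap g (fmap h F)"
  by (simp add: fps_eq_iff)

lemmas fmap_weyl_comp = fmap_comp[of "weyl_act i" "weyl_act j" for i j]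
  fmap_comp[of "weyl_act i" "\<lambda>a. weyl_act j (weyl_act k a)" for i j k]
  fmap_comp[of "weyl_act i" "\<lambda>a. weyl_act j (weyl_act k (weyl_act l a))" for i j k l]

lemma transpose_ge_1: "i \<ge> 1 \<Longrightarrow> j \<ge> 1 \<Longrightarrow> Suc 0 \<le> transpose i (Suc i) j"
  by (auto simp: transpose_def)

lemma weyl_cfps_0: "fmap (weyl_act 0) cfps = kfps (xg 1) * cfps"
  and weyl_cfps_pos: "i \<noteq> 0 \<Longrightarrow> fmap (weyl_act i) cfps = cfps"
  by (simp_all add: weyl_cfps)

lemma weyl_x1: "weyl_act 0 (xg 1) = - xg 1" "weyl_act 1 (xg 1) = xg 2" "weyl_act 0 (xg 2) = xg 2"
  "weyl_act 1 (xg 2) = xg 1"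
  by (simp_all add: weyl_x transpose_def numeral_2_eq_2)

lemmas weyl_c_simps = weyl_cfps_0 weyl_cfps_pos[OF one_neq_zero] is_ring_homD(3)[OF is_ring_hom_fmap[OF weyl_hom]]
  fmap_kfps[OF weyl_hom] kfps_cancel weyl_x1 is_ring_homD(5)[OF weyl_hom]

lemmas weyl_gen = weyl_x weyl_y is_ring_homD(5)[OF weyl_hom]

lemmas hom_intros = weyl_hom is_ring_hom_id is_ring_hom_comp[OF weyl_hom]

lemma weyl_weyl: "weyl_act i (weyl_act i f) = f"
proof (rule gxy_hom_eqI[of _ "\<lambda>f. f"])
  have id: "fmap (\<lambda>f. f) F = F" for F :: "gxy fps" by (simp add: fps_eq_iff)
  show "fmap (\<lambda>a. weyl_act i (weyl_act i a)) cfps = fmap (\<lambda>f. f) cfps"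
    unfolding fmap_weyl_comp id by (cases "i = 0") (simp_all only: weyl_c_simps weyl_cfps_pos not_False_eq_True)
qed (auto simp: weyl_gen is_ring_hom_id transpose_ge_1 intro!: hom_intros)

lemma weyl_commute:
  assumes "i + 1 < j"
  shows "weyl_act i (weyl_act j f) = weyl_act j (weyl_act i f)"
proof (rule gxy_hom_eqI[of "\<lambda>a. weyl_act i (weyl_act j a)" "\<lambda>a. weyl_act j (weyl_act i a)"])
  show "fmap (\<lambda>a. weyl_act i (weyl_act j a)) cfps = fmap (\<lambda>a. weyl_act j (weyl_act i a)) cfps"
    using assms by (cases "i = 0")
      (simp_all add: fmap_weyl_comp weyl_c_simps weyl_cfps_pos weyl_x del: One_nat_def)
next
  fix l :: nat assume "l \<ge> 1"
  then show "weyl_act i (weyl_act j (xg l)) = weyl_act j (weyl_act i (xg l))"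
    using assms by (cases "i = 0") (auto simp: weyl_gen transpose_def)
qed (auto simp: weyl_gen intro!: hom_intros)

lemma weyl_braid3:
  assumes "i \<ge> 1"
  shows "weyl_act i (weyl_act (i + 1) (weyl_act i f)) = weyl_act (i + 1) (weyl_act i (weyl_act (i + 1) f))"
proof (rule gxy_hom_eqI[of "\<lambda>a. weyl_act i (weyl_act (i + 1) (weyl_act i a))" "\<lambda>a. weyl_act (i + 1) (weyl_act i (weyl_act (i + 1) a))"])
  show "fmap (\<lambda>a. weyl_act i (weyl_act (i + 1) (weyl_act i a))) cfps =
      fmap (\<lambda>a. weyl_act (i + 1) (weyl_act i (weyl_act (i + 1) a))) cfps"
    using assms by (simp add: fmap_weyl_comp weyl_cfps_pos)
next
  fix l :: nat assume "l \<ge> 1"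
  then show "weyl_act i (weyl_act (i + 1) (weyl_act i (xg l))) =
      weyl_act (i + 1) (weyl_act i (weyl_act (i + 1) (xg l)))"
    using assms by (auto simp: weyl_gen transpose_def)
qed (auto simp: weyl_gen intro!: hom_intros)

lemma weyl_braid4:
  "weyl_act 0 (weyl_act 1 (weyl_act 0 (weyl_act 1 f))) = weyl_act 1 (weyl_act 0 (weyl_act 1 (weyl_act 0 f)))"
proof (rule gxy_hom_eqI[of "\<lambda>a. weyl_act 0 (weyl_act 1 (weyl_act 0 (weyl_act 1 a)))" "\<lambda>a. weyl_act 1 (weyl_act 0 (weyl_act 1 (weyl_act 0 a)))"])
  show "fmap (\<lambda>a. weyl_act 0 (weyl_act 1 (weyl_act 0 (weyl_act 1 a)))) cfps =
      fmap (\<lambda>a. weyl_act 1 (weyl_act 0 (weyl_act 1 (weyl_act 0 a)))) cfps"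
    by (simp only: fmap_weyl_comp weyl_c_simps mult_ac)
next
  fix l :: nat assume "l \<ge> 1"
  then show "weyl_act 0 (weyl_act 1 (weyl_act 0 (weyl_act 1 (xg l)))) =
      weyl_act 1 (weyl_act 0 (weyl_act 1 (weyl_act 0 (xg l))))"
    by (auto simp: weyl_gen transpose_def)
qed (auto simp: weyl_gen intro!: hom_intros)

section \<open>The action on the variables \<open>y\<close>\<close>

lemmas omega_simps = is_ring_homD[OF omega(1)]

lemma omega_c: "omega (cg p) = cg p"
  using omega(2)[of "nat p"] by (cases "p < 0") (simp_all add: cg_nonpos omega_simps)

lemma omega_cfps: "fmap omega cfps = cfps"
  by (simp add: fps_eq_iff cfps_def omega_c)

lemma omega_omega: "omega (omega f) = f"
  by (rule gxy_hom_eqI[of _ "\<lambda>f. f"])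
     (auto simp: is_ring_hom_id omega omega_simps fmap_comp[of omega omega] omega_cfps is_ring_hom_comp[OF omega(1) omega(1)],
       simp add: fps_eq_iff)

definition weyl_y_act :: "nat \<Rightarrow> gxy \<Rightarrow> gxy" where
  "weyl_y_act i f = omega (weyl_act i (omega f))"

lemma weyl_y_hom: "is_ring_hom (weyl_y_act i)"
proof -
  have "weyl_y_act i = (\<lambda>f. omega (weyl_act i (omega f)))" by (intro ext) (rule weyl_y_act_def)
  then show ?thesis using is_ring_hom_comp[OF omega(1) is_ring_hom_comp[OF weyl_hom omega(1)]] by simp
qed

lemmas hom_y_intros = hom_intros is_ring_hom_comp[OF weyl_y_hom] weyl_y_hom

lemma weyl_y_act_x: "j \<ge> 1 \<Longrightarrow> weyl_y_act i (xg j) = xg j"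
  by (simp add: weyl_y_act_def omega omega_simps weyl_y weyl_simps)

lemma weyl_y_act_y: "j \<ge> 1 \<Longrightarrow> weyl_y_act i (yg j) =
    (if i = 0 then if j = 1 then - yg 1 else yg j else yg (transpose i (i + 1) j))"
  by (auto simp: weyl_y_act_def omega omega_simps weyl_x weyl_simps transpose_ge_1)

lemma weyl_y_cfps: "fmap (weyl_y_act i) cfps = (if i = 0 then kfps (- yg 1) * cfps else cfps)"
proof -
  have "fmap (weyl_y_act i) cfps = fmap omega (fmap (weyl_act i) (fmap omega cfps))"
    by (simp add: fps_eq_iff weyl_y_act_def)
  then show ?thesis
    by (simp add: omega_cfps weyl_cfps is_ring_homD[OF is_ring_hom_fmap[OF omega(1)]] fmap_kfps[OF omega(1)] omega)
qed

text \<open>On \<open>c(t)\<close> the two actions multiply by series in \<open>x_1\<close> and in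
  \<open>y_1\<close>, each fixed by the other action.\<close>

lemma weyl_weyl_y_commute: "weyl_act i (weyl_y_act j f) = weyl_y_act j (weyl_act i f)"
proof (rule gxy_hom_eqI[of "\<lambda>a. weyl_act i (weyl_y_act j a)" "\<lambda>a. weyl_y_act j (weyl_act i a)"])
  show "fmap (\<lambda>a. weyl_act i (weyl_y_act j a)) cfps = fmap (\<lambda>a. weyl_y_act j (weyl_act i a)) cfps"
    unfolding fmap_comp[of "weyl_act i" "weyl_y_act j"] fmap_comp[of "weyl_y_act j" "weyl_act i"]
    by (simp add: weyl_cfps weyl_y_cfps is_ring_homD(3)[OF is_ring_hom_fmap[OF weyl_y_hom]]
        is_ring_homD(3)[OF is_ring_hom_fmap[OF weyl_hom]] fmap_kfps[OF weyl_y_hom] fmap_kfps[OF weyl_hom]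
        weyl_y_act_x weyl_y weyl_simps mult_ac)
qed (auto simp: weyl_gen weyl_y_act_x weyl_y_act_y transpose_ge_1 is_ring_homD[OF weyl_y_hom]
      intro!: hom_y_intros)

section \<open>Divided differences\<close>

text \<open>The simple root that is the denominator of \<open>ddx i\<close>.\<close>

definition root :: "nat \<Rightarrow> gxy" where
  "root i = (if i = 0 then - 2 * xg 1 else xg i - xg (i + 1))"

lemma pvar_eq_iff: "pvar u = (pvar v :: gxy) \<longleftrightarrow> u = v"
proof
  assume "pvar u = (pvar v :: gxy)"
  then have "Poly_Mapping.keys (pvar u :: gxy) = Poly_Mapping.keys (pvar v :: gxy)" by simp
  then have s: "Poly_Mapping.single u (1::nat) = Poly_Mapping.single v 1" by (simp add: pvar_def)
  show "u = v" using arg_cong[OF s, of Poly_Mapping.keys] by simp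
qed simp

lemma single_eq_0_iff: "Poly_Mapping.single t a = 0 \<longleftrightarrow> a = 0"
  by (metis lookup_single_eq lookup_zero single_zero)

lemma pvar_nonzero: "pvar v \<noteq> (0 :: gxy)"
  by (simp add: pvar_def single_eq_0_iff)

lemma root_nonzero: "root i \<noteq> 0"
  by (auto simp: root_def xg_def pvar_eq_iff pvar_nonzero)

lemma weyl_root: "weyl_act i (root i) = - root i"
  by (auto simp: root_def weyl_simps weyl_x)

text \<open>Divisibility is checked on the generators and passes to products by the twisted Leibniz
  rule \<open>f g - s(f g) = (f - s f) g + s(f) (g - s g)\<close>.\<close>

lemma ddx_divides: "\<exists>q. f - weyl_act i f = q * root i"
proof (induction f rule: gxy_induct)
  case (c p)
  show ?case
  proof (cases "i = 0")
    case True
    have "cg (int p) - weyl_act 0 (cg (int p)) = (\<Sum>j=1..p. xg 1 ^ (j - 1) * cg (int p - int j)) * root 0"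
    proof -
      have "2 * (xg 1 ^ j * cg (int p - int j)) = - (xg 1 ^ (j - 1) * cg (int p - int j) * root 0)"
        if "j \<in> {1..p}" for j
        using that by (cases j) (simp_all add: root_def mult_ac)
      then show ?thesis
        unfolding weyl_act_0(2) by (simp add: sum_distrib_left sum_distrib_right sum_negf)
    qed
    then show ?thesis using True by blast
  qed (auto simp: weyl_c_pos intro!: exI[of _ 0])
next
  case (x j)
  show ?case
  proof (cases "i = 0")
    case True
    then show ?thesis using x
      by (cases "j = 1") (auto simp: weyl_x root_def intro: exI[of _ "-1"] exI[of _ 0])
  next
    case False
    then show ?thesis using x
      by (cases "j = i"; cases "j = i + 1")
         (auto simp: weyl_x root_def transpose_def intro: exI[of _ "-1"] exI[of _ 0] exI[of _ 1])
  qed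
next
  case (add p q)
  then obtain a b where "p - weyl_act i p = a * root i" "q - weyl_act i q = b * root i" by blast
  then have "p + q - weyl_act i (p + q) = (a + b) * root i" by (simp add: weyl_simps algebra_simps)
  then show ?case by blast
next
  case (mult p q)
  then obtain a b where ab: "p - weyl_act i p = a * root i" "q - weyl_act i q = b * root i" by blast
  have "p * q - weyl_act i (p * q) = (p - weyl_act i p) * q + weyl_act i p * (q - weyl_act i q)"
    by (simp add: weyl_simps algebra_simps)
  also have "\<dots> = (a * q + weyl_act i p * b) * root i" unfolding ab by (simp add: algebra_simps)
  finally show ?case by blast
next
  case (uminus p)
  then obtain a where "p - weyl_act i p = a * root i" by blast
  then have "- p - weyl_act i (- p) = (- a) * root i" by (simp add: weyl_simps algebra_simps)
  then show ?case by blast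
qed (auto simp: weyl_y weyl_simps intro!: exI[of _ 0])

lemma ddx_unique: "f - weyl_act i f = q * root i \<Longrightarrow> ddx i f = q"
  unfolding ddx_def exact_div_def
  by (rule the_equality) (use root_nonzero[of i] in \<open>auto simp: root_def split: if_splits\<close>)

lemma ddx_eq: "ddx i f * root i = f - weyl_act i f"
  using ddx_divides[of f i] ddx_unique by metis

lemma ddx_eqI: "f * root i = g - weyl_act i g \<Longrightarrow> ddx i g = f"
  by (rule ddx_unique) simp

lemma ddx_add: "ddx i (f + g) = ddx i f + ddx i g"
  by (rule ddx_eqI) (simp add: distrib_right ddx_eq weyl_simps)

lemma ddx_diff: "ddx i (f - g) = ddx i f - ddx i g"
  by (rule ddx_eqI) (simp add: left_diff_distrib ddx_eq weyl_simps)

lemma ddx_mult_left: "weyl_act i g = g \<Longrightarrow> ddx i (g * f) = g * ddx i f"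
  by (rule ddx_eqI) (simp add: mult.assoc ddx_eq weyl_simps right_diff_distrib)

lemma ddx_mult_right: "weyl_act i g = g \<Longrightarrow> ddx i (f * g) = ddx i f * g"
  using ddx_mult_left[of i g f] by (simp add: mult.commute)

lemma ddx_of_int: "ddx i (of_int k * f) = of_int k * ddx i f"
  by (rule ddx_mult_left) (simp add: is_ring_hom_of_int_eq[OF weyl_hom])

lemma ddx_eq_0_iff: "ddx i f = 0 \<longleftrightarrow> weyl_act i f = f"
  using ddx_eq[of i f] root_nonzero[of i] by auto

lemma ddx_0 [simp]: "ddx i 0 = 0"
  by (simp add: ddx_eq_0_iff weyl_simps)

lemma weyl_ddx: "weyl_act i (ddx i f) = ddx i f"
proof -
  have "weyl_act i (ddx i f * root i) = - (ddx i f * root i)"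
    unfolding ddx_eq by (simp add: weyl_simps weyl_weyl)
  then have "weyl_act i (ddx i f) * root i = ddx i f * root i"
    by (simp add: weyl_simps weyl_root)
  then show ?thesis using root_nonzero[of i] by simp
qed

lemma ddx_ddx: "ddx i (ddx i f) = 0"
  by (simp add: ddx_eq_0_iff weyl_ddx)

lemma weyl_root_fixed: "i + 1 < j \<or> j + 1 < i \<Longrightarrow> weyl_act i (root j) = root j"
  by (auto simp: root_def weyl_simps weyl_x)

lemma ddx_commute:
  assumes "i + 1 < j"
  shows "ddx i (ddx j f) = ddx j (ddx i f)"
proof -
  have A: "weyl_act i (ddx j f) * root j = weyl_act i f - weyl_act i (weyl_act j f)"
    using arg_cong[OF ddx_eq[of j f], of "weyl_act i"] assms by (simp add: weyl_simps weyl_root_fixed)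
  have B: "weyl_act j (ddx i f) * root i = weyl_act j f - weyl_act j (weyl_act i f)"
    using arg_cong[OF ddx_eq[of i f], of "weyl_act j"] assms by (simp add: weyl_simps weyl_root_fixed)
  have "ddx i (ddx j f) * root i * root j = (f - weyl_act j f) - (weyl_act i f - weyl_act i (weyl_act j f))"
    by (simp only: ddx_eq left_diff_distrib A)
  also have "\<dots> = (f - weyl_act i f) - (weyl_act j f - weyl_act j (weyl_act i f))"
    using weyl_commute[OF assms, of f] by simp
  also have "\<dots> = ddx j (ddx i f) * root j * root i"
    by (simp only: ddx_eq left_diff_distrib B)
  finally have "ddx i (ddx j f) * (root i * root j) = ddx j (ddx i f) * (root i * root j)" by (simp only: mult_ac)
  then show ?thesis using root_nonzero by simp
qed

text \<open>In both braid relations each side times the product of the positive roots is the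
  alternating sum over the rank two Weyl group.\<close>

lemma ddx_braid3:
  assumes i: "i \<ge> 1"
  shows "ddx i (ddx (i + 1) (ddx i f)) = ddx (i + 1) (ddx i (ddx (i + 1) f))"
proof -
  define s t where "s = weyl_act i" and "t = weyl_act (i + 1)"
  define a b where "a = root i" and "b = root (i + 1)"
  note sh = is_ring_homD[OF weyl_hom[of i], folded s_def] and th = is_ring_homD[OF weyl_hom[of "i + 1"], folded t_def]
  have s: "s (s g) = g" "s a = - a" "s b = a + b" for g
    using i by (auto simp: s_def a_def b_def weyl_weyl weyl_root root_def weyl_simps weyl_x transpose_def)
  have t: "t (t g) = g" "t b = - b" "t a = a + b" for g
    using i weyl_root[of "i + 1"] by (auto simp: t_def a_def b_def weyl_weyl root_def weyl_simps weyl_x transpose_def)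
  have br: "s (t (s g)) = t (s (t g))" for g
    unfolding s_def t_def using i by (rule weyl_braid3)
  have nz: "a \<noteq> 0" "b \<noteq> 0" "a + b \<noteq> 0"
    using root_nonzero[of i] root_nonzero[of "i + 1"] s(3) sh(4) s(1) unfolding a_def[symmetric] b_def[symmetric]
    by metis+
  have D: "ddx i g * a = g - s g" "ddx (i + 1) g * b = g - t g" for g
    unfolding s_def t_def a_def b_def by (rule ddx_eq)+
  have ab: "s (a + b) = b" "t (a + b) = a"
    using s t by (simp_all add: sh th)
  note hom = sh(3,5,6) th(3,5,6) s t ab
  define E where "E = f - s f - t f + s (t f) + t (s f) - s (t (s f))"
  have "ddx i (ddx (i + 1) (ddx i f)) * (a * b * (a + b)) = E"
  proof -
    define g1 where "g1 = ddx i f"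
    define g2 where "g2 = ddx (i + 1) g1"
    define g3 where "g3 = ddx i g2"
    have 1: "g1 * a = f - s f" and 2: "g2 * b = g1 - t g1" and 3: "g3 * a = g2 - s g2"
      by (simp_all only: g1_def g2_def g3_def D)
    \<comment> \<open>The reflection \<open>t\<close> carries the denominator \<open>a\<close> to
      \<open>a + b\<close>; this is how the third positive root enters.\<close>
    have t1: "t g1 * (a + b) = t f - t (s f)" using arg_cong[OF 1, of t] by (simp add: hom)
    have 4: "g2 * (a * b * (a + b)) = (f - s f) * (a + b) - (t f - t (s f)) * a"
    proof -
      have "g2 * (a * b * (a + b)) = (g2 * b) * a * (a + b)" by (simp only: mult_ac)
      also have "\<dots> = (g1 * a) * (a + b) - (t g1 * (a + b)) * a" unfolding 2 by (simp add: algebra_simps)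
      finally show ?thesis unfolding 1 t1 .
    qed
    have 5: "s g2 * (- a * (a + b) * b) = (s f - f) * b - (s (t f) - s (t (s f))) * (- a)"
      using arg_cong[OF 4, of s] by (simp only: hom)
    have "g3 * (a * b * (a + b)) * a = (g2 - s g2) * (a * b * (a + b))" unfolding 3[symmetric] by (simp only: mult_ac)
    also have "\<dots> = g2 * (a * b * (a + b)) + s g2 * (- a * (a + b) * b)" by (simp add: algebra_simps)
    also have "\<dots> = E * a" unfolding 4 5 E_def by (simp add: algebra_simps)
    finally show ?thesis using nz by (simp add: g3_def g2_def g1_def)
  qed
  moreover have "ddx (i + 1) (ddx i (ddx (i + 1) f)) * (a * b * (a + b)) = E"
  proof -
    define g1 where "g1 = ddx (i + 1) f"
    define g2 where "g2 = ddx i g1"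
    define g3 where "g3 = ddx (i + 1) g2"
    have 1: "g1 * b = f - t f" and 2: "g2 * a = g1 - s g1" and 3: "g3 * b = g2 - t g2"
      by (simp_all only: g1_def g2_def g3_def D)
    have t1: "s g1 * (a + b) = s f - s (t f)" using arg_cong[OF 1, of s] by (simp add: hom)
    have 4: "g2 * (a * b * (a + b)) = (f - t f) * (a + b) - (s f - s (t f)) * b"
    proof -
      have "g2 * (a * b * (a + b)) = (g2 * a) * b * (a + b)" by (simp only: mult_ac)
      also have "\<dots> = (g1 * b) * (a + b) - (s g1 * (a + b)) * b" unfolding 2 by (simp add: algebra_simps)
      finally show ?thesis unfolding 1 t1 .
    qed
    have 5: "t g2 * ((a + b) * (- b) * a) = (t f - f) * a - (t (s f) - s (t (s f))) * (- b)"
      using arg_cong[OF 4, of t] by (simp only: hom br)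
    have "g3 * (a * b * (a + b)) * b = (g2 - t g2) * (a * b * (a + b))" unfolding 3[symmetric] by (simp only: mult_ac)
    also have "\<dots> = g2 * (a * b * (a + b)) + t g2 * ((a + b) * (- b) * a)" by (simp add: algebra_simps)
    also have "\<dots> = E * b" unfolding 4 5 E_def by (simp add: algebra_simps)
    finally show ?thesis using nz by (simp add: g3_def g2_def g1_def)
  qed
  ultimately show ?thesis using nz by (metis mult_eq_0_iff mult_right_cancel)
qed

lemma ddx_braid4: "ddx 0 (ddx 1 (ddx 0 (ddx 1 f))) = ddx 1 (ddx 0 (ddx 1 (ddx 0 f)))"
proof -
  define s t where "s = weyl_act 0" and "t = weyl_act 1"
  define a b where "a = root 0" and "b = root 1"
  note sh = is_ring_homD[OF weyl_hom[of 0], folded s_def] and th = is_ring_homD[OF weyl_hom[of 1], folded t_def]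
  have s: "s (s g) = g" "s a = - a" "s b = a + b" for g
    by (auto simp: s_def a_def b_def weyl_weyl weyl_root root_def weyl_simps weyl_x)
  have t: "t (t g) = g" "t b = - b" "t a = a + 2 * b" for g
    using weyl_root[of 1] by (auto simp: t_def a_def b_def weyl_weyl root_def weyl_simps weyl_x transpose_def numeral_2_eq_2)
  have br: "s (t (s (t g))) = t (s (t (s g)))" for g
    unfolding s_def t_def by (rule weyl_braid4)
  have nz: "a \<noteq> 0" "b \<noteq> 0" "a + b \<noteq> 0" "a + 2 * b \<noteq> 0"
    using root_nonzero[of 0] root_nonzero[of 1] s(3) sh(4) s(1) t(3) th(4) t(1)
    unfolding a_def[symmetric] b_def[symmetric] by metis+
  have D: "ddx 0 g * a = g - s g" "ddx 1 g * b = g - t g" for g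
    unfolding s_def t_def a_def b_def by (rule ddx_eq)+
  have ab: "s (a + b) = b" "t (a + 2 * b) = a" "s (a + 2 * b) = a + 2 * b" "t (a + b) = a + b"
    using s t by (simp_all add: sh th algebra_simps)
  note hom = sh(3,5,6) th(3,5,6) s t ab
  \<comment> \<open>The four positive roots of type C, with \<open>a\<close> long and
    \<open>b\<close> short.\<close>
  define d where "d = a * b * (a + b) * (a + 2 * b)"
  define E where "E = f - s f - t f + s (t f) + t (s f) - s (t (s f)) - t (s (t f)) + s (t (s (t f)))"
  have "ddx 0 (ddx 1 (ddx 0 (ddx 1 f))) * d = E"
  proof -
    define g1 where "g1 = ddx 1 f"
    define g2 where "g2 = ddx 0 g1"
    define g3 where "g3 = ddx 1 g2"
    define g4 where "g4 = ddx 0 g3"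
    have 1: "g1 * b = f - t f" and 2: "g2 * a = g1 - s g1" and 3: "g3 * b = g2 - t g2" and 4: "g4 * a = g3 - s g3"
      by (simp_all only: g1_def g2_def g3_def g4_def D)
    have s1: "s g1 * (a + b) = s f - s (t f)" using arg_cong[OF 1, of s] by (simp add: hom)
    have m2: "g2 * (a * b * (a + b)) = (f - t f) * (a + b) - (s f - s (t f)) * b"
    proof -
      have "g2 * (a * b * (a + b)) = (g2 * a) * b * (a + b)" by (simp only: mult_ac)
      also have "\<dots> = (g1 * b) * (a + b) - (s g1 * (a + b)) * b" unfolding 2 by (simp add: algebra_simps)
      finally show ?thesis unfolding 1 s1 .
    qed
    have t2: "t g2 * ((a + 2 * b) * (- b) * (a + b)) = (t f - f) * (a + b) - (t (s f) - t (s (t f))) * (- b)"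
      using arg_cong[OF m2, of t] by (simp only: hom)
    have m3: "g3 * d = (f - t f) * (2 * (a + b)) - (s f - s (t f)) * (a + 2 * b) + (t (s f) - t (s (t f))) * a"
    proof -
      have "(g3 * d) * b = (g2 - t g2) * d" unfolding 3[symmetric] by (simp only: mult_ac)
      also have "\<dots> = (g2 * (a * b * (a + b))) * (a + 2 * b) + (t g2 * ((a + 2 * b) * (- b) * (a + b))) * a"
        unfolding d_def by (simp add: algebra_simps)
      also have "\<dots> = ((f - t f) * (2 * (a + b)) - (s f - s (t f)) * (a + 2 * b) + (t (s f) - t (s (t f))) * a) * b"
        unfolding m2 t2 by (simp add: algebra_simps)
      finally show ?thesis using nz by simp
    qed
    have sd: "s d = - d" unfolding d_def by (simp only: hom) (simp add: algebra_simps)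
    have s3: "s g3 * (- d) = (s f - s (t f)) * (2 * b) - (f - t f) * (a + 2 * b) + (s (t (s f)) - s (t (s (t f)))) * (- a)"
    proof -
      have e: "s (2 * (a + b)) = 2 * b" by (simp only: sh(3) sh(9) ab)
      have "s (x * u - y * v + z * w) = s x * s u - s y * s v + s z * s w" for x y z u v w
        by (simp only: sh(2,3,6))
      from this[of "f - t f" "2 * (a + b)" "s f - s (t f)" "a + 2 * b" "t (s f) - t (s (t f))" a]
      have "s (g3 * d) = s (f - t f) * (2 * b) - s (s f - s (t f)) * (a + 2 * b) + s (t (s f) - t (s (t f))) * (- a)"
        unfolding m3 e ab(3) s(2) .
      then show ?thesis by (simp only: sh(3,5,6) s(1) sd)
    qed
    have "(g4 * d) * a = (g3 - s g3) * d" unfolding 4[symmetric] by (simp only: mult_ac)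
    also have "\<dots> = g3 * d + s g3 * (- d)" by (simp add: left_diff_distrib)
    also have "\<dots> = E * a" unfolding m3 s3 E_def by (simp add: algebra_simps)
    finally show ?thesis using nz by (simp add: g4_def g3_def g2_def g1_def)
  qed
  moreover have "ddx 1 (ddx 0 (ddx 1 (ddx 0 f))) * d = E"
  proof -
    define g1 where "g1 = ddx 0 f"
    define g2 where "g2 = ddx 1 g1"
    define g3 where "g3 = ddx 0 g2"
    define g4 where "g4 = ddx 1 g3"
    have 1: "g1 * a = f - s f" and 2: "g2 * b = g1 - t g1" and 3: "g3 * a = g2 - s g2" and 4: "g4 * b = g3 - t g3"
      by (simp_all only: g1_def g2_def g3_def g4_def D)
    have t1: "t g1 * (a + 2 * b) = t f - t (s f)" using arg_cong[OF 1, of t] by (simp only: hom)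
    have m2: "g2 * (a * b * (a + 2 * b)) = (f - s f) * (a + 2 * b) - (t f - t (s f)) * a"
    proof -
      have "g2 * (a * b * (a + 2 * b)) = (g2 * b) * a * (a + 2 * b)" by (simp only: mult_ac)
      also have "\<dots> = (g1 * a) * (a + 2 * b) - (t g1 * (a + 2 * b)) * a" unfolding 2 by (simp add: algebra_simps)
      finally show ?thesis unfolding 1 t1 .
    qed
    have s2: "s g2 * (- a * (a + b) * (a + 2 * b)) = (s f - f) * (a + 2 * b) - (s (t f) - s (t (s f))) * (- a)"
      using arg_cong[OF m2, of s] by (simp only: hom)
    have m3: "g3 * d = (f - s f) * (a + 2 * b) - (t f - t (s f)) * (a + b) + (s (t f) - s (t (s f))) * b"
    proof -
      have "(g3 * d) * a = (g2 - s g2) * d" unfolding 3[symmetric] by (simp only: mult_ac)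
      also have "\<dots> = (g2 * (a * b * (a + 2 * b))) * (a + b) + (s g2 * (- a * (a + b) * (a + 2 * b))) * b"
        unfolding d_def by (simp add: algebra_simps)
      also have "\<dots> = ((f - s f) * (a + 2 * b) - (t f - t (s f)) * (a + b) + (s (t f) - s (t (s f))) * b) * a"
        unfolding m2 s2 by (simp add: algebra_simps)
      finally show ?thesis using nz by simp
    qed
    have td: "t d = - d" unfolding d_def by (simp only: hom) (simp add: algebra_simps)
    have t3: "t g3 * (- d) = (t f - t (s f)) * a - (f - s f) * (a + b) + (t (s (t f)) - s (t (s (t f)))) * (- b)"
    proof -
      have "t (x * u - y * v + z * w) = t x * t u - t y * t v + t z * t w" for x y z u v w
        by (simp only: th(2,3,6))
      from this[of "f - s f" "a + 2 * b" "t f - t (s f)" "a + b" "s (t f) - s (t (s f))" b]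
      have "t (g3 * d) = t (f - s f) * a - t (t f - t (s f)) * (a + b) + t (s (t f) - s (t (s f))) * (- b)"
        unfolding m3 ab(2) ab(4) t(2) .
      then show ?thesis by (simp only: th(3,5,6) t(1) td br)
    qed
    have "(g4 * d) * b = (g3 - t g3) * d" unfolding 4[symmetric] by (simp only: mult_ac)
    also have "\<dots> = g3 * d + t g3 * (- d)" by (simp add: left_diff_distrib)
    also have "\<dots> = E * b" unfolding m3 t3 E_def by (simp add: algebra_simps)
    finally show ?thesis using nz by (simp add: g4_def g3_def g2_def g1_def)
  qed
  ultimately have "ddx 0 (ddx 1 (ddx 0 (ddx 1 f))) * d = ddx 1 (ddx 0 (ddx 1 (ddx 0 f))) * d" by simp
  moreover have "d \<noteq> 0" using nz by (simp add: d_def)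
  ultimately show ?thesis by simp
qed

lemma omega_eq_iff: "omega f = omega g \<longleftrightarrow> f = g"
  using omega_omega by metis

lemma ddy_eq: "ddy i f * omega (root i) = f - weyl_y_act i f"
  using arg_cong[OF ddx_eq[of i "omega f"], of omega]
  by (simp add: ddy_def weyl_y_act_def omega_simps omega_omega)

lemma ddy_eq_0_iff: "ddy i f = 0 \<longleftrightarrow> weyl_y_act i f = f"
  using ddx_eq_0_iff[of i "omega f"] omega_eq_iff[of "weyl_act i (omega f)" "omega f"] omega_eq_iff[of _ 0]
  by (simp add: ddy_def weyl_y_act_def omega_omega omega_simps)

lemma ddy_add: "ddy i (f + g) = ddy i f + ddy i g"
  by (simp add: ddy_def omega_simps ddx_add)

lemma ddy_diff: "ddy i (f - g) = ddy i f - ddy i g"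
  by (simp add: ddy_def omega_simps ddx_diff)

lemma ddy_of_int: "ddy i (of_int k * f) = of_int k * ddy i f"
  by (simp add: ddy_def omega_simps is_ring_hom_of_int_eq[OF omega(1)] ddx_of_int)

lemma ddy_0 [simp]: "ddy i 0 = 0"
  by (simp add: ddy_def omega_simps)

lemma omega_root_nonzero: "omega (root i) \<noteq> 0"
  using root_nonzero[of i] omega_omega[of "root i"] omega_simps(4) by metis

lemma weyl_omega_root: "weyl_act i (omega (root j)) = omega (root j)"
  by (simp add: root_def omega_simps omega weyl_simps weyl_y)

lemma weyl_y_root: "weyl_y_act i (root j) = root j"
  by (simp add: root_def is_ring_homD[OF weyl_y_hom] weyl_y_act_x)

text \<open>The two actions commute, and each fixes the denominators of the other.\<close>

lemma ddx_ddy: "ddx i (ddy j f) = ddy j (ddx i f)"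
proof -
  have A: "weyl_act i (ddy j f) * omega (root j) = weyl_act i f - weyl_act i (weyl_y_act j f)"
    using arg_cong[OF ddy_eq[of j f], of "weyl_act i"] by (simp add: weyl_simps weyl_omega_root)
  have B: "weyl_y_act j (ddx i f) * root i = weyl_y_act j f - weyl_y_act j (weyl_act i f)"
    using arg_cong[OF ddx_eq[of i f], of "weyl_y_act j"] by (simp add: is_ring_homD[OF weyl_y_hom] weyl_y_root)
  have "ddx i (ddy j f) * root i * omega (root j) = (f - weyl_y_act j f) - (weyl_act i f - weyl_act i (weyl_y_act j f))"
    by (simp only: ddx_eq ddy_eq left_diff_distrib A)
  also have "\<dots> = (f - weyl_act i f) - (weyl_y_act j f - weyl_y_act j (weyl_act i f))"
    by (simp add: weyl_weyl_y_commute)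
  also have "\<dots> = ddy j (ddx i f) * omega (root j) * root i"
    by (simp only: ddx_eq ddy_eq left_diff_distrib B)
  finally have "ddx i (ddy j f) * (root i * omega (root j)) = ddy j (ddx i f) * (root i * omega (root j))"
    by (simp only: mult_ac)
  then show ?thesis using root_nonzero omega_root_nonzero by simp
qed

section \<open>The common kernel of the divided differences\<close>

lemma gam_hom_eqI:
  assumes h: "is_ring_hom h" and k: "is_ring_hom k"
    and c: "\<And>p. p \<ge> 1 \<Longrightarrow> h (gam_c (int p)) = k (gam_c (int p))"
  shows "h (f :: gam) = k f"
  by (induction f rule: gam_induct) (auto simp: c is_ring_homD[OF h] is_ring_homD[OF k])

text \<open>Derivations into a ring regarded as a module through \<open>h\<close>. They are
  determined by their values on the \<open>c_p\<close>, which is how the identities between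
  derivations below are checked.\<close>

definition derivation_over :: "('a::comm_ring_1 \<Rightarrow> 'b::comm_ring_1) \<Rightarrow> ('a \<Rightarrow> 'b) \<Rightarrow> bool" where
  "derivation_over h d \<longleftrightarrow> (\<forall>a b. d (a + b) = d a + d b) \<and> (\<forall>a b. d (a * b) = d a * h b + h a * d b)"

lemma derivation_overD:
  assumes "derivation_over h d" "is_ring_hom h"
  shows "d (a + b) = d a + d b" "d (a * b) = d a * h b + h a * d b" "d 1 = 0" "d (- a) = - d a"
proof -
  show a: "d (a + b) = d a + d b" for a b using assms(1) by (simp add: derivation_over_def)
  show m: "d (a * b) = d a * h b + h a * d b" for a b using assms(1) by (simp add: derivation_over_def)
  show "d 1 = 0" using m[of 1 1] is_ring_homD(1)[OF assms(2)] by simp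
  have "d 0 = 0" using a[of 0 0] by simp
  then show "d (- a) = - d a" using a[of a "- a"] by (simp add: eq_neg_iff_add_eq_0 add.commute)
qed

lemma gam_derivation_eqI:
  assumes h: "is_ring_hom h" and d: "derivation_over h d" and e: "derivation_over h e"
    and c: "\<And>p. p \<ge> 1 \<Longrightarrow> d (gam_c (int p)) = e (gam_c (int p))"
  shows "d (f :: gam) = e f"
  by (induction f rule: gam_induct) (auto simp: c derivation_overD[OF d h] derivation_overD[OF e h])

lemma map_poly_hom:
  assumes h: "is_ring_hom h"
  shows "is_ring_hom (map_poly h)"
proof -
  note D = is_ring_homD[OF h]
  have a: "map_poly h (p + q) = map_poly h p + map_poly h q" for p q
    by (intro poly_eqI) (simp add: coeff_map_poly D)
  have s: "map_poly h (smult c q) = smult (h c) (map_poly h q)" for c q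
    by (intro poly_eqI) (simp add: coeff_map_poly D)
  have m: "map_poly h (p * q) = map_poly h p * map_poly h q" for p q
    by (induction p) (simp_all add: a s map_poly_pCons D)
  show ?thesis unfolding is_ring_hom_def by (simp add: a m map_poly_1 D)
qed

definition poly_ev :: "('a::comm_ring_1 \<Rightarrow> 'b::comm_ring_1) \<Rightarrow> 'b \<Rightarrow> 'a poly \<Rightarrow> 'b" where
  "poly_ev h a p = poly (map_poly h p) a"

lemma poly_ev_hom: "is_ring_hom h \<Longrightarrow> is_ring_hom (poly_ev h a)"
  using is_ring_homD[OF map_poly_hom, of h] by (simp add: is_ring_hom_def poly_ev_def)

lemma poly_ev_const: "is_ring_hom h \<Longrightarrow> poly_ev h a [:c:] = h c"
  by (simp add: poly_ev_def map_poly_pCons is_ring_homD)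

lemma poly_ev_X: "is_ring_hom h \<Longrightarrow> poly_ev h a [:0, 1:] = a"
  by (simp add: poly_ev_def map_poly_pCons is_ring_homD)

lemma is_ring_hom_const_poly: "is_ring_hom (\<lambda>a :: 'a::comm_ring_1. [:a:])"
  by (simp add: is_ring_hom_def one_pCons)

definition gfps :: "gam fps" where "gfps = Abs_fps (\<lambda>p. gam_c (int p))"

lemma gfps_flip: "gfps * fps_flip gfps = 1"
  using gam_c_relations unfolding gamma_relations_iff gfps_def by blast

abbreviation Xg :: "gam poly" where "Xg \<equiv> [:0, 1:]"

text \<open>The action of \<open>s_0\<close> on \<Gamma>, with \<open>a\<close> in place of
  \<open>x_1\<close>.\<close>

definition gshift :: "gam poly \<Rightarrow> gam \<Rightarrow> gam poly" where
  "gshift a = gam_lift (\<lambda>p. fps_nth (kfps a * fmap (\<lambda>c. [:c:]) gfps) p)"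

lemma gfps_poly_relations: "gamma_relations (\<lambda>p. [:gam_c (int p):])"
proof -
  note h = is_ring_hom_fmap[OF is_ring_hom_const_poly[where ?'a = gam]]
  have "fmap (\<lambda>c. [:c:]) (fps_flip gfps) = fps_flip (fmap (\<lambda>c. [:c:]) gfps)"
    by (auto simp: fps_eq_iff fps_flip_def minus_one_power_iff)
  moreover have "fmap (\<lambda>c. [:c:]) gfps = Abs_fps (\<lambda>p. [:gam_c (int p):])"
    by (simp add: fps_eq_iff gfps_def)
  ultimately show ?thesis
    using arg_cong[OF gfps_flip, of "fmap (\<lambda>c. [:c:])"]
    by (simp add: gamma_relations_iff is_ring_homD[OF h] gam_c_nonpos one_pCons)
qed

lemma kfps_gfps_nth:
  "fps_nth (kfps a * fmap (\<lambda>c. [:c:]) gfps) p = [:gam_c (int p):] + 2 * (\<Sum>j = 1..p. a ^ j * [:gam_c (int (p - j)):])"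
proof -
  have "fps_nth (kfps a * fmap (\<lambda>c. [:c:]) gfps) p = (\<Sum>j=0..p. (if j = 0 then 1 else 2 * a ^ j) * [:gam_c (int (p - j)):])"
    by (simp add: kfps_def gfps_def fps_mult_nth del: One_nat_def)
  also have "\<dots> = [:gam_c (int p):] + (\<Sum>j=1..p. 2 * a ^ j * [:gam_c (int (p - j)):])"
    by (subst sum.atLeast_Suc_atMost) (auto intro!: sum.cong)
  finally show ?thesis by (simp only: sum_distrib_left mult.assoc)
qed

lemma gshift_relations: "gamma_relations (\<lambda>p. fps_nth (kfps a * fmap (\<lambda>c. [:c:]) gfps) p)"
  using gamma_relations_s0[OF gfps_poly_relations, of a] by (simp only: kfps_gfps_nth)

lemma gshift_hom: "is_ring_hom (gshift a)"
  unfolding gshift_def by (rule is_ring_hom_gam_lift[OF gshift_relations])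

lemma gshift_gfps: "fmap (gshift a) gfps = kfps a * fmap (\<lambda>c. [:c:]) gfps"
proof (rule fps_ext)
  fix n
  have "gshift a (gam_c (int n)) = fps_nth (kfps a * fmap (\<lambda>c. [:c:]) gfps) n"
    unfolding gshift_def by (rule gam_lift_c[OF gshift_relations])
  then show "fps_nth (fmap (gshift a) gfps) n = fps_nth (kfps a * fmap (\<lambda>c. [:c:]) gfps) n"
    by (simp only: fmap_nth gfps_def fps_nth_Abs_fps)
qed

text \<open>As \<open>c(-t) = 1 / c(t)\<close>, this is the logarithmic derivative of
  \<open>c(t)\<close>; its coefficients play the role of power sums.\<close>

definition psum :: "gam fps" where "psum = fps_deriv gfps * fps_flip gfps"

text \<open>Differentiating \<open>c(t) c(-t) = 1\<close> shows that \<open>c'(t) / c(t)\<close> is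
  even in \<open>t\<close>, as there is no 2-torsion.\<close>

lemma psum_even: "odd n \<Longrightarrow> fps_nth psum n = 0"
proof -
  have dflip: "fps_deriv (fps_flip F) = - fps_flip (fps_deriv F)" for F :: "gam fps"
    by (simp add: fps_eq_iff fps_flip_def algebra_simps)
  have ff: "fps_flip (fps_flip F) = F" for F :: "gam fps"
    by (simp add: fps_eq_iff fps_flip_def mult.assoc[symmetric] flip: power_add)
  have "fps_deriv (gfps * fps_flip gfps) = 0" by (simp add: gfps_flip)
  then have "psum = gfps * fps_flip (fps_deriv gfps)"
    by (simp add: psum_def dflip algebra_simps)
  then have "fps_flip psum = psum"
    by (simp add: psum_def fps_flip_mult ff mult.commute)
  moreover assume "odd n"
  ultimately have "- fps_nth psum n = fps_nth psum n"
    by (metis (no_types, lifting) fps_flip_def fps_nth_Abs_fps mult_minus1 power_minus_odd power_one)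
  then have "fps_nth psum n + fps_nth psum n = 0" by (metis add.right_inverse)
  then have "2 * fps_nth psum n = 0" by (simp only: mult_2)
  then show ?thesis by simp
qed

lemma psum_gfps: "psum * gfps = fps_deriv gfps"
  using gfps_flip by (simp add: psum_def mult.assoc mult.commute[of "fps_flip gfps"])

text \<open>If \<open>f\<close> is invariant under \<open>c(t) \<mapsto> c(t) (1 + x t) / (1 - x t)\<close>, differentiating in
  \<open>x\<close> shows that the derivations \<open>c\<^bsub>p\<^esub> \<mapsto> 2 c\<^bsub>p-k\<^esub>\<close>, \<open>k\<close> odd, kill \<open>f\<close>. With the power sums
  as coefficients these add up to twice the Euler derivation \<open>c\<^bsub>p\<^esub> \<mapsto> p c\<^bsub>p\<^esub>\<close>.\<close>

definition gdelta :: "gam \<Rightarrow> gam poly" where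
  "gdelta f = poly_ev (gshift (- Xg)) Xg (pderiv (gshift Xg f))"

text \<open>The evaluation shifts the coefficients back and keeps \<open>Xg\<close>, and
  \<open>kfps Xg * kfps (- Xg) = 1\<close>. This is what makes \<open>gdelta\<close> a derivation
  over the embedding of the constants.\<close>

lemma poly_ev_gshift: "poly_ev (gshift (- Xg)) Xg (gshift Xg f) = [:f:]"
proof (rule gam_hom_eqI[of "\<lambda>f. poly_ev (gshift (- Xg)) Xg (gshift Xg f)" "\<lambda>f. [:f:]"])
  note e = poly_ev_hom[OF gshift_hom, of "- Xg" Xg]
  show "is_ring_hom (\<lambda>f. poly_ev (gshift (- Xg)) Xg (gshift Xg f))"
    by (rule is_ring_hom_comp[OF e gshift_hom])
  show "is_ring_hom (\<lambda>f :: gam. [:f:])" by (rule is_ring_hom_const_poly)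
  fix p :: nat
  have "fmap (poly_ev (gshift (- Xg)) Xg) (fmap (gshift Xg) gfps) =
      kfps Xg * fmap (poly_ev (gshift (- Xg)) Xg) (fmap (\<lambda>c. [:c:]) gfps)"
    unfolding gshift_gfps by (simp only: is_ring_homD(3)[OF is_ring_hom_fmap[OF e]] fmap_kfps[OF e] poly_ev_X[OF gshift_hom])
  also have "fmap (poly_ev (gshift (- Xg)) Xg) (fmap (\<lambda>c. [:c:]) gfps) = fmap (gshift (- Xg)) gfps"
    by (simp add: fps_eq_iff poly_ev_const[OF gshift_hom])
  also have "kfps Xg * fmap (gshift (- Xg)) gfps = (kfps Xg * kfps (- Xg)) * fmap (\<lambda>c. [:c:]) gfps"
    unfolding gshift_gfps by (simp only: mult.assoc)
  also have "kfps Xg * kfps (- Xg) = 1"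
  proof -
    define A where "A = fps_const Xg * fps_X"
    have k: "(1 - A) * kfps Xg = 1 + A" unfolding A_def by (rule kfps_mult)
    have m: "(1 + A) * kfps (- Xg) = 1 - A"
      using kfps_mult[of "- Xg"] by (simp only: A_def fps_const_neg[symmetric] mult_minus_left diff_minus_eq_add add_uminus_conv_diff)
    have "((1 - A) * (1 + A)) * (kfps Xg * kfps (- Xg)) = ((1 - A) * kfps Xg) * ((1 + A) * kfps (- Xg))"
      by (simp only: mult_ac)
    also have "\<dots> = ((1 - A) * (1 + A)) * 1" unfolding k m by (simp only: mult_ac mult_1_left)
    finally have *: "((1 - A) * (1 + A)) * (kfps Xg * kfps (- Xg)) = ((1 - A) * (1 + A)) * 1" .
    have "fps_nth (1 - A) 0 \<noteq> 0" "fps_nth (1 + A) 0 \<noteq> 0" by (simp_all add: A_def)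
    then have "(1 - A) * (1 + A) \<noteq> 0" by (metis mult_eq_0_iff fps_zero_nth)
    then show ?thesis using * mult_left_cancel by blast
  qed
  finally have "fps_nth (fmap (poly_ev (gshift (- Xg)) Xg) (fmap (gshift Xg) gfps)) p = fps_nth (fmap (\<lambda>c. [:c:]) gfps) p"
    by simp
  then show "poly_ev (gshift (- Xg)) Xg (gshift Xg (gam_c (int p))) = [:gam_c (int p):]"
    by (simp add: gfps_def)
qed

lemma gdelta_derivation: "derivation_over (\<lambda>f. [:f:]) gdelta"
  unfolding derivation_over_def gdelta_def
  using is_ring_homD[OF poly_ev_hom[OF gshift_hom, of "- Xg" Xg]] poly_ev_gshift
  by (simp add: is_ring_homD[OF gshift_hom] pderiv_add pderiv_mult algebra_simps)

definition fps_pderiv :: "gam poly fps \<Rightarrow> gam poly fps" where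
  "fps_pderiv = fmap pderiv"

lemma pderiv_sum': "pderiv (sum f A) = (\<Sum>a\<in>A. pderiv (f a))"
  by (induction A rule: infinite_finite_induct) (auto simp: pderiv_add)

lemma fps_pderiv_mult: "fps_pderiv (F * G) = fps_pderiv F * G + F * fps_pderiv G"
  by (rule fps_ext, simp only: fps_pderiv_def fmap_nth fps_add_nth fps_mult_nth pderiv_sum' pderiv_mult)
    (simp add: sum.distrib mult.commute add.commute)

text \<open>The generating function \<open>G\<close> of the left sides is \<open>c(t)\<close> times
  the logarithmic derivative of \<open>(1 + X t) / (1 - X t)\<close> with respect to
  \<open>X\<close>, that is \<open>2 t c(t) / (1 - X^2 t^2)\<close>.\<close>

lemma gdelta_c:
  "gdelta (gam_c (int p)) = (\<Sum>k\<in>{k. odd k \<and> k \<le> p}. monom (2 * gam_c (int (p - k))) (k - 1))"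
proof -
  note e = poly_ev_hom[OF gshift_hom, of "- Xg" Xg]
  define h where "h = fmap (poly_ev (gshift (- Xg)) Xg)"
  have h: "is_ring_hom h" unfolding h_def by (rule is_ring_hom_fmap[OF e])
  define A where "A = fps_const Xg * fps_X"
  define C where "C = fmap (\<lambda>c. [:c:]) gfps"
  have k: "(1 - A) * kfps Xg = 1 + A" unfolding A_def by (rule kfps_mult)
  have m: "(1 + A) * kfps (- Xg) = 1 - A"
    using kfps_mult[of "- Xg"] by (simp only: A_def fps_const_neg[symmetric] mult_minus_left diff_minus_eq_add add_uminus_conv_diff)
  have hA: "h A = A"
    unfolding A_def h_def is_ring_homD(3)[OF is_ring_hom_fmap[OF e]] fmap_const[OF e] fmap_X[OF e] poly_ev_X[OF gshift_hom] ..
  have hk: "h (kfps Xg) = kfps Xg"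
    unfolding h_def fmap_kfps[OF e] poly_ev_X[OF gshift_hom] ..
  have hX: "h fps_X = fps_X" unfolding h_def by (rule fmap_X[OF e])
  have dA: "fps_pderiv A = fps_X" "fps_pderiv (1 - A) = - fps_X" "fps_pderiv (1 + A) = fps_X"
    unfolding A_def by (auto simp: fps_eq_iff fps_pderiv_def fps_X_def pderiv_pCons pderiv_minus pderiv_diff pderiv_add)
  have dC: "fps_pderiv C = 0" by (simp add: fps_eq_iff fps_pderiv_def C_def pderiv_pCons)
  have hC: "h C = kfps (- Xg) * C"
  proof -
    have "h C = fmap (gshift (- Xg)) gfps"
      by (simp add: fps_eq_iff h_def C_def poly_ev_const[OF gshift_hom])
    then show ?thesis unfolding gshift_gfps C_def .
  qed
  define G where "G = fmap gdelta gfps"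
  have G: "G = h (fps_pderiv (kfps Xg * C))"
    using gshift_gfps[of Xg] by (simp add: fps_eq_iff G_def h_def gdelta_def fps_pderiv_def C_def)
  have "fps_pderiv (1 - A) * kfps Xg + (1 - A) * fps_pderiv (kfps Xg) = fps_X"
    unfolding fps_pderiv_mult[symmetric] k dA(3) ..
  then have d: "(1 - A) * fps_pderiv (kfps Xg) = fps_X * (1 + kfps Xg)"
    unfolding dA(2) by (simp add: algebra_simps)
  have "G = h (fps_pderiv (kfps Xg)) * (kfps (- Xg) * C)"
    unfolding G by (simp add: fps_pderiv_mult dC is_ring_homD(3)[OF h] hC)
  then have "(1 - A) * G = h ((1 - A) * fps_pderiv (kfps Xg)) * (kfps (- Xg) * C)"
    by (simp add: is_ring_homD[OF h] hA mult.assoc)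
  also have "\<dots> = fps_X * (1 + kfps Xg) * (kfps (- Xg) * C)"
    unfolding d is_ring_homD(1,2,3)[OF h] hk hX ..
  finally have st: "(1 - A) * G = fps_X * (1 + kfps Xg) * (kfps (- Xg) * C)" .
  have "(1 + A) * ((1 - A) * ((1 - A) * G)) = fps_X * ((1 - A) + (1 - A) * kfps Xg) * (((1 + A) * kfps (- Xg)) * C)"
    unfolding st by (simp add: algebra_simps)
  also have "\<dots> = (1 - A) * (2 * fps_X * C)" unfolding k m by (simp add: algebra_simps)
  finally have "(1 - A) * ((1 + A) * ((1 - A) * G)) = (1 - A) * (2 * fps_X * C)" by (simp only: mult_ac)
  moreover have "fps_nth (1 - A) 0 \<noteq> 0" by (simp add: A_def)
  then have nz: "1 - A \<noteq> 0" by (metis fps_zero_nth)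
  ultimately have eq: "(1 + A) * ((1 - A) * G) = 2 * fps_X * C" using mult_left_cancel by blast
  \<comment> \<open>The coefficients of \<open>(1 - X^2 t^2) G = 2 t c(t)\<close>.\<close>
  have rec: "fps_nth G n = (if n = 0 then 0 else [:2 * gam_c (int (n - 1)):]) + (if n < 2 then 0 else Xg ^ 2 * fps_nth G (n - 2))" for n
  proof -
    have "G = 2 * fps_X * C + fps_const (Xg ^ 2) * (fps_X * (fps_X * G))"
    proof -
      have "fps_const (Xg ^ 2) = fps_const Xg * fps_const Xg" by (simp only: power2_eq_square fps_const_mult)
      then show ?thesis using eq by (simp add: A_def algebra_simps del: fps_const_mult)
    qed
    then have "fps_nth G n = fps_nth (2 * fps_X * C) n + fps_nth (fps_const (Xg ^ 2) * (fps_X * (fps_X * G))) n"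
      by (metis fps_add_nth)
    also have "fps_nth (2 * fps_X * C) n = (if n = 0 then 0 else [:2 * gam_c (int (n - 1)):])"
    proof -
      have "2 * fps_X * C = fps_X * (C + C)" by (simp add: algebra_simps)
      then show ?thesis
        by (simp only: fps_X_mult_nth fps_add_nth C_def fmap_nth gfps_def fps_nth_Abs_fps mult_2 add_pCons add_0_left)
    qed
    also have "fps_nth (fps_const (Xg ^ 2) * (fps_X * (fps_X * G))) n = (if n < 2 then 0 else Xg ^ 2 * fps_nth G (n - 2))"
      by (auto simp: fps_X_mult_nth numeral_2_eq_2)
    finally show ?thesis .
  qed
  have "fps_nth G p = (\<Sum>k\<in>{k. odd k \<and> k \<le> p}. monom (2 * gam_c (int (p - k))) (k - 1))"
  proof (induction p rule: less_induct)
    case (less p)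
    show ?case
    proof (cases "p < 2")
      case True
      have "{k. odd k \<and> k \<le> p} = (if p = 0 then {} else {1})" using True by (auto elim!: oddE)
      then show ?thesis using True unfolding rec[of p] by (cases p) (simp_all add: monom_0)
    next
      case False
      have X: "Xg ^ 2 * monom c l = monom c (l + 2)" for c l
        by (simp add: monom_Suc numeral_2_eq_2)
      have "{k. odd k \<and> k \<le> p} = insert 1 ((\<lambda>k. k + 2) ` {k. odd k \<and> k \<le> p - 2})"
      proof (intro equalityI subsetI)
        fix k assume "k \<in> {k. odd k \<and> k \<le> p}"
        then show "k \<in> insert 1 ((\<lambda>k. k + 2) ` {k. odd k \<and> k \<le> p - 2})"
          by (cases "k = 1") (auto intro!: image_eqI[of _ _ "k - 2"] elim!: oddE)
      qed (use False in auto)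
      moreover have "finite {k. odd k \<and> k \<le> p - 2}" by simp
      moreover have "1 \<notin> (\<lambda>k. k + 2) ` {k. odd k \<and> k \<le> p - 2}" by auto
      ultimately have "(\<Sum>k\<in>{k. odd k \<and> k \<le> p}. monom (2 * gam_c (int (p - k))) (k - 1)) =
          monom (2 * gam_c (int (p - 1))) 0 + (\<Sum>k\<in>{k. odd k \<and> k \<le> p - 2}. monom (2 * gam_c (int (p - (k + 2)))) (k + 2 - 1))"
        by (simp add: sum.reindex inj_on_def)
      also have "(\<Sum>k\<in>{k. odd k \<and> k \<le> p - 2}. monom (2 * gam_c (int (p - (k + 2)))) (k + 2 - 1)) = Xg ^ 2 * fps_nth G (p - 2)"
      proof -
        have "p - 2 < p" using False by simp
        then have "Xg ^ 2 * fps_nth G (p - 2) =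
            (\<Sum>k\<in>{k. odd k \<and> k \<le> p - 2}. Xg ^ 2 * monom (2 * gam_c (int (p - 2 - k))) (k - 1))"
          by (simp only: less.IH sum_distrib_left)
        also have "\<dots> = (\<Sum>k\<in>{k. odd k \<and> k \<le> p - 2}. monom (2 * gam_c (int (p - (k + 2)))) (k + 2 - 1))"
        proof (intro sum.cong refl)
          fix k assume "k \<in> {k. odd k \<and> k \<le> p - 2}"
          then have "k - 1 + 2 = k + 2 - 1" "p - 2 - k = p - (k + 2)" by (auto elim!: oddE)
          then show "Xg ^ 2 * monom (2 * gam_c (int (p - 2 - k))) (k - 1) = monom (2 * gam_c (int (p - (k + 2)))) (k + 2 - 1)"
            by (simp only: X)
        qed
        finally show ?thesis ..
      qed
      finally show ?thesis using False by (subst rec) (simp add: monom_0)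
    qed
  qed
  then show ?thesis by (simp add: G_def gfps_def)
qed

text \<open>The grading of \<Gamma>, with the degree as the exponent of \<open>Xg\<close>.\<close>

definition ghom :: "gam \<Rightarrow> gam poly" where
  "ghom = gam_lift (\<lambda>p. monom (gam_c (int p)) p)"

lemma ghom_relations: "gamma_relations (\<lambda>p. monom (gam_c (int p)) p)"
  unfolding gamma_relations_def
proof (intro conjI allI impI)
  fix p :: nat assume p: "p \<ge> 1"
  have s: "(-1) ^ i * monom a (p + i) * monom b (p - i) = monom ((-1) ^ i * a * b) (2 * p)" if "i \<le> p" for i and a b :: gam
  proof -
    have "(-1 :: gam poly) ^ i = monom ((-1) ^ i) 0"
      unfolding minus_one_power_iff by (simp add: monom_0 one_pCons)
    then show ?thesis using that by (simp add: mult_monom mult_2)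
  qed
  have "(\<Sum>i = 1..p. (-1) ^ i * monom (gam_c (int (p + i))) (p + i) * monom (gam_c (int (p - i))) (p - i)) =
      monom (\<Sum>i = 1..p. (-1) ^ i * gam_c (int (p + i)) * gam_c (int (p - i))) (2 * p)"
    unfolding monom_sum by (intro sum.cong refl) (use s in auto)
  moreover have "monom (gam_c (int p)) p ^ 2 = monom (gam_c (int p) ^ 2) (2 * p)"
    by (simp add: monom_power mult.commute)
  moreover have "2 * monom a k = monom (2 * a) k" for a :: gam and k by (simp only: mult_2 add_monom)
  ultimately have "monom (gam_c (int p)) p ^ 2 + 2 * (\<Sum>i = 1..p. (-1) ^ i * monom (gam_c (int (p + i))) (p + i) * monom (gam_c (int (p - i))) (p - i))
    = monom (gam_c (int p) ^ 2 + 2 * (\<Sum>i = 1..p. (-1) ^ i * gam_c (int (p + i)) * gam_c (int (p - i)))) (2 * p)"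
    by (simp only: add_monom)
  also have "\<dots> = 0" using gam_c_relations p unfolding gamma_relations_def by simp
  finally show "monom (gam_c (int p)) p ^ 2 + 2 * (\<Sum>i = 1..p. (-1) ^ i * monom (gam_c (int (p + i))) (p + i) * monom (gam_c (int (p - i))) (p - i)) = 0" .
qed (simp add: gam_c_nonpos)

lemma ghom_hom: "is_ring_hom ghom"
  unfolding ghom_def by (rule is_ring_hom_gam_lift[OF ghom_relations])

lemma ghom_c: "ghom (gam_c (int p)) = monom (gam_c (int p)) p"
  unfolding ghom_def by (rule gam_lift_c[OF ghom_relations])

lemma poly_is_ring_hom: "is_ring_hom (\<lambda>p. poly p (a :: 'a::comm_ring_1))"
  by (simp add: is_ring_hom_def)

lemma poly_ghom_1: "poly (ghom f) 1 = f"
  by (rule gam_hom_eqI[of "\<lambda>f. poly (ghom f) 1" "\<lambda>f. f"])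
     (auto simp: ghom_c poly_monom is_ring_hom_id is_ring_hom_comp[OF poly_is_ring_hom ghom_hom])

definition euler :: "gam \<Rightarrow> gam" where "euler f = poly (pderiv (ghom f)) 1"

lemma euler_derivation: "derivation_over (\<lambda>f. f) euler"
  unfolding derivation_over_def euler_def
  by (simp add: is_ring_homD[OF ghom_hom] pderiv_add pderiv_mult poly_ghom_1 algebra_simps)

lemma euler_c: "euler (gam_c (int p)) = of_nat p * gam_c (int p)"
  by (simp add: euler_def ghom_c pderiv_monom poly_monom)

text \<open>\<open>X d/dX\<close> takes \<open>ghom f\<close> to \<open>ghom (euler f)\<close>,
  which vanishes; in characteristic zero a polynomial with derivative zero is constant.\<close>

lemma euler_eq_0:
  assumes "euler f = 0" shows "ghom f = [:poly (ghom f) 0:]"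
proof -
  have "Xg * pderiv (ghom f) = ghom (euler f)"
  proof (rule gam_derivation_eqI[of ghom "\<lambda>f. Xg * pderiv (ghom f)" "\<lambda>f. ghom (euler f)"])
    show "derivation_over ghom (\<lambda>f. Xg * pderiv (ghom f))"
      unfolding derivation_over_def
      by (simp add: is_ring_homD[OF ghom_hom] pderiv_add pderiv_mult algebra_simps)
    show "derivation_over ghom (\<lambda>f. ghom (euler f))"
      using euler_derivation unfolding derivation_over_def by (simp add: is_ring_homD[OF ghom_hom])
    fix p :: nat assume p: "p \<ge> 1"
    have n: "ghom (of_nat p) = [:of_nat p:]"
      using is_ring_hom_of_nat_eq[OF ghom_hom, of p] by (simp add: of_nat_poly)
    show "Xg * pderiv (ghom (gam_c (int p))) = ghom (euler (gam_c (int p)))"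
      using p by (simp add: euler_c ghom_c n is_ring_homD(3)[OF ghom_hom] pderiv_monom smult_monom)
        (cases p; simp add: monom_Suc)
  qed (rule ghom_hom)
  then have "Xg * pderiv (ghom f) = 0" using assms by (simp add: is_ring_homD[OF ghom_hom])
  then have "pderiv (ghom f) = 0" by simp
  then have "degree (ghom f) = 0" by (simp add: pderiv_eq_0_iff)
  then obtain a where "ghom f = [:a:]" by (auto elim: degree_eq_zeroE)
  then show ?thesis by simp
qed

lemma gshift_invariant:
  assumes "gshift Xg f = [:f:]"
  shows "f = of_int (gam_lift (\<lambda>p. if p = 0 then 1 else 0) f)"
proof -
  \<comment> \<open>\<open>\<theta>\<close> replaces the \<open>i\<close>-th power of
    \<open>Xg\<close> by the \<open>i\<close>-th coefficient of \<open>psum\<close>. It is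
    \<Gamma>-linear, so \<open>\<theta> (gdelta f)\<close> is a derivation in \<open>f\<close> and
    can be compared with \<open>euler\<close> on the \<open>c_p\<close>.\<close>
  define \<theta> where "\<theta> = (\<lambda>q :: gam poly. \<Sum>i\<le>degree q. fps_nth psum i * coeff q i)"
  have \<theta>: "\<theta> q = (\<Sum>i\<le>N. fps_nth psum i * coeff q i)" if "N \<ge> degree q" for q N
    unfolding \<theta>_def by (intro sum.mono_neutral_left) (use that in \<open>auto simp: coeff_eq_0\<close>)
  have \<theta>_add: "\<theta> (p + q) = \<theta> p + \<theta> q" for p q
    using degree_add_le_max[of p q]
    by (simp add: \<theta>[of _ "max (degree p) (degree q)"] distrib_left sum.distrib)
  have \<theta>_smult: "\<theta> (smult a q) = a * \<theta> q" for a q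
    by (subst (1 2) \<theta>[of _ "degree q"]) (auto simp: degree_smult_le sum_distrib_left mult_ac)
  have \<theta>0: "\<theta> 0 = 0" by (simp add: \<theta>_def)
  have \<theta>_sum: "\<theta> (sum g A) = (\<Sum>a\<in>A. \<theta> (g a))" for g and A :: "nat set"
    by (induction A rule: infinite_finite_induct) (auto simp: \<theta>_add \<theta>0)
  have \<theta>_monom: "\<theta> (monom a k) = fps_nth psum k * a" for a k
    by (subst \<theta>[of _ k]) (auto simp: degree_monom_le if_distrib[of "\<lambda>x. _ * x"] cong: if_cong)
  have "\<theta> (gdelta f) = 2 * euler f"
  proof (rule gam_derivation_eqI[of "\<lambda>f. f" "\<lambda>f. \<theta> (gdelta f)" "\<lambda>f. 2 * euler f"])
    show "derivation_over (\<lambda>f. f) (\<lambda>f. \<theta> (gdelta f))"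
      using gdelta_derivation unfolding derivation_over_def
      by (simp add: \<theta>_add \<theta>_smult mult.commute[of "gdelta _"])
    show "derivation_over (\<lambda>f. f) (\<lambda>f. 2 * euler f)"
      using euler_derivation unfolding derivation_over_def by (simp add: algebra_simps)
    fix p :: nat assume "p \<ge> 1"
    then obtain q where q: "p = Suc q" by (cases p) auto
    \<comment> \<open>The equation \<open>c' = (c' / c) c\<close> in degree \<open>q\<close>. Only
      even powers occur in \<open>psum\<close>, so \<open>k = i + 1\<close> runs over the odd
      numbers, as in \<open>gdelta_c\<close>.\<close>
    have "of_nat p * gam_c (int p) = fps_nth (psum * gfps) q"
      unfolding psum_gfps by (simp add: q gfps_def)
    also have "\<dots> = (\<Sum>i=0..q. fps_nth psum i * gam_c (int (q - i)))"
      by (simp add: fps_mult_nth gfps_def)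
    also have "\<dots> = (\<Sum>i\<in>{i. even i \<and> i \<le> q}. fps_nth psum i * gam_c (int (q - i)))"
      by (intro sum.mono_neutral_right) (auto, metis psum_even)
    also have "\<dots> = (\<Sum>k\<in>{k. odd k \<and> k \<le> p}. fps_nth psum (k - 1) * gam_c (int (p - k)))"
      by (rule sum.reindex_bij_witness[of _ "\<lambda>k. k - 1" Suc]) (auto simp: q elim!: oddE)
    finally have "2 * (of_nat p * gam_c (int p)) = (\<Sum>k\<in>{k. odd k \<and> k \<le> p}. fps_nth psum (k - 1) * (2 * gam_c (int (p - k))))"
      by (simp add: sum_distrib_left mult_ac)
    then show "\<theta> (gdelta (gam_c (int p))) = 2 * euler (gam_c (int p))"
      by (simp add: gdelta_c \<theta>_sum \<theta>_monom euler_c)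
  qed (rule is_ring_hom_id)
  moreover have "gdelta f = 0"
    unfolding gdelta_def assms using is_ring_homD(4)[OF poly_ev_hom[OF gshift_hom]] by (simp add: pderiv_pCons)
  ultimately have "euler f = 0" using \<theta>0 by simp
  from arg_cong[OF euler_eq_0[OF this], of "\<lambda>p. poly p 1"] have "f = poly (ghom f) 0"
    by (simp add: poly_ghom_1)
  also have "poly (ghom f) 0 = of_int (gam_lift (\<lambda>p. if p = 0 then 1 else 0) f)"
  proof (rule gam_hom_eqI[of "\<lambda>f. poly (ghom f) 0" "\<lambda>f. of_int (gam_lift (\<lambda>p. if p = 0 then 1 else 0) f)"])
    have r: "gamma_relations (\<lambda>p. if p = 0 then 1 else (0::int))"
      unfolding gamma_relations_def by auto
    show "is_ring_hom (\<lambda>f. of_int (gam_lift (\<lambda>p. if p = 0 then 1 else 0) f) :: gam)"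
      by (rule is_ring_hom_comp[OF is_ring_hom_of_int is_ring_hom_gam_lift[OF r]])
    show "is_ring_hom (\<lambda>f. poly (ghom f) 0)" by (rule is_ring_hom_comp[OF poly_is_ring_hom ghom_hom])
    show "poly (ghom (gam_c (int p))) 0 = of_int (gam_lift (\<lambda>p. if p = 0 then 1 else 0) (gam_c (int p)))"
      if "p \<ge> 1" for p
      using that unfolding gam_lift_c[OF r] by (simp add: ghom_c poly_monom)
  qed
  finally show ?thesis .
qed

section \<open>Invariance and the variables that occur\<close>

definition vars_in :: "var set \<Rightarrow> gxy set" where
  "vars_in V = {f. \<forall>t\<in>Poly_Mapping.keys f. Poly_Mapping.keys t \<subseteq> V}"

lemma subring_XY_eq: "subring_XY n r = vars_in (VX ` {..<n} \<union> VY ` {..<r})"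
  by (simp add: subring_XY_def vars_in_def)

lemma vars_in_const: "pconst a \<in> vars_in V"
  by (cases "a = 0") (auto simp: vars_in_def pconst_def)

lemma vars_in_0: "0 \<in> vars_in V" and vars_in_1: "1 \<in> vars_in V"
  using vars_in_const[of 0 V] vars_in_const[of 1 V] by (simp_all add: pconst_def)

lemma vars_in_pvar: "v \<in> V \<Longrightarrow> pvar v \<in> vars_in V"
  by (auto simp: vars_in_def pvar_def)

lemma vars_in_add: "f \<in> vars_in V \<Longrightarrow> g \<in> vars_in V \<Longrightarrow> f + g \<in> vars_in V"
  unfolding vars_in_def using keys_add[of f g] by blast

lemma vars_in_uminus: "f \<in> vars_in V \<Longrightarrow> - f \<in> vars_in V"
  by (simp add: vars_in_def)

lemma vars_in_mult:
  assumes f: "f \<in> vars_in V" and g: "g \<in> vars_in V"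
  shows "f * g \<in> vars_in V"
  unfolding vars_in_def
proof (intro CollectI ballI)
  fix t assume "t \<in> Poly_Mapping.keys (f * g)"
  then obtain s u where "t = s + u" "s \<in> Poly_Mapping.keys f" "u \<in> Poly_Mapping.keys g"
    using keys_mult[of f g] by blast
  then show "Poly_Mapping.keys t \<subseteq> V"
    using f g keys_add[of s u] unfolding vars_in_def by blast
qed

lemma vars_in_power: "f \<in> vars_in V \<Longrightarrow> f ^ k \<in> vars_in V"
  by (induction k) (auto intro: vars_in_1 vars_in_mult)

lemma vars_in_sum: "(\<And>a. a \<in> A \<Longrightarrow> f a \<in> vars_in V) \<Longrightarrow> sum f A \<in> vars_in V"
  by (induction A rule: infinite_finite_induct) (auto intro: vars_in_0 vars_in_add)

lemma vars_in_prod: "(\<And>a. a \<in> A \<Longrightarrow> f a \<in> vars_in V) \<Longrightarrow> prod f A \<in> vars_in V"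
  by (induction A rule: infinite_finite_induct) (auto intro: vars_in_1 vars_in_mult)

lemma vars_in_of_int: "of_int k \<in> vars_in V"
  using vars_in_const[of "of_int k" V] is_ring_hom_of_int_eq[OF is_ring_hom_pconst[where ?'a = gam and ?'b = var], of k]
  by simp

lemma vars_in_peval:
  assumes f: "f \<in> vars_in V" and \<phi>: "\<And>a. \<phi> a \<in> vars_in V'" and g: "\<And>v. v \<in> V \<Longrightarrow> g v \<in> vars_in V'"
  shows "peval \<phi> g f \<in> vars_in V'"
  unfolding peval_def meval_def
  by (intro vars_in_sum vars_in_mult \<phi> vars_in_prod vars_in_power g) (use f in \<open>auto simp: vars_in_def\<close>)

lemma peval_cong_vars:
  assumes "f \<in> vars_in V" "\<And>v. v \<in> V \<Longrightarrow> g v = g' v"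
  shows "peval \<phi> g f = peval \<phi> g' f"
  unfolding peval_def meval_def
proof (intro sum.cong refl arg_cong2[of _ _ _ _ "(*)"] prod.cong)
  fix t v assume "t \<in> Poly_Mapping.keys f" "v \<in> Poly_Mapping.keys t"
  then have "v \<in> V" using assms(1) by (auto simp: vars_in_def)
  then show "g v ^ Poly_Mapping.lookup t v = g' v ^ Poly_Mapping.lookup t v" using assms(2) by simp
qed

lemma peval_pconst:
  fixes h :: "var \<Rightarrow> gxy"
  shows "is_ring_hom (peval pconst h)" "peval pconst h (cg p) = cg p" "peval pconst h (pvar v) = h v"
  by (simp_all add: is_ring_hom_peval[OF is_ring_hom_pconst] cg_def peval_pvar[OF is_ring_hom_pconst]
      Defs.peval_pconst[OF is_ring_hom_pconst])

lemma vars_in_finite: "\<exists>N. f \<in> vars_in (VX ` {..<N} \<union> VY ` UNIV)"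
proof -
  define V where "V = (\<Union>t\<in>Poly_Mapping.keys f. Poly_Mapping.keys t)"
  define N where "N = Suc (Max (insert 0 {i. VX i \<in> V}))"
  have "finite V" by (simp add: V_def)
  then have "finite {i. VX i \<in> V}" by (rule finite_vimageI[of V VX, unfolded vimage_def]) (simp add: inj_on_def)
  then have "i < N" if "VX i \<in> V" for i using that by (simp add: N_def less_Suc_eq_le)
  then have "V \<subseteq> VX ` {..<N} \<union> VY ` UNIV" by (metis (no_types, lifting) UnI1 UnI2 UNIV_I image_eqI lessThan_iff subsetI var.exhaust)
  then show ?thesis by (intro exI[of _ N]) (auto simp: vars_in_def V_def)
qed

text \<open>\<open>VX i\<close> is \<open>x_(i+1)\<close>. Since \<open>x_(i+2)\<close> does not
  occur in \<open>f\<close>, setting it to \<open>0\<close> leaves \<open>f\<close> unchanged;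
  carried out after exchanging the two variables, it removes \<open>x_(i+1)\<close>.\<close>

lemma sym_vars_step:
  assumes f: "f \<in> vars_in (VX ` {..<Suc i} \<union> Z)" and Z: "Z \<subseteq> range VY" and s: "weyl_act (Suc i) f = f"
  shows "f \<in> vars_in (VX ` {..<i} \<union> Z)"
proof -
  define g where "g = (\<lambda>v. if v = VX (Suc i) then (0 :: gxy) else pvar v)"
  define k where "k = (\<lambda>v. if v = VX i then (0 :: gxy) else if v = VX (Suc i) then pvar (VX i) else pvar v)"
  have "peval pconst g (weyl_act (Suc i) f) = peval pconst k f"
  proof (rule gxy_hom_eqI[of "\<lambda>f. peval pconst g (weyl_act (Suc i) f)"])
    show "fmap (\<lambda>f. peval pconst g (weyl_act (Suc i) f)) cfps = fmap (peval pconst k) cfps"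
      by (simp add: fps_eq_iff cfps_def weyl_c_pos peval_pconst)
    fix j :: nat assume "j \<ge> 1"
    then show "peval pconst g (weyl_act (Suc i) (xg j)) = peval pconst k (xg j)"
      and "peval pconst g (weyl_act (Suc i) (yg j)) = peval pconst k (yg j)"
      by (simp_all add: weyl_x weyl_y transpose_def) (auto simp: xg_def yg_def peval_pconst g_def k_def)
  qed (intro is_ring_hom_comp[OF peval_pconst(1)] weyl_hom peval_pconst)+
  moreover have "peval pconst g f = peval pconst pvar f"
    using f Z by (intro peval_cong_vars[OF f]) (auto simp: g_def)
  ultimately have "f = peval pconst k f" by (simp add: s peval_pconst_pvar)
  moreover have "peval pconst k f \<in> vars_in (VX ` {..<i} \<union> Z)"
    using Z by (intro vars_in_peval[OF f] vars_in_const) (auto simp: k_def vars_in_0 less_Suc_eq intro!: vars_in_pvar)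
  ultimately show ?thesis by simp
qed

lemma sym_vars:
  assumes f: "f \<in> vars_in (VX ` {..<N} \<union> Z)" and Z: "Z \<subseteq> range VY" and s: "\<And>i. i \<ge> 1 \<Longrightarrow> weyl_act i f = f"
  shows "f \<in> vars_in Z"
  using f
proof (induction N)
  case (Suc N)
  then show ?case using sym_vars_step[OF Suc.prems Z s] by simp
qed simp

lemma omega_const: "omega (pconst a) = pconst a"
  by (rule gam_hom_eqI[of "\<lambda>a. omega (pconst a)" pconst])
    (auto simp: omega_c[unfolded cg_def] is_ring_hom_pconst intro: is_ring_hom_comp[OF omega(1) is_ring_hom_pconst])

lemma omega_vars:
  assumes "f \<in> vars_in (range VY)" shows "\<exists>N. omega f \<in> vars_in (VX ` {..<N})"
proof -
  have "omega f \<in> vars_in (range VX)"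
    unfolding omega_def gxy_lift_def
  proof (rule vars_in_peval[OF assms])
    fix a show "gam_lift (\<lambda>p. cg (int p)) a \<in> vars_in (range VX)"
    proof -
      have "gam_lift (\<lambda>p. cg (int p)) a = pconst a"
        by (rule gam_hom_eqI[OF is_ring_hom_gam_lift[OF cg_relations] is_ring_hom_pconst])
          (use gam_lift_c[OF cg_relations] in \<open>simp add: cg_def\<close>)
      then show ?thesis by (simp add: vars_in_const)
    qed
  qed (auto simp: xg_def intro!: vars_in_uminus vars_in_pvar)
  moreover obtain N where "omega f \<in> vars_in (VX ` {..<N} \<union> VY ` UNIV)" using vars_in_finite by blast
  ultimately have "omega f \<in> vars_in (VX ` {..<N})" by (auto simp: vars_in_def) blast+
  then show ?thesis by blast
qed

lemma vars_in_empty: "f \<in> vars_in {} \<Longrightarrow> \<exists>a. f = pconst a"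
proof -
  assume f: "f \<in> vars_in {}"
  have "f = pconst (Poly_Mapping.lookup f 0)"
  proof (rule poly_mapping_eqI)
    fix t show "Poly_Mapping.lookup f t = Poly_Mapping.lookup (pconst (Poly_Mapping.lookup f 0)) t"
    proof (cases "t = 0")
      case False
      then have "Poly_Mapping.lookup f t = 0" using f by (auto simp: vars_in_def in_keys_iff)
      then show ?thesis using False by (simp add: pconst_def lookup_single when_def)
    qed (simp add: pconst_def)
  qed
  then show ?thesis by blast
qed

text \<open>Invariance under the \<open>s_i\<close> with \<open>i \<ge> 1\<close> on both sides
  removes all variables; by \<open>gshift_invariant\<close>, \<open>s_0\<close> then leaves only the
  integers, which the constant term detects.\<close>

lemma common_kernel:
  assumes x: "\<And>i. ddx i f = 0" and y: "\<And>i. ddy i f = 0" and c: "const_term f = 0"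
  shows "f = 0"
proof -
  obtain N where "f \<in> vars_in (VX ` {..<N} \<union> VY ` UNIV)" using vars_in_finite by blast
  then have fy: "f \<in> vars_in (range VY)" by (rule sym_vars) (use x in \<open>auto simp: ddx_eq_0_iff\<close>)
  then obtain M where "omega f \<in> vars_in (VX ` {..<M})" using omega_vars by blast
  moreover have "weyl_act i (omega f) = omega f" for i
  proof -
    have "omega (ddx i (omega f)) = 0" using y[of i] by (simp add: ddy_def)
    then have "ddx i (omega f) = 0" using omega_omega omega_simps(4) by metis
    then show ?thesis by (simp add: ddx_eq_0_iff)
  qed
  ultimately have "omega f \<in> vars_in {}" using sym_vars[of "omega f" M "{}"] by simp
  then obtain a where "omega f = pconst a" using vars_in_empty by blast
  then have f: "f = pconst a" using omega_omega omega_const by metis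
  \<comment> \<open>Sending \<open>x_1\<close> to \<open>Xg\<close> and the other variables to
    \<open>0\<close> turns the reflection \<open>s_0\<close> on \<Gamma> into
    \<open>gshift Xg\<close>.\<close>
  define e :: "gxy \<Rightarrow> gam poly" where "e = peval (\<lambda>a. [:a:]) (\<lambda>v. if v = VX 0 then Xg else 0)"
  have e: "is_ring_hom e" unfolding e_def by (rule is_ring_hom_peval[OF is_ring_hom_const_poly])
  have ec: "e (pconst b) = [:b:]" for b
    unfolding e_def by (rule Defs.peval_pconst[OF is_ring_hom_const_poly])
  have ex: "e (xg 1) = Xg" unfolding e_def xg_def by (simp add: peval_pvar[OF is_ring_hom_const_poly])
  have "e (weyl_act 0 (pconst b)) = gshift Xg b" for b
  proof (rule gam_hom_eqI[of "\<lambda>b. e (weyl_act 0 (pconst b))"])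
    fix p :: nat
    have "fmap e (fmap (weyl_act 0) cfps) = kfps Xg * fmap e cfps"
      unfolding weyl_cfps_0 by (simp only: is_ring_homD(3)[OF is_ring_hom_fmap[OF e]] fmap_kfps[OF e] ex)
    also have "fmap e cfps = fmap (\<lambda>c. [:c:]) gfps" by (simp add: fps_eq_iff cfps_def gfps_def cg_def ec)
    finally have "fmap e (fmap (weyl_act 0) cfps) = fmap (gshift Xg) gfps" unfolding gshift_gfps .
    from arg_cong[OF this, of "\<lambda>F. fps_nth F p"]
    show "e (weyl_act 0 (pconst (gam_c (int p)))) = gshift Xg (gam_c (int p))"
      by (simp add: cfps_def gfps_def cg_def)
  qed (intro is_ring_hom_comp[OF e] is_ring_hom_comp[OF weyl_hom] is_ring_hom_pconst gshift_hom)+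
  moreover have "weyl_act 0 (pconst a) = pconst a" using x[of 0] by (simp add: ddx_eq_0_iff f)
  ultimately have "gshift Xg a = [:a:]" using ec by metis
  then have "a = of_int (gam_lift (\<lambda>p. if p = 0 then 1 else 0) a)" by (rule gshift_invariant)
  also have "gam_lift (\<lambda>p. if p = 0 then 1 else 0) a = const_term f"
    by (simp add: const_term_def f pconst_def)
  finally show ?thesis using c f by (simp add: pconst_def)
qed

section \<open>Lengths of signed permutations\<close>

lemma sref_0: "sref 0 x = (if x = 1 then -1 else if x = -1 then 1 else x)"
  by (auto simp: sref_def transpose_def)

lemma sref_pos: "i \<ge> 1 \<Longrightarrow> sref i x = (if x = int i then int i + 1 else if x = int i + 1 then int i
    else if x = - int i then - int i - 1 else if x = - int i - 1 then - int i else x)"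
  by (auto simp: sref_def transpose_def)

lemma sref_sref: "sref i (sref i x) = x"
  by (cases "i = 0") (auto simp: sref_0 sref_pos)

lemma sref_comp_sref: "sref i \<circ> sref i = id" "u \<circ> sref i \<circ> sref i = u"
  by (auto simp: fun_eq_iff sref_sref)

lemma sref_uminus: "sref i (- x) = - sref i x"
  by (cases "i = 0") (auto simp: sref_0 sref_pos)

lemma Weyl_mono: "w \<in> Weyl k \<Longrightarrow> k \<le> l \<Longrightarrow> w \<in> Weyl l"
  unfolding Weyl_def by (auto intro: permutes_subset)

lemma Weyl_W_inf: "w \<in> Weyl k \<Longrightarrow> w \<in> W_inf"
  by (auto simp: W_inf_def)

lemma Weyl_comp: "u \<in> Weyl k \<Longrightarrow> w \<in> Weyl k \<Longrightarrow> u \<circ> w \<in> Weyl k"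
  unfolding Weyl_def by (auto intro: permutes_compose)

lemma Weyl_id: "id \<in> Weyl k"
  unfolding Weyl_def by (auto simp: permutes_id)

lemma Weyl_bij: "w \<in> Weyl k \<Longrightarrow> bij w"
  unfolding Weyl_def by (auto intro: permutes_bij)

lemma Weyl_inv: "w \<in> Weyl k \<Longrightarrow> inv w \<in> Weyl k"
proof -
  assume w: "w \<in> Weyl k"
  have "inv w (- x) = - inv w x" for x
  proof (rule inv_f_eq)
    show "inj w" using Weyl_bij[OF w] by (rule bij_is_inj)
    have "w (- inv w x) = - w (inv w x)" using w by (simp add: Weyl_def)
    then show "w (- inv w x) = - x" using Weyl_bij[OF w] by (simp add: bij_is_surj surj_f_inv_f)
  qed
  then show ?thesis using w unfolding Weyl_def by (auto intro: permutes_inv)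
qed

lemma sref_Weyl: "i < k \<Longrightarrow> sref i \<in> Weyl k"
proof -
  assume i: "i < k"
  have "sref i permutes {- int k..int k}"
    unfolding permutes_def
  proof (intro conjI allI impI)
    fix x assume "x \<notin> {- int k..int k}"
    then show "sref i x = x" using i by (cases "i = 0") (auto simp: sref_0 sref_pos)
  next
    fix y show "\<exists>!x. sref i x = y" using sref_sref by metis
  qed
  then show ?thesis by (simp add: Weyl_def sref_uminus)
qed

lemma W_inf_common: "u \<in> W_inf \<Longrightarrow> w \<in> W_inf \<Longrightarrow> \<exists>k. u \<in> Weyl k \<and> w \<in> Weyl k"
  unfolding W_inf_def using Weyl_mono by (metis UN_E linorder_le_cases)

lemma W_inf_comp: "u \<in> W_inf \<Longrightarrow> w \<in> W_inf \<Longrightarrow> u \<circ> w \<in> W_inf"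
  using W_inf_common Weyl_comp Weyl_W_inf by metis

lemma W_inf_sref: "sref i \<in> W_inf"
  using sref_Weyl[of i "Suc i"] Weyl_W_inf by blast

lemma W_inf_id: "id \<in> W_inf"
  using Weyl_id Weyl_W_inf by blast

lemma W_inf_inv: "w \<in> W_inf \<Longrightarrow> inv w \<in> W_inf"
  unfolding W_inf_def using Weyl_inv by blast

lemma W_inf_odd: "w \<in> W_inf \<Longrightarrow> w (- x) = - w x"
  by (auto simp: W_inf_def Weyl_def)

lemma W_inf_bij: "w \<in> W_inf \<Longrightarrow> bij w"
  by (auto simp: W_inf_def intro: Weyl_bij)

lemma W_inf_eq_iff: "w \<in> W_inf \<Longrightarrow> w x = w y \<longleftrightarrow> x = y"
  using W_inf_bij by (metis bij_pointE)

lemma W_inf_0: "w \<in> W_inf \<Longrightarrow> w 0 = 0"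
  using W_inf_odd[of w 0] by simp

lemma W_inf_eq_0: "w \<in> W_inf \<Longrightarrow> w x = 0 \<longleftrightarrow> x = 0"
  using W_inf_eq_iff[of w x 0] W_inf_0[of w] by simp

lemma Weyl_bound: "w \<in> Weyl k \<Longrightarrow> \<bar>x\<bar> \<le> int k \<Longrightarrow> \<bar>w x\<bar> \<le> int k"
  unfolding Weyl_def using permutes_in_image[of w "{- int k..int k}" x] by auto

lemma Weyl_fixed: "w \<in> Weyl k \<Longrightarrow> \<bar>x\<bar> > int k \<Longrightarrow> w x = x"
proof -
  assume "w \<in> Weyl k" "\<bar>x\<bar> > int k"
  then have "w permutes {- int k..int k}" "x \<notin> {- int k..int k}" by (auto simp: Weyl_def)
  then show "w x = x" by (rule permutes_not_in)
qed

text \<open>One pair for each positive root of type B: \<open>(a, b)\<close> and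
  \<open>(- b, - a)\<close> give the same root, and \<open>- b \<le> a\<close> selects one of them.
  The pair \<open>(- b, b)\<close> belongs to the sign change of \<open>b\<close>.\<close>

definition invs :: "(int \<Rightarrow> int) \<Rightarrow> (int \<times> int) set" where
  "invs w = {(a, b). 0 < b \<and> - b \<le> a \<and> a < b \<and> a \<noteq> 0 \<and> w b < w a}"

definition len :: "(int \<Rightarrow> int) \<Rightarrow> nat" where "len w = card (invs w)"

definition desc :: "nat \<Rightarrow> (int \<Rightarrow> int) \<Rightarrow> bool" where
  "desc i w \<longleftrightarrow> (if i = 0 then w 1 < 0 else w (int i + 1) < w (int i))"

lemma invs_subset: "w \<in> Weyl k \<Longrightarrow> invs w \<subseteq> {- int k..int k} \<times> {1..int k}"
proof
  fix p assume w: "w \<in> Weyl k" and "p \<in> invs w"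
  then obtain a b where p: "p = (a, b)" "0 < b" "- b \<le> a" "a < b" "w b < w a" by (auto simp: invs_def)
  have "b \<le> int k"
  proof (rule ccontr)
    assume "\<not> b \<le> int k"
    then have "w b = b" using w by (intro Weyl_fixed) auto
    moreover have "w a \<le> max (int k) a"
      using Weyl_fixed[OF w, of a] Weyl_bound[OF w, of a] p by (cases "\<bar>a\<bar> \<le> int k") auto
    ultimately show False using p \<open>\<not> b \<le> int k\<close> by auto
  qed
  then show "p \<in> {- int k..int k} \<times> {1..int k}" using p by auto
qed

lemma finite_invs: "w \<in> W_inf \<Longrightarrow> finite (invs w)"
  using finite_subset[OF invs_subset] by (auto simp: W_inf_def)

lemma len_sref:
  assumes w: "w \<in> W_inf"
  shows "desc i w \<Longrightarrow> len w = Suc (len (w \<circ> sref i))" "\<not> desc i w \<Longrightarrow> len (w \<circ> sref i) = Suc (len w)"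
proof -
  define r :: "int \<times> int" where "r = (if i = 0 then (-1, 1) else (int i, int i + 1))"
  \<comment> \<open>The reflection permutes the positive roots other than its own root
    \<open>r\<close>. The pair \<open>(- i, i + 1)\<close> would go to \<open>(- i - 1, i)\<close>,
    the other pair of the same root, and is therefore kept.\<close>
  define \<phi> :: "int \<times> int \<Rightarrow> int \<times> int" where
    "\<phi> = (\<lambda>(a, b). if i \<ge> 1 \<and> a = - int i \<and> b = int i + 1 then (a, b) else (sref i a, sref i b))"
  define R :: "(int \<times> int) set" where "R = {(a, b). 0 < b \<and> - b \<le> a \<and> a < b \<and> a \<noteq> 0}"
  have 1: "\<phi> p \<in> R \<and> \<phi> p \<noteq> r \<and> \<phi> (\<phi> p) = p" if "p \<in> R" "p \<noteq> r" for p
  proof (cases "i = 0")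
    case True
    then show ?thesis using that by (cases p) (auto simp: \<phi>_def R_def r_def sref_0)
  next
    case False
    then show ?thesis using that by (cases p) (auto simp: \<phi>_def R_def r_def sref_pos split: if_splits)
  qed
  have 2: "w (sref i b) < w (sref i a) \<longleftrightarrow> w (snd (\<phi> (a, b))) < w (fst (\<phi> (a, b)))" for a b
  proof (cases "i \<ge> 1 \<and> a = - int i \<and> b = int i + 1")
    case True
    then have "sref i a = - b" "sref i b = - a" by (auto simp: sref_pos)
    moreover have "w (- b) = - w b" "w (- a) = - w a" using W_inf_odd[OF w] by auto
    ultimately show ?thesis using True by (simp add: \<phi>_def)
  qed (auto simp: \<phi>_def)
  have I: "invs u = {p \<in> R. u (snd p) < u (fst p)}" for u by (auto simp: invs_def R_def)
  have 3: "p \<in> invs (w \<circ> sref i) - {r} \<longleftrightarrow> \<phi> p \<in> invs w - {r}" if "p \<in> R" "p \<noteq> r" for p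
    using 1[OF that] 2[of "snd p" "fst p"] that by (simp add: I)
  have "bij_betw \<phi> (invs (w \<circ> sref i) - {r}) (invs w - {r})"
  proof (rule bij_betw_byWitness[where f' = \<phi>])
    show "\<phi> ` (invs (w \<circ> sref i) - {r}) \<subseteq> invs w - {r}"
    proof
      fix q assume "q \<in> \<phi> ` (invs (w \<circ> sref i) - {r})"
      then obtain p where p: "q = \<phi> p" "p \<in> invs (w \<circ> sref i) - {r}" by blast
      then have "p \<in> R" "p \<noteq> r" by (auto simp: I)
      then show "q \<in> invs w - {r}" using 3[of p] p by simp
    qed
    show "\<phi> ` (invs w - {r}) \<subseteq> invs (w \<circ> sref i) - {r}"
    proof
      fix q assume "q \<in> \<phi> ` (invs w - {r})"
      then obtain p where p: "q = \<phi> p" "p \<in> invs w - {r}" by blast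
      then have "p \<in> R" "p \<noteq> r" by (auto simp: I)
      then show "q \<in> invs (w \<circ> sref i) - {r}" using 1[of p] 3[of "\<phi> p"] p by simp
    qed
  qed (use 1 in \<open>auto simp: I\<close>)
  then have c: "card (invs (w \<circ> sref i) - {r}) = card (invs w - {r})" by (rule bij_betw_same_card)
  have rR: "r \<in> R" by (auto simp: r_def R_def)
  have r: "r \<in> invs w \<longleftrightarrow> desc i w" "r \<in> invs (w \<circ> sref i) \<longleftrightarrow> \<not> desc i w"
  proof -
    have "w 1 \<noteq> 0" using W_inf_eq_0[OF w, of 1] by simp
    moreover have "w (int i) \<noteq> w (int i + 1)" using W_inf_eq_iff[OF w] by simp
    ultimately show "r \<in> invs w \<longleftrightarrow> desc i w" "r \<in> invs (w \<circ> sref i) \<longleftrightarrow> \<not> desc i w"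
      using rR W_inf_odd[OF w, of 1] by (auto simp: I r_def desc_def sref_0 sref_pos)
  qed
  have f: "finite (invs w)" "finite (invs (w \<circ> sref i))"
    using finite_invs w W_inf_comp[OF w W_inf_sref] by auto
  show "len w = Suc (len (w \<circ> sref i))" if "desc i w"
  proof -
    have "len w = Suc (card (invs w - {r}))"
      unfolding len_def using that r f by (intro card.remove) auto
    moreover have "invs (w \<circ> sref i) - {r} = invs (w \<circ> sref i)" using that r by blast
    ultimately show ?thesis using c by (simp only: len_def)
  qed
  show "len (w \<circ> sref i) = Suc (len w)" if "\<not> desc i w"
  proof -
    have "len (w \<circ> sref i) = Suc (card (invs (w \<circ> sref i) - {r}))"
      unfolding len_def using that r f by (intro card.remove) auto
    moreover have "invs w - {r} = invs w" using that r by blast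
    ultimately show ?thesis using c by (simp only: len_def)
  qed
qed

lemma increasing_id:
  fixes f :: "int \<Rightarrow> int"
  assumes m: "\<And>i. a \<le> i \<Longrightarrow> i < b \<Longrightarrow> f i < f (i + 1)" and l: "a \<le> f a" and u: "f b \<le> b"
    and i: "a \<le> i" "i \<le> b"
  shows "f i = i"
proof -
  have "j \<le> f j" if "a \<le> j" "j \<le> b" for j
    using that by (induction j rule: int_ge_induct) (use l m in fastforce)+
  moreover have "f j \<le> j" if "j \<le> b" "a \<le> j" for j
    using that by (induction j rule: int_le_induct) (use u m[of "_ - 1"] in fastforce)+
  ultimately show ?thesis using i by force
qed

lemma no_desc_id:
  assumes w: "w \<in> W_inf" and d: "\<And>i. \<not> desc i w"
  shows "w = id"
proof -
  obtain k where k: "w \<in> Weyl k" using w by (auto simp: W_inf_def)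
  have "w x = x" if x: "1 \<le> x" "x \<le> int k" for x
  proof (rule increasing_id[of 1 "int k" w])
    show "1 \<le> w 1" using d[of 0] W_inf_eq_0[OF w, of 1] by (simp add: desc_def)
    show "w (int k) \<le> int k" using Weyl_bound[OF k, of "int k"] by simp
    fix i :: int assume i: "1 \<le> i"
    then have "w i \<le> w (i + 1)" using d[of "nat i"] by (simp add: desc_def)
    then show "w i < w (i + 1)" using W_inf_eq_iff[OF w, of i "i + 1"] by simp
  qed (use x in auto)
  then have p: "w x = x" if "x > 0" for x using that Weyl_fixed[OF k, of x] by (cases "x \<le> int k") auto
  have "w x = x" for x
    using p[of x] p[of "- x"] W_inf_odd[OF w, of x] W_inf_0[OF w] by (cases "x > 0"; cases "x = 0") auto
  then show ?thesis by auto
qed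

lemma len_0_id: "w \<in> W_inf \<Longrightarrow> len w = 0 \<Longrightarrow> w = id"
  using no_desc_id[of w] len_sref(1)[of w] by (metis nat.distinct(1))

lemma len_id: "len id = 0"
proof -
  have "invs id = {}" by (auto simp: invs_def)
  then show ?thesis by (simp add: len_def)
qed

text \<open>Words are read from the right: the head of the list is the last factor.\<close>

definition wprod :: "nat list \<Rightarrow> int \<Rightarrow> int" where
  "wprod is = foldr (\<lambda>i u. u \<circ> sref i) is id"

lemma wprod_simps: "wprod [] = id" "wprod (i # is) = wprod is \<circ> sref i"
  by (simp_all add: wprod_def)

lemma wprod_W_inf: "wprod is \<in> W_inf"
  by (induction "is") (simp_all only: wprod_simps W_inf_id W_inf_comp W_inf_sref)

lemma wprod_append: "wprod (is @ js) = wprod js \<circ> wprod is"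
  by (induction "is") (simp_all only: wprod_simps append.simps comp_assoc comp_id)

lemma foldr_sref: "foldr (\<lambda>i u. sref i \<circ> u) is id = wprod (rev is)"
  by (induction "is") (simp_all only: wprod_simps foldr.simps o_apply id_apply rev.simps wprod_append id_comp)

lemma wprod_rev: "wprod (rev is) \<circ> wprod is = id"
proof (induction "is")
  case (Cons i "is")
  have "wprod (rev (i # is)) \<circ> wprod (i # is) = sref i \<circ> (wprod (rev is) \<circ> wprod is) \<circ> sref i"
    by (simp only: rev.simps wprod_append wprod_simps id_comp comp_assoc)
  then show ?case by (simp only: Cons.IH sref_comp_sref comp_id)
qed (simp only: rev.simps wprod_simps comp_id)

lemma len_wprod_le: "len (wprod is) \<le> length is"
proof (induction "is")
  case (Cons i "is")
  have "len (wprod (i # is)) = len (wprod is \<circ> sref i)" by (simp only: wprod_simps)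
  moreover have "len (wprod is \<circ> sref i) \<le> Suc (len (wprod is))"
    using len_sref[OF wprod_W_inf[of "is"], of i] by linarith
  ultimately show ?case using Cons.IH by simp
qed (simp only: wprod_simps len_id)

lemma reduced_word_ex:
  assumes "w \<in> W_inf" shows "\<exists>is. wprod is = w \<and> length is = len w"
  using assms
proof (induction "len w" arbitrary: w)
  case 0
  then have "w = id" using len_0_id by simp
  then show ?case using 0 by (intro exI[of _ "[]"]) (simp add: wprod_simps)
next
  case (Suc l)
  then have "w \<noteq> id" using len_id by auto
  then obtain i where i: "desc i w" using no_desc_id Suc by blast
  then have "l = len (w \<circ> sref i)" using len_sref(1)[of w i] Suc by simp
  then obtain "is" where "wprod is = w \<circ> sref i" "length is = len (w \<circ> sref i)"
    using Suc.hyps(1) Suc.prems W_inf_comp W_inf_sref by blast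
  then show ?case using Suc \<open>l = _\<close> by (intro exI[of _ "i # is"]) (simp add: wprod_simps sref_comp_sref)
qed

lemma wlen_len:
  assumes w: "w \<in> W_inf" shows "wlen w = len w"
  unfolding wlen_def
proof (rule Least_equality)
  obtain "is" where "wprod is = w" "length is = len w" using reduced_word_ex[OF w] by blast
  then show "\<exists>is. length is = len w \<and> w = foldr (\<lambda>i u. sref i \<circ> u) is id"
    by (intro exI[of _ "rev is"]) (simp add: foldr_sref)
  fix l assume "\<exists>is. length is = l \<and> w = foldr (\<lambda>i u. sref i \<circ> u) is id"
  then show "len w \<le> l" using len_wprod_le by (metis foldr_sref length_rev)
qed

lemma inv_wprod: "inv (wprod is) = wprod (rev is)"
  using wprod_rev[of "is"] wprod_rev[of "rev is"] by (intro inv_unique_comp) auto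

lemma len_inv: assumes w: "w \<in> W_inf" shows "len (inv w) = len w"
proof -
  have "len (inv u) \<le> len u" if u: "u \<in> W_inf" for u
  proof -
    obtain "is" where "wprod is = u" "length is = len u" using reduced_word_ex[OF u] by blast
    then show ?thesis using len_wprod_le[of "rev is"] inv_wprod[of "is"] by simp
  qed
  from this[OF w] this[OF W_inf_inv[OF w]] show ?thesis
    using inv_inv_eq[OF W_inf_bij[OF w]] by simp
qed

lemma wlen_right: "w \<in> W_inf \<Longrightarrow> wlen (w \<circ> sref i) < wlen w \<longleftrightarrow> desc i w"
  using len_sref[of w i] by (cases "desc i w") (auto simp: wlen_len W_inf_comp W_inf_sref)

lemma wlen_right_gt: "w \<in> W_inf \<Longrightarrow> wlen (w \<circ> sref i) > wlen w \<longleftrightarrow> \<not> desc i w"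
  using len_sref[of w i] by (cases "desc i w") (auto simp: wlen_len W_inf_comp W_inf_sref)

lemma wlen_left:
  assumes w: "w \<in> W_inf" shows "wlen (sref i \<circ> w) < wlen w \<longleftrightarrow> desc i (inv w)"
proof -
  have "bij (sref i)" "inv (sref i) = sref i"
    using W_inf_bij[OF W_inf_sref] inv_unique_comp[OF sref_comp_sref(1) sref_comp_sref(1)] by auto
  then have "inv (sref i \<circ> w) = inv w \<circ> sref i" using W_inf_bij[OF w] by (simp add: o_inv_distrib)
  then have "wlen (sref i \<circ> w) = len (inv w \<circ> sref i)"
    using wlen_len len_inv W_inf_comp[OF W_inf_sref w] by metis
  then show ?thesis
    using wlen_right[OF W_inf_inv[OF w], of i] wlen_len len_inv[OF w] W_inf_inv[OF w] w W_inf_comp W_inf_sref by metis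
qed

section \<open>Divided differences along reduced words\<close>

text \<open>The head acts first, in agreement with \<open>wprod\<close>: \<open>ddx i\<close> takes
  \<open>C w\<close> to \<open>C (w \<circ> sref i)\<close>, which strips the head of a reduced
  word.\<close>

fun opw :: "nat list \<Rightarrow> gxy \<Rightarrow> gxy" where
  "opw [] f = f"
| "opw (i # is) f = opw is (ddx i f)"

lemma opw_append: "opw (is @ js) f = opw js (opw is f)"
  by (induction "is" arbitrary: f) auto

lemma opw_0 [simp]: "opw is 0 = 0"
  by (induction "is") auto

lemma sref_commute: "i + 1 < j \<Longrightarrow> sref i \<circ> sref j = sref j \<circ> sref i"
  by (cases "i = 0") (auto simp: fun_eq_iff sref_0 sref_pos)

lemma sref_braid3: "i \<ge> 1 \<Longrightarrow> sref i \<circ> (sref (i + 1) \<circ> sref i) = sref (i + 1) \<circ> (sref i \<circ> sref (i + 1))"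
  by (auto simp: fun_eq_iff sref_pos)

lemma sref_braid4: "sref 0 \<circ> (sref 1 \<circ> (sref 0 \<circ> sref 1)) = sref 1 \<circ> (sref 0 \<circ> (sref 1 \<circ> sref 0))"
proof (rule ext)
  fix x :: int
  have 1: "sref 1 x = (if x = 1 then 2 else if x = 2 then 1 else if x = -1 then -2 else if x = -2 then -1 else x)" for x
    by (simp add: sref_pos)
  consider "x = 1" | "x = 2" | "x = -1" | "x = -2" | "x \<noteq> 1" "x \<noteq> 2" "x \<noteq> -1" "x \<noteq> -2" by blast
  then show "(sref 0 \<circ> (sref 1 \<circ> (sref 0 \<circ> sref 1))) x = (sref 1 \<circ> (sref 0 \<circ> (sref 1 \<circ> sref 0))) x"
    by cases (simp_all only: o_apply, simp_all add: 1 sref_0 del: One_nat_def)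
qed

text \<open>An element with two descents has the longest element of the subgroup generated by the
  two reflections as its last factor. The two reduced words of that factor are the sides of a braid
  relation, and \<open>c\<close> is a reduced word of the rest.\<close>

lemma descents_word:
  assumes u: "u \<in> W_inf" and d: "desc i u" "desc j u" and ij: "i < j"
  shows "\<exists>p q. wprod (i # p) = u \<and> wprod (j # q) = u \<and> Suc (length p) = len u \<and> length q = length p \<and>
    opw (i # p) = opw (j # q)"
proof -
  have W: "u \<circ> sref a \<in> W_inf" "u \<circ> sref a \<circ> sref b \<in> W_inf" "u \<circ> sref a \<circ> sref b \<circ> sref c \<in> W_inf"
    "u \<circ> sref a \<circ> sref b \<circ> sref c \<circ> sref e \<in> W_inf" for a b c e
    by (intro W_inf_comp W_inf_sref u)+
  consider "i + 1 < j" | "j = i + 1" "i \<ge> 1" | "i = 0" "j = 1" using ij by linarith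
  then show ?thesis
  proof cases
    case 1
    have "desc j (u \<circ> sref i)"
      using d 1 by (cases "i = 0") (auto simp: desc_def sref_0 sref_pos)
    then have l: "len u = Suc (Suc (len (u \<circ> sref i \<circ> sref j)))"
      using len_sref(1)[OF u d(1)] len_sref(1)[OF W(1)] by simp
    obtain c where c: "wprod c = u \<circ> sref i \<circ> sref j" "length c = len (u \<circ> sref i \<circ> sref j)"
      using reduced_word_ex[OF W(2)] by blast
    have "wprod (i # j # c) = u" by (simp only: wprod_simps c sref_comp_sref)
    moreover have "wprod (j # i # c) = u"
    proof -
      have "wprod (j # i # c) = u \<circ> (sref i \<circ> sref j) \<circ> sref i \<circ> sref j"
        by (simp only: wprod_simps c comp_assoc)
      also have "\<dots> = u" unfolding sref_commute[OF 1] by (simp only: comp_assoc[symmetric] sref_comp_sref)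
      finally show ?thesis .
    qed
    moreover have "opw (i # j # c) = opw (j # i # c)"
      using ddx_commute[OF 1] by (intro ext) simp
    ultimately show ?thesis using l c by (intro exI[of _ "j # c"] exI[of _ "i # c"]) simp
  next
    case 2
    have o: "u (int i + 1) < u (int i)" "u (int i + 2) < u (int i + 1)" using d 2 by (auto simp: desc_def add.commute)
    have d2: "desc (i + 1) (u \<circ> sref i)" "desc i (u \<circ> sref i \<circ> sref (i + 1))"
      using o 2 by (auto simp: desc_def sref_pos add.commute)
    let ?v = "u \<circ> sref i \<circ> sref (i + 1) \<circ> sref i"
    have l: "len u = Suc (Suc (Suc (len ?v)))"
      using len_sref(1)[OF u d(1)] len_sref(1)[OF W(1) d2(1)] len_sref(1)[OF W(2) d2(2)] by simp
    obtain c where c: "wprod c = ?v" "length c = len ?v" using reduced_word_ex[OF W(3)] by blast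
    have "wprod (i # (i + 1) # i # c) = u" by (simp only: wprod_simps c sref_comp_sref)
    moreover have "wprod ((i + 1) # i # (i + 1) # c) = u"
    proof -
      have "wprod ((i + 1) # i # (i + 1) # c) = u \<circ> (sref i \<circ> (sref (i + 1) \<circ> sref i)) \<circ> sref (i + 1) \<circ> sref i \<circ> sref (i + 1)"
        by (simp only: wprod_simps c comp_assoc)
      also have "\<dots> = u" unfolding sref_braid3[OF 2(2)] by (simp only: comp_assoc[symmetric] sref_comp_sref)
      finally show ?thesis .
    qed
    moreover have "opw (i # (i + 1) # i # c) = opw ((i + 1) # i # (i + 1) # c)"
      using ddx_braid3[OF 2(2)] by (intro ext) simp
    ultimately show ?thesis using l c 2
      by (intro exI[of _ "(i + 1) # i # c"] exI[of _ "i # (i + 1) # c"]) simp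
  next
    case 3
    have o: "u 1 < 0" "u 2 < u 1" using d 3 by (auto simp: desc_def)
    have d3: "desc 1 (u \<circ> sref 0)" "desc 0 (u \<circ> sref 0 \<circ> sref 1)" "desc 1 (u \<circ> sref 0 \<circ> sref 1 \<circ> sref 0)"
      using o W_inf_odd[OF u, of 1] W_inf_odd[OF u, of 2] by (auto simp: desc_def sref_0 sref_pos)
    let ?v = "u \<circ> sref 0 \<circ> sref 1 \<circ> sref 0 \<circ> sref 1"
    have l: "len u = Suc (Suc (Suc (Suc (len ?v))))"
      using len_sref(1)[OF u, of 0] d 3 len_sref(1)[OF W(1) d3(1)] len_sref(1)[OF W(2) d3(2)] len_sref(1)[OF W(3) d3(3)] by simp
    obtain c where c: "wprod c = ?v" "length c = len ?v" using reduced_word_ex[OF W(4)] by blast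
    have "wprod (0 # 1 # 0 # 1 # c) = u" by (simp only: wprod_simps c sref_comp_sref)
    moreover have "wprod (1 # 0 # 1 # 0 # c) = u"
    proof -
      have "wprod (1 # 0 # 1 # 0 # c) = u \<circ> (sref 0 \<circ> (sref 1 \<circ> (sref 0 \<circ> sref 1))) \<circ> sref 0 \<circ> sref 1 \<circ> sref 0 \<circ> sref 1"
        by (simp only: wprod_simps c comp_assoc)
      also have "\<dots> = u" unfolding sref_braid4 by (simp only: comp_assoc[symmetric] sref_comp_sref)
      finally show ?thesis .
    qed
    moreover have "opw (0 # 1 # 0 # 1 # c) = opw (1 # 0 # 1 # 0 # c)"
      by (intro ext) (simp only: opw.simps ddx_braid4)
    ultimately show ?thesis using l c 3
      by (intro exI[of _ "1 # 0 # 1 # c"] exI[of _ "0 # 1 # 0 # c"]) simp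
  qed
qed

text \<open>The argument of Matsumoto's theorem: words with the same head are compared by induction
  on their tails, and different heads are linked by the pair of words from
  \<open>descents_word\<close>.\<close>

lemma opw_reduced_unique:
  assumes "wprod a = wprod b" "length a = len (wprod a)" "length b = len (wprod a)"
  shows "opw a = opw b"
  using assms
proof (induction "length a" arbitrary: a b)
  case 0
  then have "length a = 0" "length b = 0" by linarith+
  then show ?case by (simp only: length_0_conv)
next
  case (Suc l)
  obtain i a' where a: "a = i # a'" using Suc by (cases a) auto
  obtain j b' where b: "b = j # b'" using Suc by (cases b) auto
  define u where "u = wprod a"
  have u: "u \<in> W_inf" "len u = Suc l" using Suc by (simp_all add: u_def wprod_W_inf)
  have tail: "wprod c = u \<circ> sref k \<and> len (wprod c) = l \<and> desc k u"
    if "wprod (k # c) = u" "length c = l" for k c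
  proof -
    have "wprod c = u \<circ> sref k" using that(1) unfolding wprod_simps by (metis sref_comp_sref(2))
    then show ?thesis using len_wprod_le[of c] len_sref[OF u(1), of k] u that
      by (cases "desc k u") auto
  qed
  have IH: "opw (k # c) = opw (k # d)" if "wprod (k # c) = u" "wprod (k # d) = u" "length c = l" "length d = l" for k c d
  proof -
    have "opw c = opw d"
      by (rule Suc.hyps(1)) (use tail[OF that(1,3)] tail[OF that(2,4)] that in auto)
    then show ?thesis by (intro ext) simp
  qed
  have a': "wprod (i # a') = u" "length a' = l" and b': "wprod (j # b') = u" "length b' = l"
    using Suc a b by (auto simp: u_def)
  note d = tail[OF a'] tail[OF b']
  show ?case
  proof (cases i j rule: linorder_cases)
    case less
    then obtain p q where "wprod (i # p) = u" "wprod (j # q) = u" "length p = l" "length q = l" "opw (i # p) = opw (j # q)"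
      using descents_word[OF u(1), of i j] d u by auto
    then show ?thesis using IH[of i a' p] IH[of j b' q] a' b' unfolding a b by metis
  next
    case equal
    then show ?thesis using IH a' b' unfolding a b by metis
  next
    case greater
    then obtain p q where "wprod (j # p) = u" "wprod (i # q) = u" "length p = l" "length q = l" "opw (j # p) = opw (i # q)"
      using descents_word[OF u(1), of j i] d u by auto
    then show ?thesis using IH[of i a' q] IH[of j b' p] a' b' unfolding a b by metis
  qed
qed

text \<open>Where a letter in front of a reduced tail first makes the word non-reduced, the tail may
  be exchanged for a reduced word beginning with that same letter, and \<open>ddx_ddx\<close>
  applies.\<close>

lemma opw_nonreduced:
  assumes "len (wprod a) < length a"
  shows "opw a f = 0"
  using assms
proof (induction a arbitrary: f)
  case (Cons i a)
  show ?case
  proof (cases "len (wprod a) < length a")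
    case False
    define v where "v = wprod a"
    have l: "len v = length a" using False len_wprod_le[of a] by (simp add: v_def)
    have v: "v \<in> W_inf" by (simp add: v_def wprod_W_inf)
    have "len (v \<circ> sref i) < Suc (len v)"
      using Cons.prems l by (simp only: v_def wprod_simps list.size add_Suc_right add_0_right)
    then have "desc i v" using len_sref(2)[OF v, of i] by linarith
    then have lv: "len v = Suc (len (v \<circ> sref i))" by (rule len_sref(1)[OF v])
    obtain c where c: "wprod c = v \<circ> sref i" "length c = len (v \<circ> sref i)"
      using reduced_word_ex[OF W_inf_comp[OF v W_inf_sref]] by blast
    have "opw a = opw (i # c)"
      using c l lv by (intro opw_reduced_unique) (simp_all add: v_def wprod_simps sref_comp_sref)
    then show ?thesis by (simp add: ddx_ddx)
  qed (use Cons in simp)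
qed (simp add: wprod_simps len_id)

section \<open>A recursion for multi-Schur Pfaffians\<close>

text \<open>\<open>shiftop s G\<close> is the coefficient of \<open>t\<^sup>s\<close> in the product of the \<open>(1 - t S\<^bsub>i\<^esub>) / (1 + t S\<^bsub>i\<^esub>)\<close>
  applied to \<open>G\<close>, where \<open>S\<^bsub>i\<^esub>\<close> raises the \<open>i\<close>-th argument by one.\<close>

fun shiftop :: "nat \<Rightarrow> (int list \<Rightarrow> gxy) \<Rightarrow> int list \<Rightarrow> gxy" where
  "shiftop s G [] = (if s = 0 then G [] else 0)"
| "shiftop s G (a # as) = (\<Sum>n\<le>s. of_int (raising_coeff n) * shiftop (s - n) (\<lambda>bs. G ((a + int n) # bs)) as)"

text \<open>The rows are listed from the last to the first.\<close>

fun Qr :: "(int \<Rightarrow> gxy) list \<Rightarrow> int list \<Rightarrow> gxy" where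
  "Qr [] as = 1"
| "Qr (f # fs) as = (\<Sum>s\<le>nat (hd as). f (hd as - int s) * shiftop s (Qr fs) (tl as))"

lemma shiftop_add: "shiftop s (\<lambda>as. G as + H as) as = shiftop s G as + shiftop s H as"
  by (induction s G as arbitrary: H rule: shiftop.induct) (auto simp: distrib_left sum.distrib)

lemma shiftop_mult: "shiftop s (\<lambda>as. c * G as) as = c * shiftop s G as"
  by (induction s G as rule: shiftop.induct) (auto simp: sum_distrib_left mult_ac)

lemma shiftop_zero: "shiftop s (\<lambda>as. 0) as = 0"
  using shiftop_mult[of s 0 "\<lambda>_. 0" as] by simp

lemma shiftop_sum: "shiftop s (\<lambda>as. \<Sum>x\<in>A. G x as) as = (\<Sum>x\<in>A. shiftop s (G x) as)"
  by (induction A rule: infinite_finite_induct) (auto simp: shiftop_zero shiftop_add)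

lemma shiftop_0: "shiftop 0 G as = G as"
  by (induction as arbitrary: G) (auto simp: raising_coeff_def)

lemma shiftop_cong:
  assumes "\<And>bs. length bs = length as \<Longrightarrow> G bs = H bs"
  shows "shiftop s G as = shiftop s H as"
  using assms
proof (induction as arbitrary: s G H)
  case (Cons a as)
  have "shiftop (s - n) (\<lambda>bs. G ((a + int n) # bs)) as = shiftop (s - n) (\<lambda>bs. H ((a + int n) # bs)) as" for n
    by (rule Cons.IH) (simp add: Cons.prems)
  then show ?case by simp
qed simp

lemma shiftop_commute: "shiftop s (shiftop u G) as = shiftop u (shiftop s G) as"
proof (induction as arbitrary: s u G)
  case (Cons a as)
  let ?r = "\<lambda>n. of_int (raising_coeff n) :: gxy"
  have A: "shiftop s (shiftop u G) (a # as) = (\<Sum>n\<le>s. \<Sum>k\<le>u. ?r n * ?r k *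
      shiftop (s - n) (shiftop (u - k) (\<lambda>bs. G ((a + int n + int k) # bs))) as)" for s u
    by (simp add: shiftop_sum shiftop_mult sum_distrib_left mult.assoc)
  show ?case unfolding A
    by (subst sum.swap) (simp add: Cons.IH mult.commute add_ac)
qed auto

text \<open>The series \<open>R(t) = (1 - t) / (1 + t)\<close> satisfies
  \<open>R(t) R(-t) = 1\<close>.\<close>

lemma raising_coeff_conv: "(\<Sum>n\<le>m. (-1) ^ n * raising_coeff n * raising_coeff (m - n)) = (if m = 0 then 1 else 0)"
proof -
  define R :: "int fps" where "R = Abs_fps raising_coeff"
  have R: "(1 + fps_X) * R = 1 - fps_X" unfolding R_def by (rule raising_coeff)
  have f: "fps_flip (1 + fps_X) = (1 - fps_X :: int fps)" "fps_flip (1 - fps_X) = (1 + fps_X :: int fps)"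
    by (auto simp: fps_eq_iff fps_flip_def fps_X_def)
  have R': "(1 - fps_X) * fps_flip R = 1 + fps_X"
    using arg_cong[OF R, of fps_flip] by (simp add: fps_flip_mult f)
  have "((1 + fps_X) * (1 - fps_X)) * (fps_flip R * R) = ((1 + fps_X) * R) * ((1 - fps_X) * fps_flip R)"
    by (simp only: mult_ac)
  also have "\<dots> = ((1 + fps_X) * (1 - fps_X)) * 1" unfolding R R' by (simp only: mult_ac mult_1_left)
  finally have *: "((1 + fps_X) * (1 - fps_X)) * (fps_flip R * R) = ((1 + fps_X) * (1 - fps_X)) * 1" .
  have "fps_nth (1 - fps_X :: int fps) 0 \<noteq> 0" "fps_nth (1 + fps_X :: int fps) 0 \<noteq> 0" by simp_all
  then have "(1 + fps_X) * (1 - fps_X :: int fps) \<noteq> 0" by (metis mult_eq_0_iff fps_zero_nth)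
  then have "fps_flip R * R = 1" using * mult_left_cancel by blast
  then have "fps_nth (fps_flip R * R) m = (if m = 0 then 1 else 0)" by simp
  then show ?thesis by (simp add: fps_mult_nth fps_flip_def R_def atMost_atLeast0)
qed

text \<open>The generating functions of \<open>(-1)^u shiftop u\<close> and of
  \<open>shiftop u\<close> have mutually inverse factors for each \<open>S_i\<close>; a single
  factor is \<open>raising_coeff_conv\<close>.\<close>

lemma shiftop_inverse:
  "(\<Sum>u\<le>m. (-1) ^ u * shiftop u (shiftop (m - u) G) as) = (if m = 0 then G as else 0)"
proof (induction as arbitrary: m G)
  case Nil
  have "(\<Sum>u\<le>m. (-1) ^ u * shiftop u (shiftop (m - u) G) []) = (\<Sum>u\<in>{0}. (-1) ^ u * shiftop u (shiftop (m - u) G) [])"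
    by (intro sum.mono_neutral_right) auto
  then show ?case by simp
next
  case (Cons a as)
  let ?r = "\<lambda>n. of_int (raising_coeff n) :: gxy"
  let ?G = "\<lambda>k bs. G ((a + int k) # bs)"
  have "(\<Sum>u\<le>m. (-1) ^ u * shiftop u (shiftop (m - u) G) (a # as)) =
      (\<Sum>u\<le>m. \<Sum>n\<le>u. \<Sum>k\<le>m - u. (-1) ^ u * (?r n * ?r k * shiftop (u - n) (shiftop (m - u - k) (?G (n + k))) as))"
    by (simp add: shiftop_sum shiftop_mult sum_distrib_left mult.assoc add.assoc)
  also have "\<dots> = (\<Sum>(u, n, k)\<in>(SIGMA u:{..m}. {..u} \<times> {..m - u}).
      (-1) ^ u * (?r n * ?r k * shiftop (u - n) (shiftop (m - u - k) (?G (n + k))) as))"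
    by (simp add: sum.Sigma sum.cartesian_product)
  also have "\<dots> = (\<Sum>(l, n, v)\<in>(SIGMA l:{..m}. {..l} \<times> {..m - l}).
      (-1) ^ n * ?r n * ?r (l - n) * ((-1) ^ v * shiftop v (shiftop (m - l - v) (?G l)) as))"
  proof (rule sum.reindex_bij_witness[of _ "\<lambda>(l, n, v). (v + n, n, l - n)" "\<lambda>(u, n, k). (n + k, n, u - n)"])
    fix p assume "p \<in> (SIGMA u:{..m}. {..u} \<times> {..m - u})"
    then obtain u n k where p: "p = (u, n, k)" "u \<le> m" "n \<le> u" "k \<le> m - u" by auto
    have eq: "m - (n + k) - (u - n) = m - u - k" using p by simp
    have "(-1 :: gxy) ^ u = (-1) ^ n * (-1) ^ (u - n)" using p by (simp flip: power_add)
    then have e: "(-1) ^ n * r * r' * ((-1) ^ (u - n) * x) = (-1) ^ u * (r * r' * x)" for r r' x :: gxy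
      by (simp add: mult_ac)
    show "(case case p of (u, n, k) \<Rightarrow> (n + k, n, u - n) of (l, n, v) \<Rightarrow>
        (-1) ^ n * ?r n * ?r (l - n) * ((-1) ^ v * shiftop v (shiftop (m - l - v) (?G l)) as)) =
      (case p of (u, n, k) \<Rightarrow> (-1) ^ u * (?r n * ?r k * shiftop (u - n) (shiftop (m - u - k) (?G (n + k))) as))"
      by (simp only: p(1) prod.case eq add_diff_cancel_left' e)
  qed auto
  also have "\<dots> = (\<Sum>l\<le>m. \<Sum>n\<le>l. (-1) ^ n * ?r n * ?r (l - n) * (\<Sum>v\<le>m - l. (-1) ^ v * shiftop v (shiftop (m - l - v) (?G l)) as))"
    by (simp add: sum.Sigma sum.cartesian_product sum_distrib_left)
  also have "\<dots> = (\<Sum>l\<le>m. of_int (\<Sum>n\<le>l. (-1) ^ n * raising_coeff n * raising_coeff (l - n)) * (if m - l = 0 then ?G l as else 0))"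
    unfolding Cons.IH by (simp add: sum_distrib_right)
  also have "\<dots> = (\<Sum>l\<in>{m}. of_int (\<Sum>n\<le>l. (-1) ^ n * raising_coeff n * raising_coeff (l - n)) * (if m - l = 0 then ?G l as else 0))"
    by (intro sum.mono_neutral_right) auto
  finally show ?case unfolding raising_coeff_conv by simp
qed

definition neg_zero :: "(int \<Rightarrow> gxy) \<Rightarrow> bool" where
  "neg_zero f \<longleftrightarrow> (\<forall>p<0. f p = 0)"

lemma Qr_Cons:
  assumes "neg_zero f" "nat a \<le> M"
  shows "Qr (f # fs) (a # as) = (\<Sum>s\<le>M. f (a - int s) * shiftop s (Qr fs) as)"
proof -
  have "(\<Sum>s\<le>M. f (a - int s) * shiftop s (Qr fs) as) = (\<Sum>s\<le>nat a. f (a - int s) * shiftop s (Qr fs) as)"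
    using assms by (intro sum.mono_neutral_right) (auto simp: neg_zero_def)
  then show ?thesis by simp
qed

subsection \<open>Equal adjacent rows\<close>

definition sgn_pow :: "int \<Rightarrow> gxy" where "sgn_pow k = (if even k then 1 else -1)"

lemma sgn_pow_diff: "sgn_pow (j - x) = sgn_pow x * sgn_pow j"
  by (auto simp: sgn_pow_def)

lemma sgn_pow_nat: "sgn_pow (int n) = (-1) ^ n"
  by (auto simp: sgn_pow_def minus_one_power_iff)

text \<open>The coefficient of \<open>t\<^sup>m\<close> in \<open>f(t) f(-t)\<close>.\<close>

definition flip_coeff :: "(int \<Rightarrow> gxy) \<Rightarrow> nat \<Rightarrow> gxy" where
  "flip_coeff f m = (\<Sum>j\<le>m. (-1) ^ j * f (int j) * f (int m - int j))"

text \<open>\<open>(1 - R) / (1 + R)\<close> on two equal rows, cut off at \<open>M\<close>. If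
  \<open>y \<le> M\<close> and \<open>f\<close> vanishes in negative degrees, nothing is
  lost.\<close>

definition pair2 :: "(int \<Rightarrow> gxy) \<Rightarrow> nat \<Rightarrow> int \<Rightarrow> int \<Rightarrow> gxy" where
  "pair2 f M x y = (\<Sum>n\<le>M. of_int (raising_coeff n) * f (x + int n) * f (y - int n))"

text \<open>With \<open>j\<close> the argument of one factor, the first sum runs over
  \<open>j \<ge> x\<close> and the second over \<open>j \<le> x\<close>. Their coefficients are
  \<open>2 (-1)^(j - x)\<close>, but \<open>1\<close> each at \<open>j = x\<close>, so together they
  give a full coefficient of \<open>f(t) f(-t)\<close>, up to the factor
  \<open>2 (-1)^x\<close>.\<close>

lemma pair2_antisym:
  assumes f: "neg_zero f" and M: "x \<le> int M" "y \<le> int M"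
  shows "pair2 f M x y + pair2 f M y x = (if x + y < 0 then 0 else 2 * sgn_pow x * flip_coeff f (nat (x + y)))"
proof (cases "x + y < 0")
  case True
  have "f (u + int n) * f (v - int n) = 0" if "u + v < 0" for u v n
    using f that unfolding neg_zero_def by (cases "u + int n < 0") auto
  then have "pair2 f M u v = 0" if "u + v < 0" for u v
    unfolding pair2_def using that by (intro sum.neutral) (simp add: mult.assoc)
  then show ?thesis using True by (simp add: add.commute)
next
  case False
  have fz: "f p \<noteq> 0 \<Longrightarrow> 0 \<le> p" for p using f by (force simp: neg_zero_def)
  define m where "m = nat (x + y)"
  have m: "int m = x + y" using False by (simp add: m_def)
  let ?r = "\<lambda>n. of_int (raising_coeff n) :: gxy"
  have 1: "pair2 f M x y = (\<Sum>j\<le>m. (if int j \<ge> x then ?r (nat (int j - x)) else 0) * (f (int j) * f (int m - int j)))"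
  proof -
    have "pair2 f M x y = (\<Sum>n\<in>{n. n \<le> M \<and> 0 \<le> x + int n \<and> 0 \<le> y - int n}. ?r n * f (x + int n) * f (y - int n))"
      unfolding pair2_def by (intro sum.mono_neutral_right) (auto dest: fz)
    also have "\<dots> = (\<Sum>j\<in>{j. j \<le> m \<and> int j \<ge> x}. ?r (nat (int j - x)) * (f (int j) * f (int m - int j)))"
      by (rule sum.reindex_bij_witness[of _ "\<lambda>j. nat (int j - x)" "\<lambda>n. nat (x + int n)"])
         (use m M in \<open>auto simp: mult.assoc algebra_simps\<close>)
    also have "\<dots> = (\<Sum>j\<le>m. (if int j \<ge> x then ?r (nat (int j - x)) else 0) * (f (int j) * f (int m - int j)))"
      by (intro sum.mono_neutral_cong_left) auto
    finally show ?thesis .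
  qed
  have 2: "pair2 f M y x = (\<Sum>j\<le>m. (if int j \<le> x then ?r (nat (x - int j)) else 0) * (f (int j) * f (int m - int j)))"
  proof -
    have "pair2 f M y x = (\<Sum>n\<in>{n. n \<le> M \<and> 0 \<le> y + int n \<and> 0 \<le> x - int n}. ?r n * f (y + int n) * f (x - int n))"
      unfolding pair2_def by (intro sum.mono_neutral_right) (auto dest: fz)
    also have "\<dots> = (\<Sum>j\<in>{j. j \<le> m \<and> int j \<le> x}. ?r (nat (x - int j)) * (f (int j) * f (int m - int j)))"
      by (rule sum.reindex_bij_witness[of _ "\<lambda>j. nat (x - int j)" "\<lambda>n. nat (x - int n)"])
         (use m M in \<open>auto simp: mult_ac algebra_simps\<close>)
    also have "\<dots> = (\<Sum>j\<le>m. (if int j \<le> x then ?r (nat (x - int j)) else 0) * (f (int j) * f (int m - int j)))"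
      by (intro sum.mono_neutral_cong_left) auto
    finally show ?thesis .
  qed
  have r: "?r n = (if n = 0 then 1 else 2 * (-1) ^ n)" for n
    by (simp add: raising_coeff_def)
  have "(if int j \<ge> x then ?r (nat (int j - x)) else 0) + (if int j \<le> x then ?r (nat (x - int j)) else 0)
      = 2 * sgn_pow (int j - x)" for j
    unfolding r by (cases "int j" x rule: linorder_cases) (auto simp: sgn_pow_def minus_one_power_iff even_nat_iff)
  then have "pair2 f M x y + pair2 f M y x = (\<Sum>j\<le>m. 2 * sgn_pow (int j - x) * (f (int j) * f (int m - int j)))"
    unfolding 1 2 sum.distrib[symmetric] distrib_right[symmetric] by simp
  then show ?thesis
    using False by (simp add: sgn_pow_diff sgn_pow_nat flip_coeff_def m_def[symmetric] sum_distrib_left mult_ac)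
qed

text \<open>\<open>s\<close> and \<open>u\<close> are the shifts that the two equal rows cause in
  the remaining ones; the operator between the two rows themselves is collected in
  \<open>pair2\<close>.\<close>

lemma Qr_two:
  assumes f: "neg_zero f" and M: "a \<ge> 0" "b \<ge> 0" "int M = a + b"
  shows "Qr (f # f # fs) (b # a # as) = (\<Sum>s\<le>M. \<Sum>u\<le>M. pair2 f M (a - int u) (b - int s) * shiftop s (shiftop u (Qr fs)) as)"
proof -
  let ?r = "\<lambda>n. of_int (raising_coeff n) :: gxy"
  let ?D = "\<lambda>s u. shiftop s (shiftop u (Qr fs)) as"
  have fz: "f p \<noteq> 0 \<Longrightarrow> 0 \<le> p" for p using f by (force simp: neg_zero_def)
  have "Qr (f # f # fs) (b # a # as) = (\<Sum>s\<le>M. f (b - int s) * shiftop s (Qr (f # fs)) (a # as))"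
    using M by (intro Qr_Cons f) auto
  also have "\<dots> = (\<Sum>s\<le>M. f (b - int s) * (\<Sum>n\<le>s. ?r n * shiftop (s - n) (\<lambda>bs. Qr (f # fs) ((a + int n) # bs)) as))"
    by simp
  \<comment> \<open>\<open>M + M\<close> bounds \<open>a + n\<close> for every
    \<open>n \<le> M\<close>. Only \<open>n \<le> b\<close> gives a non-zero factor
    \<open>f (b - t - n)\<close>, so the bound can return to \<open>M = a + b\<close> below.\<close>
  also have "\<dots> = (\<Sum>s\<le>M. \<Sum>n\<le>s. f (b - int s) * (?r n * (\<Sum>u\<le>M + M. f (a + int n - int u) * ?D (s - n) u)))"
    unfolding sum_distrib_left
  proof (intro sum.cong refl)
    fix s n assume "s \<in> {..M}" "n \<in> {..s}"
    then have le: "nat (a + int n) \<le> M + M" using M by auto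
    show "f (b - int s) * (?r n * shiftop (s - n) (\<lambda>bs. Qr (f # fs) ((a + int n) # bs)) as) =
        (\<Sum>u\<le>M + M. f (b - int s) * (?r n * (f (a + int n - int u) * ?D (s - n) u)))"
      unfolding Qr_Cons[OF f le] by (simp only: shiftop_sum shiftop_mult sum_distrib_left)
  qed
  also have "\<dots> = (\<Sum>(s, n)\<in>(SIGMA s:{..M}. {..s}). f (b - int s) * (?r n * (\<Sum>u\<le>M + M. f (a + int n - int u) * ?D (s - n) u)))"
    by (simp add: sum.Sigma)
  also have "\<dots> = (\<Sum>(t, n)\<in>{(t, n). t + n \<le> M}. f (b - int t - int n) * (?r n * (\<Sum>u\<le>M + M. f (a + int n - int u) * ?D t u)))"
    by (rule sum.reindex_bij_witness[of _ "\<lambda>(t, n). (t + n, n)" "\<lambda>(s, n). (s - n, n)"]) (auto simp: algebra_simps)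
  also have "\<dots> = (\<Sum>(t, n)\<in>{..M} \<times> {..M}. f (b - int t - int n) * (?r n * (\<Sum>u\<le>M + M. f (a + int n - int u) * ?D t u)))"
    using M by (intro sum.mono_neutral_left) (auto, drule fz, linarith)
  also have "\<dots> = (\<Sum>(t, n)\<in>{..M} \<times> {..M}. f (b - int t - int n) * (?r n * (\<Sum>u\<le>M. f (a + int n - int u) * ?D t u)))"
  proof (intro sum.cong refl, clarify)
    fix t n :: nat
    show "f (b - int t - int n) * (?r n * (\<Sum>u\<le>M + M. f (a + int n - int u) * ?D t u)) =
        f (b - int t - int n) * (?r n * (\<Sum>u\<le>M. f (a + int n - int u) * ?D t u))"
    proof (cases "int n \<le> b")
      case True
      then have "(\<Sum>u\<le>M + M. f (a + int n - int u) * ?D t u) = (\<Sum>u\<le>M. f (a + int n - int u) * ?D t u)"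
        using f M by (intro sum.mono_neutral_right) (auto simp: neg_zero_def)
      then show ?thesis by simp
    next
      case False
      then have "f (b - int t - int n) = 0" using f by (simp add: neg_zero_def)
      then show ?thesis by simp
    qed
  qed
  also have "\<dots> = (\<Sum>t\<le>M. \<Sum>n\<le>M. \<Sum>u\<le>M. ?r n * f (a - int u + int n) * f (b - int t - int n) * ?D t u)"
    by (simp add: sum.cartesian_product[symmetric] sum_distrib_left mult_ac algebra_simps)
  also have "\<dots> = (\<Sum>t\<le>M. \<Sum>u\<le>M. \<Sum>n\<le>M. ?r n * f (a - int u + int n) * f (b - int t - int n) * ?D t u)"
    by (intro sum.cong refl sum.swap)
  finally show ?thesis by (simp add: pair2_def sum_distrib_right)
qed

text \<open>By \<open>pair2_antisym\<close> the sum involves only the coefficients of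
  \<open>f(t) f(-t)\<close>, with signs that fit \<open>shiftop_inverse\<close>; the term without
  any shift is the only one to survive.\<close>

lemma Qr_two_antisym:
  assumes f: "neg_zero f" and ab: "a \<ge> 0" "b \<ge> 0"
  shows "Qr (f # f # fs) (b # a # as) + Qr (f # f # fs) (a # b # as) =
    2 * sgn_pow a * flip_coeff f (nat (a + b)) * Qr fs as"
proof -
  define M where "M = nat (a + b)"
  have M: "int M = a + b" "int M = b + a" using ab by (auto simp: M_def)
  let ?D = "\<lambda>s u. shiftop s (shiftop u (Qr fs)) as"
  have "Qr (f # f # fs) (a # b # as) = (\<Sum>s\<le>M. \<Sum>u\<le>M. pair2 f M (b - int u) (a - int s) * ?D s u)"
    using ab M by (intro Qr_two f) auto
  also have "\<dots> = (\<Sum>s\<le>M. \<Sum>u\<le>M. pair2 f M (b - int s) (a - int u) * ?D s u)"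
    by (subst sum.swap) (simp add: shiftop_commute)
  finally have "Qr (f # f # fs) (b # a # as) + Qr (f # f # fs) (a # b # as) =
      (\<Sum>s\<le>M. \<Sum>u\<le>M. (pair2 f M (a - int u) (b - int s) + pair2 f M (b - int s) (a - int u)) * ?D s u)"
    using ab M by (simp add: Qr_two[OF f, of a b M] distrib_right sum.distrib del: Qr.simps)
  also have "\<dots> = (\<Sum>s\<le>M. \<Sum>u\<le>M. (if s + u \<le> M then 2 * sgn_pow a * (-1) ^ u * flip_coeff f (M - (s + u)) else 0) * ?D s u)"
  proof (intro sum.cong refl)
    fix s u
    have "a - int u \<le> int M" "b - int s \<le> int M" using ab M by auto
    note pair2_antisym[OF f this]
    moreover have "a - int u + (b - int s) < 0 \<longleftrightarrow> \<not> s + u \<le> M" using M by auto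
    moreover have "nat (a - int u + (b - int s)) = M - (s + u)" using M by auto
    moreover have "sgn_pow (a - int u) = sgn_pow a * (-1) ^ u"
      by (simp add: sgn_pow_diff sgn_pow_nat mult.commute)
    ultimately show "(pair2 f M (a - int u) (b - int s) + pair2 f M (b - int s) (a - int u)) * ?D s u =
        (if s + u \<le> M then 2 * sgn_pow a * (-1) ^ u * flip_coeff f (M - (s + u)) else 0) * ?D s u"
      by (simp add: mult.assoc)
  qed
  also have "\<dots> = (\<Sum>(s, u)\<in>{(s, u). s + u \<le> M}. 2 * sgn_pow a * (-1) ^ u * flip_coeff f (M - (s + u)) * ?D s u)"
    unfolding sum.cartesian_product by (intro sum.mono_neutral_cong_right) (auto split: if_splits)
  also have "\<dots> = (\<Sum>k\<le>M. \<Sum>s\<le>k. 2 * sgn_pow a * (-1) ^ (k - s) * flip_coeff f (M - (s + (k - s))) * ?D s (k - s))"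
    by (rule sum.triangle_reindex_eq)
  also have "\<dots> = (\<Sum>k\<le>M. 2 * sgn_pow a * (-1) ^ k * flip_coeff f (M - k) * (\<Sum>s\<le>k. (-1) ^ s * ?D s (k - s)))"
    unfolding sum_distrib_left
  proof (intro sum.cong refl)
    fix k s :: nat assume "s \<in> {..k}"
    then have s: "s \<le> k" by simp
    then have e: "(-1 :: gxy) ^ (k - s) = (-1) ^ k * (-1) ^ s"
      by (auto simp: minus_one_power_iff)
    show "2 * sgn_pow a * (-1) ^ (k - s) * flip_coeff f (M - (s + (k - s))) * ?D s (k - s) =
        2 * sgn_pow a * (-1) ^ k * flip_coeff f (M - k) * ((-1) ^ s * ?D s (k - s))"
      unfolding e using s by (simp add: mult_ac)
  qed
  also have "\<dots> = (\<Sum>k\<in>{0}. 2 * sgn_pow a * (-1) ^ k * flip_coeff f (M - k) * (\<Sum>s\<le>k. (-1) ^ s * ?D s (k - s)))"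
    unfolding shiftop_inverse by (intro sum.mono_neutral_right) auto
  finally show ?thesis by (simp add: M_def shiftop_0)
qed

text \<open>Antisymmetry is available only for entries from \<open>a\<close> and \<open>b\<close>
  upwards, because \<open>flip_coeff\<close> vanishes only in large degrees; this suffices, as the
  shifts only raise entries.\<close>

lemma shiftop_antisym:
  assumes G: "\<And>(cs' :: int list) a' b' as'. length cs' = length cs \<Longrightarrow> a \<le> a' \<Longrightarrow> b \<le> b' \<Longrightarrow>
      G (cs' @ b' # a' # as') = - G (cs' @ a' # b' # as')"
  shows "shiftop s G (cs @ b # a # as) = - shiftop s G (cs @ a # b # as)"
  using assms
proof (induction cs arbitrary: s G)
  case Nil
  let ?r = "\<lambda>n. of_int (raising_coeff n) :: gxy"
  have A: "shiftop s G (x # y # as) = (\<Sum>(n, k)\<in>{(n, k). n + k \<le> s}. ?r n * ?r k * shiftop (s - n - k) (\<lambda>bs. G ((x + int n) # (y + int k) # bs)) as)" for x y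
  proof -
    have "shiftop s G (x # y # as) = (\<Sum>n\<le>s. \<Sum>k\<le>s - n. ?r n * ?r k * shiftop (s - n - k) (\<lambda>bs. G ((x + int n) # (y + int k) # bs)) as)"
      by (simp add: sum_distrib_left mult.assoc)
    also have "\<dots> = (\<Sum>(n, k)\<in>(SIGMA n:{..s}. {..s - n}). ?r n * ?r k * shiftop (s - n - k) (\<lambda>bs. G ((x + int n) # (y + int k) # bs)) as)"
      by (simp add: sum.Sigma)
    also have "(SIGMA n:{..s}. {..s - n}) = {(n, k). n + k \<le> s}" by auto
    finally show ?thesis .
  qed
  have G': "G ((b + int n) # (a + int k) # bs) = - G ((a + int k) # (b + int n) # bs)" for n k bs
    using Nil[of "[]" "a + int k" "b + int n" bs] by simp
  have "shiftop s G (b # a # as) = (\<Sum>(n, k)\<in>{(n, k). n + k \<le> s}. - (?r k * ?r n * shiftop (s - k - n) (\<lambda>bs. G ((a + int k) # (b + int n) # bs)) as))"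
    unfolding A G' using shiftop_mult[of _ "-1"] by (intro sum.cong) (auto simp: diff_diff_add add.commute mult_ac)
  also have "\<dots> = (\<Sum>(k, n)\<in>{(k, n). k + n \<le> s}. - (?r k * ?r n * shiftop (s - k - n) (\<lambda>bs. G ((a + int k) # (b + int n) # bs)) as))"
    by (rule sum.reindex_bij_witness[of _ "\<lambda>(k, n). (n, k)" "\<lambda>(k, n). (n, k)"]) auto
  also have "\<dots> = - shiftop s G (a # b # as)" unfolding A by (simp only: split_def sum_negf)
  finally show ?case by (simp only: append_Nil)
next
  case (Cons c cs)
  have "shiftop (s - n) (\<lambda>bs. G ((c + int n) # bs)) (cs @ b # a # as) =
      - shiftop (s - n) (\<lambda>bs. G ((c + int n) # bs)) (cs @ a # b # as)" for n
  proof (rule Cons.IH)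
    fix cs' :: "int list" and a' b' as' assume "length cs' = length cs" "a \<le> a'" "b \<le> b'"
    then show "G ((c + int n) # cs' @ b' # a' # as') = - G ((c + int n) # cs' @ a' # b' # as')"
      using Cons.prems[of "(c + int n) # cs'" a' b' as'] by simp
  qed
  then show ?case by (simp add: sum_negf)
qed

lemma Qr_antisym:
  assumes f: "neg_zero f" and Z: "\<And>m. m \<ge> N \<Longrightarrow> flip_coeff f m = 0"
    and ab: "a \<ge> 0" "b \<ge> 0" "a + b \<ge> int N" and l: "length cs = length xs"
  shows "Qr (xs @ f # f # ys) (cs @ b # a # as) = - Qr (xs @ f # f # ys) (cs @ a # b # as)"
  using ab l
proof (induction xs arbitrary: cs a b as)
  case Nil
  have "flip_coeff f (nat (a + b)) = 0" using Nil by (intro Z) auto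
  then show ?case using Qr_two_antisym[OF f Nil(1,2), of ys as] Nil
    by (simp add: eq_neg_iff_add_eq_0 del: Qr.simps)
next
  case (Cons g xs)
  then obtain c cs' where c: "cs = c # cs'" by (cases cs) auto
  have "shiftop s (Qr (xs @ f # f # ys)) (cs' @ b # a # as) = - shiftop s (Qr (xs @ f # f # ys)) (cs' @ a # b # as)" for s
    using Cons.prems c by (intro shiftop_antisym Cons.IH) auto
  then show ?case by (simp add: c sum_negf)
qed

lemma Qr_equal_rows:
  assumes f: "neg_zero f" and Z: "\<And>m. m \<ge> N \<Longrightarrow> flip_coeff f m = 0"
    and a: "a \<ge> 0" "2 * a \<ge> int N" and l: "length cs = length xs"
  shows "Qr (xs @ f # f # ys) (cs @ a # a # as) = 0"
proof -
  have "Qr (xs @ f # f # ys) (cs @ a # a # as) + Qr (xs @ f # f # ys) (cs @ a # a # as) = 0"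
    using Qr_antisym[OF f Z, of N a a cs xs ys as] a l by (simp add: eq_neg_iff_add_eq_0)
  then have "2 * Qr (xs @ f # f # ys) (cs @ a # a # as) = 0" by (simp only: mult_2)
  then show ?thesis by simp
qed

subsection \<open>Linearity in the rows\<close>

lemma Qr_row_linear:
  assumes "\<And>p. f p = g p + c * h p" and l: "length cs = length xs"
  shows "Qr (xs @ f # ys) (cs @ as) = Qr (xs @ g # ys) (cs @ as) + c * Qr (xs @ h # ys) (cs @ as)"
  using l
proof (induction xs arbitrary: cs as)
  case Nil
  then show ?case by (simp add: assms(1) distrib_right sum.distrib sum_distrib_left mult.assoc)
next
  case (Cons e xs)
  then obtain d cs' where c: "cs = d # cs'" by (cases cs) auto
  have "shiftop s (Qr (xs @ f # ys)) bs = shiftop s (Qr (xs @ g # ys)) bs + c * shiftop s (Qr (xs @ h # ys)) bs"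
    if "length bs \<ge> length xs" for s bs
  proof -
    have "shiftop s (Qr (xs @ f # ys)) bs = shiftop s (\<lambda>bs. Qr (xs @ g # ys) bs + c * Qr (xs @ h # ys) bs) bs"
    proof (rule shiftop_cong)
      fix bs' :: "int list" assume "length bs' = length bs"
      then have "Qr (xs @ f # ys) (take (length xs) bs' @ drop (length xs) bs') =
          Qr (xs @ g # ys) (take (length xs) bs' @ drop (length xs) bs') + c * Qr (xs @ h # ys) (take (length xs) bs' @ drop (length xs) bs')"
        using that by (intro Cons.IH) simp
      then show "Qr (xs @ f # ys) bs' = Qr (xs @ g # ys) bs' + c * Qr (xs @ h # ys) bs'" by simp
    qed
    then show ?thesis by (simp add: shiftop_add shiftop_mult)
  qed
  then show ?case using Cons.prems c by (simp add: distrib_left sum.distrib sum_distrib_left mult_ac)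
qed

text \<open>A divided difference lowers the argument of a row by one; this turns the change of the
  row into a change of the part.\<close>

lemma Qr_row_shift:
  assumes f: "neg_zero f" and l: "length cs = length xs"
  shows "Qr (xs @ (\<lambda>p. f (p - 1)) # ys) (cs @ a # as) = Qr (xs @ f # ys) (cs @ (a - 1) # as)"
  using l
proof (induction xs arbitrary: cs a as)
  case Nil
  have "neg_zero (\<lambda>p. f (p - 1))" using f by (simp add: neg_zero_def)
  then have "Qr ((\<lambda>p. f (p - 1)) # ys) (a # as) = (\<Sum>s\<le>nat a. f (a - int s - 1) * shiftop s (Qr ys) as)"
    by (rule Qr_Cons) simp
  also have "\<dots> = Qr (f # ys) ((a - 1) # as)"
    by (subst Qr_Cons[OF f, of _ "nat a"]) (auto simp: algebra_simps)
  finally show ?case using Nil by simp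
next
  case (Cons e xs)
  then obtain d cs' where c: "cs = d # cs'" by (cases cs) auto
  have sh: "shiftop s G (bs @ a # as) = shiftop s G' (bs @ (a - 1) # as)"
    if "\<And>bs' x as'. length bs' = length bs \<Longrightarrow> G (bs' @ x # as') = G' (bs' @ (x - 1) # as')" for s bs G G'
    using that
  proof (induction bs arbitrary: s G G')
    case Nil
    have "(\<lambda>bs. G ((a + int n) # bs)) = (\<lambda>bs. G' ((a - 1 + int n) # bs))" for n
      using Nil[of "[]" "a + int n"] by (intro ext) (simp add: algebra_simps)
    then show ?case by simp
  next
    case (Cons b bs)
    have "shiftop (s - n) (\<lambda>bs. G ((b + int n) # bs)) (bs @ a # as) = shiftop (s - n) (\<lambda>bs. G' ((b + int n) # bs)) (bs @ (a - 1) # as)" for n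
      using Cons.prems[of "(b + int n) # _"] by (intro Cons.IH) simp
    then show ?case by simp
  qed
  have "shiftop s (Qr (xs @ (\<lambda>p. f (p - 1)) # ys)) (cs' @ a # as) = shiftop s (Qr (xs @ f # ys)) (cs' @ (a - 1) # as)" for s
    using Cons c by (intro sh) auto
  then show ?case by (simp add: c)
qed

text \<open>Holds for a divided difference \<open>D\<close> when \<open>g\<close> is invariant under
  its reflection.\<close>

definition commuting :: "(gxy \<Rightarrow> gxy) \<Rightarrow> gxy \<Rightarrow> bool" where
  "commuting D g \<longleftrightarrow> (\<forall>f. D (g * f) = g * D f)"

context
  fixes D :: "gxy \<Rightarrow> gxy"
  assumes D_add: "\<And>f g. D (f + g) = D f + D g"
    and D_int: "\<And>k f. D (of_int k * f) = of_int k * D f"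
begin

lemma D_0: "D 0 = 0"
  using D_int[of 0] by simp

lemma D_sum: "D (sum f A) = (\<Sum>a\<in>A. D (f a))"
  by (induction A rule: infinite_finite_induct) (auto simp: D_0 D_add)

lemma shiftop_D: "D (shiftop s G as) = shiftop s (\<lambda>as. D (G as)) as"
  by (induction s G as rule: shiftop.induct) (auto simp: D_sum D_int D_0)

lemma commuting_add: "commuting D f \<Longrightarrow> commuting D g \<Longrightarrow> commuting D (f + g)"
  by (simp add: commuting_def distrib_right D_add)

lemma commuting_mult: "commuting D f \<Longrightarrow> commuting D g \<Longrightarrow> commuting D (f * g)"
  by (simp add: commuting_def mult.assoc)

lemma commuting_of_int: "commuting D (of_int k)"
  by (simp add: commuting_def D_int)

lemma commuting_sum: "(\<And>a. a \<in> A \<Longrightarrow> commuting D (f a)) \<Longrightarrow> commuting D (sum f A)"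
  using commuting_of_int[of 0] by (induction A rule: infinite_finite_induct) (auto intro: commuting_add)

lemma commuting_shiftop: "(\<And>as. commuting D (G as)) \<Longrightarrow> commuting D (shiftop s G as)"
  using commuting_of_int[of 0]
  by (induction s G as rule: shiftop.induct) (auto intro!: commuting_sum commuting_mult commuting_of_int)

lemma commuting_Qr: "(\<And>f p. f \<in> set fs \<Longrightarrow> commuting D (f p)) \<Longrightarrow> commuting D (Qr fs as)"
  using commuting_of_int[of 1]
  by (induction fs arbitrary: as) (auto intro!: commuting_sum commuting_mult commuting_shiftop)

lemma D_Qr:
  assumes f: "\<And>p. D (f p) = f' p" and i: "\<And>g p. g \<in> set xs \<union> set ys \<Longrightarrow> commuting D (g p)"
  shows "D (Qr (xs @ f # ys) as) = Qr (xs @ f' # ys) as"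
  using i
proof (induction xs arbitrary: as)
  case Nil
  have "commuting D (Qr ys as)" for as by (rule commuting_Qr) (use Nil in auto)
  then have c: "commuting D (shiftop s (Qr ys) as)" for s as by (rule commuting_shiftop)
  have "D (f p * shiftop s (Qr ys) as) = f' p * shiftop s (Qr ys) as" for p s as
    using c[of s as] f[of p] unfolding commuting_def by (metis mult.commute)
  then show ?case by (simp add: D_sum)
next
  case (Cons g xs)
  then have IH: "D (Qr (xs @ f # ys) as) = Qr (xs @ f' # ys) as" for as by simp
  have "D (g p * F) = g p * D F" for p F using Cons.prems[of g p] by (simp add: commuting_def)
  then show ?case by (simp add: D_sum shiftop_D IH)
qed

lemma D_Qr_0:
  assumes "D 1 = 0" "\<And>g p. g \<in> set xs \<Longrightarrow> commuting D (g p)"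
  shows "D (Qr xs as) = 0"
  using commuting_Qr[of xs as] assms unfolding commuting_def by (metis mult.right_neutral mult_zero_right)

end

subsection \<open>Raising operators\<close>

definition raise_term :: "(int \<Rightarrow> gxy) list \<Rightarrow> int list \<Rightarrow> (nat \<times> nat \<Rightarrow>\<^sub>0 nat) \<Rightarrow> gxy" where
  "raise_term fs as N = of_int (\<Prod>e\<in>raising_pairs (length as). raising_coeff (Poly_Mapping.lookup N e)) *
     (\<Prod>i<length as. (fs ! i) (raise N as ! i))"

definition raise_supp :: "(int \<Rightarrow> gxy) list \<Rightarrow> int list \<Rightarrow> (nat \<times> nat \<Rightarrow>\<^sub>0 nat) set" where
  "raise_supp fs as = {N. Poly_Mapping.keys N \<subseteq> raising_pairs (length as) \<and> raise_term fs as N \<noteq> 0}"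

lemma multi_Q_raise:
  "multi_Q \<rho> \<beta> as = sum (raise_term (map (\<lambda>i. multi_c (nth_default 0 \<rho> i) (nth_default 0 \<beta> i)) [0..<length as]) as)
     (raise_supp (map (\<lambda>i. multi_c (nth_default 0 \<rho> i) (nth_default 0 \<beta> i)) [0..<length as]) as)"
proof -
  have "multi_c_prod \<rho> \<beta> (raise N as) =
      (\<Prod>i<length as. (map (\<lambda>i. multi_c (nth_default 0 \<rho> i) (nth_default 0 \<beta> i)) [0..<length as] ! i) (raise N as ! i))" for N
    by (simp add: multi_c_prod_def raise_def)
  then show ?thesis unfolding multi_Q_def raise_supp_def raise_term_def Let_def by simp
qed

definition last_col :: "nat \<Rightarrow> nat list \<Rightarrow> (nat \<times> nat) \<Rightarrow>\<^sub>0 nat" where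
  "last_col l ns = (\<Sum>i<l. Poly_Mapping.single (i, l) (ns ! i))"

lemma lookup_last_col: "Poly_Mapping.lookup (last_col l ns) (i, j) = (if j = l \<and> i < l then ns ! i else 0)"
  by (auto simp: last_col_def lookup_sum lookup_single when_def)

lemma raising_pairs_Suc: "raising_pairs (Suc l) = raising_pairs l \<union> (\<lambda>i. (i, l)) ` {..<l}"
  by (auto simp: raising_pairs_def less_Suc_eq)

lemma finite_raising_pairs: "finite (raising_pairs l)"
  by (rule finite_subset[of _ "{..<l} \<times> {..<l}"]) (auto simp: raising_pairs_def)

definition shift_by :: "int list \<Rightarrow> nat list \<Rightarrow> int list" where
  "shift_by as ns = map2 (\<lambda>a n. a + int n) as ns"

lemma shift_by_rev: "length as = length ns \<Longrightarrow> rev (shift_by as ns) = shift_by (rev as) (rev ns)"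
  by (simp add: shift_by_def rev_map zip_rev)

text \<open>The operators \<open>R_(i,l)\<close> with exponents \<open>ns\<close> raise part
  \<open>i\<close> by \<open>ns ! i\<close> and lower the last part by the sum of \<open>ns\<close>;
  the other operators do not touch the last part.\<close>

lemma raise_term_snoc:
  assumes N: "Poly_Mapping.keys N \<subseteq> raising_pairs l" and l: "length fs = l" "length as = l" "length ns = l"
  shows "raise_term (fs @ [f]) (as @ [a]) (N + last_col l ns) =
    of_int (prod_list (map raising_coeff ns)) * f (a - int (sum_list ns)) * raise_term fs (shift_by as ns) N"
proof -
  let ?M = "N + last_col l ns"
  have N0: "Poly_Mapping.lookup N (i, j) = 0" if "\<not> (i < j \<and> j < l)" for i j
    using N that by (auto simp: raising_pairs_def in_keys_iff subset_iff)
  have M: "Poly_Mapping.lookup ?M (i, j) = (if j = l \<and> i < l then ns ! i else Poly_Mapping.lookup N (i, j))" for i j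
    by (auto simp: lookup_add lookup_last_col N0)
  have sl: "length (shift_by as ns) = l" using l by (simp add: shift_by_def)
  have "(\<Prod>e\<in>raising_pairs (Suc l). raising_coeff (Poly_Mapping.lookup ?M e)) =
      (\<Prod>e\<in>raising_pairs l. raising_coeff (Poly_Mapping.lookup ?M e)) * (\<Prod>e\<in>(\<lambda>i. (i, l)) ` {..<l}. raising_coeff (Poly_Mapping.lookup ?M e))"
    unfolding raising_pairs_Suc by (intro prod.union_disjoint finite_raising_pairs) (auto simp: raising_pairs_def)
  also have "(\<Prod>e\<in>raising_pairs l. raising_coeff (Poly_Mapping.lookup ?M e)) = (\<Prod>e\<in>raising_pairs l. raising_coeff (Poly_Mapping.lookup N e))"
    by (intro prod.cong refl) (auto simp: raising_pairs_def M)
  also have "(\<Prod>e\<in>(\<lambda>i. (i, l)) ` {..<l}. raising_coeff (Poly_Mapping.lookup ?M e)) = (\<Prod>i<l. raising_coeff (ns ! i))"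
    by (subst prod.reindex) (auto simp: inj_on_def M)
  also have "\<dots> = prod_list (map raising_coeff ns)"
    using l by (simp add: prod.list_conv_set_nth atLeast0LessThan)
  finally have c: "(\<Prod>e\<in>raising_pairs (length (as @ [a])). raising_coeff (Poly_Mapping.lookup ?M e)) =
      (\<Prod>e\<in>raising_pairs (length (shift_by as ns)). raising_coeff (Poly_Mapping.lookup N e)) * prod_list (map raising_coeff ns)"
    using l sl by simp
  have r: "raise ?M (as @ [a]) ! i = raise N (shift_by as ns) ! i" if "i < l" for i
  proof -
    have "(\<Sum>j<Suc l. int (Poly_Mapping.lookup ?M (i, j))) = (\<Sum>j<l. int (Poly_Mapping.lookup N (i, j))) + int (ns ! i)"
      using that by (simp add: M)
    moreover have "(\<Sum>j<Suc l. int (Poly_Mapping.lookup ?M (j, i))) = (\<Sum>j<l. int (Poly_Mapping.lookup N (j, i)))"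
      using that by (simp add: M N0)
    ultimately show ?thesis using that l sl by (simp add: raise_def shift_by_def nth_append)
  qed
  have r': "raise ?M (as @ [a]) ! l = a - int (sum_list ns)"
  proof -
    have "(\<Sum>j<Suc l. int (Poly_Mapping.lookup ?M (l, j))) = 0" by (simp add: M N0)
    moreover have "(\<Sum>j<Suc l. int (Poly_Mapping.lookup ?M (j, l))) = int (sum_list ns)"
      using l by (simp add: M N0 sum_list_sum_nth atLeast0LessThan)
    ultimately show ?thesis using l by (simp add: raise_def nth_append)
  qed
  have "(\<Prod>i<length (as @ [a]). ((fs @ [f]) ! i) (raise ?M (as @ [a]) ! i)) =
      (\<Prod>i<l. (fs ! i) (raise N (shift_by as ns) ! i)) * f (a - int (sum_list ns))"
    using l by (simp add: r r' nth_append)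
  then show ?thesis unfolding raise_term_def c using sl by (simp add: mult_ac)
qed

lemma finite_lists_sum: "finite {ns. length ns = l \<and> sum_list ns = (s :: nat)}"
proof (rule finite_subset)
  show "{ns. length ns = l \<and> sum_list ns = s} \<subseteq> {ns. set ns \<subseteq> {..s} \<and> length ns = l}"
    using member_le_sum_list by auto
qed (simp add: finite_lists_length_eq)

lemma shiftop_sum_lists:
  "shiftop s G as = (\<Sum>ns | length ns = length as \<and> sum_list ns = s. of_int (prod_list (map raising_coeff ns)) * G (shift_by as ns))"
proof (induction as arbitrary: s G)
  case Nil
  have "{ns. length ns = 0 \<and> sum_list ns = s} = (if s = 0 then {[]} else {})" by auto
  then show ?case by (simp add: shift_by_def)
next
  case (Cons a as)
  have "shiftop s G (a # as) = (\<Sum>n\<le>s. \<Sum>ns | length ns = length as \<and> sum_list ns = s - n.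
      of_int (raising_coeff n) * (of_int (prod_list (map raising_coeff ns)) * G ((a + int n) # shift_by as ns)))"
    by (simp add: Cons.IH sum_distrib_left)
  also have "\<dots> = (\<Sum>(n, ns)\<in>(SIGMA n:{..s}. {ns. length ns = length as \<and> sum_list ns = s - n}).
      of_int (raising_coeff n) * (of_int (prod_list (map raising_coeff ns)) * G ((a + int n) # shift_by as ns)))"
    by (intro sum.Sigma) (auto simp: finite_lists_sum)
  also have "\<dots> = (\<Sum>ns | length ns = length (a # as) \<and> sum_list ns = s.
      of_int (prod_list (map raising_coeff ns)) * G (shift_by (a # as) ns))"
    by (rule sum.reindex_bij_witness[of _ "\<lambda>ns. (hd ns, tl ns)" "\<lambda>(n, ns). n # ns"])
       (auto simp: shift_by_def length_Suc_conv mult_ac)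
  finally show ?case .
qed

text \<open>A raising monomial splits uniquely into its last column and a monomial for the shorter
  sequence, and the columns with sum \<open>s\<close> make up \<open>shiftop s\<close>. Finiteness
  of the support is part of the induction because a sum over an infinite set would be
  \<open>0\<close>.\<close>

lemma sum_raise_Qr:
  assumes "length fs = length as" "\<And>f. f \<in> set fs \<Longrightarrow> neg_zero f"
  shows "finite (raise_supp fs as) \<and> sum (raise_term fs as) (raise_supp fs as) = Qr (rev fs) (rev as)"
  using assms
proof (induction fs arbitrary: as rule: rev_induct)
  case Nil
  have "raise_supp [] [] = {0}"
    by (auto simp: raise_supp_def raising_pairs_def raise_term_def)
  then show ?case using Nil by (simp add: raise_term_def raising_pairs_def)
next
  case (snoc f fs bs)
  obtain as a where bs: "bs = as @ [a]" using snoc.prems(1) by (cases bs rule: rev_cases) auto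
  define l where "l = length fs"
  have l: "length fs = l" "length as = l" using snoc.prems bs by (auto simp: l_def)
  \<comment> \<open>Columns with a larger sum give the last row a negative argument and contribute
    nothing.\<close>
  define A where "A = {ns :: nat list. length ns = l \<and> sum_list ns \<le> nat a}"
  have A: "A = (\<Union>s\<le>nat a. {ns. length ns = l \<and> sum_list ns = s})" by (auto simp: A_def)
  have fA: "finite A" unfolding A by (auto simp: finite_lists_sum)
  have fn: "neg_zero f" using snoc.prems by auto
  have IH: "finite (raise_supp fs (shift_by as ns))"
    "sum (raise_term fs (shift_by as ns)) (raise_supp fs (shift_by as ns)) = Qr (rev fs) (rev (shift_by as ns))"
    if "ns \<in> A" for ns
    using snoc.IH[of "shift_by as ns"] snoc.prems that l by (auto simp: shift_by_def A_def)
  define P where "P = (SIGMA ns:A. raise_supp fs (shift_by as ns))"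
  have fP: "finite P" unfolding P_def using fA IH by auto
  define T where "T = (\<lambda>(ns, N). of_int (prod_list (map raising_coeff ns)) * f (a - int (sum_list ns)) * raise_term fs (shift_by as ns) N)"
  define j where "j = (\<lambda>N. (map (\<lambda>i. Poly_Mapping.lookup N (i, l)) [0..<l], N - last_col l (map (\<lambda>i. Poly_Mapping.lookup N (i, l)) [0..<l])))"
  define i where "i = (\<lambda>(ns, N). N + last_col l ns)"
  have T: "raise_term (fs @ [f]) (as @ [a]) (i (ns, N)) = T (ns, N)"
    if "Poly_Mapping.keys N \<subseteq> raising_pairs l" "length ns = l" for ns N
    using raise_term_snoc[OF that(1) l that(2)] by (simp add: i_def T_def)
  have ij: "i (j N) = N \<and> Poly_Mapping.keys (snd (j N)) \<subseteq> raising_pairs l \<and> length (fst (j N)) = l"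
    if N: "Poly_Mapping.keys N \<subseteq> raising_pairs (Suc l)" for N
  proof -
    let ?c = "last_col l (map (\<lambda>i. Poly_Mapping.lookup N (i, l)) [0..<l])"
    have N0: "Poly_Mapping.lookup N (u, v) = 0" if "\<not> (u < v \<and> v < Suc l)" for u v
      using N that by (auto simp: raising_pairs_def in_keys_iff subset_iff)
    have c: "Poly_Mapping.lookup ?c (u, v) = (if v = l then Poly_Mapping.lookup N (u, v) else 0)" for u v
      by (auto simp: lookup_last_col N0)
    have "N - ?c + ?c = N"
    proof (rule poly_mapping_eqI)
      fix e show "Poly_Mapping.lookup (N - ?c + ?c) e = Poly_Mapping.lookup N e"
        by (cases e) (simp add: lookup_add lookup_minus c)
    qed
    moreover have "Poly_Mapping.keys (N - ?c) \<subseteq> raising_pairs l"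
    proof
      fix e assume "e \<in> Poly_Mapping.keys (N - ?c)"
      then have nz: "Poly_Mapping.lookup (N - ?c) e \<noteq> 0" by (simp add: in_keys_iff)
      obtain u v where e: "e = (u, v)" by (cases e)
      have "v \<noteq> l" "Poly_Mapping.lookup N (u, v) \<noteq> 0" using nz by (auto simp: e lookup_minus c split: if_splits)
      moreover then have "u < v \<and> v < Suc l" using N0[of u v] by argo
      ultimately show "e \<in> raising_pairs l" by (auto simp: e raising_pairs_def)
    qed
    ultimately show ?thesis by (simp add: i_def j_def)
  qed
  have ji: "j (i (ns, N)) = (ns, N) \<and> Poly_Mapping.keys (i (ns, N)) \<subseteq> raising_pairs (Suc l)"
    if N: "Poly_Mapping.keys N \<subseteq> raising_pairs l" "length ns = l" for ns N
  proof -
    have N0: "Poly_Mapping.lookup N (u, v) = 0" if "\<not> (u < v \<and> v < l)" for u v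
      using N that by (auto simp: raising_pairs_def in_keys_iff subset_iff)
    have "map (\<lambda>i. Poly_Mapping.lookup (N + last_col l ns) (i, l)) [0..<l] = ns"
      using N by (intro nth_equalityI) (auto simp: lookup_add lookup_last_col N0)
    moreover have "Poly_Mapping.keys (N + last_col l ns) \<subseteq> raising_pairs (Suc l)"
    proof
      fix e assume "e \<in> Poly_Mapping.keys (N + last_col l ns)"
      then have nz: "Poly_Mapping.lookup (N + last_col l ns) e \<noteq> 0" by (simp add: in_keys_iff)
      obtain u v where e: "e = (u, v)" by (cases e)
      show "e \<in> raising_pairs (Suc l)"
      proof (cases "v = l \<and> u < l")
        case False
        then have "Poly_Mapping.lookup N (u, v) \<noteq> 0" using nz by (auto simp: e lookup_add lookup_last_col)
        then have "u < v \<and> v < l" using N0[of u v] by argo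
        then show ?thesis by (auto simp: e raising_pairs_def)
      qed (auto simp: e raising_pairs_def)
    qed
    ultimately show ?thesis by (simp add: i_def j_def)
  qed
  have supp: "raise_supp (fs @ [f]) (as @ [a]) \<subseteq> i ` P"
  proof
    fix N assume "N \<in> raise_supp (fs @ [f]) (as @ [a])"
    then have N: "Poly_Mapping.keys N \<subseteq> raising_pairs (Suc l)" "raise_term (fs @ [f]) (as @ [a]) N \<noteq> 0"
      using l by (auto simp: raise_supp_def)
    obtain ns N' where jN: "j N = (ns, N')" by (cases "j N")
    have nN: "N = i (ns, N')" "Poly_Mapping.keys N' \<subseteq> raising_pairs l" "length ns = l"
      using ij[OF N(1)] jN by auto
    then have nz: "T (ns, N') \<noteq> 0" using T N by simp
    then have "f (a - int (sum_list ns)) \<noteq> 0" by (auto simp: T_def)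
    then have "\<not> a - int (sum_list ns) < 0" using fn by (auto simp: neg_zero_def)
    then have "ns \<in> A" using nN by (auto simp: A_def)
    moreover have "length (shift_by as ns) = l" using nN l by (simp add: shift_by_def)
    then have "N' \<in> raise_supp fs (shift_by as ns)" using nz nN by (auto simp: raise_supp_def T_def)
    ultimately show "N \<in> i ` P" using nN by (auto simp: P_def)
  qed
  have PI: "length ns = l" "Poly_Mapping.keys N \<subseteq> raising_pairs l" if "(ns, N) \<in> P" for ns N
  proof -
    show ns: "length ns = l" using that by (auto simp: P_def A_def)
    then have "length (shift_by as ns) = l" using l by (simp add: shift_by_def)
    then show "Poly_Mapping.keys N \<subseteq> raising_pairs l" using that by (auto simp: P_def raise_supp_def)
  qed
  have inj: "inj_on i P"
  proof (rule inj_on_inverseI)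
    fix x assume "x \<in> P"
    then show "j (i x) = x" using ji PI by (cases x) auto
  qed
  have "sum (raise_term (fs @ [f]) (as @ [a])) (raise_supp (fs @ [f]) (as @ [a])) = sum (raise_term (fs @ [f]) (as @ [a])) (i ` P)"
  proof (rule sum.mono_neutral_left)
    show "\<forall>N\<in>i ` P - raise_supp (fs @ [f]) (as @ [a]). raise_term (fs @ [f]) (as @ [a]) N = 0"
    proof
      fix N assume N: "N \<in> i ` P - raise_supp (fs @ [f]) (as @ [a])"
      then obtain ns N' where "N = i (ns, N')" "(ns, N') \<in> P" by auto
      then have "Poly_Mapping.keys N \<subseteq> raising_pairs (Suc l)" using ji PI by auto
      then show "raise_term (fs @ [f]) (as @ [a]) N = 0" using N l by (auto simp: raise_supp_def)
    qed
  qed (use fP supp in auto)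
  also have "\<dots> = sum T P"
    unfolding sum.reindex[OF inj] o_def using T PI by (intro sum.cong) auto
  also have "\<dots> = (\<Sum>ns\<in>A. of_int (prod_list (map raising_coeff ns)) * f (a - int (sum_list ns)) * Qr (rev fs) (rev (shift_by as ns)))"
    unfolding P_def T_def using fA IH by (subst sum.Sigma[symmetric]) (auto simp: sum_distrib_left[symmetric])
  also have "\<dots> = (\<Sum>s\<le>nat a. \<Sum>ns | length ns = l \<and> sum_list ns = s. of_int (prod_list (map raising_coeff ns)) * f (a - int s) * Qr (rev fs) (rev (shift_by as ns)))"
    unfolding A by (subst sum.UNION_disjoint) (auto simp: finite_lists_sum intro!: sum.cong)
  also have "\<dots> = (\<Sum>s\<le>nat a. f (a - int s) * shiftop s (Qr (rev fs)) (rev as))"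
  proof (intro sum.cong refl)
    fix s
    have "shiftop s (Qr (rev fs)) (rev as) = (\<Sum>ns | length ns = l \<and> sum_list ns = s. of_int (prod_list (map raising_coeff ns)) * Qr (rev fs) (shift_by (rev as) ns))"
      using l by (simp add: shiftop_sum_lists)
    also have "\<dots> = (\<Sum>ns | length ns = l \<and> sum_list ns = s. of_int (prod_list (map raising_coeff ns)) * Qr (rev fs) (rev (shift_by as ns)))"
      by (rule sum.reindex_bij_witness[of _ rev rev])
         (use l in \<open>auto simp: shift_by_rev prod_list.rev simp flip: rev_map\<close>)
    finally show "(\<Sum>ns | length ns = l \<and> sum_list ns = s. of_int (prod_list (map raising_coeff ns)) * f (a - int s) * Qr (rev fs) (rev (shift_by as ns))) =
        f (a - int s) * shiftop s (Qr (rev fs)) (rev as)"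
      by (simp add: sum_distrib_left mult_ac)
  qed
  finally have "sum (raise_term (fs @ [f]) (as @ [a])) (raise_supp (fs @ [f]) (as @ [a])) = Qr (f # rev fs) (a # rev as)" by simp
  moreover have "finite (raise_supp (fs @ [f]) (as @ [a]))" using supp fP by (meson finite_imageI finite_subset)
  ultimately show ?case unfolding bs by simp
qed

lemma multi_Q_Qr:
  "multi_Q \<rho> \<beta> as = Qr (rev (map (\<lambda>i. multi_c (nth_default 0 \<rho> i) (nth_default 0 \<beta> i)) [0..<length as])) (rev as)"
  unfolding multi_Q_raise
  by (rule sum_raise_Qr[THEN conjunct2]) (auto simp: neg_zero_def multi_c_neg)

section \<open>Rows\<close>

definition efps :: "nat \<Rightarrow> (nat \<Rightarrow> gxy) \<Rightarrow> gxy fps" where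
  "efps n z = (\<Prod>i\<in>{1..n}. 1 + fps_const (z i) * fps_X)"

lemma prod_one_plus:
  fixes g :: "'b \<Rightarrow> 'a::comm_ring_1"
  assumes "finite A" shows "(\<Prod>i\<in>A. 1 + g i) = (\<Sum>B\<in>Pow A. \<Prod>i\<in>B. g i)"
  using prod_add[OF assms, of g "\<lambda>_. 1"] by (simp add: add.commute)

lemma fps_const_prod: "(\<Prod>i\<in>B. fps_const (z i)) = fps_const (\<Prod>i\<in>B. z i :: gxy)"
  by (induction B rule: infinite_finite_induct) auto

lemma efps_nth: "fps_nth (efps n z) j = esym n j z"
proof -
  have "efps n z = (\<Sum>B\<in>Pow {1..n}. fps_const (\<Prod>i\<in>B. z i) * fps_X ^ card B)"
    unfolding efps_def by (subst prod_one_plus) (auto simp: prod.distrib fps_const_prod)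
  then have "fps_nth (efps n z) j = (\<Sum>B\<in>Pow {1..n}. if card B = j then \<Prod>i\<in>B. z i else 0)"
    by (auto simp: fps_sum_nth intro!: sum.cong)
  also have "\<dots> = (\<Sum>B | B \<subseteq> {1..n} \<and> card B = j. \<Prod>i\<in>B. z i)"
    by (intro sum.mono_neutral_cong_right) auto
  finally show ?thesis by (simp add: esym_def)
qed

lemma efps_Suc: "efps (Suc n) z = efps n z * (1 + fps_const (z (Suc n)) * fps_X)"
  by (simp add: efps_def)

text \<open>The generating function of \<open>multi_c k (- r)\<close>. Only \<rho> \<ge> 0 and
  \<beta> \<le> 0 occur in the theorem, so both families of symmetric polynomials are
  elementary.\<close>

definition rowfps :: "nat \<Rightarrow> nat \<Rightarrow> gxy fps" where
  "rowfps k r = cfps * efps k xg * efps r (\<lambda>l. - yg l)"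

definition row :: "nat \<Rightarrow> nat \<Rightarrow> int \<Rightarrow> gxy" where
  "row k r p = (if p < 0 then 0 else fps_nth (rowfps k r) (nat p))"

lemma neg_zero_row: "neg_zero (row k r)"
  by (simp add: neg_zero_def row_def)

lemma hgen_neg: "hgen (- int n) j z = esym n j z"
proof (cases "n = 0")
  \<comment> \<open>For \<open>n = 0\<close> the sign test in \<open>hgen\<close> selects the
    complete polynomials; without variables these agree with the elementary ones.\<close>
  case True
  have "{M :: nat multiset. set_mset M \<subseteq> {1..0} \<and> size M = j} = (if j = 0 then {{#}} else {})" by auto
  moreover have "{A :: nat set. A \<subseteq> {1..0} \<and> card A = j} = (if j = 0 then {{}} else {})" by auto
  ultimately show ?thesis using True by (simp add: hgen_def hsym_def esym_def)
qed (simp add: hgen_def)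

lemma multi_c_row: "multi_c (int k) (- int r) p = row k r p"
proof (cases "p < 0")
  case True
  then show ?thesis by (simp add: row_def multi_c_neg)
next
  case False
  define n where "n = nat p"
  have n: "p = int n" using False by (simp add: n_def)
  have cgz: "cg q \<noteq> 0 \<Longrightarrow> 0 \<le> q" for q using cg_nonpos(1)[of q] by force
  let ?g = "\<lambda>i j. esym k i xg * esym r j (\<lambda>l. - yg l)"
  have "fps_nth (rowfps k r) n = fps_nth ((efps k xg * efps r (\<lambda>l. - yg l)) * cfps) n"
    by (simp add: rowfps_def mult_ac)
  also have "\<dots> = (\<Sum>s=0..n. (\<Sum>i=0..s. ?g i (s - i)) * cg (int (n - s)))"
    by (simp add: fps_mult_nth efps_nth cfps_def)
  also have "\<dots> = (\<Sum>s\<le>n. \<Sum>i\<le>s. ?g i (s - i) * cg (int (n - s)))"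
    by (simp add: sum_distrib_right atMost_atLeast0)
  also have "\<dots> = (\<Sum>s\<le>n. \<Sum>i\<le>s. cg (p - int i - int (s - i)) * esym k i xg * esym r (s - i) (\<lambda>l. - yg l))"
    by (intro sum.cong refl) (auto simp: n of_nat_diff mult_ac)
  also have "\<dots> = (\<Sum>(i, j)\<in>{(i, j). i + j \<le> n}. cg (p - int i - int j) * esym k i xg * esym r j (\<lambda>l. - yg l))"
    by (rule sum.triangle_reindex_eq[symmetric])
  also have "\<dots> = (\<Sum>(i, j)\<in>{..n} \<times> {..n}. cg (p - int i - int j) * esym k i xg * esym r j (\<lambda>l. - yg l))"
    by (intro sum.mono_neutral_left) (auto simp: n, drule cgz, linarith)
  finally show ?thesis
    using False by (simp add: row_def multi_c_def n_def[symmetric] hgen_neg sum.cartesian_product)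
qed

lemma nth_mult_linear: "fps_nth (F * (1 + fps_const (z :: gxy) * fps_X)) n = fps_nth F n + z * (if n = 0 then 0 else fps_nth F (n - 1))"
proof -
  have "F * (1 + fps_const z * fps_X) = F + fps_const z * (fps_X * F)" by (simp add: algebra_simps)
  then show ?thesis by simp
qed

lemma row_Suc_x: "row (Suc k) r p = row k r p + xg (Suc k) * row k r (p - 1)"
proof -
  have "rowfps (Suc k) r = rowfps k r * (1 + fps_const (xg (Suc k)) * fps_X)"
    by (simp add: rowfps_def efps_Suc mult_ac)
  then show ?thesis by (auto simp: row_def nth_mult_linear nat_diff_distrib)
qed

lemma row_Suc_y: "row k (Suc r) p = row k r p + (- yg (Suc r)) * row k r (p - 1)"
proof -
  have "rowfps k (Suc r) = rowfps k r * (1 + fps_const (- yg (Suc r)) * fps_X)"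
    by (simp only: rowfps_def efps_Suc mult_ac)
  then show ?thesis by (auto simp: row_def nth_mult_linear nat_diff_distrib simp del: fps_const_neg)
qed

lemma efps_nth_0: "fps_nth (efps n z) 0 = 1"
  by (induction n) (simp_all add: efps_Suc nth_mult_linear, simp add: efps_def)

definition fps_deg_le :: "gxy fps \<Rightarrow> nat \<Rightarrow> bool" where
  "fps_deg_le F d \<longleftrightarrow> (\<forall>n>d. fps_nth F n = 0)"

lemma fps_deg_le_mult:
  assumes "fps_deg_le F d" "fps_deg_le G e" shows "fps_deg_le (F * G) (d + e)"
  unfolding fps_deg_le_def
proof (intro allI impI)
  fix n assume "n > d + e"
  then have "i > d \<or> n - i > e" for i by auto
  then have "fps_nth F i * fps_nth G (n - i) = 0" for i
    using assms by (metis fps_deg_le_def mult_eq_0_iff)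
  then show "fps_nth (F * G) n = 0" unfolding fps_mult_nth by (intro sum.neutral) blast
qed

lemma efps_deg: "fps_deg_le (efps n z) n"
proof (induction n)
  case (Suc n)
  have "fps_deg_le (1 + fps_const (z (Suc n)) * fps_X) 1" by (auto simp: fps_deg_le_def fps_X_def)
  from fps_deg_le_mult[OF Suc this] show ?case by (simp add: efps_Suc)
qed (simp add: efps_def fps_deg_le_def)

lemma fps_flip_deg: "fps_deg_le F d \<Longrightarrow> fps_deg_le (fps_flip F) d"
  by (simp add: fps_deg_le_def fps_flip_def)

lemma cfps_flip: "cfps * fps_flip cfps = 1"
  using cg_relations unfolding gamma_relations_iff cfps_def by blast

text \<open>By \<open>c(t) c(-t) = 1\<close> the factor \<open>c\<close> drops out of
  \<open>f(t) f(-t)\<close>, which leaves a polynomial in \<open>t\<close> of degree at most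
  \<open>2 (k + r)\<close>.\<close>

lemma flip_coeff_row:
  assumes "m > 2 * (k + r)" shows "flip_coeff (row k r) m = 0"
proof -
  have "flip_coeff (row k r) m = fps_nth (fps_flip (rowfps k r) * rowfps k r) m"
  proof -
    have "row k r (int j) = fps_nth (rowfps k r) j" for j by (simp add: row_def)
    moreover have "row k r (int m - int j) = fps_nth (rowfps k r) (m - j)" if "j \<le> m" for j
      using that by (simp add: row_def nat_diff_distrib)
    ultimately show ?thesis
      unfolding flip_coeff_def fps_mult_nth atMost_atLeast0 by (intro sum.cong) (auto simp: fps_flip_def)
  qed
  also have "fps_flip (rowfps k r) * rowfps k r =
      (cfps * fps_flip cfps) * ((fps_flip (efps k xg) * efps k xg) * (fps_flip (efps r (\<lambda>l. - yg l)) * efps r (\<lambda>l. - yg l)))"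
    by (simp only: rowfps_def fps_flip_mult mult_ac)
  also have "\<dots> = (fps_flip (efps k xg) * efps k xg) * (fps_flip (efps r (\<lambda>l. - yg l)) * efps r (\<lambda>l. - yg l))"
    by (simp add: cfps_flip)
  finally show ?thesis
    using fps_deg_le_mult[OF fps_deg_le_mult[OF fps_flip_deg[OF efps_deg] efps_deg] fps_deg_le_mult[OF fps_flip_deg[OF efps_deg] efps_deg], of k xg k xg r "\<lambda>l. - yg l" r "\<lambda>l. - yg l"] assms
    by (auto simp: fps_deg_le_def)
qed

lemma fmap_efps:
  assumes "is_ring_hom h" shows "fmap h (efps n z) = efps n (\<lambda>i. h (z i))"
proof -
  note h = is_ring_homD[OF is_ring_hom_fmap[OF assms]]
  show ?thesis
    unfolding efps_def is_ring_hom_prod[OF is_ring_hom_fmap[OF assms]]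
    by (simp add: h fmap_const[OF assms] fmap_X[OF assms])
qed

lemma efps_cong: "(\<And>i. 1 \<le> i \<Longrightarrow> i \<le> n \<Longrightarrow> z i = z' i) \<Longrightarrow> efps n z = efps n z'"
  unfolding efps_def by (intro prod.cong) auto

lemma weyl_efps_x:
  assumes "i \<ge> 1" "k \<noteq> i" shows "fmap (weyl_act i) (efps k xg) = efps k xg"
proof -
  have "fmap (weyl_act i) (efps k xg) = efps k (\<lambda>j. xg (transpose i (i + 1) j))"
    unfolding fmap_efps[OF weyl_hom] using assms by (intro efps_cong) (simp add: weyl_x)
  also have "\<dots> = efps k xg"
  proof (cases "i < k")
    case True
    then have "transpose i (i + 1) permutes {1..k}" using assms by (intro permutes_swap_id) auto
    then show ?thesis unfolding efps_def by (rule prod.permute[symmetric, unfolded o_def])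
  next
    case False
    then show ?thesis using assms by (intro efps_cong) (auto simp: transpose_def)
  qed
  finally show ?thesis .
qed

lemma weyl_efps_y: "fmap (weyl_act i) (efps r (\<lambda>l. - yg l)) = efps r (\<lambda>l. - yg l)"
  unfolding fmap_efps[OF weyl_hom] by (intro efps_cong) (simp add: weyl_simps weyl_y)

text \<open>For \<open>i \<ge> 1\<close> the product of the \<open>1 + x_j t\<close> with
  \<open>j \<le> k\<close> is symmetric in \<open>x_i\<close> and \<open>x_(i+1)\<close> or contains
  neither. For \<open>i = 0\<close>, \<open>s_0\<close> turns \<open>(1 + x_1 t) c(t)\<close> into
  \<open>(1 - x_1 t) c(t) (1 + x_1 t) / (1 - x_1 t)\<close>.\<close>

lemma weyl_row_fixed: assumes "k \<noteq> i" shows "weyl_act i (row k r p) = row k r p"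
proof -
  note h = is_ring_homD(3)[OF is_ring_hom_fmap[OF weyl_hom]]
  have "fmap (weyl_act i) (rowfps k r) = rowfps k r"
  proof (cases "i = 0")
    case False
    then show ?thesis using assms unfolding rowfps_def h weyl_efps_y
      by (simp add: weyl_efps_x weyl_cfps)
  next
    case True
    then obtain l where k: "k = Suc l" using assms by (cases k) auto
    let ?E = "\<Prod>j\<in>{2..k}. 1 + fps_const (xg j) * fps_X"
    have s: "{1..k} = insert 1 {2..k}" using k by auto
    have e: "efps k xg = (1 + fps_const (xg 1) * fps_X) * ?E" unfolding efps_def s by simp
    have "fmap (weyl_act 0) ?E = ?E"
      unfolding is_ring_hom_prod[OF is_ring_hom_fmap[OF weyl_hom]]
      by (intro prod.cong refl) (simp add: is_ring_homD[OF is_ring_hom_fmap[OF weyl_hom]] fmap_const[OF weyl_hom] fmap_X[OF weyl_hom] weyl_x)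
    moreover have "fmap (weyl_act 0) (1 + fps_const (xg 1) * fps_X) = 1 - fps_const (xg 1) * fps_X"
      by (simp add: is_ring_homD[OF is_ring_hom_fmap[OF weyl_hom]] fmap_const[OF weyl_hom] fmap_X[OF weyl_hom] weyl_x flip: fps_const_neg)
    ultimately have "fmap (weyl_act 0) (efps k xg) = (1 - fps_const (xg 1) * fps_X) * ?E"
      unfolding e h by simp
    then have "fmap (weyl_act 0) (rowfps k r) = ((1 - fps_const (xg 1) * fps_X) * kfps (xg 1)) * (cfps * ?E * efps r (\<lambda>l. - yg l))"
      unfolding rowfps_def h weyl_efps_y weyl_cfps_0 by (simp only: mult_ac)
    then show ?thesis unfolding True kfps_mult by (simp only: rowfps_def e mult_ac)
  qed
  from arg_cong[OF this, of "\<lambda>F. fps_nth F (nat p)"] show ?thesis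
    by (simp add: row_def weyl_simps)
qed

text \<open>\<open>row i\<close> is the invariant \<open>row (i - 1)\<close> plus \<open>x_i\<close>
  times its shift, and \<open>ddx i\<close> takes \<open>x_i\<close> to \<open>1\<close>.\<close>

lemma ddx_row:
  assumes "i \<ge> 1" shows "ddx i (row i r p) = row (i - 1) r (p - 1)"
proof -
  obtain k where k: "i = Suc k" using assms by (cases i) auto
  have "ddx i (xg i) = 1"
    by (rule ddx_unique) (use assms in \<open>simp add: weyl_x root_def\<close>)
  moreover have "weyl_act i (row k r q) = row k r q" for q by (rule weyl_row_fixed) (simp add: k)
  ultimately show ?thesis
    by (simp add: k row_Suc_x ddx_add ddx_mult_right ddx_eq_0_iff)
qed

text \<open>The row left by \<open>ddx 0\<close>: the factor \<open>1 / (1 - x_1 t)\<close> comes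
  from \<open>kfps x_1 - 1 = 2 x_1 t / (1 - x_1 t)\<close>. What matters later is its value
  \<open>1\<close> at index \<open>0\<close>, by which the row disappears.\<close>

definition row0 :: "nat \<Rightarrow> int \<Rightarrow> gxy" where
  "row0 r p = (if p < 0 then 0 else fps_nth (Abs_fps (\<lambda>n. xg 1 ^ n) * rowfps 0 r) (nat p))"

lemma row0_0: "row0 r 0 = 1"
  by (simp add: row0_def rowfps_def cfps_def efps_nth_0 cg_nonpos)

lemma neg_zero_row0: "neg_zero (row0 r)"
  by (simp add: neg_zero_def row0_def)

lemma ddx_row0: "ddx 0 (row 0 r p) = row0 r (p - 1)"
proof (rule ddx_unique)
  note h = is_ring_homD(3)[OF is_ring_hom_fmap[OF weyl_hom]]
  define G where "G = Abs_fps (\<lambda>n. xg 1 ^ n) * rowfps 0 r"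
  have "kfps (xg 1) = 1 + fps_const (2 * xg 1) * (fps_X * Abs_fps (\<lambda>n. xg 1 ^ n))"
  proof (rule fps_ext)
    fix n show "fps_nth (kfps (xg 1)) n = fps_nth (1 + fps_const (2 * xg 1) * (fps_X * Abs_fps (\<lambda>n. xg 1 ^ n))) n"
      by (cases n) (simp_all add: kfps_def mult.assoc)
  qed
  moreover have "fmap (weyl_act 0) (rowfps 0 r) = kfps (xg 1) * rowfps 0 r"
    unfolding rowfps_def h weyl_efps_y weyl_cfps_0 by (simp add: fmap_efps[OF weyl_hom] efps_def is_ring_homD(1)[OF is_ring_hom_fmap[OF weyl_hom]] mult_ac)
  ultimately have "rowfps 0 r - fmap (weyl_act 0) (rowfps 0 r) = fps_const (- 2 * xg 1) * (fps_X * G)"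
    by (simp add: G_def algebra_simps flip: fps_const_neg)
  from arg_cong[OF this, of "\<lambda>F. fps_nth F (nat p)"]
  show "row 0 r p - weyl_act 0 (row 0 r p) = row0 r (p - 1) * root 0"
    by (auto simp: row_def row0_def root_def weyl_simps G_def nat_diff_distrib mult.commute)
qed

text \<open>\<open>omega\<close> exchanges the two families of factors, so the rules for
  \<open>ddy\<close> follow from those for \<open>ddx\<close>.\<close>

lemma omega_row: "omega (row k r p) = row r k p"
proof -
  have "fmap omega (rowfps k r) = rowfps r k"
  proof -
    have "fmap omega (efps k xg) = efps k (\<lambda>l. - yg l)"
      unfolding fmap_efps[OF omega(1)] by (intro efps_cong) (simp add: omega)
    moreover have "fmap omega (efps r (\<lambda>l. - yg l)) = efps r xg"
      unfolding fmap_efps[OF omega(1)] by (intro efps_cong) (simp add: omega omega_simps)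
    ultimately show ?thesis
      by (simp only: rowfps_def is_ring_homD(3)[OF is_ring_hom_fmap[OF omega(1)]] omega_cfps mult_ac)
  qed
  from arg_cong[OF this, of "\<lambda>F. fps_nth F (nat p)"] show ?thesis
    by (simp add: row_def omega_simps)
qed

lemma commuting_ddx_row: "k \<noteq> i \<Longrightarrow> commuting (ddx i) (row k r p)"
  unfolding commuting_def by (intro allI ddx_mult_left weyl_row_fixed)

lemma commuting_ddy_row: "r \<noteq> i \<Longrightarrow> commuting (ddy i) (row k r p)"
  unfolding commuting_def ddy_def
  by (simp add: omega_simps omega_row ddx_mult_left weyl_row_fixed)

lemma ddy_row: "i \<ge> 1 \<Longrightarrow> ddy i (row k i p) = row k (i - 1) (p - 1)"
  by (simp add: ddy_def omega_row ddx_row)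

lemma ddy_row0: "ddy 0 (row k 0 p) = omega (row0 k (p - 1))"
  by (simp add: ddy_def omega_row ddx_row0)

section \<open>The Pfaffians attached to sets of values\<close>

text \<open>For \<open>v \<ge> 1\<close> the row of \<open>v\<close> has \<open>\<beta> = 1 - v\<close>. The truncated subtraction makes \<open>v = 0\<close> a junk value.\<close>

definition Pf :: "(nat \<Rightarrow> nat) \<Rightarrow> nat list \<Rightarrow> gxy" where
  "Pf \<rho> vs = Qr (map (\<lambda>v. row (\<rho> v) (v - 1)) vs) (map (\<lambda>v. int (v + \<rho> v)) vs)"

lemma Pf_cong: "(\<And>v. v \<in> set vs \<Longrightarrow> \<rho> v = \<rho>' v) \<Longrightarrow> Pf \<rho> vs = Pf \<rho>' vs"
  unfolding Pf_def by (intro arg_cong2[of _ _ _ _ Qr] map_cong) auto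

lemma Pf_split: "Pf \<rho> (us @ v # ws) =
    Qr (map (\<lambda>v. row (\<rho> v) (v - 1)) us @ row (\<rho> v) (v - 1) # map (\<lambda>v. row (\<rho> v) (v - 1)) ws)
      (map (\<lambda>v. int (v + \<rho> v)) us @ int (v + \<rho> v) # map (\<lambda>v. int (v + \<rho> v)) ws)"
  by (simp add: Pf_def)

lemma Pf_upd:
  assumes "v \<notin> set us" "v \<notin> set ws"
  shows "Pf (\<rho>(v := k)) (us @ v # ws) =
    Qr (map (\<lambda>v. row (\<rho> v) (v - 1)) us @ row k (v - 1) # map (\<lambda>v. row (\<rho> v) (v - 1)) ws)
      (map (\<lambda>v. int (v + \<rho> v)) us @ int (v + k) # map (\<lambda>v. int (v + \<rho> v)) ws)"
proof -
  have A: "map (\<lambda>u. row ((\<rho>(v := k)) u) (u - 1)) xs = map (\<lambda>v. row (\<rho> v) (v - 1)) xs"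
    and B: "map (\<lambda>u. int (u + (\<rho>(v := k)) u)) xs = map (\<lambda>v. int (v + \<rho> v)) xs" if "v \<notin> set xs" for xs
    using that by (auto intro!: map_cong)
  show ?thesis unfolding Pf_split A[OF assms(1)] A[OF assms(2)] B[OF assms(1)] B[OF assms(2)] fun_upd_same ..
qed

lemmas D_Qr_x = D_Qr[OF ddx_add ddx_of_int]
lemmas D_Qr_y = D_Qr[OF ddy_add ddy_of_int]

text \<open>All rows but that of \<open>v\<close> are invariant under \<open>s_i\<close>. The part
  \<open>v + \<rho> v\<close> drops together with \<open>\<rho> v\<close>, so the result is again a
  \<open>Pf\<close>.\<close>

lemma Pf_ddx:
  assumes "i \<ge> 1" "\<rho> v = i" "v \<notin> set us" "v \<notin> set ws" "\<And>u. u \<in> set us \<union> set ws \<Longrightarrow> \<rho> u \<noteq> i"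
  shows "ddx i (Pf \<rho> (us @ v # ws)) = Pf (\<rho>(v := i - 1)) (us @ v # ws)"
proof -
  have "ddx i (Pf \<rho> (us @ v # ws)) = Qr (map (\<lambda>v. row (\<rho> v) (v - 1)) us @ (\<lambda>p. row (i - 1) (v - 1) (p - 1)) # map (\<lambda>v. row (\<rho> v) (v - 1)) ws)
      (map (\<lambda>v. int (v + \<rho> v)) us @ int (v + \<rho> v) # map (\<lambda>v. int (v + \<rho> v)) ws)"
    unfolding Pf_split
  proof (rule D_Qr_x)
    show "ddx i (row (\<rho> v) (v - 1) p) = row (i - 1) (v - 1) (p - 1)" for p
      using assms by (simp add: ddx_row)
  qed (use assms in \<open>auto intro: commuting_ddx_row\<close>)
  also have "\<dots> = Qr (map (\<lambda>v. row (\<rho> v) (v - 1)) us @ row (i - 1) (v - 1) # map (\<lambda>v. row (\<rho> v) (v - 1)) ws)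
      (map (\<lambda>v. int (v + \<rho> v)) us @ (int (v + \<rho> v) - 1) # map (\<lambda>v. int (v + \<rho> v)) ws)"
    by (intro Qr_row_shift neg_zero_row) simp
  also have "int (v + \<rho> v) - 1 = int (v + (i - 1))" using assms by simp
  finally show ?thesis unfolding Pf_upd[OF assms(3,4)] .
qed

lemma Pf_ddx_0: "(\<And>v. v \<in> set vs \<Longrightarrow> \<rho> v \<noteq> i) \<Longrightarrow> ddx i (Pf \<rho> vs) = 0"
  unfolding Pf_def by (rule D_Qr_0[OF ddx_add ddx_of_int])
    (auto intro: commuting_ddx_row simp: ddx_eq_0_iff weyl_simps)

lemma Pf_ddy_0: "(\<And>v. v \<in> set vs \<Longrightarrow> v \<noteq> Suc i) \<Longrightarrow> (\<And>v. v \<in> set vs \<Longrightarrow> v \<ge> 1) \<Longrightarrow> ddy i (Pf \<rho> vs) = 0"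
  unfolding Pf_def
proof (rule D_Qr_0[OF ddy_add ddy_of_int])
  show "ddy i 1 = 0" by (simp add: ddy_eq_0_iff is_ring_homD[OF weyl_y_hom])
  fix g p assume "\<And>v. v \<in> set vs \<Longrightarrow> v \<noteq> Suc i" "\<And>v. v \<in> set vs \<Longrightarrow> v \<ge> 1"
    and "g \<in> set (map (\<lambda>v. row (\<rho> v) (v - 1)) vs)"
  then obtain v where "g = row (\<rho> v) (v - 1)" "v - 1 \<noteq> i" by fastforce
  then show "commuting (ddy i) (g p)" by (simp add: commuting_ddy_row)
qed

lemma Pf_ddy_row:
  assumes "i \<ge> 1" "Suc i \<notin> set us" "Suc i \<notin> set ws" "\<And>u. u \<in> set us \<union> set ws \<Longrightarrow> u \<ge> 1"
  shows "ddy i (Pf \<rho> (us @ Suc i # ws)) =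
    Qr (map (\<lambda>v. row (\<rho> v) (v - 1)) us @ row (\<rho> (Suc i)) (i - 1) # map (\<lambda>v. row (\<rho> v) (v - 1)) ws)
      (map (\<lambda>v. int (v + \<rho> v)) us @ int (i + \<rho> (Suc i)) # map (\<lambda>v. int (v + \<rho> v)) ws)"
proof -
  have ne: "u - 1 \<noteq> i" if "u \<in> set us \<union> set ws" for u using that assms by (metis Suc_pred' UnE less_eq_Suc_le One_nat_def)
  have "ddy i (Pf \<rho> (us @ Suc i # ws)) = Qr (map (\<lambda>v. row (\<rho> v) (v - 1)) us @ (\<lambda>p. row (\<rho> (Suc i)) (i - 1) (p - 1)) # map (\<lambda>v. row (\<rho> v) (v - 1)) ws)
      (map (\<lambda>v. int (v + \<rho> v)) us @ int (Suc i + \<rho> (Suc i)) # map (\<lambda>v. int (v + \<rho> v)) ws)"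
    unfolding Pf_split
  proof (rule D_Qr_y)
    show "ddy i (row (\<rho> (Suc i)) (Suc i - 1) p) = row (\<rho> (Suc i)) (i - 1) (p - 1)" for p
      using assms by (simp add: ddy_row)
  qed (use ne in \<open>auto intro!: commuting_ddy_row\<close>)
  also have "\<dots> = Qr (map (\<lambda>v. row (\<rho> v) (v - 1)) us @ row (\<rho> (Suc i)) (i - 1) # map (\<lambda>v. row (\<rho> v) (v - 1)) ws)
      (map (\<lambda>v. int (v + \<rho> v)) us @ (int (Suc i + \<rho> (Suc i)) - 1) # map (\<lambda>v. int (v + \<rho> v)) ws)"
    by (intro Qr_row_shift neg_zero_row) simp
  finally show ?thesis by simp
qed

lemma Pf_ddy_move:
  assumes "i \<ge> 1" "Suc i \<notin> set us \<union> set ws" "i \<notin> set us \<union> set ws" "\<And>u. u \<in> set us \<union> set ws \<Longrightarrow> u \<ge> 1"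
  shows "ddy i (Pf \<rho> (us @ Suc i # ws)) = Pf (\<rho>(i := \<rho> (Suc i))) (us @ i # ws)"
  using assms by (subst Pf_ddy_row) (auto simp: Pf_upd)

text \<open>Both sides differ from the Pfaffian with equal rows \<open>k\<close>, \<open>1 - i\<close> at \<open>i\<close> and \<open>i + 1\<close> by multiples
  of a Pfaffian with two identical rows.\<close>

lemma Pf_ddy_swap:
  assumes i: "i \<ge> 1" "Suc i \<notin> set us \<union> set ws" "i \<notin> set us \<union> set ws" "\<And>u. u \<in> set us \<union> set ws \<Longrightarrow> u \<ge> 1"
    and \<rho>: "\<rho> (Suc i) = Suc (\<rho> i)"
  shows "ddy i (Pf \<rho> (us @ i # Suc i # ws)) = Pf (\<rho>(Suc i := \<rho> i)) (us @ i # Suc i # ws)"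
proof -
  obtain j where j: "i = Suc j" using i by (cases i) auto
  have \<rho>': "\<rho> (Suc (Suc j)) = Suc (\<rho> (Suc j))" using \<rho> j by simp
  define k where "k = \<rho> i"
  define f where "f = row k j"
  define U where "U = map (\<lambda>v. row (\<rho> v) (v - 1)) us"
  define W where "W = map (\<lambda>v. row (\<rho> v) (v - 1)) ws"
  define Ua where "Ua = map (\<lambda>v. int (v + \<rho> v)) us"
  define Wa where "Wa = map (\<lambda>v. int (v + \<rho> v)) ws"
  have lU: "length Ua = length U" by (simp add: Ua_def U_def)
  define a where "a = int (i + k)"
  \<comment> \<open>Twice the part, \<open>2 (i + k) = 2 (k + j) + 2\<close>, exceeds the degree
    bound \<open>2 (k + j)\<close> of \<open>flip_coeff_row\<close>.\<close>
  have eq0: "Qr (U @ f # f # W) (Ua @ a # a # Wa) = 0"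
  proof (rule Qr_equal_rows)
    show "flip_coeff f m = 0" if "m \<ge> 2 * (k + j) + 1" for m
      unfolding f_def using that by (intro flip_coeff_row) simp
  qed (auto simp: f_def neg_zero_row a_def j lU)
  have lin: "Qr (U @ f # g # W) (Ua @ a # (a + 1) # Wa) = Qr (U @ f # f # W) (Ua @ a # (a + 1) # Wa)"
    if g: "\<And>p. g p = f p + c * f (p - 1)" for g c
  proof -
    have "Qr ((U @ [f]) @ g # W) ((Ua @ [a]) @ (a + 1) # Wa) =
        Qr ((U @ [f]) @ f # W) ((Ua @ [a]) @ (a + 1) # Wa) + c * Qr ((U @ [f]) @ (\<lambda>p. f (p - 1)) # W) ((Ua @ [a]) @ (a + 1) # Wa)"
      by (rule Qr_row_linear[OF g]) (simp add: lU)
    also have "Qr ((U @ [f]) @ (\<lambda>p. f (p - 1)) # W) ((Ua @ [a]) @ (a + 1) # Wa) = Qr ((U @ [f]) @ f # W) ((Ua @ [a]) @ (a + 1 - 1) # Wa)"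
      by (rule Qr_row_shift) (auto simp: f_def neg_zero_row lU)
    finally show ?thesis using eq0 by simp
  qed
  have "ddy i (Pf \<rho> ((us @ [i]) @ Suc i # ws)) = Qr (U @ f # row (Suc k) j # W) (Ua @ a # (a + 1) # Wa)"
    using i by (subst Pf_ddy_row) (auto simp: U_def W_def Ua_def Wa_def f_def k_def \<rho>' j a_def algebra_simps)
  also have "\<dots> = Qr (U @ f # f # W) (Ua @ a # (a + 1) # Wa)"
    unfolding f_def by (rule lin[unfolded f_def]) (rule row_Suc_x)
  also have "\<dots> = Qr (U @ f # row k (Suc j) # W) (Ua @ a # (a + 1) # Wa)"
    unfolding f_def by (rule lin[unfolded f_def, symmetric]) (rule row_Suc_y)
  also have "\<dots> = Pf (\<rho>(Suc i := \<rho> i)) ((us @ [i]) @ Suc i # ws)"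
    using i by (subst Pf_upd) (auto simp: U_def W_def Ua_def Wa_def f_def k_def j a_def algebra_simps)
  finally show ?thesis by simp
qed

lemma Qr_zero_row: "f 0 = 1 \<Longrightarrow> Qr (f # fs) (0 # as) = Qr fs as"
  by (simp add: shiftop_0)

text \<open>The row of the value 1 has part \<open>1\<close>, which \<open>ddy 0\<close> lowers to
  \<open>0\<close>; there the row has the value \<open>1\<close> and shifts nothing.\<close>

lemma Pf_ddy_remove:
  assumes "\<rho> (Suc 0) = 0" "\<And>v. v \<in> set ws \<Longrightarrow> v \<ge> 2"
  shows "ddy 0 (Pf \<rho> (Suc 0 # ws)) = Pf \<rho> ws"
proof -
  let ?g = "\<lambda>p. omega (row0 0 p)"
  have g: "neg_zero ?g" using neg_zero_row0 by (simp add: neg_zero_def omega_simps)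
  have "ddy 0 (Pf \<rho> ([] @ Suc 0 # ws)) = Qr (map (\<lambda>v. row (\<rho> v) (v - 1)) [] @ (\<lambda>p. ?g (p - 1)) # map (\<lambda>v. row (\<rho> v) (v - 1)) ws)
      (map (\<lambda>v. int (v + \<rho> v)) [] @ int (Suc 0 + \<rho> (Suc 0)) # map (\<lambda>v. int (v + \<rho> v)) ws)"
    unfolding Pf_split
  proof (rule D_Qr_y)
    show "ddy 0 (row (\<rho> (Suc 0)) (Suc 0 - 1) p) = ?g (p - 1)" for p using assms by (simp add: ddy_row0)
  qed (use assms in \<open>force intro!: commuting_ddy_row\<close>)
  also have "\<dots> = Qr (map (\<lambda>v. row (\<rho> v) (v - 1)) [] @ ?g # map (\<lambda>v. row (\<rho> v) (v - 1)) ws)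
      (map (\<lambda>v. int (v + \<rho> v)) [] @ (int (Suc 0 + \<rho> (Suc 0)) - 1) # map (\<lambda>v. int (v + \<rho> v)) ws)"
    by (rule Qr_row_shift[OF g]) simp
  also have "\<dots> = Pf \<rho> ws"
    using assms by (simp add: Qr_zero_row row0_0 omega_simps Pf_def del: Qr.simps)
  finally show ?thesis by simp
qed

lemma Pf_ddx_remove:
  assumes "\<rho> (Suc 0) = 0" "\<And>v. v \<in> set ws \<Longrightarrow> \<rho> v \<noteq> 0"
  shows "ddx 0 (Pf \<rho> (Suc 0 # ws)) = Pf \<rho> ws"
proof -
  have "ddx 0 (Pf \<rho> ([] @ Suc 0 # ws)) = Qr (map (\<lambda>v. row (\<rho> v) (v - 1)) [] @ (\<lambda>p. row0 0 (p - 1)) # map (\<lambda>v. row (\<rho> v) (v - 1)) ws)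
      (map (\<lambda>v. int (v + \<rho> v)) [] @ int (Suc 0 + \<rho> (Suc 0)) # map (\<lambda>v. int (v + \<rho> v)) ws)"
    unfolding Pf_split
  proof (rule D_Qr_x)
    show "ddx 0 (row (\<rho> (Suc 0)) (Suc 0 - 1) p) = row0 0 (p - 1)" for p using assms by (simp add: ddx_row0)
  qed (use assms in \<open>force intro!: commuting_ddx_row\<close>)
  also have "\<dots> = Qr (map (\<lambda>v. row (\<rho> v) (v - 1)) [] @ row0 0 # map (\<lambda>v. row (\<rho> v) (v - 1)) ws)
      (map (\<lambda>v. int (v + \<rho> v)) [] @ (int (Suc 0 + \<rho> (Suc 0)) - 1) # map (\<lambda>v. int (v + \<rho> v)) ws)"
    by (rule Qr_row_shift[OF neg_zero_row0]) simp
  also have "\<dots> = Pf \<rho> ws"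
    using assms by (simp add: Qr_zero_row row0_0 Pf_def del: Qr.simps)
  finally show ?thesis by simp
qed

section \<open>Degrees\<close>

text \<open>Since \<open>\<Gamma>\<close> is torsion-free, scaling the generators by powers of \<open>2\<close> detects degrees.\<close>

definition scale2 :: "gxy \<Rightarrow> gxy" where
  "scale2 = gxy_lift (\<lambda>p. 2 ^ p * cg (int p)) (\<lambda>j. 2 * xg j) (\<lambda>j. 2 * yg j)"

lemma scale2_relations: "gamma_relations (\<lambda>p. 2 ^ p * cg (int p))"
  unfolding gamma_relations_def
proof (intro conjI allI impI)
  fix p :: nat assume p: "p \<ge> 1"
  have "(-1) ^ i * (2 ^ (p + i) * cg (int (p + i))) * (2 ^ (p - i) * cg (int (p - i))) =
      2 ^ (2 * p) * ((-1) ^ i * cg (int (p + i)) * cg (int (p - i)))" if "i \<in> {1..p}" for i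
  proof -
    have "p + i + (p - i) = 2 * p" using that by simp
    then have "(2 :: gxy) ^ (p + i) * 2 ^ (p - i) = 2 ^ (2 * p)" by (metis power_add)
    moreover have "s * (a * b) * (c * d) = (a * c) * (s * b * d)" for a b c d s :: gxy by (simp add: mult_ac)
    ultimately show ?thesis by metis
  qed
  then have "(\<Sum>i = 1..p. (-1) ^ i * (2 ^ (p + i) * cg (int (p + i))) * (2 ^ (p - i) * cg (int (p - i)))) =
      2 ^ (2 * p) * (\<Sum>i = 1..p. (-1) ^ i * cg (int (p + i)) * cg (int (p - i)))"
    unfolding sum_distrib_left by (intro sum.cong) auto
  moreover have "(2 ^ p * cg (int p)) ^ 2 = 2 ^ (2 * p) * cg (int p) ^ 2"
    by (simp only: power_mult_distrib power_mult[symmetric] mult.commute[of p])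
  moreover have "cg (int p) ^ 2 + 2 * (\<Sum>i = 1..p. (-1) ^ i * cg (int (p + i)) * cg (int (p - i))) = 0"
    using cg_relations p unfolding gamma_relations_def by blast
  moreover have "u * a + 2 * (u * b) = u * (a + 2 * b)" for u a b :: gxy by (simp add: distrib_left)
  ultimately show "(2 ^ p * cg (int p)) ^ 2 + 2 * (\<Sum>i = 1..p. (-1) ^ i * (2 ^ (p + i) * cg (int (p + i))) * (2 ^ (p - i) * cg (int (p - i)))) = 0"
    by simp
qed (simp add: cg_nonpos)

lemma scale2_hom: "is_ring_hom scale2"
  and scale2_c: "scale2 (cg (int p)) = 2 ^ p * cg (int p)"
  and scale2_x: "j \<ge> 1 \<Longrightarrow> scale2 (xg j) = 2 * xg j"
  and scale2_y: "j \<ge> 1 \<Longrightarrow> scale2 (yg j) = 2 * yg j"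
  unfolding scale2_def using gxy_lift[OF scale2_relations] by auto

lemmas scale2_simps = is_ring_homD[OF scale2_hom]

text \<open>Degrees are integers, and negative ones force \<open>f = 0\<close>, so that the index of
  a row, which raising operators may make negative, can serve as its degree.\<close>

definition hom_deg :: "gxy \<Rightarrow> int \<Rightarrow> bool" where
  "hom_deg f d \<longleftrightarrow> (d < 0 \<longrightarrow> f = 0) \<and> scale2 f = 2 ^ nat d * f"

lemma hom_deg_0: "hom_deg 0 d"
  by (simp add: hom_deg_def scale2_simps)

lemma hom_deg_add: "hom_deg f d \<Longrightarrow> hom_deg g d \<Longrightarrow> hom_deg (f + g) d"
  by (simp add: hom_deg_def scale2_simps distrib_left)

lemma hom_deg_sum: "(\<And>a. a \<in> A \<Longrightarrow> hom_deg (f a) d) \<Longrightarrow> hom_deg (sum f A) d"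
  by (induction A rule: infinite_finite_induct) (auto intro: hom_deg_0 hom_deg_add)

lemma hom_deg_mult:
  assumes "hom_deg f d" "hom_deg g e" shows "hom_deg (f * g) (d + e)"
proof (cases "d < 0 \<or> e < 0")
  case True
  then have "f * g = 0" using assms by (auto simp: hom_deg_def)
  then show ?thesis by (simp only: hom_deg_0)
next
  case False
  then have "nat (d + e) = nat d + nat e" by (simp add: nat_add_distrib)
  then show ?thesis using assms False by (simp add: hom_deg_def scale2_simps power_add mult_ac)
qed

lemma hom_deg_of_int: "hom_deg (of_int k) 0"
  by (simp add: hom_deg_def is_ring_hom_of_int_eq[OF scale2_hom])

lemma hom_deg_of_int_mult: "hom_deg f d \<Longrightarrow> hom_deg (of_int k * f) d"
  using hom_deg_mult[OF hom_deg_of_int, of f d k] by simp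

lemma hom_deg_shiftop:
  assumes "\<And>bs. hom_deg (G bs) (sum_list bs + e)"
  shows "hom_deg (shiftop s G as) (sum_list as + e + int s)"
  using assms
proof (induction as arbitrary: s G e)
  case Nil
  then show ?case using Nil[of "[]"] by (simp add: hom_deg_0)
next
  case (Cons a as)
  have "hom_deg (shiftop (s - n) (\<lambda>bs. G ((a + int n) # bs)) as) (sum_list (a # as) + e + int s)" if "n \<le> s" for n
  proof -
    have "hom_deg (shiftop (s - n) (\<lambda>bs. G ((a + int n) # bs)) as) (sum_list as + (a + int n + e) + int (s - n))"
    proof (rule Cons.IH)
      show "hom_deg (G ((a + int n) # bs)) (sum_list bs + (a + int n + e))" for bs
        using Cons.prems[of "(a + int n) # bs"] by (simp add: algebra_simps)
    qed
    moreover have "sum_list as + (a + int n + e) + int (s - n) = sum_list (a # as) + e + int s" using that by simp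
    ultimately show ?thesis by simp
  qed
  then show ?case unfolding shiftop.simps by (intro hom_deg_sum hom_deg_of_int_mult) auto
qed

lemma hom_deg_Qr:
  assumes "\<And>f p. f \<in> set fs \<Longrightarrow> hom_deg (f p) p" "length as = length fs"
  shows "hom_deg (Qr fs as) (sum_list as)"
proof -
  have *: "hom_deg (Qr fs (take (length fs) bs)) (sum_list (take (length fs) bs))" if "length bs \<ge> length fs" for bs
    using assms(1) that
  proof (induction fs arbitrary: bs)
    case Nil
    then show ?case using hom_deg_of_int[of 1] by simp
  next
    case (Cons f fs)
    then obtain b bs' where b: "bs = b # bs'" by (cases bs) auto
    let ?G = "\<lambda>cs. if length cs = length fs then Qr fs cs else 0"
    have G: "hom_deg (?G cs) (sum_list cs + 0)" for cs
      using Cons.IH[of cs] Cons.prems by (auto simp: hom_deg_0)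
    have "shiftop s (Qr fs) (take (length fs) bs') = shiftop s ?G (take (length fs) bs')" for s
      using Cons.prems b by (intro shiftop_cong) simp
    then have S: "hom_deg (shiftop s (Qr fs) (take (length fs) bs')) (sum_list (take (length fs) bs') + 0 + int s)" for s
      using hom_deg_shiftop[of ?G 0, OF G, of s "take (length fs) bs'"] by simp
    have "hom_deg (f (b - int s) * shiftop s (Qr fs) (take (length fs) bs')) (sum_list (take (length (f # fs)) bs))" for s
    proof -
      have "(b - int s) + (sum_list (take (length fs) bs') + 0 + int s) = sum_list (take (length (f # fs)) bs)"
        by (simp add: b)
      then show ?thesis using hom_deg_mult[OF Cons.prems(1)[of f "b - int s"] S[of s]] by simp
    qed
    then show ?case by (simp add: b hom_deg_sum)
  qed
  show ?thesis using *[of as] assms(2) by simp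
qed

lemma hom_deg_row: "hom_deg (row k r p) p"
proof (cases "p < 0")
  case True
  then show ?thesis by (simp add: row_def hom_deg_0)
next
  case False
  define H where "H = (\<lambda>F :: gxy fps. \<forall>n. hom_deg (fps_nth F n) (int n))"
  have m: "H (F * G)" if "H F" "H G" for F G
    unfolding H_def fps_mult_nth
  proof (intro allI hom_deg_sum)
    fix n i :: nat assume "i \<in> {0..n}"
    then have n: "int n = int i + int (n - i)" by simp
    have "hom_deg (fps_nth F i) (int i)" "hom_deg (fps_nth G (n - i)) (int (n - i))"
      using that unfolding H_def by blast+
    then show "hom_deg (fps_nth F i * fps_nth G (n - i)) (int n)"
      unfolding n by (rule hom_deg_mult)
  qed
  have 1: "H 1" using hom_deg_of_int[of 1] by (auto simp: H_def hom_deg_0)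
  have l: "H (1 + fps_const z * fps_X)" if "hom_deg z 1" for z
    using that hom_deg_of_int[of 1] by (auto simp: H_def hom_deg_0 fps_X_def)
  have e: "H (efps n z)" if "\<And>i. i \<ge> 1 \<Longrightarrow> hom_deg (z i) 1" for n z
    using that by (induction n) (auto simp: efps_Suc intro!: m l 1, simp add: efps_def 1)
  have "hom_deg (xg i) 1" "hom_deg (- yg i) 1" if "i \<ge> 1" for i
    using that by (simp_all add: hom_deg_def scale2_x scale2_y scale2_simps)
  moreover have "H cfps" by (simp add: H_def cfps_def hom_deg_def scale2_c)
  ultimately have "H (rowfps k r)" unfolding rowfps_def by (intro m e) auto
  then show ?thesis using False unfolding H_def row_def by (metis int_nat_eq not_less)
qed

lemma hom_deg_Pf: "hom_deg (Pf \<rho> vs) (\<Sum>v\<leftarrow>vs. int (v + \<rho> v))"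
  unfolding Pf_def by (rule hom_deg_Qr) (auto simp: hom_deg_row)

lemma scale2_weyl: "scale2 (weyl_act i f) = weyl_act i (scale2 f)"
proof (rule gxy_hom_eqI[of "\<lambda>f. scale2 (weyl_act i f)" "\<lambda>f. weyl_act i (scale2 f)"])
  show "is_ring_hom (\<lambda>f. scale2 (weyl_act i f))" by (rule is_ring_hom_comp[OF scale2_hom weyl_hom])
  show "is_ring_hom (\<lambda>f. weyl_act i (scale2 f))" by (rule is_ring_hom_comp[OF weyl_hom scale2_hom])
  have c: "scale2 (weyl_act i (cg (int p))) = weyl_act i (scale2 (cg (int p)))" for p
  proof (cases "i = 0")
    case True
    have t: "scale2 (cg (int p - int j)) = 2 ^ (p - j) * cg (int p - int j)" if "j \<le> p" for j
      using scale2_c[of "p - j"] that by (simp add: of_nat_diff)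
    have p: "2 ^ j * (x * (2 ^ (p - j) * c)) = 2 ^ p * (x * c)" if "j \<le> p" for x c :: gxy and j
    proof -
      have "(2 :: gxy) ^ p = 2 ^ j * 2 ^ (p - j)" using that by (simp flip: power_add)
      then show ?thesis by (simp add: mult_ac)
    qed
    have "scale2 (\<Sum>j = 1..p. xg 1 ^ j * cg (int p - int j)) = 2 ^ p * (\<Sum>j = 1..p. xg 1 ^ j * cg (int p - int j))"
      unfolding scale2_simps sum_distrib_left
      by (intro sum.cong refl) (simp add: scale2_x t power_mult_distrib mult.assoc p)
    then show ?thesis
      unfolding True scale2_c weyl_simps weyl_act_0(2)
      by (simp add: scale2_simps scale2_c distrib_left)
  qed (simp add: weyl_c_pos scale2_c weyl_simps)
  show "fmap (\<lambda>f. scale2 (weyl_act i f)) cfps = fmap (\<lambda>f. weyl_act i (scale2 f)) cfps"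
    by (rule fps_ext) (simp only: fmap_nth cfps_def fps_nth_Abs_fps c)
  fix j :: nat assume "j \<ge> 1"
  then show "scale2 (weyl_act i (xg j)) = weyl_act i (scale2 (xg j))"
    by (cases "i = 0") (simp_all add: weyl_x scale2_x scale2_simps weyl_simps transpose_ge_1)
  show "scale2 (weyl_act i (yg j)) = weyl_act i (scale2 (yg j))"
    using \<open>j \<ge> 1\<close> by (simp add: weyl_y scale2_y weyl_simps)
qed

lemma hom_deg_ddx:
  assumes "hom_deg f d" "d \<ge> 1" shows "hom_deg (ddx i f) (d - 1)"
proof -
  have r: "scale2 (root i) = 2 * root i"
    by (simp add: root_def scale2_simps scale2_x algebra_simps)
  obtain e where e: "nat d = Suc e" "nat (d - 1) = e" using assms by (cases "nat d") auto
  have "scale2 (ddx i f) * (2 * root i) = scale2 f - weyl_act i (scale2 f)"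
    using arg_cong[OF ddx_eq[of i f], of scale2] by (simp add: scale2_simps r scale2_weyl)
  also have "\<dots> = 2 ^ nat d * (f - weyl_act i f)"
    using assms by (simp add: hom_deg_def weyl_simps right_diff_distrib)
  also have "\<dots> = (2 ^ e * ddx i f) * (2 * root i)"
    unfolding ddx_eq[symmetric] e by (simp add: mult_ac)
  finally have "scale2 (ddx i f) = 2 ^ e * ddx i f"
    using root_nonzero[of i] by (subst (asm) mult_right_cancel) auto
  then show ?thesis using assms e by (simp add: hom_deg_def)
qed

lemma const_term_hom: "is_ring_hom const_term"
proof -
  define \<phi> where "\<phi> = gam_lift (\<lambda>p. if p = 0 then 1 else (0::int))"
  have \<phi>: "is_ring_hom \<phi>" unfolding \<phi>_def by (rule is_ring_hom_gam_lift) (auto simp: gamma_relations_def)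
  have m: "meval (\<lambda>_. 0) t = (if t = 0 then 1 else (0::int))" for t :: "var \<Rightarrow>\<^sub>0 nat"
  proof (cases "t = 0")
    case False
    then obtain v where v: "v \<in> Poly_Mapping.keys t" by (metis all_not_in_conv keys_eq_empty)
    then have "(0::int) ^ Poly_Mapping.lookup t v = 0" by (simp add: in_keys_iff)
    then show ?thesis unfolding meval_def using v False by (auto intro!: prod_zero)
  qed simp
  have "const_term f = peval \<phi> (\<lambda>_. 0) f" for f
    unfolding const_term_def \<phi>_def[symmetric] peval_def m
    by (auto simp: in_keys_iff is_ring_homD[OF \<phi>] if_distrib[of "\<lambda>x. _ * x"] cong: if_cong)
  then have "const_term = peval \<phi> (\<lambda>_. 0)" by (rule ext)
  then show ?thesis using is_ring_hom_peval[OF \<phi>] by metis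
qed

lemma const_term_x: "const_term (xg j) = 0" and const_term_y: "const_term (yg j) = 0"
  and const_term_c: "p \<ge> 1 \<Longrightarrow> const_term (cg (int p)) = 0"
proof -
  define \<phi> where "\<phi> = gam_lift (\<lambda>p. if p = 0 then 1 else (0::int))"
  have r: "gamma_relations (\<lambda>p. if p = 0 then 1 else (0::int))" by (auto simp: gamma_relations_def)
  have s: "Poly_Mapping.single v (1::nat) \<noteq> 0" for v :: var by (simp add: single_eq_0_iff)
  show "const_term (xg j) = 0" "const_term (yg j) = 0"
    using s is_ring_homD(4)[OF is_ring_hom_gam_lift[OF r]]
    by (simp_all add: const_term_def xg_def yg_def pvar_def lookup_single when_def)
  show "const_term (cg (int p)) = 0" if "p \<ge> 1"
    using that by (simp add: const_term_def cg_def pconst_def gam_lift_c[OF r])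
qed

text \<open>Scaling fixes the constant term, but on \<open>f\<close> it is multiplication by a power
  of two that is at least \<open>2\<close>.\<close>

lemma hom_deg_const_term:
  assumes "hom_deg f d" "d \<ge> 1" shows "const_term f = 0"
proof -
  note h = is_ring_homD[OF const_term_hom]
  have "const_term (scale2 g) = const_term g" for g
  proof (rule gxy_hom_eqI[of "\<lambda>g. const_term (scale2 g)" const_term])
    show "is_ring_hom (\<lambda>g. const_term (scale2 g))" by (rule is_ring_hom_comp[OF const_term_hom scale2_hom])
    show "fmap (\<lambda>g. const_term (scale2 g)) cfps = fmap const_term cfps"
    proof (rule fps_ext)
      fix n show "fps_nth (fmap (\<lambda>g. const_term (scale2 g)) cfps) n = fps_nth (fmap const_term cfps) n"
        using const_term_c[of n] by (cases "n = 0") (simp_all add: cfps_def scale2_c h cg_nonpos scale2_simps)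
    qed
  qed (auto simp: const_term_hom scale2_x scale2_y h const_term_x const_term_y)
  from this[of f] have "2 ^ nat d * const_term f = const_term f"
    using assms by (simp add: hom_deg_def h)
  moreover have "(2::int) ^ nat d \<ge> 2"
    using assms power_increasing[of 1 "nat d" "2::int"] by simp
  ultimately show ?thesis by (metis mult_cancel_right1 numeral_One one_le_numeral order_antisym_conv semiring_norm(85) verit_la_disequality numeral_le_one_iff semiring_norm(69))
qed

section \<open>The longest element\<close>

lemma w_long_w_long: "w_long m \<circ> w_long m = id"
  by (auto simp: w_long_def fun_eq_iff)

lemma w_long_Weyl: "w_long m \<in> Weyl m"
proof -
  have "w_long m permutes {- int m..int m}"
    unfolding permutes_def
  proof (intro conjI allI impI)
    fix x assume "x \<notin> {- int m..int m}" then show "w_long m x = x" by (auto simp: w_long_def)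
  next
    fix y show "\<exists>!x. w_long m x = y" using w_long_w_long[of m] by (metis comp_eq_dest_lhs id_apply o_apply)
  qed
  then show ?thesis by (auto simp: Weyl_def w_long_def)
qed

lemma w_long_W_inf: "w_long m \<in> W_inf"
  using w_long_Weyl Weyl_W_inf by blast

lemma inv_w_long: "inv (w_long m) = w_long m"
  using w_long_w_long[of m] by (intro inv_unique_comp) auto

lemma desc_w_long: "desc i (w_long m) \<longleftrightarrow> i < m"
  by (cases "i = 0") (auto simp: desc_def w_long_def)

lemma w_long_central:
  assumes "w \<in> Weyl m" shows "w_long m \<circ> w = w \<circ> w_long m"
proof (rule ext)
  fix x show "(w_long m \<circ> w) x = (w \<circ> w_long m) x"
  proof (cases "\<bar>x\<bar> \<le> int m")
    case True
    then show ?thesis using Weyl_bound[OF assms True] assms by (simp add: w_long_def Weyl_def)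
  next
    case False
    then show ?thesis using Weyl_fixed[OF assms, of x] by (simp add: w_long_def)
  qed
qed

definition pos_roots :: "nat \<Rightarrow> (int \<times> int) set" where
  "pos_roots m = {(a, b). 0 < b \<and> b \<le> int m \<and> - b \<le> a \<and> a < b \<and> a \<noteq> 0}"

lemma card_pos_roots: "finite (pos_roots m) \<and> card (pos_roots m) = m * m"
proof (induction m)
  case 0
  have "pos_roots 0 = {}" by (auto simp: pos_roots_def)
  then show ?case by simp
next
  case (Suc m)
  let ?A = "({- int (Suc m)..<int (Suc m)} - {0}) \<times> {int (Suc m)}"
  have "pos_roots (Suc m) = pos_roots m \<union> ?A" by (auto simp: pos_roots_def)
  moreover have "card (pos_roots m \<union> ?A) = card (pos_roots m) + card ?A"
    using Suc by (intro card_Un_disjoint) (auto simp: pos_roots_def)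
  moreover have "card ({- int (Suc m)..<int (Suc m)} - {0}) = 2 * m + 1"
    by (subst card_Diff_singleton) auto
  then have "card ?A = 2 * m + 1" by (simp only: card_cartesian_product_singleton card_cartesian_product card.insert card.empty) simp
  ultimately show ?case using Suc by simp
qed

lemma invs_pos_roots: "w \<in> Weyl m \<Longrightarrow> invs w \<subseteq> pos_roots m"
  using invs_subset[of w m] by (auto simp: invs_def pos_roots_def)

lemma len_le: "w \<in> Weyl m \<Longrightarrow> len w \<le> m * m"
  unfolding len_def using card_mono[OF _ invs_pos_roots] card_pos_roots by metis

lemma len_w_long: "len (w_long m) = m * m"
proof -
  have "invs (w_long m) = pos_roots m"
    using invs_pos_roots[OF w_long_Weyl] by (auto simp: invs_def pos_roots_def w_long_def)
  then show ?thesis using card_pos_roots by (simp add: len_def)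
qed

text \<open>All positive roots are inverted: \<open>(- x, x)\<close> makes \<open>w x\<close>
  negative, and \<open>(i, i + 1)\<close> makes \<open>w\<close> decreasing, so \<open>- w\<close>
  is the identity on \<open>1..m\<close>.\<close>

lemma len_max:
  assumes w: "w \<in> Weyl m" and l: "len w = m * m" shows "w = w_long m"
proof -
  have inv: "invs w = pos_roots m"
    using card_seteq[of "pos_roots m" "invs w"] card_pos_roots invs_pos_roots[OF w] l by (auto simp: len_def)
  have neg: "w x < 0" if "1 \<le> x" "x \<le> int m" for x
  proof -
    have "(- x, x) \<in> invs w" unfolding inv using that by (auto simp: pos_roots_def)
    then show ?thesis using w by (auto simp: invs_def Weyl_def)
  qed
  have "- w x = x" if x: "1 \<le> x" "x \<le> int m" for x
  proof (rule increasing_id[of 1 "int m" "\<lambda>x. - w x"])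
    show "1 \<le> - w 1" using neg[of 1] x by simp
    show "- w (int m) \<le> int m" using Weyl_bound[OF w, of "int m"] by simp
    fix i assume "1 \<le> i" "i < int m"
    then have "(i, i + 1) \<in> invs w" unfolding inv by (auto simp: pos_roots_def)
    then show "- w i < - w (i + 1)" by (auto simp: invs_def)
  qed (use x in auto)
  then have p: "w x = w_long m x" if "x > 0" for x
    using that Weyl_fixed[OF w, of x] by (cases "x \<le> int m") (auto simp: w_long_def minus_equation_iff)
  have o: "w (- x) = - w x" "w_long m (- x) = - w_long m x" for x using w w_long_Weyl by (auto simp: Weyl_def)
  show ?thesis
  proof (rule ext)
    fix x show "w x = w_long m x"
      using p[of x] p[of "- x"] o[of x] o[of 0] by (cases "x > 0"; cases "x = 0") auto
  qed
qed

section \<open>Uniqueness at the longest element\<close>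

lemma schubert_ddx:
  "is_schubert_family C \<Longrightarrow> w \<in> W_inf \<Longrightarrow> ddx i (C w) = (if desc i w then C (w \<circ> sref i) else 0)"
  unfolding is_schubert_family_def using wlen_right[of w i] by simp

lemma schubert_ddy:
  "is_schubert_family C \<Longrightarrow> w \<in> W_inf \<Longrightarrow> ddy i (C w) = (if desc i (inv w) then C (sref i \<circ> w) else 0)"
  unfolding is_schubert_family_def using wlen_left[of w i] by simp

lemma schubert_const: "is_schubert_family C \<Longrightarrow> w \<in> W_inf \<Longrightarrow> const_term (C w) = (if w = id then 1 else 0)"
  unfolding is_schubert_family_def by simp

lemma opw_schubert:
  assumes C: "is_schubert_family C" and w: "w \<in> W_inf"
  shows "opw a (C w) = 0 \<or> (\<exists>u\<in>W_inf. opw a (C w) = C u \<and> len u + length a = len w)"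
  using w
proof (induction a arbitrary: w)
  case (Cons i a)
  show ?case
  proof (cases "desc i w")
    case True
    define v where "v = w \<circ> sref i"
    have "v \<in> W_inf" unfolding v_def using Cons.prems W_inf_comp W_inf_sref by blast
    then have "opw a (C v) = 0 \<or> (\<exists>u\<in>W_inf. opw a (C v) = C u \<and> len u + length a = len v)" by (rule Cons.IH)
    moreover have "opw (i # a) (C w) = opw a (C v)" "len w = Suc (len v)"
      using True len_sref(1)[OF Cons.prems True] by (simp_all add: schubert_ddx[OF C Cons.prems] v_def)
    ultimately show ?thesis by auto
  qed (simp add: schubert_ddx[OF C Cons.prems])
qed auto

lemma opw_schubert_reduced:
  assumes C: "is_schubert_family C" and l: "length a = len (wprod a)"
  shows "opw a (C (wprod a)) = C id"
  using l
proof (induction a)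
  case (Cons i a)
  let ?w = "wprod (i # a)"
  have w: "?w \<in> W_inf" by (rule wprod_W_inf)
  have e: "?w \<circ> sref i = wprod a" by (simp only: wprod_simps sref_comp_sref)
  have d: "desc i ?w"
  proof (rule ccontr)
    assume "\<not> desc i ?w"
    then have "len (wprod a) = Suc (len ?w)" using len_sref(2)[OF w, of i] e by simp
    then show False using len_wprod_le[of a] Cons.prems by simp
  qed
  have "len ?w = Suc (len (wprod a))" using len_sref(1)[OF w d] e by simp
  then have "length a = len (wprod a)" using Cons.prems by simp
  then have "opw a (C (wprod a)) = C id" by (rule Cons.IH)
  then show ?case using d e by (simp only: opw.simps schubert_ddx[OF C w] if_True)
next
  case Nil
  show ?case by (simp only: opw.simps wprod_simps)
qed

text \<open>For \<open>P\<close> with \<open>\<partial>\<^sub>i\<^sup>x P = \<partial>\<^sub>i\<^sup>y P\<close> every mixed iterated divided difference is one in \<open>x\<close>,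
  so \<open>P\<close> is determined by the constant terms of the \<open>\<partial>\<^sub>w\<^sup>x P\<close>; for reasons of degree only
  \<open>w = w\<^sub>0\<close> contributes.\<close>

lemma opw_ddy: "opw a (ddy i f) = ddy i (opw a f)"
  by (induction a arbitrary: f) (auto simp: ddx_ddy)

lemma opw_diff: "opw a (f - g) = opw a f - opw a g"
  by (induction a arbitrary: f g) (auto simp: ddx_diff)

lemma opw_of_int: "opw a (of_int k * f) = of_int k * opw a f"
  by (induction a arbitrary: f) (auto simp: ddx_of_int)

lemma opw_hom_deg: "hom_deg f d \<Longrightarrow> int (length a) \<le> d \<Longrightarrow> hom_deg (opw a f) (d - int (length a))"
proof (induction a arbitrary: f d)
  case (Cons i a)
  have "hom_deg (ddx i f) (d - 1)" using Cons by (intro hom_deg_ddx) auto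
  from Cons.IH[OF this] show ?case using Cons.prems by (simp add: algebra_simps)
qed simp

lemma wprod_Weyl: "(\<And>i. i \<in> set a \<Longrightarrow> i < m) \<Longrightarrow> wprod a \<in> Weyl m"
proof (induction a)
  case (Cons i a)
  have "wprod a \<in> Weyl m" by (rule Cons.IH) (use Cons.prems in auto)
  moreover have "sref i \<in> Weyl m" using Cons.prems by (intro sref_Weyl) auto
  ultimately show ?case unfolding wprod_simps by (rule Weyl_comp)
qed (simp only: wprod_simps Weyl_id)

lemma longest_unique:
  assumes C: "is_schubert_family C"
    and sym: "\<And>i. ddx i P = ddy i P" and z: "\<And>i. i \<ge> m \<Longrightarrow> ddx i P = 0"
    and d: "hom_deg P (int (m * m))"
  shows "\<exists>k. P = of_int k * C (w_long m)"
proof -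
  define M where "M = m * m"
  note len_w_long = len_w_long[of m, folded M_def] and len_le = len_le[of _ m, folded M_def]
    and len_max = len_max[of _ m, folded M_def] and d = d[folded M_def]
  obtain a0 where a0: "wprod a0 = w_long m" "length a0 = M"
    using reduced_word_ex[OF w_long_W_inf] len_w_long by metis
  \<comment> \<open>The value forced by taking constant terms after \<open>opw a0\<close>, since
    \<open>opw a0\<close> sends \<open>C (w_long m)\<close> to \<open>C id\<close>.\<close>
  define k where "k = const_term (opw a0 P)"
  define D where "D = P - of_int k * C (w_long m)"
  note cl = schubert_ddx[OF C w_long_W_inf, of _ m] schubert_ddy[OF C w_long_W_inf, of _ m]
  have symC: "ddx i (C (w_long m)) = ddy i (C (w_long m))" for i
    using w_long_central[OF sref_Weyl, of i m] by (simp add: cl inv_w_long desc_w_long)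
  have symD: "ddx i D = ddy i D" for i
    unfolding D_def by (simp add: ddx_diff ddy_diff ddx_of_int ddy_of_int sym symC)
  have zD: "ddx i D = 0" if "i \<ge> m" for i
    using that unfolding D_def by (simp add: ddx_diff ddx_of_int z cl desc_w_long)
  \<comment> \<open>The first letter acts on \<open>D\<close> itself, where it may be replaced by
    \<open>ddy i\<close>, and \<open>ddy i\<close> commutes to the outside.\<close>
  have peel: "opw (i # a) D = ddy i (opw a D)" for i a
    using symD[of i] opw_ddy by simp
  \<comment> \<open>A letter \<open>i \<ge> m\<close> kills \<open>D\<close> when it comes first;
    the letters in front of it are taken off by \<open>peel\<close>.\<close>
  have big: "opw a D = 0" if "\<exists>i\<in>set a. i \<ge> m" for a
    using that
  proof (induction a)
    case (Cons i a)
    show ?case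
    proof (cases "i \<ge> m")
      case True
      then show ?thesis by (simp add: zD)
    next
      case False
      then have "opw a D = 0" using Cons by auto
      then show ?thesis unfolding peel by simp
    qed
  qed simp
  have long: "opw a D = 0" if "length a > M" for a
  proof (cases "\<exists>i\<in>set a. i \<ge> m")
    case False
    then have "len (wprod a) \<le> M" by (intro len_le wprod_Weyl) auto
    then show ?thesis using that by (intro opw_nonreduced) simp
  qed (rule big)
  have const: "const_term (opw a D) = 0" for a
  proof -
    note h = is_ring_homD[OF const_term_hom]
    have D': "opw a D = opw a P - of_int k * opw a (C (w_long m))" for a
      by (simp add: D_def opw_diff opw_of_int)
    consider "length a < M" | "length a > M" | "\<exists>i\<in>set a. i \<ge> m" |
      "length a = M" "\<not> (\<exists>i\<in>set a. i \<ge> m)" by linarith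
    then show ?thesis
    proof cases
      case 1
      have "hom_deg (opw a P) (int (M) - int (length a))" using 1 by (intro opw_hom_deg d) auto
      then have "const_term (opw a P) = 0" using 1 by (intro hom_deg_const_term) auto
      moreover have "const_term (opw a (C (w_long m))) = 0"
        using opw_schubert[OF C w_long_W_inf, of a m] 1 schubert_const[OF C] len_id len_w_long h(4) by auto
      ultimately show ?thesis by (simp add: D' h)
    next
      case 2
      then show ?thesis using long h(4) by simp
    next
      case 3
      then show ?thesis using big h(4) by simp
    next
      case 4
      then have W: "wprod a \<in> Weyl m" by (intro wprod_Weyl) auto
      show ?thesis
      proof (cases "len (wprod a) = M")
        case True
        then have "wprod a = w_long m" by (rule len_max[OF W])
        then have "opw a = opw a0" using a0 4 len_w_long by (intro opw_reduced_unique) auto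
        moreover have "opw a0 (C (w_long m)) = C id"
          using opw_schubert_reduced[OF C, of a0] a0 len_w_long by simp
        ultimately show ?thesis
          using schubert_const[OF C W_inf_id] by (simp add: D' h k_def is_ring_hom_of_int_eq[OF const_term_hom])
      next
        case False
        then have "len (wprod a) < length a" using len_le[OF W] 4 by simp
        then show ?thesis using opw_nonreduced h(4) by simp
      qed
    qed
  qed
  \<comment> \<open>From long words to short ones: \<open>ddx i\<close> appends a letter and
    \<open>ddy i\<close> prepends one by \<open>peel\<close>, so both differences of
    \<open>opw a D\<close> vanish by induction.\<close>
  have "opw a D = 0" for a
  proof (induction "M + 1 - length a" arbitrary: a rule: less_induct)
    case less
    show ?case
    proof (cases "length a > M")
      case False
      show ?thesis
      proof (rule common_kernel)
        show "ddx i (opw a D) = 0" for i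
          using less[of "a @ [i]"] False by (simp add: opw_append)
        show "ddy i (opw a D) = 0" for i
          using less[of "i # a"] False unfolding peel by simp
        show "const_term (opw a D) = 0" by (rule const)
      qed
    qed (rule long)
  qed
  from this[of "[]"] show ?thesis by (auto simp: D_def)
qed

text \<open>For \<open>\<rho> v = v - 1\<close> the differences in \<open>x\<close> and in
  \<open>y\<close> have the same effect: the row of \<open>i + 1\<close> has its
  \<open>\<rho>\<close> lowered from \<open>i\<close> to \<open>i - 1\<close>, and for
  \<open>i = 0\<close> the row of 1 disappears. The parts \<open>2 v - 1\<close> add up to
  \<open>m^2\<close>.\<close>

lemma Pf_w_long:
  assumes C: "is_schubert_family C"
  shows "\<exists>k. Pf (\<lambda>v. v - 1) [1..<Suc m] = of_int k * C (w_long m)"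
proof (rule longest_unique[OF C])
  let ?\<rho> = "\<lambda>v :: nat. v - 1"
  let ?P = "Pf ?\<rho> [1..<Suc m]"
  have zx: "ddx i ?P = 0" if "i \<ge> m" for i using that by (intro Pf_ddx_0) auto
  show "ddx i ?P = 0" if "i \<ge> m" for i using zx that by blast
  have zy: "ddy i ?P = 0" if "i \<ge> m" for i using that by (intro Pf_ddy_0) auto
  show "ddx i ?P = ddy i ?P" for i
  proof -
    consider "i \<ge> m" | "i = 0" "m > 0" | "i \<ge> 1" "i < m" by linarith
    then show ?thesis
    proof cases
      case 1
      then show ?thesis using zx zy by simp
    next
      case 2
      have "[1..<Suc m] = Suc 0 # [2..<Suc m]" using 2 by (subst upt_conv_Cons) (auto simp: numeral_2_eq_2)
      moreover have "ddx 0 (Pf ?\<rho> (Suc 0 # [2..<Suc m])) = Pf ?\<rho> [2..<Suc m]"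
        by (rule Pf_ddx_remove) auto
      moreover have "ddy 0 (Pf ?\<rho> (Suc 0 # [2..<Suc m])) = Pf ?\<rho> [2..<Suc m]"
        by (rule Pf_ddy_remove) auto
      ultimately show ?thesis unfolding 2(1) by metis
    next
      case 3
      let ?us = "[1..<i]" and ?ws = "[Suc (Suc i)..<Suc m]"
      have l: "[1..<Suc m] = ?us @ i # Suc i # ?ws"
      proof -
        have "[1..<Suc m] = [1..<i] @ [i..<Suc m]" using 3 upt_add_eq_append[of 1 i "Suc m - i"] by simp
        also have "[i..<Suc m] = i # Suc i # [Suc (Suc i)..<Suc m]"
          using 3 upt_conv_Cons[of i "Suc m"] upt_conv_Cons[of "Suc i" "Suc m"] by (simp del: upt_Suc)
        finally show ?thesis .
      qed
      have "ddx i (Pf ?\<rho> ((?us @ [i]) @ Suc i # ?ws)) = Pf (?\<rho>(Suc i := i - 1)) ((?us @ [i]) @ Suc i # ?ws)"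
        using 3 by (intro Pf_ddx) auto
      moreover have "ddy i (Pf ?\<rho> (?us @ i # Suc i # ?ws)) = Pf (?\<rho>(Suc i := i - 1)) (?us @ i # Suc i # ?ws)"
        using 3 by (intro Pf_ddy_swap) auto
      ultimately show ?thesis unfolding l by simp
    qed
  qed
  have "(\<Sum>v\<leftarrow>[1..<Suc m]. int (v + (v - 1))) = int (m * m)"
    by (induction m) (simp_all add: algebra_simps)
  then show "hom_deg ?P (int (m * m))" using hom_deg_Pf[of ?\<rho> "[1..<Suc m]"] by simp
qed

section \<open>Grassmannian elements\<close>

text \<open>The permutations between \<open>w\<^sub>0\<close> and the top element: the value \<open>-v\<close> travels from position \<open>v\<close>
  to position \<open>n + 1\<close>, and is now at position \<open>j + 1\<close>.\<close>

definition stage :: "nat \<Rightarrow> nat \<Rightarrow> nat \<Rightarrow> nat \<Rightarrow> (int \<Rightarrow> int) \<Rightarrow> bool" where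
  "stage m n v j u \<longleftrightarrow> u \<in> Weyl m \<and> (\<forall>p. 1 \<le> p \<and> p \<le> int m \<longrightarrow> u p =
     (if p \<le> int n then - p else if p \<le> int j then - (int v + int n - p) else if p = int j + 1 then - int v
      else if p \<le> int v then - (int v + int n + 1 - p) else - p))"

lemma stage_step:
  assumes st: "stage m n v j u" and j: "n < j" "j < v" "v \<le> m"
  shows "stage m n v (j - 1) (u \<circ> sref j)" "desc j u"
proof -
  have u: "u \<in> Weyl m" using st by (simp add: stage_def)
  have v: "u p = (if p \<le> int n then - p else if p \<le> int j then - (int v + int n - p) else if p = int j + 1 then - int v
      else if p \<le> int v then - (int v + int n + 1 - p) else - p)" if "1 \<le> p" "p \<le> int m" for p
    using st that by (simp add: stage_def)
  show "desc j u" using j v[of "int j"] v[of "int j + 1"] by (simp add: desc_def)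
  show "stage m n v (j - 1) (u \<circ> sref j)"
    unfolding stage_def
  proof (intro conjI allI impI)
    show "u \<circ> sref j \<in> Weyl m" using j by (intro Weyl_comp u sref_Weyl) auto
    fix p :: int assume p: "1 \<le> p \<and> p \<le> int m"
    consider "p = int j" | "p = int j + 1" | "p \<noteq> int j" "p \<noteq> int j + 1" by blast
    then show "(u \<circ> sref j) p = (if p \<le> int n then - p else if p \<le> int (j - 1) then - (int v + int n - p)
        else if p = int (j - 1) + 1 then - int v else if p \<le> int v then - (int v + int n + 1 - p) else - p)"
    proof cases
      case 1
      then have "(u \<circ> sref j) p = u (int j + 1)" using j by (simp add: sref_pos)
      then show ?thesis using 1 v[of "int j + 1"] j by (simp add: of_nat_diff)
    next
      case 2
      then have "(u \<circ> sref j) p = u (int j)" using j by (simp add: sref_pos)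
      then show ?thesis using 2 v[of "int j"] j by (simp add: of_nat_diff)
    next
      case 3
      then have "(u \<circ> sref j) p = u p" using j p by (simp add: sref_pos)
      then show ?thesis using 3 v[of p] j p by (auto simp: of_nat_diff)
    qed
  qed
qed

lemma stage_next: "stage m n v n u \<Longrightarrow> n < v \<Longrightarrow> stage m n (Suc v) v u"
  unfolding stage_def by (auto split: if_splits)

text \<open>The position \<open>j + 1\<close> of the value \<open>-v\<close> is recorded as
  \<open>\<rho> v = j\<close>; smaller values have reached their final \<open>\<rho>\<close>, larger
  ones still have the initial one.\<close>

definition stage_rho :: "nat \<Rightarrow> nat \<Rightarrow> nat \<Rightarrow> nat \<Rightarrow> nat" where
  "stage_rho n v j x = (if x < v then min (x - 1) n else if x = v then j else x - 1)"

lemma upt_split: "1 \<le> v \<Longrightarrow> v \<le> m \<Longrightarrow> [1..<Suc m] = [1..<v] @ v # [Suc v..<Suc m]"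
  using upt_add_eq_append[of 1 v "Suc m - v"] upt_conv_Cons[of v "Suc m"] by (simp del: upt_Suc)

text \<open>While \<open>n < j < v\<close>, the row of \<open>v\<close> is the only one with
  \<open>\<rho> = j\<close>: smaller values have at most \<open>n\<close>, larger ones at least
  \<open>v\<close>. Hence \<open>Pf_ddx\<close> accompanies each step of \<open>-v\<close> to the
  left.\<close>

lemma stage_inner:
  assumes C: "is_schubert_family C" and nv: "n < v" "v \<le> m" and jv: "j \<le> v - 1" "n \<le> j"
    and u: "stage m n v j u" "of_int k * C u = Pf (stage_rho n v j) [1..<Suc m]"
  shows "\<exists>u. stage m n v n u \<and> of_int k * C u = Pf (stage_rho n v n) [1..<Suc m]"
  using jv u
proof (induction "j - n" arbitrary: j u)
  case 0
  then show ?case by (metis diff_is_0_eq le_antisym)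
next
  case (Suc d)
  then have j: "n < j" "j < v" using nv by auto
  note st = stage_step[OF Suc.prems(3) j nv(2)]
  have W: "u \<in> W_inf" using Suc.prems(3) Weyl_W_inf by (auto simp: stage_def)
  let ?r = "stage_rho n v j"
  have l: "[1..<Suc m] = [1..<v] @ v # [Suc v..<Suc m]" using nv by (intro upt_split) auto
  have "ddx j (Pf ?r ([1..<v] @ v # [Suc v..<Suc m])) = Pf (?r(v := j - 1)) ([1..<v] @ v # [Suc v..<Suc m])"
    using j by (intro Pf_ddx) (auto simp: stage_rho_def)
  moreover have "?r(v := j - 1) = stage_rho n v (j - 1)" by (auto simp: stage_rho_def fun_eq_iff)
  moreover have "ddx j (of_int k * C u) = of_int k * C (u \<circ> sref j)"
    using st(2) by (simp add: ddx_of_int schubert_ddx[OF C W])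
  ultimately have "of_int k * C (u \<circ> sref j) = Pf (stage_rho n v (j - 1)) [1..<Suc m]"
    using Suc.prems(4) unfolding l by metis
  then show ?case
    using Suc.hyps(1)[of "j - 1"] Suc.hyps(2) st(1) j by auto
qed

lemma stage_outer:
  assumes C: "is_schubert_family C" and k: "Pf (\<lambda>v. v - 1) [1..<Suc m] = of_int k * C (w_long m)"
    and v: "n < v" "v \<le> m"
  shows "\<exists>u. stage m n v n u \<and> of_int k * C u = Pf (stage_rho n v n) [1..<Suc m]"
proof -
  have "Suc n \<le> v" using v by simp
  then show ?thesis using v(2)
  proof (induction v rule: dec_induct)
    case base
    have "stage m n (Suc n) n (w_long m)"
      using w_long_Weyl[of m] by (auto simp: stage_def w_long_def)
    moreover have "Pf (\<lambda>v. v - 1) [1..<Suc m] = Pf (stage_rho n (Suc n) n) [1..<Suc m]"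
      by (rule Pf_cong) (auto simp: stage_rho_def)
    ultimately show ?case using k by metis
  next
    case (step v)
    then obtain u where u: "stage m n v n u" "of_int k * C u = Pf (stage_rho n v n) [1..<Suc m]" by auto
    have "Pf (stage_rho n v n) [1..<Suc m] = Pf (stage_rho n (Suc v) v) [1..<Suc m]"
      using step by (intro Pf_cong) (auto simp: stage_rho_def)
    then show ?case using stage_inner[OF C, of n "Suc v" m v u k] stage_next[OF u(1)] u step by auto
  qed
qed

text \<open>The element \<open>(-1, ..., -n, -m, ..., -(n + 1))\<close>, which is
  \<open>w w_0^(n)\<close> for the longest \<open>n\<close>-Grassmannian \<open>w\<close> in
  \<open>W_m\<close>.\<close>

definition is_top :: "nat \<Rightarrow> nat \<Rightarrow> (int \<Rightarrow> int) \<Rightarrow> bool" where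
  "is_top m n u \<longleftrightarrow> u \<in> Weyl m \<and> (\<forall>p. 1 \<le> p \<and> p \<le> int m \<longrightarrow> u p = (if p \<le> int n then - p else - (int m + int n + 1 - p)))"

lemma top_Pf:
  assumes C: "is_schubert_family C" and k: "Pf (\<lambda>v. v - 1) [1..<Suc m] = of_int k * C (w_long m)"
    and n: "n \<le> m"
  shows "\<exists>u. is_top m n u \<and> of_int k * C u = Pf (\<lambda>v. min (v - 1) n) [1..<Suc m]"
proof (cases "n = m")
  case True
  have "Pf (\<lambda>v. v - 1) [1..<Suc m] = Pf (\<lambda>v. min (v - 1) n) [1..<Suc m]"
    using True by (intro Pf_cong) auto
  moreover have "is_top m n (w_long m)"
    using True w_long_Weyl[of m] by (auto simp: is_top_def w_long_def)
  ultimately show ?thesis using k by metis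
next
  case False
  then obtain u where u: "stage m n m n u" "of_int k * C u = Pf (stage_rho n m n) [1..<Suc m]"
    using stage_outer[OF C k, of n m] n by auto
  have "Pf (stage_rho n m n) [1..<Suc m] = Pf (\<lambda>v. min (v - 1) n) [1..<Suc m]"
    using False n by (intro Pf_cong) (auto simp: stage_rho_def)
  moreover have "is_top m n u" using u(1) by (auto simp: is_top_def stage_def)
  ultimately show ?thesis using u by metis
qed

lemma W_inf_ext:
  assumes "u \<in> Weyl m" "w \<in> Weyl m" "\<And>p. 1 \<le> p \<Longrightarrow> p \<le> int m \<Longrightarrow> u p = w p"
  shows "u = w"
proof (rule ext)
  have p: "u x = w x" if "x > 0" for x
    using that assms Weyl_fixed[of u m x] Weyl_fixed[of w m x] by (cases "x \<le> int m") auto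
  fix x show "u x = w x"
    using p[of x] p[of "- x"] W_inf_odd[OF Weyl_W_inf[OF assms(1)], of x] W_inf_odd[OF Weyl_W_inf[OF assms(2)], of x]
      W_inf_0[OF Weyl_W_inf[OF assms(1)]] W_inf_0[OF Weyl_W_inf[OF assms(2)]]
    by (cases "x > 0"; cases "x = 0") auto
qed

text \<open>The values \<open>w\<^sub>1, \<dots>, w\<^sub>n\<close>, and the absolute values of the negative entries of \<open>w w\<^sub>0\<^sup>(\<^sup>n\<^sup>)\<close>.\<close>

definition Aset :: "nat \<Rightarrow> (int \<Rightarrow> int) \<Rightarrow> nat set" where
  "Aset n w = {a. 1 \<le> inv w (int a) \<and> inv w (int a) \<le> int n}"

definition Sset :: "nat \<Rightarrow> (int \<Rightarrow> int) \<Rightarrow> nat set" where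
  "Sset n w = {a. 1 \<le> inv w (int a) \<and> inv w (int a) \<le> int n \<or> inv w (int a) < - int n}"

text \<open>For \<open>A = Aset n w\<close> this turns out to be the part of \<nu> that belongs to
  the row of \<open>v\<close>, see \<open>nu_part_hat\<close>.\<close>

definition rho :: "nat set \<Rightarrow> nat \<Rightarrow> nat" where
  "rho A v = card {a \<in> A. a < v}"

section \<open>Grassmannian elements through their sets of values\<close>

definition gr :: "nat \<Rightarrow> nat \<Rightarrow> (int \<Rightarrow> int) \<Rightarrow> bool" where
  "gr m n w \<longleftrightarrow> w \<in> Weyl m \<and> n \<le> m \<and> (\<forall>i. i \<noteq> n \<longrightarrow> \<not> desc i w)"

context
  fixes m n w
  assumes gr: "gr m n w"
begin

lemma gr_Weyl: "w \<in> Weyl m" and gr_nm: "n \<le> m"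
  using gr by (auto simp: gr_def)

lemma gr_W_inf: "w \<in> W_inf"
  using gr_Weyl Weyl_W_inf by blast

lemma gr_inv: "inv w (w x) = x" "w (inv w x) = x"
  using W_inf_bij[OF gr_W_inf] by (auto simp: bij_is_inj bij_is_surj surj_f_inv_f)

lemma gr_inv_odd: "inv w (- x) = - inv w x"
  using W_inf_odd[OF W_inf_inv[OF gr_W_inf]] .

lemma gr_inv_0: "inv w x = 0 \<longleftrightarrow> x = 0"
  using W_inf_eq_0[OF W_inf_inv[OF gr_W_inf]] .

lemma gr_step: "1 \<le> p \<Longrightarrow> p \<noteq> int n \<Longrightarrow> w p < w (p + 1)"
proof -
  assume p: "1 \<le> p" "p \<noteq> int n"
  then have "\<not> desc (nat p) w" using gr unfolding gr_def by (metis int_nat_eq not_one_le_zero order_trans zero_le_one)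
  then have "w p \<le> w (p + 1)" using p by (auto simp: desc_def)
  moreover have "w p \<noteq> w (p + 1)" using W_inf_eq_iff[OF gr_W_inf] by simp
  ultimately show ?thesis by simp
qed

lemma gr_mono:
  assumes "1 \<le> p" "p < q" "q \<le> int n \<or> p > int n" shows "w p < w q"
proof -
  have "p + 1 \<le> q" using assms by simp
  then show ?thesis using assms(3)
  proof (induction q rule: int_ge_induct)
    case base
    then show ?case using assms(1) by (intro gr_step) auto
  next
    case (step q)
    then have "w p < w q" by auto
    also have "w q < w (q + 1)" using step assms by (intro gr_step) auto
    finally show ?case .
  qed
qed

lemma gr_pos:
  assumes "1 \<le> p" "p \<le> int n" shows "w p > 0"
proof -
  have "\<not> desc 0 w" using gr assms by (auto simp: gr_def)
  then have "w 1 > 0" using W_inf_eq_0[OF gr_W_inf, of 1] by (simp add: desc_def)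
  then show ?thesis using gr_mono[of 1 p] assms by (cases "p = 1") auto
qed

text \<open>The first \<open>n\<close> entries of \<open>w\<close> are positive, so no value
  \<open>a\<close> has its position among \<open>-n, ..., -1\<close>.\<close>

lemma inv_cases:
  assumes "a \<ge> 1"
  shows "a \<in> Aset n w \<or> (a \<in> Sset n w \<and> a \<notin> Aset n w \<and> inv w (int a) < - int n) \<or> (a \<notin> Sset n w \<and> inv w (int a) > int n)"
proof -
  have "inv w (int a) \<noteq> 0" using assms gr_inv_0 by simp
  moreover have "\<not> (- int n \<le> inv w (int a) \<and> inv w (int a) \<le> -1)"
  proof
    assume "- int n \<le> inv w (int a) \<and> inv w (int a) \<le> -1"
    then have "w (- inv w (int a)) > 0" by (intro gr_pos) auto
    then show False using W_inf_odd[OF gr_W_inf] gr_inv by simp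
  qed
  ultimately show ?thesis by (auto simp: Aset_def Sset_def)
qed

lemma Aset_subset: "Aset n w \<subseteq> Sset n w"
  by (auto simp: Aset_def Sset_def)

lemma Sset_range: "Sset n w \<subseteq> {1..m}"
proof
  fix a assume a: "a \<in> Sset n w"
  have "inv w (int a) \<noteq> 0" using a by (auto simp: Sset_def)
  then have "a \<noteq> 0" using gr_inv_0[of "int a"] by auto
  moreover have "a \<le> m"
  proof (rule ccontr)
    assume "\<not> a \<le> m"
    then have "inv w (int a) = int a" by (intro Weyl_fixed[OF Weyl_inv[OF gr_Weyl]]) simp
    then show False using a gr_nm \<open>\<not> a \<le> m\<close> by (auto simp: Sset_def)
  qed
  ultimately show "a \<in> {1..m}" by auto
qed

lemma finite_Sset: "finite (Sset n w)" and finite_Aset: "finite (Aset n w)"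
  using Sset_range Aset_subset by (auto intro: finite_subset)

lemma Aset_image: "Aset n w = (\<lambda>p. nat (w p)) ` {1..int n}"
proof (intro equalityI subsetI)
  fix a assume "a \<in> Aset n w"
  then show "a \<in> (\<lambda>p. nat (w p)) ` {1..int n}"
    using gr_inv by (intro image_eqI[of _ _ "inv w (int a)"]) (auto simp: Aset_def)
next
  fix a assume "a \<in> (\<lambda>p. nat (w p)) ` {1..int n}"
  then obtain p where p: "1 \<le> p" "p \<le> int n" "a = nat (w p)" by auto
  then have "int a = w p" using gr_pos[of p] by simp
  then show "a \<in> Aset n w" using p gr_inv(1)[of p] by (simp add: Aset_def)
qed

lemma card_Aset: "card (Aset n w) = n"
proof -
  have "inj_on (\<lambda>p. nat (w p)) {1..int n}"
    using gr_pos W_inf_eq_iff[OF gr_W_inf] by (intro inj_onI) (metis atLeastAtMost_iff int_nat_eq less_imp_le)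
  then show ?thesis unfolding Aset_image by (simp add: card_image)
qed

text \<open>The hypotheses say that none of the steps \<open>move\<close>, \<open>add\<close>,
  \<open>swap\<close> in \<open>grassmannian_Pf_multiple\<close> is possible.
  \<open>Aset n w\<close> is then an initial segment, the entries at the positions
  \<open>n + 1, ..., m\<close> are negative, and monotonicity determines everything.\<close>

lemma is_top_terminal:
  assumes S: "Sset n w = {1..m}" and A: "\<And>i. i \<ge> 1 \<Longrightarrow> Suc i \<in> Aset n w \<Longrightarrow> i \<in> Aset n w"
  shows "Aset n w = {1..n}" "is_top m n (w \<circ> w_long n)"
proof -
  have down: "j \<in> Aset n w" if "a \<in> Aset n w" "1 \<le> j" "j \<le> a" for a j
    using that(3,1,2) by (induction j rule: inc_induct) (auto intro: A)
  have "Aset n w \<subseteq> {1..n}"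
  proof
    fix a assume a: "a \<in> Aset n w"
    then have "{1..a} \<subseteq> Aset n w" using down by auto
    then have "a \<le> n" using card_mono[OF finite_Aset, of "{1..a}"] card_Aset by simp
    moreover have "a \<ge> 1" using a Aset_subset Sset_range by auto
    ultimately show "a \<in> {1..n}" by simp
  qed
  then show Aeq: "Aset n w = {1..n}" using card_Aset by (intro card_subset_eq) auto
  have le: "1 \<le> w p \<and> w p \<le> int n" if "1 \<le> p" "p \<le> int n" for p
  proof -
    have "nat (w p) \<in> Aset n w" unfolding Aset_image using that by auto
    then show ?thesis using gr_pos[OF that] unfolding Aeq by auto
  qed
  have w1: "w p = p" if p: "1 \<le> p" "p \<le> int n" for p
  proof (rule increasing_id[of 1 "int n"])
    show "w i < w (i + 1)" if "1 \<le> i" "i < int n" for i using that by (intro gr_mono) auto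
    show "1 \<le> w 1" "w (int n) \<le> int n" using le[of 1] le[of "int n"] p by auto
  qed (use p in auto)
  have neg: "w p \<le> - (int n + 1)" if p: "int n < p" "p \<le> int m" for p
  proof (rule ccontr)
    assume c: "\<not> w p \<le> - (int n + 1)"
    define a where "a = nat \<bar>w p\<bar>"
    have "w p \<noteq> 0" using p W_inf_eq_0[OF gr_W_inf] by auto
    then have a: "a \<ge> 1" "a \<le> m" using Weyl_bound[OF gr_Weyl, of p] p by (auto simp: a_def)
    then have aS: "a \<in> Sset n w" unfolding S by auto
    show False
    proof (cases "w p > 0")
      case True
      then have "inv w (int a) = p" using gr_inv(1)[of p] by (simp add: a_def)
      then show False using aS p by (auto simp: Sset_def)
    next
      case False
      then have ai: "int a = - w p" by (simp add: a_def)
      then have "inv w (int a) = - p" using gr_inv(1)[of p] gr_inv_odd[of "w p"] by simp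
      moreover have "a \<in> Aset n w" unfolding Aeq using a c ai by auto
      ultimately show False using p by (auto simp: Aset_def)
    qed
  qed
  have w2: "w p = - (int m + int n + 1 - p)" if p: "int n < p" "p \<le> int m" for p
  proof -
    \<comment> \<open>Adding \<open>m + n + 1\<close> carries the possible values
      \<open>-m, ..., -(n + 1)\<close> to the positions \<open>n + 1, ..., m\<close>.\<close>
    have "w p + (int m + int n + 1) = p"
    proof (rule increasing_id[of "int n + 1" "int m" "\<lambda>p. w p + (int m + int n + 1)"])
      show "w i + (int m + int n + 1) < w (i + 1) + (int m + int n + 1)" if "int n + 1 \<le> i" "i < int m" for i
        using gr_mono[of i "i + 1"] that by auto
      show "int n + 1 \<le> w (int n + 1) + (int m + int n + 1)"
        using Weyl_bound[OF gr_Weyl, of "int n + 1"] p by auto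
      show "w (int m) + (int m + int n + 1) \<le> int m" using neg[of "int m"] p by auto
    qed (use p in auto)
    then show ?thesis by simp
  qed
  show "is_top m n (w \<circ> w_long n)"
    unfolding is_top_def
  proof (intro conjI allI impI)
    show "w \<circ> w_long n \<in> Weyl m" using gr_Weyl Weyl_mono[OF w_long_Weyl gr_nm] by (rule Weyl_comp)
    fix p :: int assume p: "1 \<le> p \<and> p \<le> int m"
    then show "(w \<circ> w_long n) p = (if p \<le> int n then - p else - (int m + int n + 1 - p))"
      using w1[of p] w2[of p] W_inf_odd[OF gr_W_inf, of p] by (auto simp: w_long_def)
  qed
qed

end

lemma inv_sref_comp:
  assumes "w \<in> W_inf" shows "inv (sref i \<circ> w) x = inv w (sref i x)"
proof -
  have "inv (sref i) = sref i" using sref_comp_sref(1) by (intro inv_unique_comp) auto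
  then have "inv (sref i \<circ> w) = inv w \<circ> sref i"
    using W_inf_bij[OF W_inf_sref] W_inf_bij[OF assms] by (simp add: o_inv_distrib)
  then show ?thesis by simp
qed

lemma inv_comp_w_long:
  assumes "w \<in> W_inf" shows "inv (w \<circ> w_long n) x = w_long n (inv w x)"
  using W_inf_bij[OF assms] W_inf_bij[OF w_long_W_inf[of n]] by (simp add: o_inv_distrib inv_w_long)

lemma len_left_up:
  assumes w: "w \<in> W_inf" and d: "\<not> desc i (inv w)" shows "len (sref i \<circ> w) = Suc (len w)"
proof -
  have "inv (sref i \<circ> w) = inv w \<circ> sref i" using inv_sref_comp[OF w] by (simp add: fun_eq_iff)
  then have "len (sref i \<circ> w) = len (inv w \<circ> sref i)" using len_inv[OF W_inf_comp[OF W_inf_sref w], of i] by simp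
  then show ?thesis using len_sref(2)[OF W_inf_inv[OF w] d] len_inv[OF w] by simp
qed

lemma sref_mono: "a < b \<Longrightarrow> i \<ge> 1 \<Longrightarrow> \<not> (a = int i \<and> b = int i + 1) \<Longrightarrow> \<not> (a = - int i - 1 \<and> b = - int i) \<Longrightarrow> sref i a < sref i b"
  by (auto simp: sref_pos)

lemma sref_mono_0: "a < b \<Longrightarrow> a \<noteq> 0 \<Longrightarrow> b \<noteq> 0 \<Longrightarrow> a \<noteq> -1 \<Longrightarrow> sref 0 a < sref 0 b"
  by (auto simp: sref_0)

text \<open>\<open>sref i\<close> reverses the order of \<open>i\<close> and \<open>i + 1\<close>
  and of their negatives, for \<open>i = 0\<close> that of \<open>-1\<close> and \<open>1\<close>.
  The conditions keep such pairs away from neighbouring positions \<open>j\<close>,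
  \<open>j + 1\<close> with \<open>j \<noteq> n\<close>, and \<open>z\<close> keeps the first entry
  different from \<open>1\<close> when \<open>n > 0\<close>.\<close>

lemma gr_left:
  assumes g: "gr m n w" and i: "i < m"
    and ex: "inv w (- int (Suc i)) \<le> 0" "i \<ge> 1 \<Longrightarrow> inv w (int i) \<le> 0 \<or> inv w (int i) \<le> int n \<and> int n < inv w (int i + 1)"
    and z: "i = 0 \<Longrightarrow> inv w 1 > int n"
  shows "gr m n (sref i \<circ> w)"
proof -
  note W = gr_W_inf[OF g]
  have "\<not> desc j (sref i \<circ> w)" if j: "j \<noteq> n" for j
  proof (cases "j = 0")
    case True
    then have w1: "w 1 > 0" using j gr_pos[OF g, of 1] by simp
    have "sref i (w 1) > 0"
    proof (cases "i = 0")
      case True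
      have "w 1 \<noteq> 1" using gr_inv(1)[OF g, of 1] z True j \<open>j = 0\<close> by auto
      then show ?thesis using w1 True by (auto simp: sref_0)
    qed (use w1 in \<open>auto simp: sref_pos\<close>)
    then show ?thesis using True by (simp add: desc_def)
  next
    case False
    have lt: "w (int j) < w (int j + 1)" using False j by (intro gr_step[OF g]) auto
    have a: "w (int j) \<noteq> - int (Suc i)" using ex(1) gr_inv(1)[OF g, of "int j"] False by auto
    have "sref i (w (int j)) < sref i (w (int j + 1))"
    proof (cases "i = 0")
      case True
      have "w (int j) \<noteq> 0" "w (int j + 1) \<noteq> 0" using W_inf_eq_0[OF W] False by auto
      then show ?thesis using lt a True by (auto intro!: sref_mono_0)
    next
      case i0: False
      have "\<not> (w (int j) = int i \<and> w (int j + 1) = int i + 1)"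
      proof
        assume "w (int j) = int i \<and> w (int j + 1) = int i + 1"
        then have "inv w (int i) = int j" "inv w (int i + 1) = int j + 1" using gr_inv(1)[OF g] by metis+
        then show False using ex(2) i0 False j by auto
      qed
      then show ?thesis using lt a i0 by (intro sref_mono) auto
    qed
    then show ?thesis using False by (simp add: desc_def)
  qed
  then show ?thesis using g i by (auto simp: gr_def intro: Weyl_comp sref_Weyl)
qed

lemma schubert_up:
  assumes C: "is_schubert_family C" and w: "w \<in> W_inf"
    and d: "if i = 0 then w_long n (inv w 1) > 0 else w_long n (inv w (int i)) < w_long n (inv w (int i + 1))"
  shows "ddy i (C (sref i \<circ> w \<circ> w_long n)) = C (w \<circ> w_long n)"
proof -
  let ?u = "sref i \<circ> w \<circ> w_long n"
  have W: "sref i \<circ> w \<in> W_inf" "?u \<in> W_inf" by (intro W_inf_comp W_inf_sref w w_long_W_inf)+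
  have v: "inv ?u x = w_long n (inv w (sref i x))" for x
    using inv_comp_w_long[OF W(1)] inv_sref_comp[OF w] by simp
  have o: "inv w (-1) = - inv w 1" using W_inf_odd[OF W_inf_inv[OF w], of 1] by simp
  have "desc i (inv ?u)"
  proof (cases "i = 0")
    case True
    then show ?thesis using d v[of 1] by (simp add: desc_def sref_0 o w_long_def split: if_splits)
  qed (use d in \<open>simp add: desc_def v sref_pos\<close>)
  moreover have "sref i \<circ> ?u = w \<circ> w_long n" by (simp add: fun_eq_iff sref_sref)
  ultimately show ?thesis by (simp add: schubert_ddy[OF C W(2)])
qed

text \<open>Exchanging \<open>i\<close> and \<open>i + 1\<close> can alter the number of elements
  below \<open>v\<close> only if exactly one of the two lies below \<open>v\<close>, that is for
  \<open>v = i + 1\<close>.\<close>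

lemma rho_transpose:
  assumes "\<And>a. a \<in> B \<longleftrightarrow> transpose i (Suc i) a \<in> A" "v \<noteq> Suc i"
  shows "rho B v = rho A v"
proof -
  have "bij_betw (transpose i (Suc i)) {a \<in> B. a < v} {a \<in> A. a < v}"
    by (rule bij_betw_byWitness[where f' = "transpose i (Suc i)"]) (use assms in \<open>auto simp: transpose_def split: if_splits\<close>)
  then show ?thesis unfolding rho_def by (rule bij_betw_same_card)
qed

lemma rho_Suc: "rho A (Suc v) = rho A v + (if v \<in> A then 1 else 0)"
proof -
  have "{a \<in> A. a < Suc v} = {a \<in> A. a < v} \<union> (if v \<in> A then {v} else {})" by (auto simp: less_Suc_eq)
  then show ?thesis unfolding rho_def by simp
qed

lemma sref_Aset:
  assumes w: "w \<in> W_inf" and i: "i \<ge> 1"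
  shows "a \<in> Aset n (sref i \<circ> w) \<longleftrightarrow> transpose i (Suc i) a \<in> Aset n w"
    "a \<in> Sset n (sref i \<circ> w) \<longleftrightarrow> transpose i (Suc i) a \<in> Sset n w"
proof -
  have "sref i (int a) = int (transpose i (Suc i) a)" using i by (auto simp: sref_pos transpose_def)
  then show "a \<in> Aset n (sref i \<circ> w) \<longleftrightarrow> transpose i (Suc i) a \<in> Aset n w"
    "a \<in> Sset n (sref i \<circ> w) \<longleftrightarrow> transpose i (Suc i) a \<in> Sset n w"
    by (simp_all add: Aset_def Sset_def inv_sref_comp[OF w])
qed

lemma sorted_list_split:
  assumes "finite S" "v \<in> S"
  shows "sorted_list_of_set S = sorted_list_of_set {x \<in> S. x < v} @ v # sorted_list_of_set {x \<in> S. x > (v :: nat)}"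
proof (rule sorted_distinct_set_unique)
  show "set (sorted_list_of_set S) = set (sorted_list_of_set {x \<in> S. x < v} @ v # sorted_list_of_set {x \<in> S. x > v})"
    using assms by auto
qed (use assms in \<open>auto simp: sorted_append\<close>)

text \<open>Induction from the top down. Unless \<open>w\<close> is the longest
  \<open>n\<close>-Grassmannian element of \<open>W_m\<close>, some \<open>s_i w\<close> is a longer
  one, and \<open>ddy i\<close> takes \<open>C (s_i w w_0^(n))\<close> back to
  \<open>C (w w_0^(n))\<close>. The three kinds of \<open>s_i\<close> match the three effects of
  \<open>ddy\<close> on a \<open>Pf\<close>.\<close>

lemma grassmannian_Pf_multiple:
  assumes C: "is_schubert_family C" and k: "Pf (\<lambda>v. v - 1) [1..<Suc m] = of_int k * C (w_long m)"
    and g: "gr m n w"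
  shows "of_int k * C (w \<circ> w_long n) = Pf (rho (Aset n w)) (sorted_list_of_set (Sset n w))"
  using g
proof (induction "m * m - len w" arbitrary: w rule: less_induct)
  case less
  note g = less.prems
  note W = gr_W_inf[OF g]
  define A where "A = Aset n w"
  define S where "S = Sset n w"
  have AS: "A \<subseteq> S" "finite S" "S \<subseteq> {1..m}"
    using Aset_subset[OF g] finite_Sset[OF g] Sset_range[OF g] by (auto simp: A_def S_def)
  have cases: "a \<in> A \<or> (a \<in> S \<and> a \<notin> A \<and> inv w (int a) < - int n) \<or> (a \<notin> S \<and> inv w (int a) > int n)" if "a \<ge> 1" for a
    using inv_cases[OF g that] by (simp add: A_def S_def)
  have Av: "1 \<le> inv w (int a) \<and> inv w (int a) \<le> int n" if "a \<in> A" for a using that by (simp add: A_def Aset_def)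
  have up: "of_int k * C (w \<circ> w_long n) = ddy i (Pf (rho (Aset n (sref i \<circ> w))) (sorted_list_of_set (Sset n (sref i \<circ> w))))"
    if "gr m n (sref i \<circ> w)" "\<not> desc i (inv w)"
      "if i = 0 then w_long n (inv w 1) > 0 else w_long n (inv w (int i)) < w_long n (inv w (int i + 1))" for i
  proof -
    have l: "len (sref i \<circ> w) = Suc (len w)" by (rule len_left_up[OF W that(2)])
    moreover have "len (sref i \<circ> w) \<le> m * m" by (rule len_le[OF gr_Weyl[OF that(1)]])
    ultimately have "m * m - len (sref i \<circ> w) < m * m - len w" by simp
    from less.hyps[OF this that(1)]
    have "ddy i (of_int k * C (sref i \<circ> w \<circ> w_long n)) = ddy i (Pf (rho (Aset n (sref i \<circ> w))) (sorted_list_of_set (Sset n (sref i \<circ> w))))"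
      by (rule arg_cong)
    then show ?thesis unfolding ddy_of_int schubert_up[OF C W that(3)] .
  qed
  have io: "inv w (- int (Suc i)) = - inv w (int (Suc i))" for i by (rule gr_inv_odd[OF g])
  consider (move) i where "i \<ge> 1" "i < m" "i \<in> S" "Suc i \<notin> S"
    | (add) "m > 0" "1 \<notin> S"
    | (swap) i where "i \<ge> 1" "Suc i \<in> A" "i \<in> S" "i \<notin> A"
    | (top) "S = {1..m}" "\<And>i. i \<ge> 1 \<Longrightarrow> Suc i \<in> A \<Longrightarrow> i \<in> A"
  proof (cases "S = {1..m}")
    case True
    show ?thesis
    proof (cases "\<forall>i\<ge>1. Suc i \<in> A \<longrightarrow> i \<in> A")
      case False
      then obtain i where i: "i \<ge> 1" "Suc i \<in> A" "i \<notin> A" by blast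
      then have "Suc i \<in> {1..m}" using AS by blast
      then have "i \<in> S" using i True by auto
      then show ?thesis using swap i by blast
    qed (use True top in blast)
  next
    case False
    show ?thesis
    proof (cases "m > 0 \<and> 1 \<notin> S")
      case False
      have "\<exists>i. i \<ge> 1 \<and> i < m \<and> i \<in> S \<and> Suc i \<notin> S"
      proof (rule ccontr)
        assume c: "\<not> ?thesis"
        have "i \<in> S" if "1 \<le> i" "i \<le> m" for i
          using that by (induction i rule: dec_induct) (use False c in auto)
        then have "S = {1..m}" using AS by auto
        then show False using \<open>S \<noteq> {1..m}\<close> by simp
      qed
      then show ?thesis using move by blast
    qed (use add in blast)
  qed
  then show ?case
  proof cases
    \<comment> \<open>There is a gap above \<open>i\<close>: passing to \<open>s_i w\<close>
      replaces the row of \<open>i\<close> by one of \<open>i + 1\<close>, and \<open>ddy i\<close>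
      moves it back.\<close>
    case move
    have q: "inv w (int (Suc i)) > int n" using cases[of "Suc i"] move AS by auto
    have p: "inv w (int i) < - int n \<or> (1 \<le> inv w (int i) \<and> inv w (int i) \<le> int n)"
      using cases[of i] Av[of i] move by auto
    have g': "gr m n (sref i \<circ> w)"
      by (rule gr_left[OF g]) (use move p q io[of i] in \<open>auto simp: add.commute\<close>)
    have "of_int k * C (w \<circ> w_long n) = ddy i (Pf (rho (Aset n (sref i \<circ> w))) (sorted_list_of_set (Sset n (sref i \<circ> w))))"
      by (rule up[OF g']) (use move p q in \<open>auto simp: desc_def w_long_def add.commute\<close>)
    also have "sorted_list_of_set (Sset n (sref i \<circ> w)) = sorted_list_of_set {x \<in> S. x < i} @ Suc i # sorted_list_of_set {x \<in> S. x > i}"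
    proof -
      note sA = sref_Aset(2)[OF W move(1), of _ n, folded S_def]
      have "Suc i \<in> Sset n (sref i \<circ> w)" using move by (simp add: sA)
      moreover have "{x \<in> Sset n (sref i \<circ> w). x < Suc i} = {x \<in> S. x < i}" "{x \<in> Sset n (sref i \<circ> w). x > Suc i} = {x \<in> S. x > i}"
        unfolding sA using move by (auto simp: transpose_def less_Suc_eq split: if_splits)
      ultimately show ?thesis using sorted_list_split[OF finite_Sset[OF g'], of "Suc i"] by simp
    qed
    also have "ddy i (Pf (rho (Aset n (sref i \<circ> w))) (sorted_list_of_set {x \<in> S. x < i} @ Suc i # sorted_list_of_set {x \<in> S. x > i})) =
        Pf ((rho (Aset n (sref i \<circ> w)))(i := rho (Aset n (sref i \<circ> w)) (Suc i))) (sorted_list_of_set {x \<in> S. x < i} @ i # sorted_list_of_set {x \<in> S. x > i})"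
      using move AS by (intro Pf_ddy_move) auto
    also have "\<dots> = Pf (rho A) (sorted_list_of_set {x \<in> S. x < i} @ i # sorted_list_of_set {x \<in> S. x > i})"
    proof (rule Pf_cong)
      note sA = sref_Aset(1)[OF W move(1), of _ n, folded A_def]
      fix v assume v: "v \<in> set (sorted_list_of_set {x \<in> S. x < i} @ i # sorted_list_of_set {x \<in> S. x > i})"
      then have "v \<noteq> Suc i" using move AS by auto
      then have "rho (Aset n (sref i \<circ> w)) v = rho A v" by (rule rho_transpose[rotated]) (simp add: sA)
      moreover have "i \<notin> Aset n (sref i \<circ> w)" using move AS by (auto simp: sA)
      ultimately show "((rho (Aset n (sref i \<circ> w)))(i := rho (Aset n (sref i \<circ> w)) (Suc i))) v = rho A v"
        by (simp add: rho_Suc)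
    qed
    also have "sorted_list_of_set {x \<in> S. x < i} @ i # sorted_list_of_set {x \<in> S. x > i} = sorted_list_of_set S"
      using sorted_list_split[OF AS(2), of i] move by simp
    finally show ?thesis unfolding A_def S_def .
  next
    \<comment> \<open>In \<open>s_0 w\<close> the entry \<open>1\<close>, which stands behind
      position \<open>n\<close>, becomes negative. This adds the row of 1, with
      \<open>\<rho> = 0\<close>, and \<open>ddy 0\<close> removes it.\<close>
    case add
    have q: "inv w 1 > int n" using cases[of 1] add AS by auto
    have g': "gr m n (sref 0 \<circ> w)"
      by (rule gr_left[OF g]) (use add q io[of 0] in auto)
    have sv: "inv (sref 0 \<circ> w) (int a) = (if a = 1 then - inv w 1 else inv w (int a))" for a
      using gr_inv_odd[OF g, of 1] by (simp add: inv_sref_comp[OF W] sref_0)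
    have A': "Aset n (sref 0 \<circ> w) = A" using q by (auto simp: Aset_def A_def sv split: if_splits)
    have S': "Sset n (sref 0 \<circ> w) = insert 1 S" using q by (auto simp: Sset_def S_def sv split: if_splits)
    have "of_int k * C (w \<circ> w_long n) = ddy 0 (Pf (rho (Aset n (sref 0 \<circ> w))) (sorted_list_of_set (Sset n (sref 0 \<circ> w))))"
      by (rule up[OF g']) (use add q in \<open>auto simp: desc_def w_long_def\<close>)
    also have "\<dots> = ddy 0 (Pf (rho A) (Suc 0 # sorted_list_of_set S))"
    proof -
      have "x > 1" if "x \<in> S" for x
      proof -
        have "x \<ge> 1" "x \<noteq> 1" using that AS add by auto
        then show ?thesis by simp
      qed
      then have e: "{x \<in> insert 1 S. x < 1} = {}" "{x \<in> insert 1 S. x > 1} = S" using AS by auto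
      have "sorted_list_of_set (insert 1 S) = [] @ 1 # sorted_list_of_set S"
        using sorted_list_split[OF finite.insertI[OF AS(2)] insertI1, of 1] unfolding e
        by (simp only: sorted_list_of_set_empty)
      then show ?thesis unfolding A' S' by (simp only: append_Nil One_nat_def)
    qed
    also have "\<dots> = Pf (rho A) (sorted_list_of_set S)"
    proof (rule Pf_ddy_remove)
      have "{a \<in> A. a < Suc 0} = {}" using AS by auto
      then show "rho A (Suc 0) = 0" by (simp add: rho_def)
      fix v assume "v \<in> set (sorted_list_of_set S)"
      then have "v \<in> S" using AS by simp
      then have "v \<noteq> 1" "v \<ge> 1" using add AS by auto
      then show "v \<ge> 2" by simp
    qed
    finally show ?thesis unfolding A_def S_def .
  next
    \<comment> \<open>Both values keep their rows, but for \<open>s_i w\<close> the set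
      \<open>Aset\<close> contains \<open>i\<close> instead of \<open>i + 1\<close>, which raises
      \<open>rho\<close> at \<open>i + 1\<close> by one; \<open>ddy i\<close> lowers it
      again.\<close>
    case swap
    have q: "1 \<le> inv w (int (Suc i))" "inv w (int (Suc i)) \<le> int n" using Av[of "Suc i"] swap by auto
    have p: "inv w (int i) < - int n" using cases[of i] swap by auto
    have iS: "Suc i \<in> S" using swap AS by auto
    have im: "i < m" using iS AS by auto
    have g': "gr m n (sref i \<circ> w)"
      by (rule gr_left[OF g im]) (use swap p q io[of i] in \<open>auto simp: add.commute\<close>)
    note sA = sref_Aset(1)[OF W swap(1), of _ n, folded A_def] sref_Aset(2)[OF W swap(1), of _ n, folded S_def]
    have S': "Sset n (sref i \<circ> w) = S" using swap iS by (auto simp: sA transpose_def split: if_splits)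
    have l: "sorted_list_of_set S = sorted_list_of_set {x \<in> S. x < i} @ i # Suc i # sorted_list_of_set {x \<in> S. x > Suc i}"
    proof -
      have "{x \<in> {x \<in> S. x > i}. x < Suc i} = {}" "{x \<in> {x \<in> S. x > i}. x > Suc i} = {x \<in> S. x > Suc i}" by auto
      then show ?thesis using sorted_list_split[OF AS(2), of i] swap sorted_list_split[of "{x \<in> S. x > i}" "Suc i"] iS AS by simp
    qed
    let ?r = "rho (Aset n (sref i \<circ> w))"
    have "of_int k * C (w \<circ> w_long n) = ddy i (Pf ?r (sorted_list_of_set (Sset n (sref i \<circ> w))))"
      by (rule up[OF g']) (use swap p q in \<open>auto simp: desc_def w_long_def add.commute\<close>)
    also have "\<dots> = Pf (?r(Suc i := ?r i)) (sorted_list_of_set S)"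
      unfolding S' l
    proof (rule Pf_ddy_swap)
      show "?r (Suc i) = Suc (?r i)" using swap by (simp add: rho_Suc sA)
    qed (use swap AS in auto)
    also have "\<dots> = Pf (rho A) (sorted_list_of_set S)"
    proof (rule Pf_cong)
      fix v
      have "?r x = rho A x" if "x \<noteq> Suc i" for x using that by (rule rho_transpose[rotated]) (simp add: sA)
      then show "(?r(Suc i := ?r i)) v = rho A v" using swap by (simp add: rho_Suc)
    qed
    finally show ?thesis unfolding A_def S_def .
  next
    \<comment> \<open>No step is left: \<open>w \<circ> w_long n\<close> is the element reached from
      the longest one in \<open>top_Pf\<close>.\<close>
    case top
    note t = is_top_terminal[OF g top(1)[unfolded S_def] top(2)[unfolded A_def]]
    obtain u where u: "is_top m n u" "of_int k * C u = Pf (\<lambda>v. min (v - 1) n) [1..<Suc m]"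
      using top_Pf[OF C k gr_nm[OF g]] by blast
    have "u = w \<circ> w_long n" by (rule W_inf_ext[of _ m]) (use u(1) t(2) in \<open>auto simp: is_top_def\<close>)
    moreover have "Pf (rho (Aset n w)) (sorted_list_of_set (Sset n w)) = Pf (\<lambda>v. min (v - 1) n) [1..<Suc m]"
    proof -
      have "sorted_list_of_set {1..m} = [1..<Suc m]" by (simp add: atLeastLessThanSuc_atLeastAtMost[symmetric] del: upt_Suc)
      moreover have "rho {1..n} v = min (v - 1) n" if "v \<ge> 1" for v
      proof -
        have "{a \<in> {1..n}. a < v} = {1..min (v - 1) n}" using that by auto
        then show ?thesis by (simp add: rho_def)
      qed
      ultimately show ?thesis using t(1) top(1) unfolding S_def by (auto intro!: Pf_cong simp del: upt_Suc)
    qed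
    ultimately show ?thesis using u by metis
  qed
qed

lemma grassmannian_Pf:
  assumes C: "is_schubert_family C" and g: "gr m n w"
  shows "C (w \<circ> w_long n) = Pf (rho (Aset n w)) (sorted_list_of_set (Sset n w))"
proof -
  obtain k where k: "Pf (\<lambda>v. v - 1) [1..<Suc m] = of_int k * C (w_long m)" using Pf_w_long[OF C] by blast
  have id: "\<not> desc i id" for i by (auto simp: desc_def)
  have "gr m 0 id" using Weyl_id id by (auto simp: gr_def)
  from grassmannian_Pf_multiple[OF C k this]
  have "of_int k * C (id \<circ> w_long 0) = Pf (rho (Aset 0 id)) (sorted_list_of_set (Sset 0 id))" .
  moreover have "w_long 0 = id" by (auto simp: w_long_def fun_eq_iff)
  moreover have "Sset 0 id = {}" by (auto simp: Sset_def)
  ultimately have "of_int k * C id = 1" by (simp add: Pf_def)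
  from arg_cong[OF this, of const_term] have "k = 1"
    using schubert_const[OF C W_inf_id] by (simp add: is_ring_homD[OF const_term_hom] is_ring_hom_of_int_eq[OF const_term_hom])
  then show ?thesis using grassmannian_Pf_multiple[OF C k g] by (simp only: of_int_1 mult_1_left)
qed

section \<open>Partitions\<close>

lemma nth_default_conj_part: "nth_default 0 (conj_part p) j = length (filter (\<lambda>a. a > j) p)"
proof (cases "j < Max (insert 0 (set p))")
  case True
  then show ?thesis by (simp add: conj_part_def nth_default_def)
next
  case False
  have "a \<le> Max (insert 0 (set p))" if "a \<in> set p" for a using that by (intro Max_ge) auto
  then have "\<not> a > j" if "a \<in> set p" for a using False that by (metis leI le_trans not_less)
  then have "filter (\<lambda>a. a > j) p = []" by (simp add: filter_empty_conv)
  then show ?thesis using False by (simp add: conj_part_def nth_default_def)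
qed

lemma nth_default_add_part: "nth_default 0 (add_part p q) i = nth_default 0 p i + nth_default 0 q i"
  by (auto simp: add_part_def nth_default_def)

lemma gamma_code_support:
  assumes u: "u \<in> Weyl m" shows "gamma_code u i \<noteq> 0 \<Longrightarrow> i \<le> int m"
proof (rule ccontr)
  assume g: "gamma_code u i \<noteq> 0" and i: "\<not> i \<le> int m"
  have "u j = j" if "j \<ge> i" for j using i that by (intro Weyl_fixed[OF u]) auto
  then have "{j. j > i \<and> u j < u i} = {}" by auto
  then have "gamma_code u i = 0" unfolding gamma_code_def by (simp only: card.empty)
  then show False using g by simp
qed

lemma finite_gamma_code: "u \<in> Weyl m \<Longrightarrow> finite {i. i > 0 \<and> gamma_code u i \<noteq> 0}"
  by (rule finite_subset[of _ "{1..int m}"]) (auto dest: gamma_code_support)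

lemma set_delta_part:
  assumes "u \<in> Weyl m" shows "set (delta_part u) = gamma_code u ` {i. i > 0 \<and> gamma_code u i \<noteq> 0}"
  using finite_gamma_code[OF assms] by (simp add: delta_part_def)

lemma nth_default_nu_part:
  assumes u: "u \<in> Weyl m" shows "nth_default 0 (nu_part u) j = card {i. i > 0 \<and> gamma_code u i > j}"
proof -
  let ?I = "{i. i > 0 \<and> gamma_code u i \<noteq> 0}"
  have "length (filter (\<lambda>a. a > j) (delta_part u)) = size (filter_mset (\<lambda>a. a > j) (mset (delta_part u)))"
    by (metis mset_filter size_mset)
  also have "mset (delta_part u) = image_mset (gamma_code u) (mset_set ?I)" by (simp add: delta_part_def)
  also have "filter_mset (\<lambda>a. a > j) (image_mset (gamma_code u) (mset_set ?I)) =
      image_mset (gamma_code u) (mset_set {i \<in> ?I. gamma_code u i > j})"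
    using finite_gamma_code[OF u] by (simp add: filter_mset_image_mset)
  also have "size (image_mset (gamma_code u) (mset_set {i \<in> ?I. gamma_code u i > j})) = card {i \<in> ?I. gamma_code u i > j}" by simp
  also have "{i \<in> ?I. gamma_code u i > j} = {i. i > 0 \<and> gamma_code u i > j}" by auto
  finally show ?thesis by (simp add: nu_part_def nth_default_conj_part)
qed

lemma length_nu_part:
  assumes u: "u \<in> Weyl m" and b: "\<And>i. i > 0 \<Longrightarrow> gamma_code u i \<le> b" shows "length (nu_part u) \<le> b"
proof -
  have "Max (insert 0 (set (delta_part u))) \<le> b"
    using b finite_gamma_code[OF u] by (intro Max.boundedI) (auto simp: set_delta_part[OF u])
  then show ?thesis by (simp add: nu_part_def conj_part_def)
qed

lemma length_filter_decreasing:
  fixes a :: nat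
  assumes "sorted_wrt (>) xs" "j < length xs"
  shows "j < length (filter (\<lambda>v. v > a) xs) \<longleftrightarrow> a < xs ! j"
  using assms
proof (induction xs arbitrary: j)
  case (Cons x xs)
  show ?case
  proof (cases "a < x")
    case True
    then show ?thesis using Cons by (cases j) auto
  next
    case False
    then have "\<forall>v\<in>set (x # xs). \<not> a < v" using Cons.prems by auto
    moreover from this have "filter (\<lambda>v. v > a) (x # xs) = []" by (simp only: filter_empty_conv)
    ultimately show ?thesis using Cons.prems nth_mem[of j "x # xs"] by auto
  qed
qed simp

section \<open>The partitions of \<open>w w_0^(n)\<close>\<close>

lemma gr_gamma_code_large:
  assumes g: "gr m n w" and i: "i > int n" shows "gamma_code w i = 0" "gamma_code (w \<circ> w_long n) i = 0"
proof -
  have "w i < w j" if "j > i" for j using that i by (intro gr_mono[OF g]) auto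
  then have "{j. j > i \<and> w j < w i} = {}" "{j. j > i \<and> (w \<circ> w_long n) j < (w \<circ> w_long n) i} = {}"
    using i by (force simp: w_long_def)+
  then show "gamma_code w i = 0" "gamma_code (w \<circ> w_long n) i = 0"
    unfolding gamma_code_def by (simp_all only: card.empty)
qed

context
  fixes m n w u
  assumes g: "gr m n w" and u: "u = w \<circ> w_long n"
begin

lemma hat_Weyl: "u \<in> Weyl m"
  unfolding u using gr_Weyl[OF g] Weyl_mono[OF w_long_Weyl gr_nm[OF g]] by (rule Weyl_comp)

lemma hat_apply: "u j = w (w_long n j)"
  by (simp add: u)

lemma Sset_hat: "v \<in> Sset n w \<longleftrightarrow> (\<exists>j>0. u j = - int v) \<and> v \<ge> 1"
proof
  assume v: "v \<in> Sset n w"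
  have "v \<ge> 1" using v Sset_range[OF g] by auto
  moreover have "\<exists>j>0. u j = - int v"
  proof (cases "inv w (int v) \<le> int n \<and> 1 \<le> inv w (int v)")
    case True
    then show ?thesis
      using W_inf_odd[OF gr_W_inf[OF g]] gr_inv[OF g]
      by (intro exI[of _ "inv w (int v)"]) (simp add: hat_apply w_long_def)
  next
    case False
    then have "inv w (int v) < - int n" using v by (auto simp: Sset_def)
    then show ?thesis
      using W_inf_odd[OF gr_W_inf[OF g]] gr_inv[OF g]
      by (intro exI[of _ "- inv w (int v)"]) (simp add: hat_apply w_long_def)
  qed
  ultimately show "(\<exists>j>0. u j = - int v) \<and> v \<ge> 1" by blast
next
  assume "(\<exists>j>0. u j = - int v) \<and> v \<ge> 1"
  then obtain j where j: "j > 0" "u j = - int v" by blast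
  then have "inv w (- int v) = w_long n j" using gr_inv(1)[OF g, of "w_long n j"] by (simp add: hat_apply)
  then have "inv w (int v) = - w_long n j" using gr_inv_odd[OF g, of "int v"] by simp
  then show "v \<in> Sset n w" using j by (auto simp: Sset_def w_long_def)
qed

lemma mu_part_hat: "mu_part u = rev (sorted_list_of_set (Sset n w))"
proof -
  have "{nat \<bar>u i\<bar> |i. i > 0 \<and> u i < 0} = Sset n w"
  proof (intro equalityI subsetI)
    fix v assume "v \<in> {nat \<bar>u i\<bar> |i. i > 0 \<and> u i < 0}"
    then obtain i where "v = nat \<bar>u i\<bar>" "i > 0" "u i < 0" by blast
    then show "v \<in> Sset n w" by (auto simp: Sset_hat intro!: exI[of _ i])
  next
    fix v assume "v \<in> Sset n w"
    then obtain j where "j > 0" "u j = - int v" "v \<ge> 1" by (auto simp: Sset_hat)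
    then show "v \<in> {nat \<bar>u i\<bar> |i. i > 0 \<and> u i < 0}" by (intro CollectI exI[of _ j]) auto
  qed
  then show ?thesis by (simp add: mu_part_def)
qed

text \<open>The first \<open>n\<close> entries of \<open>u\<close> are the \<open>- w i\<close>, in
  decreasing order. The entries at positive positions below \<open>- w i\<close> are the
  \<open>- v\<close> with \<open>v > w i\<close> in \<open>Sset n w\<close>, and all of them stand
  to the right of position \<open>i\<close>.\<close>

lemma gamma_code_hat:
  assumes i: "1 \<le> i" "i \<le> int n" shows "gamma_code u i = card {v \<in> Sset n w. v > nat (w i)}"
proof -
  have wi: "w i > 0" "u i = - w i"
    using gr_pos[OF g i] i W_inf_odd[OF gr_W_inf[OF g], of i] by (auto simp: hat_apply w_long_def)
  have "bij_betw (\<lambda>j. nat (- u j)) {j. j > i \<and> u j < u i} {v \<in> Sset n w. v > nat (w i)}"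
  proof (rule bij_betwI')
    fix x y assume "x \<in> {j. j > i \<and> u j < u i}" "y \<in> {j. j > i \<and> u j < u i}"
    then have "nat (- u x) = nat (- u y) \<longleftrightarrow> u x = u y" using wi by auto
    then show "nat (- u x) = nat (- u y) \<longleftrightarrow> x = y"
      using W_inf_eq_iff[OF Weyl_W_inf[OF hat_Weyl]] by simp
  next
    fix x assume x: "x \<in> {j. j > i \<and> u j < u i}"
    then have "nat (- u x) \<in> Sset n w" using wi i by (auto simp: Sset_hat intro!: exI[of _ x])
    then show "nat (- u x) \<in> {v \<in> Sset n w. v > nat (w i)}" using x wi by auto
  next
    fix v assume v: "v \<in> {v \<in> Sset n w. v > nat (w i)}"
    then obtain j where j: "j > 0" "u j = - int v" by (auto simp: Sset_hat)
    have lt: "u j < u i" using v j wi by auto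
    have "j > i"
    proof (rule ccontr)
      assume "\<not> j > i"
      then have "w j \<le> w i" using gr_mono[OF g, of j i] j i by (cases "j = i") auto
      moreover have "u j = - w j" using \<open>\<not> j > i\<close> j i W_inf_odd[OF gr_W_inf[OF g], of j] by (simp add: hat_apply w_long_def)
      ultimately show False using lt wi by simp
    qed
    then show "\<exists>x\<in>{j. j > i \<and> u j < u i}. v = nat (- u x)" using j lt by (intro bexI[of _ j]) auto
  qed
  then show ?thesis unfolding gamma_code_def by (rule bij_betw_same_card)
qed

lemma mu_rank:
  assumes "j < length (mu_part u)" shows "card {v \<in> Sset n w. v > a} > j \<longleftrightarrow> a < mu_part u ! j"
proof -
  have s: "sorted_wrt (>) (mu_part u)" by (simp add: mu_part_hat sorted_wrt_rev)
  have "distinct (filter (\<lambda>v. v > a) (mu_part u))" by (simp add: mu_part_hat)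
  then have "length (filter (\<lambda>v. v > a) (mu_part u)) = card (set (filter (\<lambda>v. v > a) (mu_part u)))"
    by (simp only: distinct_card)
  also have "set (filter (\<lambda>v. v > a) (mu_part u)) = {v \<in> Sset n w. v > a}"
    using finite_Sset[OF g] by (auto simp: mu_part_hat)
  finally show ?thesis using length_filter_decreasing[OF s assms, of a] by simp
qed

text \<open>By \<open>gamma_code_hat\<close> and \<open>mu_rank\<close> a position \<open>i\<close>
  has a code above \<open>j\<close> iff \<open>i \<le> n\<close> and \<open>w i\<close> is less than
  the part of \<mu> at \<open>j\<close>.\<close>

lemma nu_part_hat:
  assumes j: "j < length (mu_part u)" shows "nth_default 0 (nu_part u) j = rho (Aset n w) (mu_part u ! j)"
proof -
  have eq: "{i. i > 0 \<and> gamma_code u i > j} = {i \<in> {1..int n}. nat (w i) < mu_part u ! j}"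
  proof (intro equalityI subsetI)
    fix i assume i: "i \<in> {i. i > 0 \<and> gamma_code u i > j}"
    then have "i \<le> int n" using gr_gamma_code_large(2)[OF g, of i] u by force
    then show "i \<in> {i \<in> {1..int n}. nat (w i) < mu_part u ! j}"
      using i gamma_code_hat[of i] mu_rank[OF j] by auto
  qed (use gamma_code_hat mu_rank[OF j] in auto)
  have "inj_on (\<lambda>p. nat (w p)) {1..int n}"
    using gr_pos[OF g] W_inf_eq_iff[OF gr_W_inf[OF g]] by (intro inj_onI) (metis atLeastAtMost_iff int_nat_eq less_imp_le)
  then have inj: "inj_on (\<lambda>p. nat (w p)) {i \<in> {1..int n}. nat (w i) < mu_part u ! j}" by (rule inj_on_subset) auto
  have "{a \<in> Aset n w. a < mu_part u ! j} = (\<lambda>p. nat (w p)) ` {i \<in> {1..int n}. nat (w i) < mu_part u ! j}"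
    by (auto simp: Aset_image[OF g])
  then show ?thesis
    unfolding nth_default_nu_part[OF hat_Weyl] eq rho_def by (simp only: card_image[OF inj])
qed

text \<open>The codes are at most the number of negative entries, so \<nu> is not longer than
  \<mu>.\<close>

lemma length_lam_part_hat: "length (lam_part u) = length (mu_part u)"
proof -
  have L: "length (mu_part u) = card (Sset n w)" by (simp add: mu_part_hat)
  have "gamma_code u i \<le> card (Sset n w)" if "i > 0" for i
  proof (cases "i \<le> int n")
    case True
    then show ?thesis using that gamma_code_hat[of i] by (auto intro: card_mono[OF finite_Sset[OF g]])
  next
    case False
    then show ?thesis using gr_gamma_code_large(2)[OF g, of i] u by simp
  qed
  then show ?thesis using length_nu_part[OF hat_Weyl] by (simp add: lam_part_def add_part_def L)
qed

lemma lam_part_hat: "j < length (mu_part u) \<Longrightarrow> lam_part u ! j = mu_part u ! j + rho (Aset n w) (mu_part u ! j)"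
  using nu_part_hat[of j] length_lam_part_hat by (simp add: lam_part_def add_part_def nth_default_def[of _ "mu_part u"])

lemma multi_Q_hat:
  "multi_Q (map int (nu_part u)) (beta_seq u) (map int (lam_part u)) = Pf (rho (Aset n w)) (sorted_list_of_set (Sset n w))"
proof -
  let ?L = "length (mu_part u)"
  let ?row = "\<lambda>v. row (rho (Aset n w) v) (v - 1)"
  have "map (\<lambda>i. multi_c (nth_default 0 (map int (nu_part u)) i) (nth_default 0 (beta_seq u) i)) [0..<length (map int (lam_part u))]
      = map ?row (mu_part u)"
  proof (rule nth_equalityI)
    fix i assume "i < length (map (\<lambda>i. multi_c (nth_default 0 (map int (nu_part u)) i) (nth_default 0 (beta_seq u) i)) [0..<length (map int (lam_part u))])"
    then have i: "i < ?L" by (simp add: length_lam_part_hat)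
    have "mu_part u ! i \<in> set (mu_part u)" using i by simp
    then have "mu_part u ! i \<ge> 1" using Sset_range[OF g] finite_Sset[OF g] by (auto simp: mu_part_hat)
    \<comment> \<open>Parts of \<mu> are at least 1, so the minimum with \<open>0\<close> in
      \<open>beta_seq\<close> is its first argument.\<close>
    then have b: "nth_default 0 (beta_seq u) i = - int (mu_part u ! i - 1)"
      using i by (simp add: beta_seq_def nth_default_def of_nat_diff)
    have "nth_default 0 (map int (nu_part u)) i = int (rho (Aset n w) (mu_part u ! i))"
      using nu_part_hat[OF i] by (simp add: nth_default_map_eq[of int 0])
    then show "map (\<lambda>i. multi_c (nth_default 0 (map int (nu_part u)) i) (nth_default 0 (beta_seq u) i)) [0..<length (map int (lam_part u))] ! i
        = map ?row (mu_part u) ! i"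
      using i b by (simp add: length_lam_part_hat multi_c_row fun_eq_iff)
  qed (simp add: length_lam_part_hat)
  moreover have "map int (lam_part u) = map (\<lambda>v. int (v + rho (Aset n w) v)) (mu_part u)"
    by (rule nth_equalityI) (simp_all add: length_lam_part_hat lam_part_hat)
  ultimately show ?thesis unfolding multi_Q_Qr Pf_def by (simp add: mu_part_hat flip: rev_map)
qed

end

section \<open>Unsigned permutations\<close>

context
  fixes m n w
  assumes g: "gr m n w" and sym: "w \<in> Sym m"
begin

lemma Sym_pos: "i > 0 \<Longrightarrow> w i > 0"
  using sym by (auto simp: Sym_def)

lemma Sym_inv_pos: "i > 0 \<Longrightarrow> inv w i > 0"
proof (rule ccontr)
  assume i: "i > 0" "\<not> inv w i > 0"
  then have "inv w i \<noteq> 0" using gr_inv_0[OF g] by simp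
  then have "w (- inv w i) > 0" using i by (intro Sym_pos) auto
  then show False using i W_inf_odd[OF gr_W_inf[OF g], of "inv w i"] gr_inv(2)[OF g] by simp
qed

lemma Sym_Sset: "Sset n w = Aset n w"
proof -
  have "\<not> inv w (int a) < - int n" for a
    using Sym_inv_pos[of "int a"] gr_inv_0[OF g, of 0] by (cases "a = 0") auto
  then show ?thesis by (auto simp: Aset_def Sset_def)
qed

text \<open>Of the \<open>w i - 1\<close> positive values below \<open>w i\<close> exactly
  \<open>i - 1\<close> stand to the left of position \<open>i\<close>, because the first
  \<open>n\<close> entries increase.\<close>

lemma Sym_gamma_code:
  assumes i: "1 \<le> i" "i \<le> int n" shows "int (gamma_code w i) = w i - i"
proof -
  have wi: "w i > 0" using i Sym_pos by simp
  have sub: "w ` {1..<i} \<subseteq> {1..<w i}"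
  proof
    fix y assume "y \<in> w ` {1..<i}"
    then obtain j where "1 \<le> j" "j < i" "y = w j" by auto
    then show "y \<in> {1..<w i}" using gr_mono[OF g, of j i] Sym_pos[of j] i by auto
  qed
  have "{j. j > i \<and> w j < w i} = inv w ` ({1..<w i} - w ` {1..<i})"
  proof (intro equalityI subsetI)
    fix j assume j: "j \<in> {j. j > i \<and> w j < w i}"
    then have "w j \<notin> w ` {1..<i}" using W_inf_eq_iff[OF gr_W_inf[OF g]] by auto
    then show "j \<in> inv w ` ({1..<w i} - w ` {1..<i})"
      using j i Sym_pos[of j] gr_inv(1)[OF g] by (intro image_eqI[of _ _ "w j"]) auto
  next
    fix j assume "j \<in> inv w ` ({1..<w i} - w ` {1..<i})"
    then obtain y where y: "j = inv w y" "1 \<le> y" "y < w i" "y \<notin> w ` {1..<i}" by auto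
    then have wj: "w j = y" using gr_inv(2)[OF g] by simp
    have "j > 0" using Sym_inv_pos y by simp
    then have "j \<ge> i" using y(4) wj by (auto simp: not_less[symmetric])
    moreover have "j \<noteq> i" using wj y by auto
    ultimately show "j \<in> {j. j > i \<and> w j < w i}" using wj y by auto
  qed
  moreover have "inj (inv w)" using W_inf_bij[OF W_inf_inv[OF gr_W_inf[OF g]]] by (rule bij_is_inj)
  ultimately have "gamma_code w i = card ({1..<w i} - w ` {1..<i})"
    unfolding gamma_code_def by (simp add: card_image inj_on_subset)
  also have "\<dots> = card {1..<w i} - card (w ` {1..<i})" using sub by (intro card_Diff_subset) auto
  also have "card (w ` {1..<i}) = card {1..<i}"
    using W_inf_bij[OF gr_W_inf[OF g]] by (intro card_image) (auto intro: inj_on_subset bij_is_inj)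
  finally have gc: "gamma_code w i = nat (w i - 1) - nat (i - 1)" by simp
  have "card (w ` {1..<i}) \<le> card {1..<w i}" using sub by (intro card_mono) auto
  moreover have "card (w ` {1..<i}) = card {1..<i}"
    using W_inf_bij[OF gr_W_inf[OF g]] by (intro card_image) (auto intro: inj_on_subset bij_is_inj)
  ultimately show ?thesis unfolding gc using i wi by auto
qed

lemma Sym_gamma_code_mono:
  assumes "1 \<le> i" "i \<le> j" "j \<le> int n" shows "gamma_code w i \<le> gamma_code w j"
proof -
  have "w i - i \<le> w j - j"
    using assms(2,3)
  proof (induction j rule: int_ge_induct)
    case (step j)
    then have "w j < w (j + 1)" using assms(1) by (intro gr_mono[OF g]) auto
    then show ?case using step by auto
  qed simp
  then have "int (gamma_code w i) \<le> int (gamma_code w j)" using Sym_gamma_code assms by simp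
  then show ?thesis by simp
qed

lemma Sym_lam_part: "lam_part w = nu_part w"
proof -
  have "{nat \<bar>w i\<bar> |i. i > 0 \<and> w i < 0} = {}" using Sym_pos by fastforce
  then have "mu_part w = []" unfolding mu_part_def by (simp only: sorted_list_of_set_empty rev.simps)
  then show ?thesis unfolding lam_part_def add_part_def
    by (intro nth_equalityI) (auto simp: nth_default_def)
qed

text \<open>The codes increase weakly on \<open>1..n\<close> and vanish beyond, so the positions
  with code above \<open>j\<close> form a final segment of \<open>1..n\<close>; it has more than
  \<open>t\<close> elements iff it contains \<open>n - t\<close>.\<close>

lemma Sym_nu_count:
  shows "card {i. i > 0 \<and> gamma_code w i > j} \<le> n"
    and "t < n \<Longrightarrow> card {i. i > 0 \<and> gamma_code w i > j} > t \<longleftrightarrow> j < gamma_code w (int n - int t)"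
proof -
  let ?I = "{i. i > 0 \<and> gamma_code w i > j}"
  have I: "?I \<subseteq> {1..int n}"
  proof
    fix i assume "i \<in> ?I"
    then show "i \<in> {1..int n}" using gr_gamma_code_large(1)[OF g, of i] by (cases "i \<le> int n") auto
  qed
  show "card ?I \<le> n" using card_mono[OF _ I] by simp
  show "card ?I > t \<longleftrightarrow> j < gamma_code w (int n - int t)" if t: "t < n"
  proof
    assume "j < gamma_code w (int n - int t)"
    then have "i \<in> ?I" if "i \<in> {int n - int t..int n}" for i
      using Sym_gamma_code_mono[of "int n - int t" i] that t by auto
    then have "{int n - int t..int n} \<subseteq> ?I" by blast
    then have "card {int n - int t..int n} \<le> card ?I" using I by (intro card_mono) (auto intro: finite_subset)
    then show "card ?I > t" by simp
  next
    assume c: "card ?I > t"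
    show "j < gamma_code w (int n - int t)"
    proof (rule ccontr)
      assume n: "\<not> j < gamma_code w (int n - int t)"
      have "?I \<subseteq> {int n - int t + 1..int n}"
      proof
        fix i assume i: "i \<in> ?I"
        then have "i \<in> {1..int n}" using I by blast
        moreover have "i > int n - int t"
        proof (rule ccontr)
          assume "\<not> i > int n - int t"
          then have "gamma_code w i \<le> gamma_code w (int n - int t)" using i by (intro Sym_gamma_code_mono) auto
          then show False using n i by auto
        qed
        ultimately show "i \<in> {int n - int t + 1..int n}" by auto
      qed
      then have "card ?I \<le> t" using card_mono[of "{int n - int t + 1..int n}" ?I] by simp
      then show False using c by simp
    qed
  qed
qed

text \<open>\<nu> is the conjugate of the sorted codes, so conjugating once more returns the codes,
  read from position \<open>n\<close> downwards.\<close>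

lemma Sym_conj_lam:
  shows "length (conj_part (lam_part w)) \<le> n"
    and "t < n \<Longrightarrow> nth_default 0 (conj_part (lam_part w)) t = gamma_code w (int n - int t)"
proof -
  note wW = gr_Weyl[OF g]
  have nth: "nu_part w ! j = card {i. i > 0 \<and> gamma_code w i > j}" if "j < length (nu_part w)" for j
    using that nth_default_nu_part[OF wW, of j] by (simp add: nth_default_def)
  have "a \<le> n" if "a \<in> set (nu_part w)" for a
    using that nth Sym_nu_count(1) by (auto simp: in_set_conv_nth)
  then show "length (conj_part (lam_part w)) \<le> n" by (simp add: Sym_lam_part conj_part_def)
  assume t: "t < n"
  have "nth_default 0 (conj_part (lam_part w)) t = card {j. j < length (nu_part w) \<and> nu_part w ! j > t}"
    by (simp add: Sym_lam_part nth_default_conj_part length_filter_conv_card)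
  also have "{j. j < length (nu_part w) \<and> nu_part w ! j > t} = {j. j < gamma_code w (int n - int t)}"
  proof (intro equalityI subsetI)
    fix j assume "j \<in> {j. j < length (nu_part w) \<and> nu_part w ! j > t}"
    then show "j \<in> {j. j < gamma_code w (int n - int t)}" using nth Sym_nu_count(2)[OF t] by auto
  next
    fix j assume "j \<in> {j. j < gamma_code w (int n - int t)}"
    then have c: "card {i. i > 0 \<and> gamma_code w i > j} > t" using Sym_nu_count(2)[OF t] by auto
    have "j < length (nu_part w)"
    proof (rule ccontr)
      assume "\<not> j < length (nu_part w)"
      then have "card {i. i > 0 \<and> gamma_code w i > j} = 0" using nth_default_nu_part[OF wW, of j] by (simp add: nth_default_def)
      then show False using c by simp
    qed
    then show "j \<in> {j. j < length (nu_part w) \<and> nu_part w ! j > t}" using c nth by auto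
  qed
  finally show "nth_default 0 (conj_part (lam_part w)) t = gamma_code w (int n - int t)" by simp
qed

text \<open>The elements of \<open>Aset n w\<close> below \<open>w p\<close> are
  \<open>w 1, ..., w (p - 1)\<close>.\<close>

lemma Sym_rho: assumes p: "1 \<le> p" "p \<le> int n" shows "rho (Aset n w) (nat (w p)) = nat (p - 1)"
proof -
  have lt: "w q < w p \<longleftrightarrow> q < p" if "1 \<le> q" "q \<le> int n" for q
    using gr_mono[OF g, of q p] gr_mono[OF g, of p q] that p by (cases q p rule: linorder_cases) auto
  have "{a \<in> Aset n w. a < nat (w p)} = (\<lambda>q. nat (w q)) ` {1..<p}"
    using lt p Sym_pos by (auto simp: Aset_image[OF g] image_iff)
  moreover have "inj_on (\<lambda>q. nat (w q)) {1..<p}"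
    using Sym_pos W_inf_eq_iff[OF gr_W_inf[OF g]] by (intro inj_onI) (simp add: eq_nat_nat_iff less_imp_le)
  ultimately show ?thesis by (simp add: rho_def card_image)
qed

lemma Sym_list: "sorted_list_of_set (Sset n w) = rev (map (\<lambda>t. nat (w (int n - int t))) [0..<n])"
proof (rule sorted_distinct_set_unique)
  let ?f = "\<lambda>t. nat (w (int n - int t))"
  have "sorted_wrt (\<lambda>s t. ?f s > ?f t) [0..<n]"
  proof (rule sorted_wrt_mono_rel[OF _ sorted_wrt_upt])
    fix s t assume "s \<in> set [0..<n]" "t \<in> set [0..<n]" "s < t"
    then have "w (int n - int t) < w (int n - int s)" "w (int n - int t) > 0"
      by (auto intro: gr_mono[OF g] Sym_pos)
    then show "?f s > ?f t" by simp
  qed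
  then have s: "sorted_wrt (<) (rev (map ?f [0..<n]))" by (simp add: sorted_wrt_rev sorted_wrt_map)
  then show "sorted (rev (map ?f [0..<n]))" "distinct (rev (map ?f [0..<n]))"
    by (simp_all only: strict_sorted_iff)
  have "set (rev (map ?f [0..<n])) = (\<lambda>p. nat (w p)) ` {1..int n}"
  proof -
    have "{1..int n} = (\<lambda>t. int n - int t) ` {0..<n}"
    proof (intro equalityI subsetI)
      fix p assume "p \<in> {1..int n}"
      then show "p \<in> (\<lambda>t. int n - int t) ` {0..<n}" by (intro image_eqI[of _ _ "nat (int n - p)"]) auto
    qed auto
    then show ?thesis by (simp add: image_image)
  qed
  then show "set (sorted_list_of_set (Sset n w)) = set (rev (map ?f [0..<n]))"
    using finite_Sset[OF g] by (simp add: Sym_Sset Aset_image[OF g])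
qed simp_all

lemma length_stair: "length (stair k) = nat (k + 1)"
  by (simp add: stair_def)

lemma stair_nth: "t < nat (k + 1) \<Longrightarrow> stair k ! t = k - int t"
  by (simp add: stair_def rev_nth nth_upto of_nat_diff)

text \<open>At list position \<open>t\<close>, with \<open>p = n - t\<close>, the part is
  \<open>(n - t) + (n - 1 - t) + (w p - p)\<close>, which is \<open>w p\<close> plus the number
  \<open>p - 1\<close> of smaller values in \<open>Aset n w\<close>.\<close>

lemma multi_Q_Sym:
  "multi_Q (stair (int n - 1)) (map (\<lambda>i. 1 - w i) (rev [1..int n]))
     (add_part (add_part (stair (int n)) (stair (int n - 1))) (map int (conj_part (lam_part w)))) =
   Pf (rho (Aset n w)) (sorted_list_of_set (Sset n w))"
proof -
  let ?f = "\<lambda>t. nat (w (int n - int t))"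
  let ?row = "\<lambda>v. row (rho (Aset n w) v) (v - 1)"
  define \<alpha> where "\<alpha> = add_part (add_part (stair (int n)) (stair (int n - 1))) (map int (conj_part (lam_part w)))"
  define R where "R = (\<lambda>i. multi_c (nth_default 0 (stair (int n - 1)) i) (nth_default 0 (map (\<lambda>i. 1 - w i) (rev [1..int n])) i))"
  have lc: "length (conj_part (lam_part w)) \<le> n" by (rule Sym_conj_lam)
  have l1: "length (add_part (stair (int n)) (stair (int n - 1))) = Suc n"
    by (simp add: add_part_def length_stair nat_add_distrib)
  have l: "length \<alpha> = Suc n" using lc unfolding \<alpha>_def add_part_def[of "add_part _ _"] by (simp add: l1)
  have \<alpha>: "\<alpha> ! t = nth_default 0 (stair (int n)) t + nth_default 0 (stair (int n - 1)) t + int (nth_default 0 (conj_part (lam_part w)) t)" if "t \<le> n" for t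
  proof -
    have "nth_default 0 (map int (conj_part (lam_part w))) t = int (nth_default 0 (conj_part (lam_part w)) t)"
      by (simp add: nth_default_map_eq[of int 0])
    then show ?thesis using that l nth_default_nth[of t \<alpha> 0] by (simp add: \<alpha>_def nth_default_add_part)
  qed
  \<comment> \<open>\<open>stair (int n)\<close> ends in \<open>0\<close>, so the sequence has one
    part more than \<open>Pf\<close> has rows; that part is \<open>0\<close>, and its row
    contributes the factor \<open>1\<close>.\<close>
  have \<alpha>n: "\<alpha> ! n = 0"
  proof -
    have "nth_default 0 (conj_part (lam_part w)) n = 0" using lc by (simp add: nth_default_def)
    then show ?thesis by (simp add: \<alpha> nth_default_def length_stair stair_nth)
  qed
  have \<alpha>t: "\<alpha> ! t = int (?f t + rho (Aset n w) (?f t))" and Rt: "R t = ?row (?f t)" if t: "t < n" for t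
  proof -
    let ?p = "int n - int t"
    have p: "1 \<le> ?p" "?p \<le> int n" using t by auto
    have wp: "w ?p > 0" using p by (intro Sym_pos) auto
    have r: "int (rho (Aset n w) (?f t)) = int n - 1 - int t" using Sym_rho[OF p] t by simp
    have s: "nth_default 0 (stair (int n - 1)) t = int n - 1 - int t" using t by (simp add: nth_default_def length_stair stair_nth)
    have "nth_default 0 (stair (int n)) t = int n - int t" using t by (simp add: nth_default_def length_stair stair_nth)
    then show "\<alpha> ! t = int (?f t + rho (Aset n w) (?f t))"
      using t s r wp Sym_gamma_code[OF p] Sym_conj_lam(2)[OF t] by (simp add: \<alpha>)
    have "rev [1..int n] ! t = ?p" using t by (simp add: rev_nth nth_upto of_nat_diff)
    then have "nth_default 0 (map (\<lambda>i. 1 - w i) (rev [1..int n])) t = - int (?f t - 1)"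
      using t wp by (simp add: nth_default_def of_nat_diff)
    then show "R t = ?row (?f t)"
      unfolding R_def s r[symmetric] by (simp add: multi_c_row fun_eq_iff)
  qed
  have "\<alpha> = map (\<lambda>t. int (?f t + rho (Aset n w) (?f t))) [0..<n] @ [0]"
    using l \<alpha>t \<alpha>n by (intro nth_equalityI) (auto simp: nth_append less_Suc_eq)
  moreover have "map R [0..<Suc n] = map (\<lambda>t. ?row (?f t)) [0..<n] @ [R n]"
    unfolding upt_Suc_append[OF le0] map_append using Rt by (intro arg_cong2[of _ _ _ _ append] map_cong) auto
  moreover have "R n 0 = 1" by (simp add: R_def multi_c_zero)
  ultimately have "multi_Q (stair (int n - 1)) (map (\<lambda>i. 1 - w i) (rev [1..int n])) \<alpha> =
      Qr (rev (map (\<lambda>t. ?row (?f t)) [0..<n])) (rev (map (\<lambda>t. int (?f t + rho (Aset n w) (?f t))) [0..<n]))"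
    unfolding multi_Q_Qr l R_def[symmetric] by (simp add: Qr_zero_row del: Qr.simps upt_Suc)
  then show ?thesis unfolding \<alpha>_def Pf_def Sym_list by (simp add: rev_map o_def)
qed

end

section \<open>The variables that occur\<close>

lemma vars_in_shiftop: "(\<And>bs. G bs \<in> vars_in V) \<Longrightarrow> shiftop s G as \<in> vars_in V"
  by (induction s G as rule: shiftop.induct) (auto intro!: vars_in_sum vars_in_mult vars_in_of_int vars_in_0)

lemma vars_in_Qr: "(\<And>f p. f \<in> set fs \<Longrightarrow> f p \<in> vars_in V) \<Longrightarrow> Qr fs as \<in> vars_in V"
  by (induction fs arbitrary: as) (auto intro!: vars_in_sum vars_in_mult vars_in_shiftop vars_in_1)

lemma vars_in_row:
  assumes k: "k \<le> n" and r: "r \<le> l" shows "row k r p \<in> vars_in (VX ` {..<n} \<union> VY ` {..<l})"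
proof -
  let ?V = "VX ` {..<n} \<union> VY ` {..<l}"
  have x: "xg i \<in> vars_in ?V" if "i \<in> {1..k}" for i using that k by (auto simp: xg_def intro!: vars_in_pvar)
  have y: "- yg i \<in> vars_in ?V" if "i \<in> {1..r}" for i using that r by (auto simp: yg_def intro!: vars_in_pvar vars_in_uminus)
  have e: "fps_nth (efps b z) j \<in> vars_in ?V" if "\<And>i. i \<in> {1..b} \<Longrightarrow> z i \<in> vars_in ?V" for b z j
    unfolding efps_nth esym_def using that by (intro vars_in_sum vars_in_prod) auto
  have m: "fps_nth (F * G) j \<in> vars_in ?V" if "\<And>i. fps_nth F i \<in> vars_in ?V" "\<And>i. fps_nth G i \<in> vars_in ?V" for F G j
    unfolding fps_mult_nth using that by (intro vars_in_sum vars_in_mult) auto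
  show ?thesis
    unfolding row_def rowfps_def using x y
    by (auto intro!: vars_in_0 m e simp: cfps_def cg_def vars_in_const)
qed

lemma vars_in_Pf:
  assumes "\<And>v. v \<in> set vs \<Longrightarrow> \<rho> v \<le> n \<and> v - 1 \<le> l"
  shows "Pf \<rho> vs \<in> vars_in (VX ` {..<n} \<union> VY ` {..<l})"
  unfolding Pf_def using assms by (intro vars_in_Qr) (auto intro!: vars_in_row)

theorem proposition4:
  fixes m n :: nat and w w' :: "int \<Rightarrow> int" and C :: "(int \<Rightarrow> int) \<Rightarrow> gxy"
  assumes "is_schubert_family C"
    and "m > n"
    and "w \<in> Weyl m"
    and "grassmannian n w"
    and "w' = w \<circ> w_long n"
  shows "C w' \<in> subring_XY n (m - 1)
    \<and> C w' = multi_Q (map int (nu_part w')) (beta_seq w') (map int (lam_part w'))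
    \<and> (w \<in> Sym m \<longrightarrow>
         C w' = multi_Q (stair (int n - 1)) (map (\<lambda>i. 1 - w i) (rev [1..int n]))
                  (add_part (add_part (stair (int n)) (stair (int n - 1)))
                            (map int (conj_part (lam_part w)))))"
proof -
  have g: "gr m n w"
    using assms(2-4) wlen_right_gt by (auto simp: gr_def grassmannian_def)
  have C: "C w' = Pf (rho (Aset n w)) (sorted_list_of_set (Sset n w))"
    unfolding assms(5) by (rule grassmannian_Pf[OF assms(1) g])
  have "C w' \<in> subring_XY n (m - 1)"
    unfolding C subring_XY_eq
  proof (rule vars_in_Pf)
    fix v assume "v \<in> set (sorted_list_of_set (Sset n w))"
    then have "v \<le> m" using Sset_range[OF g] finite_Sset[OF g] by auto
    moreover have "rho (Aset n w) v \<le> n"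
      unfolding rho_def using card_mono[OF finite_Aset[OF g], of "{a \<in> Aset n w. a < v}"] card_Aset[OF g] by auto
    ultimately show "rho (Aset n w) v \<le> n \<and> v - 1 \<le> m - 1" by auto
  qed
  moreover note multi_Q_hat[OF g assms(5)]
  moreover have "w \<in> Sym m \<Longrightarrow> C w' = multi_Q (stair (int n - 1)) (map (\<lambda>i. 1 - w i) (rev [1..int n]))
      (add_part (add_part (stair (int n)) (stair (int n - 1))) (map int (conj_part (lam_part w))))"
    unfolding C by (rule multi_Q_Sym[OF g, symmetric])
  ultimately show ?thesis using C by simp
qed

end
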